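(* For a 2-reduced simplicial set $X$ there is a canonical identification isomorphism $$\Omega^2C_*(X)\;\approx\;C_*^{\diamondsuit}(\mathbf{\Omega}^2X).$$
   Context: Fix a commutative ring $R$ with identity. A simplicial, cubical or permutahedral set $W$ is $k$-reduced if $W_i$ contains exactly one element for each $i\le k$. For $W$ with base point $*$, $C_*(W)$ denotes the quotient $C_*(W)/C_{>0}( * )$ of the chains of $W$ (similarly for the chains $C_*^\Box$ of a cubical set); for a simplicial set $X$ the chains are regarded as a DG coalgebra with the Alexander–Whitney coproduct, whose components are $\nu_i(x)=\partial_{i+1}\cdots\partial_n(x)\times\partial_0\cdots\partial_{i-1}(x)$, $x\in X_n$, $0\le i\le n$. **Cobar construction.** $\Omega C$ denotes the cobar construction on a 1-reduced DG coalgebra $C$: the tensor algebra $T(s^{-1}C_{>0})$ with the derivation $d(s^{-1}a)=-s^{-1}\partial a+\sum(-1)^{|a'|}s^{-1}a'\otimes s^{-1}a''$, where $\sum a'\otimes a''$ is the reduced coproduct of $a$. **The cubical set $\mathbf{\Omega}X$ of a 1-reduced simplicial set $X=\{X_n,\partial_i,s_i\}$.** Let $X^c$ be the graded set of formal expressions $\eta_{i_k}\cdots\eta_{i_1}(x)$, $x\in X_n$, $k\ge 0$, $i_1\le\cdots\le i_k$, $1\le i_j\le n+j-1$, of degree $n+k$. Let $\bar X^c=s^{-1}(X^c_{>0})$ be its desuspension, and let $\mathbf{\Omega}X$ be the graded monoid generated by $\bar X^c$ (with $\bar x=e$ the unit for the unique $x\in X_1$), modulo $\overline{\eta_n(x)}\sim\overline{s_n(x)}$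 for $x\in X_n$, $n>0$, and $\bar x_1\cdots\overline{\eta_{m_i+1}(x_i)}\cdot\bar x_{i+1}\cdots\bar x_k\sim\bar x_1\cdots\bar x_i\cdot\overline{\eta_1(x_{i+1})}\cdots\bar x_k$ for $x_i\in X^c_{m_i+1}$, $i<k$. For $x\in X_n$ and $1\le i\le n-1$ put $d_i^1(\bar x)=\overline{\partial_i x}$ and $d_i^0(\bar x)=\overline{\partial_{i+1}\cdots\partial_n x}\cdot\overline{\partial_0\cdots\partial_{i-1}x}$. On a product $\bar x_1\cdots\bar x_k$ with $|\bar x_j|=m_j$, $d^\epsilon_i$ applies $d^\epsilon_j$ to the factor $\bar x_q$, where $i=m_1+\cdots+m_{q-1}+j$, $1\le j\le m_q$. Degeneracies are $\eta_i(\bar x)=\overline{\eta_i(x)}$ on generators; on products they act on the factor $\bar x_q$ in the same way, and the last degeneracy acts as $\eta_{m_k+1}$ on the last factor. Face operators are extended to degenerate elements so that the cubical identities hold. **Cubical chains.** For a 1-reduced cubical set $Q=(Q_n,d_i^0,d_i^1,\eta_i)$, $C_*^\Box(Q)$ is the free $R$-module on cubes modulo degenerate cubes, with $\partial a=\sum_i(-1)^{i-1}(d_i^1a-d_i^0a)$ and strictly coassociative coproduct $\Delta(a)=\sum_{(A;B)}\mathrm{shuff}(A;B)\,d_B^0(a)\otimes d_A^1(a)$ for $a\in Q_n$, the sum being over all decompositions $A\sqcup B=\{1,\dots,n\}$ ($A$ or $B$ possibly empty). Here $d_B^0=d_{j_1}^0\cdots d_{j_r}^0$ for $B=\{j_1<\cdots<j_r\}$,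 similarly $d_A^1$, and $\mathrm{shuff}(A;B)$ is the sign of the permutation taking $1,\dots,n$ to $A$ (increasing) followed by $B$ (increasing). There is a canonical identification (Kadeishvili–Saneblidze) $\Omega C_*(X)\approx C^\Box_*(\mathbf{\Omega}X)$ for 1-reduced $X$; it gives $\Omega C_*(X)$ the structure of a DG coalgebra, and $\Omega^2C_*(X)=\Omega(\Omega C_*(X))$ is formed with respect to it. **The multipermutahedral set $\mathbf{\Omega}Q$ of a 1-reduced cubical set $Q$.** Write $\underline n=\{1,\dots,n\}$. Let $\bar Q=s^{-1}(Q_{>0})$, and let $e=\bar a$ for the unique $a\in Q_1$. $\mathbf{\Omega}Q$ is the graded monoid with unit $e$ generated by $\bar Q$ together with the formal expressions $$\varrho_{M_k|N_k}((\cdots\varrho_{M_2|N_2}(\varrho_{M_1|N_1}(\bar a_1\cdot\bar a_2)\cdot\bar a_3)\cdots)\cdot\bar a_{k+1}),\qquad a_i\in Q_{r_i},\ r_i\ge1,\ k\ge1,$$ where $M_i|N_i$ is an ordered partition of $\{1,\dots,r_1+\cdots+r_{i+1}\}$ into two blocks of sizes $r_1+\cdots+r_i$ and $r_{i+1}$, in either order (some $a_i$ may give the unit $e$). These are taken modulo $\varrho_{M|N}(\bar a\cdot\bar b)\sim\varrho_{N|M}(\bar a\cdot\bar b)$, $\varrho_{j|\underline n\setminus j}(e\cdot\bar a)\sim\varrho_{\underline n\setminus j|j}(\bar a\cdot e)\sim\overline{\eta_j(a)}$ for $a,b\in Q_{>0}$, and $\bar a_1\cdots\varrho_{\underline{r_i}|r_i+1}(\bar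 a_i\cdot e)\cdot\bar a_{i+2}\cdots\bar a_{k+1}\sim\bar a_1\cdots\bar a_i\cdot\varrho_{1|\underline{r_{i+2}+1}\setminus1}(e\cdot\bar a_{i+2})\cdots\bar a_{k+1}$ for $a_i\in Q_{r_i}$, $a_{i+1}=e$. For $a\in Q_n$ and an ordered partition $A|B$ of $\underline n$ into two non-empty blocks, the face operator is $d_{A|B}(\bar a)=\overline{d_B^0(a)}\cdot\overline{d_A^1(a)}$. On products, the face operators that enter the differential below apply some $d_{A|B}$ to one factor, and the corresponding degeneracy operators replace two adjacent factors $u\cdot v$ by $\varrho_{M|N}(u\cdot v)$; the remaining face and degeneracy operators are composites involving degeneracy operators, and add nothing to the differential or to the span of degenerate elements. The monomial $\bar a_1\cdots\bar a_k$, $a_i\in Q_{n_i+1}$, has multidegree $(n_1,\dots,n_k)$ and chain degree $n_1+\cdots+n_k$. For 2-reduced $X$, put $\mathbf{\Omega}^2X=\mathbf{\Omega}(\mathbf{\Omega}X)$, i.e. take $Q=\mathbf{\Omega}X$. **Chains $C_*^\diamondsuit$.** $C_*^\diamondsuit(\mathbf{\Omega}Q)$ is the free $R$-module $C_*(\mathbf{\Omega}Q)$ on the elements of $\mathbf{\Omega}Q$ modulo the submodule generated by the degeneracies (the elements in the images of degeneracy operators), with differential $$d(\bar a_1\cdots\bar a_k)=\sum_{i=1}^k\ \sum_{A|B}(-1)^{n_1+\cdots+n_{i-1}}(-1)^{\#A}\,\mathrm{shuff}(A;B)\;\bar a_1\cdots d_{A|B}(\bar a_i)\cdots\bar a_k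 ,$$ where $A|B$ runs over the ordered partitions of $\{1,\dots,n_i+1\}$ into two non-empty blocks. There is a canonical identification (Kadeishvili–Saneblidze) $\Omega C_*^\Box(Q)\approx C_*^\diamondsuit(\mathbf{\Omega}Q)$ for every 1-reduced cubical set $Q$; the isomorphism of the claim is obtained by setting $Q=\mathbf{\Omega}X$.
   Formalization: C_*(X) is taken modulo C_{>0}( * ) and also modulo the last degeneracies s_n(x), x in X_n, n>0; with unnormalized or fully normalized chains the isomorphism fails by ranks in degree 2 for X = Δ^3/∂Δ^3. *)

theory Defs
  imports "HOL-Combinatorics.Permutations" "HOL-Algebra.Module" "HOL-Algebra.QuotRing"
begin

section \<open>Modules over a commutative ring\<close>

text \<open>
  An algebra over \<open>R\<close> is a module record whose multiplicative part is used; for plain modules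
  the fields \<^const>\<open>mult\<close> and \<^const>\<open>one\<close> carry no information.
\<close>

definition linear_maps ::
    "('r, 'x) ring_scheme \<Rightarrow> ('r, 'm, 'y) module_scheme \<Rightarrow> ('r, 'n, 'z) module_scheme
      \<Rightarrow> ('m \<Rightarrow> 'n) set" where
  "linear_maps R M N =
    {h \<in> carrier M \<rightarrow>\<^sub>E carrier N.
      (\<forall>x\<in>carrier M. \<forall>y\<in>carrier M. h (x \<oplus>\<^bsub>M\<^esub> y) = h x \<oplus>\<^bsub>N\<^esub> h y) \<and>
      (\<forall>r\<in>carrier R. \<forall>x\<in>carrier M. h (r \<odot>\<^bsub>M\<^esub> x) = r \<odot>\<^bsub>N\<^esub> h x)}"

definition gen_submodule ::
    "('r, 'x) ring_scheme \<Rightarrow> ('r, 'm, 'y) module_scheme \<Rightarrow> 'm set \<Rightarrow> 'm set" where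
  "gen_submodule R M S = \<Inter>{N. submodule N R M \<and> S \<subseteq> N}"

text \<open>
  The product of the quotient is meaningful when \<open>N\<close> is a two-sided ideal; compare
  \<^const>\<open>FactRing\<close>.
\<close>

definition quot_module :: "('r, 'm, 'y) module_scheme \<Rightarrow> 'm set \<Rightarrow> ('r, 'm set) module" where
  "quot_module M N =
    \<lparr>carrier = a_rcosets\<^bsub>M\<^esub> N, mult = rcoset_mult M N, one = N +>\<^bsub>M\<^esub> \<one>\<^bsub>M\<^esub>,
     zero = N, add = set_add M, smult = (\<lambda>r A. \<Union>a\<in>A. N +>\<^bsub>M\<^esub> (r \<odot>\<^bsub>M\<^esub> a))\<rparr>"

definition basis_elt :: "('r, 'x) ring_scheme \<Rightarrow> 'b \<Rightarrow> 'b \<Rightarrow> 'r" where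
  "basis_elt R b = (\<lambda>c. if c = b then \<one>\<^bsub>R\<^esub> else \<zero>\<^bsub>R\<^esub>)"

definition free_module :: "('r, 'x) ring_scheme \<Rightarrow> 'b set \<Rightarrow> ('r, 'b \<Rightarrow> 'r) module" where
  "free_module R B =
    \<lparr>carrier = {f. (\<forall>b. f b \<in> carrier R) \<and> (\<forall>b. b \<notin> B \<longrightarrow> f b = \<zero>\<^bsub>R\<^esub>) \<and>
                   finite {b. f b \<noteq> \<zero>\<^bsub>R\<^esub>}},
     mult = undefined, one = undefined,
     zero = (\<lambda>b. \<zero>\<^bsub>R\<^esub>), add = (\<lambda>f g b. f b \<oplus>\<^bsub>R\<^esub> g b), smult = (\<lambda>r f b. r \<otimes>\<^bsub>R\<^esub> f b)\<rparr>"

definition monoid_algebra ::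
    "('r, 'x) ring_scheme \<Rightarrow> ('g, 'y) monoid_scheme \<Rightarrow> ('r, 'g \<Rightarrow> 'r) module" where
  "monoid_algebra R G = (free_module R (carrier G))
    \<lparr>mult := (\<lambda>f g c. \<Oplus>\<^bsub>R\<^esub>p\<in>{(a, b). f a \<noteq> \<zero>\<^bsub>R\<^esub> \<and> g b \<noteq> \<zero>\<^bsub>R\<^esub> \<and> a \<otimes>\<^bsub>G\<^esub> b = c}.
                 f (fst p) \<otimes>\<^bsub>R\<^esub> g (snd p)),
     one := basis_elt R \<one>\<^bsub>G\<^esub>\<rparr>"

definition neg_one_pow :: "('r, 'x) ring_scheme \<Rightarrow> nat \<Rightarrow> 'r" where
  "neg_one_pow R k = (\<ominus>\<^bsub>R\<^esub> \<one>\<^bsub>R\<^esub>) [^]\<^bsub>R\<^esub> k"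


subsection \<open>Tensor products\<close>

definition tensor_relations ::
    "('r, 'x) ring_scheme \<Rightarrow> ('r, 'm, 'y) module_scheme \<Rightarrow> ('r, 'n, 'z) module_scheme
      \<Rightarrow> ('m \<times> 'n \<Rightarrow> 'r) set" where
  "tensor_relations R M N =
    (let F = free_module R (carrier M \<times> carrier N); E = basis_elt R in gen_submodule R F
      ({E (m \<oplus>\<^bsub>M\<^esub> m', n) \<ominus>\<^bsub>F\<^esub> (E (m, n) \<oplus>\<^bsub>F\<^esub> E (m', n)) | m m' n.
          m \<in> carrier M \<and> m' \<in> carrier M \<and> n \<in> carrier N} \<union>
       {E (m, n \<oplus>\<^bsub>N\<^esub> n') \<ominus>\<^bsub>F\<^esub> (E (m, n) \<oplus>\<^bsub>F\<^esub> E (m, n')) | m n n'.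
          m \<in> carrier M \<and> n \<in> carrier N \<and> n' \<in> carrier N} \<union>
       {E (r \<odot>\<^bsub>M\<^esub> m, n) \<ominus>\<^bsub>F\<^esub> (r \<odot>\<^bsub>F\<^esub> E (m, n)) | r m n.
          r \<in> carrier R \<and> m \<in> carrier M \<and> n \<in> carrier N} \<union>
       {E (m, r \<odot>\<^bsub>N\<^esub> n) \<ominus>\<^bsub>F\<^esub> (r \<odot>\<^bsub>F\<^esub> E (m, n)) | r m n.
          r \<in> carrier R \<and> m \<in> carrier M \<and> n \<in> carrier N}))"

definition tensor_prod ::
    "('r, 'x) ring_scheme \<Rightarrow> ('r, 'm, 'y) module_scheme \<Rightarrow> ('r, 'n, 'z) module_scheme
      \<Rightarrow> ('r, ('m \<times> 'n \<Rightarrow> 'r) set) module" where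
  "tensor_prod R M N =
    quot_module (free_module R (carrier M \<times> carrier N)) (tensor_relations R M N)"

definition tensor ::
    "('r, 'x) ring_scheme \<Rightarrow> ('r, 'm, 'y) module_scheme \<Rightarrow> ('r, 'n, 'z) module_scheme
      \<Rightarrow> 'm \<Rightarrow> 'n \<Rightarrow> ('m \<times> 'n \<Rightarrow> 'r) set" where
  "tensor R M N m n =
    tensor_relations R M N +>\<^bsub>free_module R (carrier M \<times> carrier N)\<^esub> basis_elt R (m, n)"

definition tensor_map ::
    "('r, 'x) ring_scheme \<Rightarrow> ('r, 'm, 'y) module_scheme \<Rightarrow> ('r, 'n, 'z) module_scheme
      \<Rightarrow> ('m \<Rightarrow> 'n) \<Rightarrow> ('m \<times> 'm \<Rightarrow> 'r) set \<Rightarrow> ('n \<times> 'n \<Rightarrow> 'r) set" where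
  "tensor_map R M N f =
    (THE h. h \<in> linear_maps R (tensor_prod R M M) (tensor_prod R N N) \<and>
      (\<forall>x\<in>carrier M. \<forall>y\<in>carrier M. h (tensor R M M x y) = tensor R N N (f x) (f y)))"

definition free_monoid :: "'a set \<Rightarrow> 'a list monoid" where
  "free_monoid S = \<lparr>carrier = lists S, mult = (@), one = []\<rparr>"

definition tensor_algebra_relations ::
    "('r, 'x) ring_scheme \<Rightarrow> ('r, 'm, 'y) module_scheme \<Rightarrow> ('m list \<Rightarrow> 'r) set" where
  "tensor_algebra_relations R V =
    (let F = monoid_algebra R (free_monoid (carrier V)); E = basis_elt R in Idl\<^bsub>F\<^esub>
      ({E [v \<oplus>\<^bsub>V\<^esub> w] \<ominus>\<^bsub>F\<^esub> (E [v] \<oplus>\<^bsub>F\<^esub> E [w]) | v w. v \<in> carrier V \<and> w \<in> carrier V} \<union>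
       {E [r \<odot>\<^bsub>V\<^esub> v] \<ominus>\<^bsub>F\<^esub> (r \<odot>\<^bsub>F\<^esub> E [v]) | r v. r \<in> carrier R \<and> v \<in> carrier V}))"

definition tensor_algebra ::
    "('r, 'x) ring_scheme \<Rightarrow> ('r, 'm, 'y) module_scheme \<Rightarrow> ('r, ('m list \<Rightarrow> 'r) set) module" where
  "tensor_algebra R V =
    quot_module (monoid_algebra R (free_monoid (carrier V))) (tensor_algebra_relations R V)"

text \<open>The element \<open>v\<^sub>1 \<otimes> \<dots> \<otimes> v\<^sub>k\<close> of the tensor algebra.\<close>

definition tensor_word ::
    "('r, 'x) ring_scheme \<Rightarrow> ('r, 'm, 'y) module_scheme \<Rightarrow> 'm list \<Rightarrow> ('m list \<Rightarrow> 'r) set" where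
  "tensor_word R V vs =
    tensor_algebra_relations R V +>\<^bsub>monoid_algebra R (free_monoid (carrier V))\<^esub> basis_elt R vs"


section \<open>DG modules, DG coalgebras and the cobar construction\<close>

text \<open>\<open>hcomp M n\<close> is the submodule of elements of degree \<open>n\<close>.\<close>

record ('r, 'm) dg_module = "('r, 'm) module" +
  hcomp :: "nat \<Rightarrow> 'm set"
  diff :: "'m \<Rightarrow> 'm"

text \<open>
  \<open>coaug\<close> is the image of the unit of the ground ring under the coaugmentation, needed to form
  the reduced coproduct.
\<close>

record ('r, 'm) dg_coalgebra = "('r, 'm) dg_module" +
  coprod :: "'m \<Rightarrow> ('m \<times> 'm \<Rightarrow> 'r) set"
  coaug :: 'm

definition dg_iso ::
    "('r, 'x) ring_scheme \<Rightarrow> ('r, 'm, 'y) dg_module_scheme \<Rightarrow> ('r, 'n, 'z) dg_module_scheme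
      \<Rightarrow> ('m \<Rightarrow> 'n) \<Rightarrow> bool" where
  "dg_iso R M N f \<longleftrightarrow>
    f \<in> linear_maps R M N \<and> bij_betw f (carrier M) (carrier N) \<and>
    (\<forall>n. f ` hcomp M n = hcomp N n) \<and>
    diff M \<in> carrier M \<rightarrow> carrier M \<and> diff N \<in> carrier N \<rightarrow> carrier N \<and>
    (\<forall>x\<in>carrier M. f (diff M x) = diff N (f x))"

definition dg_algebra_iso ::
    "('r, 'x) ring_scheme \<Rightarrow> ('r, 'm, 'y) dg_module_scheme \<Rightarrow> ('r, 'n, 'z) dg_module_scheme
      \<Rightarrow> ('m \<Rightarrow> 'n) \<Rightarrow> bool" where
  "dg_algebra_iso R M N f \<longleftrightarrow> dg_iso R M N f \<and> f \<in> ring_hom M N"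

definition pos_part ::
    "('r, 'x) ring_scheme \<Rightarrow> ('r, 'm, 'y) dg_module_scheme \<Rightarrow> ('r, 'm, 'y) dg_module_scheme" where
  "pos_part R C = C\<lparr>carrier := gen_submodule R C (\<Union>n\<in>{0<..}. hcomp C n)\<rparr>"

text \<open>
  Desuspension only shifts degrees: \<open>s\<^sup>-\<^sup>1a\<close> is \<open>tensor_word R (pos_part R C) [a]\<close>, of degree
  \<open>n\<close> when \<open>a\<close> has degree \<open>n + 1\<close>.
\<close>

definition cobar_hcomp ::
    "('r, 'x) ring_scheme \<Rightarrow> ('r, 'm, 'y) dg_module_scheme \<Rightarrow> nat \<Rightarrow> ('m list \<Rightarrow> 'r) set set" where
  "cobar_hcomp R C n = gen_submodule R (tensor_algebra R (pos_part R C))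
    {tensor_word R (pos_part R C) vs | vs ks.
      list_all2 (\<lambda>v k. v \<in> hcomp C (Suc k)) vs ks \<and> sum_list ks = n}"

text \<open>
  The sum \<open>\<Sum>a' \<otimes> a''\<close> of the reduced coproduct \<open>\<Delta>a - a \<otimes> 1 - 1 \<otimes> a\<close> is written
  \<open>\<Sum>t<k. b t \<otimes> c t\<close> with \<open>b t\<close>, \<open>c t\<close> homogeneous of positive degrees \<open>p t\<close>, \<open>q t\<close>.
\<close>

definition cobar_diff ::
    "('r, 'x) ring_scheme \<Rightarrow> ('r, 'm, 'y) dg_coalgebra_scheme
      \<Rightarrow> ('m list \<Rightarrow> 'r) set \<Rightarrow> ('m list \<Rightarrow> 'r) set" where
  "cobar_diff R C =
    (let T = tensor_algebra R (pos_part R C); W = tensor_word R (pos_part R C);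
         CC = tensor_prod R C C; ten = tensor R C C
     in THE d. d \<in> linear_maps R T T \<and>
       (\<forall>p. \<forall>x\<in>cobar_hcomp R C p. \<forall>y\<in>carrier T.
          d (x \<otimes>\<^bsub>T\<^esub> y) = (d x \<otimes>\<^bsub>T\<^esub> y) \<oplus>\<^bsub>T\<^esub> (neg_one_pow R p \<odot>\<^bsub>T\<^esub> (x \<otimes>\<^bsub>T\<^esub> d y))) \<and>
       (\<forall>n>0. \<forall>a\<in>hcomp C n. \<forall>(k::nat) p q b c.
          (\<forall>t<k. 0 < p t \<and> 0 < q t \<and> b t \<in> hcomp C (p t) \<and> c t \<in> hcomp C (q t)) \<longrightarrow>
          coprod C a = ten a (coaug C) \<oplus>\<^bsub>CC\<^esub> ten (coaug C) a
                         \<oplus>\<^bsub>CC\<^esub> (\<Oplus>\<^bsub>CC\<^esub>t\<in>{..<k}. ten (b t) (c t)) \<longrightarrow>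
          d (W [a]) = (\<ominus>\<^bsub>T\<^esub> W [diff C a])
                        \<oplus>\<^bsub>T\<^esub> (\<Oplus>\<^bsub>T\<^esub>t\<in>{..<k}. neg_one_pow R (p t) \<odot>\<^bsub>T\<^esub> W [b t, c t])))"

definition cobar ::
    "('r, 'x) ring_scheme \<Rightarrow> ('r, 'm, 'y) dg_coalgebra_scheme
      \<Rightarrow> ('r, ('m list \<Rightarrow> 'r) set) dg_module" where
  "cobar R C = module.extend (tensor_algebra R (pos_part R C))
    (dg_module.fields (cobar_hcomp R C) (cobar_diff R C))"


section \<open>Simplicial sets and their chains\<close>

text \<open>
  \<open>face X n i\<close> is \<open>\<partial>\<^sub>i\<close> on \<open>X\<^sub>n\<close> and \<open>degen X n i\<close> is \<open>s\<^sub>i\<close> on \<open>X\<^sub>n\<close>. The sets \<open>X\<^sub>n\<close> need not be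
  disjoint, so dimensions are passed explicitly.
\<close>

record 'a sset =
  simp :: "nat \<Rightarrow> 'a set"
  face :: "nat \<Rightarrow> nat \<Rightarrow> 'a \<Rightarrow> 'a"
  degen :: "nat \<Rightarrow> nat \<Rightarrow> 'a \<Rightarrow> 'a"

locale simplicial_set =
  fixes X :: "'a sset"
  assumes face_closed:
      "\<lbrakk>x \<in> simp X (Suc n); i \<le> Suc n\<rbrakk> \<Longrightarrow> face X (Suc n) i x \<in> simp X n"
    and degen_closed:
      "\<lbrakk>x \<in> simp X n; i \<le> n\<rbrakk> \<Longrightarrow> degen X n i x \<in> simp X (Suc n)"
    and face_face:
      "\<lbrakk>x \<in> simp X (Suc (Suc n)); i < j; j \<le> Suc (Suc n)\<rbrakk> \<Longrightarrow>
        face X (Suc n) i (face X (Suc (Suc n)) j x) =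
        face X (Suc n) (j - 1) (face X (Suc (Suc n)) i x)"
    and face_degen_less:
      "\<lbrakk>x \<in> simp X (Suc n); i < j; j \<le> Suc n\<rbrakk> \<Longrightarrow>
        face X (Suc (Suc n)) i (degen X (Suc n) j x) = degen X n (j - 1) (face X (Suc n) i x)"
    and face_degen_same:
      "\<lbrakk>x \<in> simp X n; j \<le> n; i = j \<or> i = Suc j\<rbrakk> \<Longrightarrow> face X (Suc n) i (degen X n j x) = x"
    and face_degen_greater:
      "\<lbrakk>x \<in> simp X (Suc n); Suc j < i; i \<le> Suc (Suc n)\<rbrakk> \<Longrightarrow>
        face X (Suc (Suc n)) i (degen X (Suc n) j x) = degen X n j (face X (Suc n) (i - 1) x)"
    and degen_degen:
      "\<lbrakk>x \<in> simp X n; i \<le> j; j \<le> n\<rbrakk> \<Longrightarrow>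
        degen X (Suc n) i (degen X n j x) = degen X (Suc n) (Suc j) (degen X n i x)"

definition reduced :: "nat \<Rightarrow> (nat \<Rightarrow> 'a set) \<Rightarrow> bool" where
  "reduced k W \<longleftrightarrow> (\<forall>i\<le>k. \<exists>!w. w \<in> W i)"

text \<open>
  \<open>iter_face f [j\<^sub>1, \<dots>, j\<^sub>r] n x = f\<^bsub>j\<^sub>1\<^esub> (\<dots> (f\<^bsub>j\<^sub>r\<^esub> x))\<close> for \<open>x\<close> of dimension \<open>n\<close>.
\<close>

primrec iter_face :: "(nat \<Rightarrow> nat \<Rightarrow> 'a \<Rightarrow> 'a) \<Rightarrow> nat list \<Rightarrow> nat \<Rightarrow> 'a \<Rightarrow> 'a" where
  "iter_face f [] n x = x"
| "iter_face f (j # js) n x = f (n - length js) j (iter_face f js n x)"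

definition front_face :: "'a sset \<Rightarrow> nat \<Rightarrow> nat \<Rightarrow> 'a \<Rightarrow> 'a" where
  "front_face X n i x = iter_face (face X) [Suc i..<Suc n] n x"

definition back_face :: "'a sset \<Rightarrow> nat \<Rightarrow> nat \<Rightarrow> 'a \<Rightarrow> 'a" where
  "back_face X n i x = iter_face (face X) [0..<i] n x"

text \<open>The degenerate simplices of the base point of a simplicial set with one vertex.\<close>

primrec base_simplex :: "'a sset \<Rightarrow> nat \<Rightarrow> 'a" where
  "base_simplex X 0 = (THE x. x \<in> simp X 0)"
| "base_simplex X (Suc n) = degen X n 0 (base_simplex X n)"

text \<open>
  Simplicial chains are divided by the chains of positive degree on the base point and by the
  last degeneracies \<open>s\<^sub>n(x)\<close>, \<open>x \<in> X\<^sub>n\<close>, \<open>n > 0\<close>. The latter are exactly the simplices made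
  degenerate in the cubical loop set below (\<open>\<eta>\<^sub>n(x) \<sim> s\<^sub>n(x)\<close>), where the other degenerate simplices
  stay non-degenerate; neither unnormalized nor fully normalized chains would make the cobar
  construction match the cubical chains.
\<close>

definition simp_relations ::
    "('r, 'x) ring_scheme \<Rightarrow> 'a sset \<Rightarrow> (nat \<times> 'a \<Rightarrow> 'r) set" where
  "simp_relations R X = gen_submodule R (free_module R (SIGMA n:UNIV. simp X n))
    ({basis_elt R (n, base_simplex X n) | n. 0 < n} \<union>
     {basis_elt R (Suc n, degen X n n x) | n x. 0 < n \<and> x \<in> simp X n})"

definition simp_module ::
    "('r, 'x) ring_scheme \<Rightarrow> 'a sset \<Rightarrow> ('r, (nat \<times> 'a \<Rightarrow> 'r) set) module" where
  "simp_module R X = quot_module (free_module R (SIGMA n:UNIV. simp X n)) (simp_relations R X)"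

definition simp_class ::
    "('r, 'x) ring_scheme \<Rightarrow> 'a sset \<Rightarrow> nat \<Rightarrow> 'a \<Rightarrow> (nat \<times> 'a \<Rightarrow> 'r) set" where
  "simp_class R X n x =
    simp_relations R X +>\<^bsub>free_module R (SIGMA n:UNIV. simp X n)\<^esub> basis_elt R (n, x)"

definition simp_boundary ::
    "('r, 'x) ring_scheme \<Rightarrow> 'a sset \<Rightarrow> (nat \<times> 'a \<Rightarrow> 'r) set \<Rightarrow> (nat \<times> 'a \<Rightarrow> 'r) set" where
  "simp_boundary R X =
    (let M = simp_module R X in THE d. d \<in> linear_maps R M M \<and>
      (\<forall>x\<in>simp X 0. d (simp_class R X 0 x) = \<zero>\<^bsub>M\<^esub>) \<and>
      (\<forall>n>0. \<forall>x\<in>simp X n. d (simp_class R X n x) =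
        (\<Oplus>\<^bsub>M\<^esub>i\<in>{..n}. neg_one_pow R i \<odot>\<^bsub>M\<^esub> simp_class R X (n - 1) (face X n i x))))"

definition alexander_whitney ::
    "('r, 'x) ring_scheme \<Rightarrow> 'a sset \<Rightarrow> (nat \<times> 'a \<Rightarrow> 'r) set
      \<Rightarrow> ((nat \<times> 'a \<Rightarrow> 'r) set \<times> (nat \<times> 'a \<Rightarrow> 'r) set \<Rightarrow> 'r) set" where
  "alexander_whitney R X =
    (let M = simp_module R X; MM = tensor_prod R M M in THE \<nu>. \<nu> \<in> linear_maps R M MM \<and>
      (\<forall>n. \<forall>x\<in>simp X n. \<nu> (simp_class R X n x) =
        (\<Oplus>\<^bsub>MM\<^esub>i\<in>{..n}.
          tensor R M M (simp_class R X i (front_face X n i x)) (simp_class R X (n - i) (back_face X n i x)))))"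

definition simp_chains ::
    "('r, 'x) ring_scheme \<Rightarrow> 'a sset \<Rightarrow> ('r, (nat \<times> 'a \<Rightarrow> 'r) set) dg_coalgebra" where
  "simp_chains R X = dg_module.extend
    (module.extend (simp_module R X)
      (dg_module.fields
        (\<lambda>n. gen_submodule R (simp_module R X) {simp_class R X n x | x. x \<in> simp X n})
        (simp_boundary R X)))
    (dg_coalgebra.fields (alexander_whitney R X) (simp_class R X 0 (base_simplex X 0)))"


section \<open>Cubical sets and their chains\<close>

text \<open>
  \<open>cface Q True n i\<close> is \<open>d\<^sub>i\<^sup>1\<close>, \<open>cface Q False n i\<close> is \<open>d\<^sub>i\<^sup>0\<close> and \<open>cdegen Q n i\<close> is \<open>\<eta>\<^sub>i\<close>, all on
  \<open>Q\<^sub>n\<close>; indices start at \<open>1\<close>.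
\<close>

record 'q cset =
  cubes :: "nat \<Rightarrow> 'q set"
  cface :: "bool \<Rightarrow> nat \<Rightarrow> nat \<Rightarrow> 'q \<Rightarrow> 'q"
  cdegen :: "nat \<Rightarrow> nat \<Rightarrow> 'q \<Rightarrow> 'q"

definition cface_set :: "'q cset \<Rightarrow> bool \<Rightarrow> nat set \<Rightarrow> nat \<Rightarrow> 'q \<Rightarrow> 'q" where
  "cface_set Q \<epsilon> B n a = iter_face (cface Q \<epsilon>) (sorted_list_of_set B) n a"

definition shuff_perm :: "nat set \<Rightarrow> nat set \<Rightarrow> nat \<Rightarrow> nat" where
  "shuff_perm A B i =
    (let l = sorted_list_of_set A @ sorted_list_of_set B
     in if 1 \<le> i \<and> i \<le> length l then l ! (i - 1) else i)"

definition shuff :: "('r, 'x) ring_scheme \<Rightarrow> nat set \<Rightarrow> nat set \<Rightarrow> 'r" where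
  "shuff R A B = (if sign (shuff_perm A B) = 1 then \<one>\<^bsub>R\<^esub> else \<ominus>\<^bsub>R\<^esub> \<one>\<^bsub>R\<^esub>)"

definition cube_relations ::
    "('r, 'x) ring_scheme \<Rightarrow> 'q cset \<Rightarrow> (nat \<times> 'q \<Rightarrow> 'r) set" where
  "cube_relations R Q = gen_submodule R (free_module R (SIGMA n:UNIV. cubes Q n))
    {basis_elt R (Suc n, cdegen Q n i a) | n i a. a \<in> cubes Q n \<and> 1 \<le> i \<and> i \<le> Suc n}"

definition cube_module ::
    "('r, 'x) ring_scheme \<Rightarrow> 'q cset \<Rightarrow> ('r, (nat \<times> 'q \<Rightarrow> 'r) set) module" where
  "cube_module R Q = quot_module (free_module R (SIGMA n:UNIV. cubes Q n)) (cube_relations R Q)"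

definition cube_class ::
    "('r, 'x) ring_scheme \<Rightarrow> 'q cset \<Rightarrow> nat \<Rightarrow> 'q \<Rightarrow> (nat \<times> 'q \<Rightarrow> 'r) set" where
  "cube_class R Q n a =
    cube_relations R Q +>\<^bsub>free_module R (SIGMA n:UNIV. cubes Q n)\<^esub> basis_elt R (n, a)"

definition cube_boundary ::
    "('r, 'x) ring_scheme \<Rightarrow> 'q cset \<Rightarrow> (nat \<times> 'q \<Rightarrow> 'r) set \<Rightarrow> (nat \<times> 'q \<Rightarrow> 'r) set" where
  "cube_boundary R Q =
    (let M = cube_module R Q in THE d. d \<in> linear_maps R M M \<and>
      (\<forall>n. \<forall>a\<in>cubes Q n. d (cube_class R Q n a) =
        (\<Oplus>\<^bsub>M\<^esub>i\<in>{1..n}. neg_one_pow R (i - 1) \<odot>\<^bsub>M\<^esub>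
          (cube_class R Q (n - 1) (cface Q True n i a)
            \<ominus>\<^bsub>M\<^esub> cube_class R Q (n - 1) (cface Q False n i a)))))"

definition cube_coprod ::
    "('r, 'x) ring_scheme \<Rightarrow> 'q cset \<Rightarrow> (nat \<times> 'q \<Rightarrow> 'r) set
      \<Rightarrow> ((nat \<times> 'q \<Rightarrow> 'r) set \<times> (nat \<times> 'q \<Rightarrow> 'r) set \<Rightarrow> 'r) set" where
  "cube_coprod R Q =
    (let M = cube_module R Q; MM = tensor_prod R M M in THE \<Delta>. \<Delta> \<in> linear_maps R M MM \<and>
      (\<forall>n. \<forall>a\<in>cubes Q n. \<Delta> (cube_class R Q n a) =
        (\<Oplus>\<^bsub>MM\<^esub>A\<in>Pow {1..n}. let B = {1..n} - A in
          shuff R A B \<odot>\<^bsub>MM\<^esub> tensor R M M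
            (cube_class R Q (card A) (cface_set Q False B n a))
            (cube_class R Q (card B) (cface_set Q True A n a)))))"

definition cube_chains ::
    "('r, 'x) ring_scheme \<Rightarrow> 'q cset \<Rightarrow> ('r, (nat \<times> 'q \<Rightarrow> 'r) set) dg_coalgebra" where
  "cube_chains R Q = dg_module.extend
    (module.extend (cube_module R Q)
      (dg_module.fields
        (\<lambda>n. gen_submodule R (cube_module R Q) {cube_class R Q n a | a. a \<in> cubes Q n})
        (cube_boundary R Q)))
    (dg_coalgebra.fields (cube_coprod R Q) (cube_class R Q 0 (THE a. a \<in> cubes Q 0)))"


section \<open>The cubical loop set of a 1-reduced simplicial set\<close>

text \<open>
  The triple \<open>([i\<^sub>k, \<dots>, i\<^sub>1], n, x)\<close> stands for \<open>\<eta>\<^bsub>i\<^sub>k\<^esub>\<dots>\<eta>\<^bsub>i\<^sub>1\<^esub>(x)\<close> with \<open>x \<in> X\<^sub>n\<close>, outermost operator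
  first; as a letter it is desuspended, and a list of letters is a product.
\<close>

type_synonym 'a letter = "nat list \<times> nat \<times> 'a"

fun letter_valid :: "'a sset \<Rightarrow> 'a letter \<Rightarrow> bool" where
  "letter_valid X (js, n, x) \<longleftrightarrow>
    1 \<le> n \<and> x \<in> simp X n \<and> sorted (rev js) \<and>
    (\<forall>t<length js. 1 \<le> rev js ! t \<and> rev js ! t \<le> n + t)"

fun letter_dim :: "'a letter \<Rightarrow> nat" where
  "letter_dim (js, n, x) = length js + n - 1"

definition word_valid :: "'a sset \<Rightarrow> 'a letter list \<Rightarrow> bool" where
  "word_valid X w \<longleftrightarrow> (\<forall>g\<in>set w. letter_valid X g)"

definition word_dim :: "'a letter list \<Rightarrow> nat" where
  "word_dim w = (\<Sum>g\<leftarrow>w. letter_dim g)"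

text \<open>Bringing \<open>\<eta>\<^sub>i \<eta>\<^bsub>j\<^sub>k\<^esub>\<dots>\<eta>\<^bsub>j\<^sub>1\<^esub>\<close> to increasing order by \<open>\<eta>\<^sub>i\<eta>\<^sub>j = \<eta>\<^bsub>j+1\<^esub>\<eta>\<^sub>i\<close>, \<open>i < j\<close>.\<close>

fun insert_degen :: "nat \<Rightarrow> nat list \<Rightarrow> nat list" where
  "insert_degen i [] = [i]"
| "insert_degen i (j # js) = (if j \<le> i then i # j # js else Suc j # insert_degen i js)"

fun letter_degen :: "nat \<Rightarrow> 'a letter \<Rightarrow> 'a letter" where
  "letter_degen i (js, n, x) = (insert_degen i js, n, x)"

text \<open>The empty word is the unit, which is also the letter of the unique 1-simplex.\<close>

fun word_degen :: "'a sset \<Rightarrow> nat \<Rightarrow> 'a letter list \<Rightarrow> 'a letter list" where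
  "word_degen X i [] = [letter_degen i ([], 1, base_simplex X 1)]"
| "word_degen X i (g # w) =
    (if i \<le> letter_dim g \<or> w = [] then letter_degen i g # w
     else g # word_degen X (i - letter_dim g) w)"

fun letter_face :: "'a sset \<Rightarrow> bool \<Rightarrow> nat \<Rightarrow> 'a letter \<Rightarrow> 'a letter list" where
  "letter_face X \<epsilon> i ([], n, x) =
    (if \<epsilon> then [([], n - 1, face X n i x)]
     else [([], i, front_face X n i x), ([], n - i, back_face X n i x)])"
| "letter_face X \<epsilon> i (j # js, n, x) =
    (if i = j then [(js, n, x)]
     else if i < j then word_degen X (j - 1) (letter_face X \<epsilon> i (js, n, x))
     else word_degen X j (letter_face X \<epsilon> (i - 1) (js, n, x)))"

fun word_face :: "'a sset \<Rightarrow> bool \<Rightarrow> nat \<Rightarrow> 'a letter list \<Rightarrow> 'a letter list" where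
  "word_face X \<epsilon> i [] = []"
| "word_face X \<epsilon> i (g # w) =
    (if i \<le> letter_dim g then letter_face X \<epsilon> i g @ w
     else g # word_face X \<epsilon> (i - letter_dim g) w)"

text \<open>
  Besides the monoid relations \<open>unit\<close>, \<open>last_degen\<close> and \<open>shift\<close>, the congruence is closed under
  the degeneracy operators and contains the cubical identity for them, so that degeneracies and
  faces are well defined on the quotient (\<open>\<eta>\<^sub>i\<eta>\<^sub>i\<close> and \<open>\<eta>\<^bsub>i+1\<^esub>\<eta>\<^sub>i\<close> are different formal expressions).
\<close>

inductive loop_eq :: "'a sset \<Rightarrow> 'a letter list \<Rightarrow> 'a letter list \<Rightarrow> bool" for X where
  refl: "word_valid X u \<Longrightarrow> loop_eq X u u"
| sym: "loop_eq X u v \<Longrightarrow> loop_eq X v u"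
| trans: "loop_eq X u v \<Longrightarrow> loop_eq X v w \<Longrightarrow> loop_eq X u w"
| mult: "loop_eq X u u' \<Longrightarrow> loop_eq X v v' \<Longrightarrow> loop_eq X (u @ v) (u' @ v')"
| unit: "x \<in> simp X 1 \<Longrightarrow> loop_eq X [([], 1, x)] []"
| last_degen: "0 < n \<Longrightarrow> x \<in> simp X n \<Longrightarrow>
    loop_eq X [letter_degen n ([], n, x)] [([], Suc n, degen X n n x)]"
| shift: "letter_valid X g \<Longrightarrow> letter_valid X h \<Longrightarrow>
    loop_eq X [letter_degen (Suc (letter_dim g)) g, h] [g, letter_degen 1 h]"
| degen: "loop_eq X u v \<Longrightarrow> 1 \<le> i \<Longrightarrow> i \<le> Suc (word_dim u) \<Longrightarrow>
    loop_eq X (word_degen X i u) (word_degen X i v)"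
| degen_degen: "word_valid X u \<Longrightarrow> 1 \<le> i \<Longrightarrow> i \<le> j \<Longrightarrow> j \<le> Suc (word_dim u) \<Longrightarrow>
    loop_eq X (word_degen X i (word_degen X j u)) (word_degen X (Suc j) (word_degen X i u))"

definition loop_class :: "'a sset \<Rightarrow> 'a letter list \<Rightarrow> 'a letter list set" where
  "loop_class X u = {v. loop_eq X u v}"

definition loop_cubes :: "'a sset \<Rightarrow> 'a letter list set cset" where
  "loop_cubes X =
    \<lparr>cubes = (\<lambda>n. {loop_class X u | u. word_valid X u \<and> word_dim u = n}),
     cface = (\<lambda>\<epsilon> n i c. \<Union>u\<in>c. loop_class X (word_face X \<epsilon> i u)),
     cdegen = (\<lambda>n i c. \<Union>u\<in>c. loop_class X (word_degen X i u))\<rparr>"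


section \<open>The double cobar construction on simplicial chains\<close>

text \<open>
  For \<open>xs = [(n\<^sub>1, x\<^sub>1), \<dots>, (n\<^sub>k, x\<^sub>k)]\<close>, the element \<open>s\<^sup>-\<^sup>1x\<^sub>1 \<otimes> \<dots> \<otimes> s\<^sup>-\<^sup>1x\<^sub>k\<close> of the cobar construction
  and the cube \<open>x\<^sub>1 \<cdots> x\<^sub>k\<close>, of dimension \<open>bar_dim xs\<close>.
\<close>

definition cobar_word ::
    "('r, 'x) ring_scheme \<Rightarrow> 'a sset \<Rightarrow> (nat \<times> 'a) list \<Rightarrow> ((nat \<times> 'a \<Rightarrow> 'r) set list \<Rightarrow> 'r) set" where
  "cobar_word R X xs =
    tensor_word R (pos_part R (simp_chains R X)) (map (\<lambda>(n, x). simp_class R X n x) xs)"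

definition bar_word :: "'a sset \<Rightarrow> (nat \<times> 'a) list \<Rightarrow> 'a letter list set" where
  "bar_word X xs = loop_class X (map (\<lambda>(n, x). ([], n, x)) xs)"

definition bar_dim :: "(nat \<times> 'a) list \<Rightarrow> nat" where
  "bar_dim xs = (\<Sum>(n, x)\<leftarrow>xs. n - 1)"

definition simplex_list :: "'a sset \<Rightarrow> (nat \<times> 'a) list \<Rightarrow> bool" where
  "simplex_list X xs \<longleftrightarrow> (\<forall>(n, x)\<in>set xs. 2 \<le> n \<and> x \<in> simp X n)"

text \<open>
  The identification of the cobar construction on \<open>C\<^sub>*(X)\<close> with the cubical chains of the loop set.
  Simplices of dimension 1 are excluded: they are zero in \<open>C\<^sub>*(X)\<close> but give the unit of the monoid.
\<close>

definition loop_ident ::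
    "('r, 'x) ring_scheme \<Rightarrow> 'a sset \<Rightarrow> ((nat \<times> 'a \<Rightarrow> 'r) set list \<Rightarrow> 'r) set
      \<Rightarrow> (nat \<times> 'a letter list set \<Rightarrow> 'r) set" where
  "loop_ident R X =
    (THE \<iota>. dg_iso R (cobar R (simp_chains R X)) (cube_chains R (loop_cubes X)) \<iota> \<and>
      (\<forall>xs. simplex_list X xs \<longrightarrow>
        \<iota> (cobar_word R X xs) = cube_class R (loop_cubes X) (bar_dim xs) (bar_word X xs)))"

text \<open>The DG coalgebra structure transported along \<^const>\<open>loop_ident\<close>.\<close>

definition cobar_coalgebra ::
    "('r, 'x) ring_scheme \<Rightarrow> 'a sset
      \<Rightarrow> ('r, ((nat \<times> 'a \<Rightarrow> 'r) set list \<Rightarrow> 'r) set) dg_coalgebra" where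
  "cobar_coalgebra R X =
    (let T = cobar R (simp_chains R X); K = cube_chains R (loop_cubes X); \<iota> = loop_ident R X;
         \<kappa> = inv_into (carrier T) \<iota>
     in dg_module.extend T
       (dg_coalgebra.fields (\<lambda>w. tensor_map R K T \<kappa> (coprod K (\<iota> w))) (\<kappa> (coaug K))))"

definition double_cobar ::
    "('r, 'x) ring_scheme \<Rightarrow> 'a sset
      \<Rightarrow> ('r, (((nat \<times> 'a \<Rightarrow> 'r) set list \<Rightarrow> 'r) set list \<Rightarrow> 'r) set) dg_module" where
  "double_cobar R X = cobar R (cobar_coalgebra R X)"


section \<open>The multipermutahedral set of a 1-reduced cubical set and its chains\<close>

text \<open>
  \<open>Cube r a\<close> is the desuspension of \<open>a \<in> Q\<^sub>r\<close> and \<open>Rho M N u s b\<close> is \<open>\<rho>\<^bsub>M|N\<^esub>(u \<cdot> b)\<close> with \<open>b\<close> the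
  desuspension of an element of \<open>Q\<^sub>s\<close>. A generator of size \<open>n\<close> has degree \<open>n - 1\<close>.
\<close>

datatype 'q perm_cell =
    Cube nat 'q
  | Rho "nat set" "nat set" "'q perm_cell" nat 'q

primrec cell_size :: "'q perm_cell \<Rightarrow> nat" where
  "cell_size (Cube r a) = r"
| "cell_size (Rho M N u s b) = cell_size u + s"

primrec cell_valid :: "'q cset \<Rightarrow> 'q perm_cell \<Rightarrow> bool" where
  "cell_valid Q (Cube r a) \<longleftrightarrow> 1 \<le> r \<and> a \<in> cubes Q r"
| "cell_valid Q (Rho M N u s b) \<longleftrightarrow>
    cell_valid Q u \<and> 1 \<le> s \<and> b \<in> cubes Q s \<and>
    M \<union> N = {1..cell_size u + s} \<and> M \<inter> N = {} \<and>
    (card M = cell_size u \<and> card N = s \<or> card M = s \<and> card N = cell_size u)"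

definition cells_valid :: "'q cset \<Rightarrow> 'q perm_cell list \<Rightarrow> bool" where
  "cells_valid Q w \<longleftrightarrow> (\<forall>c\<in>set w. cell_valid Q c)"

definition cells_degree :: "'q perm_cell list \<Rightarrow> nat" where
  "cells_degree w = (\<Sum>c\<leftarrow>w. cell_size c - 1)"

text \<open>
  Closure under \<open>rho\<close> makes the degeneracy operators \<open>u \<cdot> b \<mapsto> \<rho>\<^bsub>M|N\<^esub>(u \<cdot> b)\<close> compatible with the
  relations.
\<close>

inductive perm_eq :: "'q cset \<Rightarrow> 'q perm_cell list \<Rightarrow> 'q perm_cell list \<Rightarrow> bool" for Q where
  refl: "cells_valid Q u \<Longrightarrow> perm_eq Q u u"
| sym: "perm_eq Q u v \<Longrightarrow> perm_eq Q v u"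
| trans: "perm_eq Q u v \<Longrightarrow> perm_eq Q v w \<Longrightarrow> perm_eq Q u w"
| mult: "perm_eq Q u u' \<Longrightarrow> perm_eq Q v v' \<Longrightarrow> perm_eq Q (u @ v) (u' @ v')"
| rho: "perm_eq Q [u] [u'] \<Longrightarrow> cell_valid Q (Rho M N u s b) \<Longrightarrow>
    perm_eq Q [Rho M N u s b] [Rho M N u' s b]"
| unit: "a \<in> cubes Q 1 \<Longrightarrow> perm_eq Q [Cube 1 a] []"
| swap: "cell_valid Q (Rho M N (Cube r a) s b) \<Longrightarrow>
    perm_eq Q [Rho M N (Cube r a) s b] [Rho N M (Cube r a) s b]"
| unit_left: "e \<in> cubes Q 1 \<Longrightarrow> 1 \<le> r \<Longrightarrow> a \<in> cubes Q r \<Longrightarrow> j \<in> {1..Suc r} \<Longrightarrow>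
    perm_eq Q [Rho {j} ({1..Suc r} - {j}) (Cube 1 e) r a] [Cube (Suc r) (cdegen Q r j a)]"
| unit_right: "e \<in> cubes Q 1 \<Longrightarrow> 1 \<le> r \<Longrightarrow> a \<in> cubes Q r \<Longrightarrow> j \<in> {1..Suc r} \<Longrightarrow>
    perm_eq Q [Rho ({1..Suc r} - {j}) {j} (Cube r a) 1 e] [Cube (Suc r) (cdegen Q r j a)]"
| shift: "e \<in> cubes Q 1 \<Longrightarrow> 1 \<le> r \<Longrightarrow> a \<in> cubes Q r \<Longrightarrow> 1 \<le> s \<Longrightarrow> b \<in> cubes Q s \<Longrightarrow>
    perm_eq Q [Rho {1..r} {Suc r} (Cube r a) 1 e, Cube s b]
              [Cube r a, Rho {1} ({1..Suc s} - {1}) (Cube 1 e) s b]"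

definition perm_class :: "'q cset \<Rightarrow> 'q perm_cell list \<Rightarrow> 'q perm_cell list set" where
  "perm_class Q u = {v. perm_eq Q u v}"

definition perm_monoid :: "'q cset \<Rightarrow> 'q perm_cell list set monoid" where
  "perm_monoid Q =
    \<lparr>carrier = {perm_class Q u | u. cells_valid Q u},
     mult = (\<lambda>c d. \<Union>u\<in>c. \<Union>v\<in>d. perm_class Q (u @ v)),
     one = perm_class Q []\<rparr>"

definition perm_degenerate :: "'q cset \<Rightarrow> 'q perm_cell list set set" where
  "perm_degenerate Q =
    {perm_class Q (u @ [Rho M N c s b] @ v) | u v M N c s b.
      cells_valid Q (u @ [c, Cube s b] @ v) \<and> cell_valid Q (Rho M N c s b)}"

definition perm_relations ::
    "('r, 'x) ring_scheme \<Rightarrow> 'q cset \<Rightarrow> ('q perm_cell list set \<Rightarrow> 'r) set" where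
  "perm_relations R Q =
    gen_submodule R (monoid_algebra R (perm_monoid Q)) (basis_elt R ` perm_degenerate Q)"

definition perm_module ::
    "('r, 'x) ring_scheme \<Rightarrow> 'q cset \<Rightarrow> ('r, ('q perm_cell list set \<Rightarrow> 'r) set) module" where
  "perm_module R Q = quot_module (monoid_algebra R (perm_monoid Q)) (perm_relations R Q)"

definition perm_chain ::
    "('r, 'x) ring_scheme \<Rightarrow> 'q cset \<Rightarrow> 'q perm_cell list \<Rightarrow> ('q perm_cell list set \<Rightarrow> 'r) set" where
  "perm_chain R Q w =
    perm_relations R Q +>\<^bsub>monoid_algebra R (perm_monoid Q)\<^esub> basis_elt R (perm_class Q w)"

text \<open>Products of desuspended cubes generate modulo degeneracies, so they determine the differential.\<close>

definition perm_diff ::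
    "('r, 'x) ring_scheme \<Rightarrow> 'q cset
      \<Rightarrow> ('q perm_cell list set \<Rightarrow> 'r) set \<Rightarrow> ('q perm_cell list set \<Rightarrow> 'r) set" where
  "perm_diff R Q =
    (let M = perm_module R Q; cs = map (\<lambda>(r, a). Cube r a)
     in THE d. d \<in> linear_maps R M M \<and>
      (\<forall>w. cells_valid Q (cs w) \<longrightarrow>
        d (perm_chain R Q (cs w)) =
        (\<Oplus>\<^bsub>M\<^esub>i\<in>{..<length w}. let r = fst (w ! i); a = snd (w ! i) in
          \<Oplus>\<^bsub>M\<^esub>A\<in>{A. A \<noteq> {} \<and> A \<subset> {1..r}}. let B = {1..r} - A in
            (neg_one_pow R (cells_degree (cs (take i w))) \<otimes>\<^bsub>R\<^esub> neg_one_pow R (card A)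
               \<otimes>\<^bsub>R\<^esub> shuff R A B) \<odot>\<^bsub>M\<^esub>
            perm_chain R Q (cs (take i w @
              [(card A, cface_set Q False B r a), (card B, cface_set Q True A r a)] @
              drop (Suc i) w)))))"

definition perm_chains ::
    "('r, 'x) ring_scheme \<Rightarrow> 'q cset \<Rightarrow> ('r, ('q perm_cell list set \<Rightarrow> 'r) set) dg_module" where
  "perm_chains R Q = module.extend (perm_module R Q)
    (dg_module.fields
      (\<lambda>n. gen_submodule R (perm_module R Q)
        {perm_chain R Q w | w. cells_valid Q w \<and> cells_degree w = n})
      (perm_diff R Q))"

end

theory Submission
  imports Defs
begin

text \<open>
  Every word of the cubical loop set is degenerate or equivalent to a unique product of simplices
  that are not last degeneracies, and every multipermutahedral word is degenerate or equivalent to a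
  unique product of non-degenerate cubes of dimension at least 2; both claims rest on invariants of
  the defining congruences. So the chains modulo degeneracies are free on bases that match those of
  the tensor algebras, compatibly with products. The differentials agree on generators because a
  letter of dimension 1 is the unit of the monoid but zero in the coalgebra: the faces that contain
  such a letter give the linear part of the cobar differential and all other faces give the reduced
  coproduct. In the second stage the signs match since the shuffles of \<open>{i}\<close> and its complement in
  \<open>{1..n}\<close> have signs \<open>(-1)^(i-1)\<close> and \<open>(-1)^(n-i)\<close>, according to the order of the two blocks.
\<close>

section \<open>Modules\<close>

text \<open>Boundaries, coproducts, the cobar and permutahedral differentials and the first
  identification are definite descriptions, so each must be shown to exist and to be unique before
  it can be computed. Bases do this: every quotient of chains is taken by the span of part of a
  basis and stays free on the rest. The cobar differential is described for every presentation of
  the reduced coproduct at once, so independence of the presentation has to come from a formula that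
  uses only the coproduct itself. The permutahedral differential is described on all products of
  cubes, degenerate ones and units included; its consistency is not checked directly but imported
  from the cobar differential through the algebra isomorphism. The hypothesis of 2-reducedness acts
  in low dimensions: the unique 2-simplex is a last degeneracy, so surviving simplices of positive
  dimension start at 3 and surviving cubes of positive dimension at 2. Hence the loop set is
  1-reduced, as the second stage requires.\<close>

definition lin ::
    "('r, 'x) ring_scheme \<Rightarrow> ('r, 'm, 'y) module_scheme \<Rightarrow> ('r, 'n, 'z) module_scheme \<Rightarrow> ('m \<Rightarrow> 'n) \<Rightarrow> bool" where
  "lin R M N h \<longleftrightarrow> h \<in> carrier M \<rightarrow> carrier N \<and>
    (\<forall>x\<in>carrier M. \<forall>y\<in>carrier M. h (x \<oplus>\<^bsub>M\<^esub> y) = h x \<oplus>\<^bsub>N\<^esub> h y) \<and>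
    (\<forall>r\<in>carrier R. \<forall>x\<in>carrier M. h (r \<odot>\<^bsub>M\<^esub> x) = r \<odot>\<^bsub>N\<^esub> h x)"

lemma linear_maps_iff: "h \<in> linear_maps R M N \<longleftrightarrow> lin R M N h \<and> h \<in> extensional (carrier M)"
  by (auto simp: linear_maps_def lin_def PiE_def)

lemma linI:
  assumes "\<And>x. x \<in> carrier M \<Longrightarrow> h x \<in> carrier N"
    and "\<And>x y. x \<in> carrier M \<Longrightarrow> y \<in> carrier M \<Longrightarrow> h (x \<oplus>\<^bsub>M\<^esub> y) = h x \<oplus>\<^bsub>N\<^esub> h y"
    and "\<And>r x. r \<in> carrier R \<Longrightarrow> x \<in> carrier M \<Longrightarrow> h (r \<odot>\<^bsub>M\<^esub> x) = r \<odot>\<^bsub>N\<^esub> h x"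
  shows "lin R M N h"
  using assms by (auto simp: lin_def)

lemma lin_closed: "lin R M N h \<Longrightarrow> x \<in> carrier M \<Longrightarrow> h x \<in> carrier N"
  by (auto simp: lin_def)
lemma lin_add: "lin R M N h \<Longrightarrow> x \<in> carrier M \<Longrightarrow> y \<in> carrier M \<Longrightarrow> h (x \<oplus>\<^bsub>M\<^esub> y) = h x \<oplus>\<^bsub>N\<^esub> h y"
  by (auto simp: lin_def)
lemma lin_smult: "lin R M N h \<Longrightarrow> r \<in> carrier R \<Longrightarrow> x \<in> carrier M \<Longrightarrow> h (r \<odot>\<^bsub>M\<^esub> x) = r \<odot>\<^bsub>N\<^esub> h x"
  by (auto simp: lin_def)

lemma lin_cong:
  assumes "module R M" "lin R M N f" "\<And>x. x \<in> carrier M \<Longrightarrow> f x = g x"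
  shows "lin R M N g"
proof -
  interpret M: module R M by fact
  show ?thesis using assms(2,3) by (auto simp: lin_def Pi_def)
qed

text \<open>The descriptions range over \<open>linear_maps\<close>, whose members are
  \<open>undefined\<close> off the carrier. The predicate \<open>lin\<close> is stable under
  composition and sums; restriction leads back to the extensional set.\<close>

lemma lin_restrict: "module R M \<Longrightarrow> lin R M N h \<Longrightarrow> restrict h (carrier M) \<in> linear_maps R M N"
  by (auto simp: linear_maps_iff intro: lin_cong)

lemma lin_comp:
  assumes "lin R M N f" "lin R N P g"
  shows "lin R M P (\<lambda>x. g (f x))"
  using assms by (auto simp: lin_def Pi_def)

lemma lin_id: "module R M \<Longrightarrow> lin R M M (\<lambda>x. x)"
  by (auto simp: lin_def)

lemma module_minus_eq_zero:
  assumes "module R M" "x \<in> carrier M" "y \<in> carrier M" "x \<ominus>\<^bsub>M\<^esub> y = \<zero>\<^bsub>M\<^esub>"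
  shows "x = y"
proof -
  interpret M: module R M by fact
  have "\<ominus>\<^bsub>M\<^esub> (\<ominus>\<^bsub>M\<^esub> y) = x"
    using assms by (intro M.M.minus_equality) (auto simp: a_minus_def)
  then show ?thesis using assms by simp
qed

lemma lin_zero:
  assumes "module R M" "module R N" "lin R M N h"
  shows "h \<zero>\<^bsub>M\<^esub> = \<zero>\<^bsub>N\<^esub>"
proof -
  interpret M: module R M by fact
  interpret N: module R N by fact
  have "h (\<zero>\<^bsub>R\<^esub> \<odot>\<^bsub>M\<^esub> \<zero>\<^bsub>M\<^esub>) = \<zero>\<^bsub>R\<^esub> \<odot>\<^bsub>N\<^esub> h \<zero>\<^bsub>M\<^esub>"
    by (rule lin_smult[OF assms(3)]) auto
  then show ?thesis using lin_closed[OF assms(3)] by simp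
qed

lemma lin_neg:
  assumes "module R M" "module R N" "lin R M N h" "x \<in> carrier M"
  shows "h (\<ominus>\<^bsub>M\<^esub> x) = \<ominus>\<^bsub>N\<^esub> h x"
proof -
  interpret M: module R M by fact
  interpret N: module R N by fact
  have hx: "h x \<in> carrier N" by (rule lin_closed[OF assms(3,4)])
  have "h ((\<ominus>\<^bsub>R\<^esub> \<one>\<^bsub>R\<^esub>) \<odot>\<^bsub>M\<^esub> x) = (\<ominus>\<^bsub>R\<^esub> \<one>\<^bsub>R\<^esub>) \<odot>\<^bsub>N\<^esub> h x"
    using assms by (auto intro!: lin_smult)
  then show ?thesis using assms hx by (simp add: M.smult_l_minus N.smult_l_minus)
qed

lemma lin_minus:
  assumes "module R M" "module R N" "lin R M N h" "x \<in> carrier M" "y \<in> carrier M"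
  shows "h (x \<ominus>\<^bsub>M\<^esub> y) = h x \<ominus>\<^bsub>N\<^esub> h y"
proof -
  interpret M: module R M by fact
  interpret N: module R N by fact
  show ?thesis using assms by (simp add: a_minus_def lin_add lin_neg)
qed

lemma lin_finsum:
  assumes "module R M" "module R N" "lin R M N h" "f \<in> A \<rightarrow> carrier M"
  shows "h (\<Oplus>\<^bsub>M\<^esub>i\<in>A. f i) = (\<Oplus>\<^bsub>N\<^esub>i\<in>A. h (f i))"
proof -
  interpret M: module R M by fact
  interpret N: module R N by fact
  show ?thesis
  proof (cases "finite A")
    case True
    then show ?thesis using assms(4)
    proof (induction A)
      case (insert a A)
      then have f:"f \<in> A \<rightarrow> carrier M" "f a \<in> carrier M" by auto
      then have "(\<lambda>i. h (f i)) \<in> A \<rightarrow> carrier N" "h (f a) \<in> carrier N"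
        by (auto simp: Pi_iff intro: lin_closed[OF assms(3)])
      moreover have "(\<Oplus>\<^bsub>M\<^esub>i\<in>A. f i) \<in> carrier M" using f by (intro M.finsum_closed)
      ultimately show ?case using insert f
        by (simp add: M.finsum_insert N.finsum_insert lin_add[OF assms(3)])
    qed (simp add: lin_zero[OF assms(1-3)])
  next
    case False
    then show ?thesis by (simp add: M.finsum_infinite N.finsum_infinite lin_zero[OF assms(1-3)])
  qed
qed

lemma lin_const_zero: "module R M \<Longrightarrow> module R N \<Longrightarrow> lin R M N (\<lambda>x. \<zero>\<^bsub>N\<^esub>)"
proof -
  assume "module R M" "module R N"
  then interpret M: module R M + N: module R N by auto
  show ?thesis by (auto simp: lin_def)
qed

lemma lin_plus:
  assumes "module R M" "module R N" "lin R M N f" "lin R M N g"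
  shows "lin R M N (\<lambda>x. f x \<oplus>\<^bsub>N\<^esub> g x)"
proof -
  interpret M: module R M by fact
  interpret N: module R N by fact
  show ?thesis using assms(3,4)
    by (intro linI) (auto simp: lin_closed lin_add lin_smult N.smult_r_distr N.a_ac)
qed

lemma lin_scale:
  assumes "module R M" "module R N" "lin R M N f" "r \<in> carrier R"
  shows "lin R M N (\<lambda>x. r \<odot>\<^bsub>N\<^esub> f x)"
proof -
  interpret M: module R M by fact
  interpret N: module R N by fact
  show ?thesis using assms(3,4)
    by (intro linI) (auto simp: lin_closed lin_add lin_smult N.smult_r_distr N.smult_assoc1[symmetric] M.m_comm)
qed

lemma lin_uminus:
  assumes "module R M" "module R N" "lin R M N f"
  shows "lin R M N (\<lambda>x. \<ominus>\<^bsub>N\<^esub> f x)"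
proof -
  interpret M: module R M by fact
  interpret N: module R N by fact
  show ?thesis using assms(3)
    by (intro linI) (auto simp: lin_closed lin_add lin_smult N.minus_add N.smult_r_minus)
qed

subsection \<open>Generated submodules\<close>

text \<open>Closure under negation is recovered from multiplication by -1.\<close>

lemma submodule_iff:
  assumes "module R M"
  shows "submodule H R M \<longleftrightarrow> H \<subseteq> carrier M \<and> \<zero>\<^bsub>M\<^esub> \<in> H \<and> (\<forall>x\<in>H. \<forall>y\<in>H. x \<oplus>\<^bsub>M\<^esub> y \<in> H) \<and>
    (\<forall>r\<in>carrier R. \<forall>x\<in>H. r \<odot>\<^bsub>M\<^esub> x \<in> H)" (is "_ \<longleftrightarrow> ?P")
proof -
  interpret M: module R M by fact
  show ?thesis
  proof
    assume H: "submodule H R M"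
    then have "\<zero>\<^bsub>M\<^esub> \<in> H"
      using subgroup.one_closed[OF submodule.axioms(1)[OF H]] by simp
    then show ?P using M.submoduleE[OF H] by auto
  next
    assume P: ?P
    have "\<ominus>\<^bsub>M\<^esub> x \<in> H" if "x \<in> H" for x
    proof -
      have "\<ominus>\<^bsub>M\<^esub> x = (\<ominus>\<^bsub>R\<^esub> \<one>\<^bsub>R\<^esub>) \<odot>\<^bsub>M\<^esub> x" using P that by (simp add: M.smult_l_minus subset_iff)
      then show ?thesis using P that by simp
    qed
    then show "submodule H R M" using P by (intro M.submoduleI) auto
  qed
qed

lemma gen_submodule_submodule:
  assumes "module R M" "S \<subseteq> carrier M"
  shows "submodule (gen_submodule R M S) R M"
proof -
  interpret M: module R M by fact
  have "carrier M \<in> {N. submodule N R M \<and> S \<subseteq> N}"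
    using assms M.carrier_is_submodule by auto
  then have "gen_submodule R M S \<subseteq> carrier M"
    by (auto simp: gen_submodule_def)
  then show ?thesis
    unfolding submodule_iff[OF assms(1)] by (auto simp: gen_submodule_def submodule_iff[OF assms(1)])
qed

lemma gen_submodule_incl: "S \<subseteq> gen_submodule R M S"
  by (auto simp: gen_submodule_def)

lemma gen_submodule_least: "submodule N R M \<Longrightarrow> S \<subseteq> N \<Longrightarrow> gen_submodule R M S \<subseteq> N"
  by (auto simp: gen_submodule_def)

lemma gen_submodule_closed:
  assumes "module R M" "S \<subseteq> carrier M"
  shows "gen_submodule R M S \<subseteq> carrier M" "\<zero>\<^bsub>M\<^esub> \<in> gen_submodule R M S"
    "\<And>x y. x \<in> gen_submodule R M S \<Longrightarrow> y \<in> gen_submodule R M S \<Longrightarrow> x \<oplus>\<^bsub>M\<^esub> y \<in> gen_submodule R M S"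
    "\<And>r x. r \<in> carrier R \<Longrightarrow> x \<in> gen_submodule R M S \<Longrightarrow> r \<odot>\<^bsub>M\<^esub> x \<in> gen_submodule R M S"
  using gen_submodule_submodule[OF assms] unfolding submodule_iff[OF assms(1)] by auto

lemma gen_submodule_induct [consumes 3, case_names zero gen add smult]:
  assumes "module R M" "S \<subseteq> carrier M" "x \<in> gen_submodule R M S"
    and "P \<zero>\<^bsub>M\<^esub>" "\<And>s. s \<in> S \<Longrightarrow> P s"
    and "\<And>x y. x \<in> carrier M \<Longrightarrow> y \<in> carrier M \<Longrightarrow> P x \<Longrightarrow> P y \<Longrightarrow> P (x \<oplus>\<^bsub>M\<^esub> y)"
    and "\<And>r x. r \<in> carrier R \<Longrightarrow> x \<in> carrier M \<Longrightarrow> P x \<Longrightarrow> P (r \<odot>\<^bsub>M\<^esub> x)"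
  shows "P x"
proof -
  interpret M: module R M by fact
  have "submodule {x \<in> carrier M. P x} R M"
    unfolding submodule_iff[OF assms(1)] using assms(4-) by auto
  from gen_submodule_least[OF this, of S] assms(2,3,5) show ?thesis by auto
qed

lemma gen_submodule_mono:
  assumes "module R M" "T \<subseteq> carrier M" "S \<subseteq> gen_submodule R M T"
  shows "gen_submodule R M S \<subseteq> gen_submodule R M T"
  using gen_submodule_least gen_submodule_submodule assms by blast

lemma gen_submodule_eqI:
  assumes "module R M" "S \<subseteq> carrier M" "T \<subseteq> carrier M"
    "S \<subseteq> gen_submodule R M T" "T \<subseteq> gen_submodule R M S"
  shows "gen_submodule R M S = gen_submodule R M T"
  using gen_submodule_mono assms by blast

lemma lin_eq_on_gen:
  assumes "module R M" "module R N" "lin R M N f" "lin R M N g" "S \<subseteq> carrier M"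
    "\<And>s. s \<in> S \<Longrightarrow> f s = g s" "x \<in> gen_submodule R M S"
  shows "f x = g x"
  using assms(1,5,7)
proof (induction rule: gen_submodule_induct)
  case zero
  then show ?case using lin_zero assms(1-4) by metis
qed (auto simp: assms(6) lin_add[OF assms(3)] lin_add[OF assms(4)] lin_smult[OF assms(3)] lin_smult[OF assms(4)])

lemma linear_maps_eqI:
  assumes "module R M" "module R N" "f \<in> linear_maps R M N" "g \<in> linear_maps R M N"
    "S \<subseteq> carrier M" "carrier M \<subseteq> gen_submodule R M S" "\<And>s. s \<in> S \<Longrightarrow> f s = g s"
  shows "f = g"
proof (rule extensionalityI[of _ "carrier M"])
  fix x assume x: "x \<in> carrier M"
  have xg: "x \<in> gen_submodule R M S" using assms(6) x by blast
  show "f x = g x"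
    by (rule lin_eq_on_gen[OF assms(1,2) _ _ assms(5) assms(7) xg])
       (use assms(3,4) in \<open>simp_all add: linear_maps_iff\<close>)
qed (use assms in \<open>auto simp: linear_maps_iff\<close>)

lemma lin_gen_submodule_into:
  assumes "module R M" "module R N" "lin R M N f" "S \<subseteq> carrier M" "submodule H R N"
    "\<And>s. s \<in> S \<Longrightarrow> f s \<in> H" "x \<in> gen_submodule R M S"
  shows "f x \<in> H"
  using assms(1,4,7)
  by (induction rule: gen_submodule_induct)
     (use assms(5,6) in \<open>auto simp: submodule_iff[OF assms(2)] lin_zero[OF assms(1-3)]
        lin_add[OF assms(3)] lin_smult[OF assms(3)]\<close>)

lemma lin_image_gen_submodule:
  assumes "module R M" "module R N" "lin R M N f" "S \<subseteq> carrier M"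
  shows "f ` gen_submodule R M S = gen_submodule R N (f ` S)"
proof
  interpret M: module R M by fact
  interpret N: module R N by fact
  have fS: "f ` S \<subseteq> carrier N" using assms by (auto intro: lin_closed)
  show "f ` gen_submodule R M S \<subseteq> gen_submodule R N (f ` S)"
    using lin_gen_submodule_into[OF assms gen_submodule_submodule[OF assms(2) fS]]
      gen_submodule_incl[of "f ` S"] by fastforce
  have "submodule (f ` gen_submodule R M S) R N"
    unfolding submodule_iff[OF assms(2)]
  proof (intro conjI ballI)
    note cl = gen_submodule_closed[OF assms(1,4)]
    show "f ` gen_submodule R M S \<subseteq> carrier N" using cl(1) assms(3) by (auto intro: lin_closed)
    show "\<zero>\<^bsub>N\<^esub> \<in> f ` gen_submodule R M S" using cl(2) lin_zero[OF assms(1-3)] by (metis imageI)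
    fix x assume "x \<in> f ` gen_submodule R M S"
    then obtain x' where x': "x' \<in> gen_submodule R M S" "x = f x'" by auto
    { fix y assume "y \<in> f ` gen_submodule R M S"
      then obtain y' where y': "y' \<in> gen_submodule R M S" "y = f y'" by auto
      then show "x \<oplus>\<^bsub>N\<^esub> y \<in> f ` gen_submodule R M S"
        using x' cl(1,3) by (auto simp: lin_add[OF assms(3), symmetric] subset_iff) }
    { fix r assume "r \<in> carrier R"
      then show "r \<odot>\<^bsub>N\<^esub> x \<in> f ` gen_submodule R M S"
        using x' cl(1,4) by (auto simp: lin_smult[OF assms(3), symmetric] subset_iff) }
  qed
  then show "gen_submodule R N (f ` S) \<subseteq> f ` gen_submodule R M S"
    by (rule gen_submodule_least) (use gen_submodule_incl[of S] in blast)
qed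

lemma finsum_gen_submodule:
  assumes "module R M" "submodule H R M" "\<And>i. i \<in> A \<Longrightarrow> f i \<in> H"
  shows "(\<Oplus>\<^bsub>M\<^esub>i\<in>A. f i) \<in> H"
proof -
  interpret M: module R M by fact
  note H = assms(2)[unfolded submodule_iff[OF assms(1)]]
  show ?thesis
  proof (cases "finite A")
    case True
    then show ?thesis using assms(3)
    proof (induction A)
      case (insert a A)
      then have "f \<in> A \<rightarrow> carrier M" "f a \<in> carrier M" using H by auto
      then show ?case using insert H by (simp add: M.finsum_insert)
    qed (use H in simp)
  qed (use H in \<open>simp add: M.finsum_infinite\<close>)
qed

subsection \<open>Free modules\<close>

lemma free_module_simps [simp]:
  "zero (free_module R B) = (\<lambda>b. \<zero>\<^bsub>R\<^esub>)"
  "add (free_module R B) = (\<lambda>f g b. f b \<oplus>\<^bsub>R\<^esub> g b)"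
  "smult (free_module R B) = (\<lambda>r f b. r \<otimes>\<^bsub>R\<^esub> f b)"
  by (simp_all add: free_module_def)

lemma free_module_carrier:
  "f \<in> carrier (free_module R B) \<longleftrightarrow> (\<forall>b. f b \<in> carrier R) \<and> (\<forall>b. b \<notin> B \<longrightarrow> f b = \<zero>\<^bsub>R\<^esub>) \<and>
    finite {b. f b \<noteq> \<zero>\<^bsub>R\<^esub>}"
  by (simp add: free_module_def)

lemma module_free_module:
  assumes "cring R"
  shows "module R (free_module R B)"
proof -
  interpret R: cring R by fact
  let ?F = "free_module R B"
  have add: "f \<oplus>\<^bsub>?F\<^esub> g \<in> carrier ?F" if "f \<in> carrier ?F" "g \<in> carrier ?F" for f g
  proof -
    have "{b. f b \<oplus>\<^bsub>R\<^esub> g b \<noteq> \<zero>\<^bsub>R\<^esub>} \<subseteq> {b. f b \<noteq> \<zero>\<^bsub>R\<^esub>} \<union> {b. g b \<noteq> \<zero>\<^bsub>R\<^esub>}" by auto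
    moreover have "finite ({b. f b \<noteq> \<zero>\<^bsub>R\<^esub>} \<union> {b. g b \<noteq> \<zero>\<^bsub>R\<^esub>})"
      using that by (simp add: free_module_carrier)
    ultimately have "finite {b. f b \<oplus>\<^bsub>R\<^esub> g b \<noteq> \<zero>\<^bsub>R\<^esub>}" by (rule finite_subset)
    with that show ?thesis unfolding free_module_carrier by simp
  qed
  have smult: "r \<odot>\<^bsub>?F\<^esub> f \<in> carrier ?F" if "r \<in> carrier R" "f \<in> carrier ?F" for r f
  proof -
    have "{b. r \<otimes>\<^bsub>R\<^esub> f b \<noteq> \<zero>\<^bsub>R\<^esub>} \<subseteq> {b. f b \<noteq> \<zero>\<^bsub>R\<^esub>}" using that by auto
    then have "finite {b. r \<otimes>\<^bsub>R\<^esub> f b \<noteq> \<zero>\<^bsub>R\<^esub>}"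
      using that(2) unfolding free_module_carrier by (auto elim: finite_subset)
    with that show ?thesis unfolding free_module_carrier by simp
  qed
  have "abelian_group ?F"
  proof (rule abelian_groupI)
    fix f assume f: "f \<in> carrier ?F"
    have "(\<ominus>\<^bsub>R\<^esub> \<one>\<^bsub>R\<^esub>) \<odot>\<^bsub>?F\<^esub> f \<in> carrier ?F" using f by (intro smult) auto
    moreover have "((\<ominus>\<^bsub>R\<^esub> \<one>\<^bsub>R\<^esub>) \<odot>\<^bsub>?F\<^esub> f) \<oplus>\<^bsub>?F\<^esub> f = \<zero>\<^bsub>?F\<^esub>"
      using f by (auto simp: free_module_carrier R.l_minus R.l_neg)
    ultimately show "\<exists>g\<in>carrier ?F. g \<oplus>\<^bsub>?F\<^esub> f = \<zero>\<^bsub>?F\<^esub>" by auto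
  next
    show "\<zero>\<^bsub>?F\<^esub> \<in> carrier ?F" by (simp add: free_module_carrier)
  qed (rule add, assumption+, auto simp: free_module_carrier R.a_ac fun_eq_iff)
  then show ?thesis
    using assms smult
    by (intro moduleI)
       (auto simp: free_module_carrier fun_eq_iff R.l_distr R.r_distr R.m_assoc)
qed

lemma basis_elt_closed:
  assumes "cring R" "b \<in> B"
  shows "basis_elt R b \<in> carrier (free_module R B)"
proof -
  interpret R: cring R by fact
  have "{c. basis_elt R b c \<noteq> \<zero>\<^bsub>R\<^esub>} \<subseteq> {b}" by (auto simp: basis_elt_def)
  then show ?thesis using assms
    by (auto simp: free_module_carrier basis_elt_def elim: finite_subset)
qed

text \<open>Induction over a finite set that contains the support: one coordinate is split off as a
  multiple of its basis element.\<close>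

lemma free_module_gen:
  assumes "cring R"
  shows "gen_submodule R (free_module R B) (basis_elt R ` B) = carrier (free_module R B)"
proof -
  interpret R: cring R by fact
  let ?F = "free_module R B" and ?G = "gen_submodule R (free_module R B) (basis_elt R ` B)"
  note mF = module_free_module[OF assms, of B]
  have E: "basis_elt R ` B \<subseteq> carrier ?F" using basis_elt_closed[OF assms] by auto
  note cl = gen_submodule_closed[OF mF E]
  have "f \<in> ?G" if "finite S" "f \<in> carrier ?F" "{b. f b \<noteq> \<zero>\<^bsub>R\<^esub>} \<subseteq> S" for S f
    using that
  proof (induction S arbitrary: f)
    case empty
    then have "f = \<zero>\<^bsub>?F\<^esub>" by auto
    then show ?case using cl(2) by simp
  next
    case (insert a S)
    show ?case
    proof (cases "f a = \<zero>\<^bsub>R\<^esub>")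
      case True
      then show ?thesis using insert by (intro insert.IH) auto
    next
      case False
      then have aB: "a \<in> B" using insert.prems by (auto simp: free_module_carrier)
      have fa: "f a \<in> carrier R" using insert.prems by (auto simp: free_module_carrier)
      define g where "g = f(a := \<zero>\<^bsub>R\<^esub>)"
      have "{b. g b \<noteq> \<zero>\<^bsub>R\<^esub>} \<subseteq> {b. f b \<noteq> \<zero>\<^bsub>R\<^esub>}" by (auto simp: g_def)
      then have "finite {b. g b \<noteq> \<zero>\<^bsub>R\<^esub>}" using insert.prems(1)
        unfolding free_module_carrier by (auto elim: finite_subset)
      then have "g \<in> carrier ?F" using insert.prems(1)
        unfolding free_module_carrier by (simp add: g_def)
      moreover have "{b. g b \<noteq> \<zero>\<^bsub>R\<^esub>} \<subseteq> S" using insert.prems(2) by (auto simp: g_def)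
      ultimately have g: "g \<in> ?G" by (rule insert.IH)
      have "f = g \<oplus>\<^bsub>?F\<^esub> (f a \<odot>\<^bsub>?F\<^esub> basis_elt R a)"
        using insert.prems(1) fa by (auto simp: g_def basis_elt_def free_module_carrier fun_eq_iff)
      moreover have "f a \<odot>\<^bsub>?F\<^esub> basis_elt R a \<in> ?G"
        using aB fa gen_submodule_incl[of "basis_elt R ` B" R ?F] by (intro cl(4)) auto
      ultimately show ?thesis using g cl(3) by metis
    qed
  qed
  then have "carrier ?F \<subseteq> ?G" by (auto simp: free_module_carrier)
  then show ?thesis using cl(1) by auto
qed

lemma free_module_ext:
  assumes "cring R" "module R N" "g \<in> B \<rightarrow> carrier N"
  shows "\<exists>h. lin R (free_module R B) N h \<and> (\<forall>b\<in>B. h (basis_elt R b) = g b)"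
proof -
  interpret N: module R N by fact
  let ?F = "free_module R B"
  define h where "h f = (\<Oplus>\<^bsub>N\<^esub>b\<in>{b. f b \<noteq> \<zero>\<^bsub>R\<^esub>}. f b \<odot>\<^bsub>N\<^esub> g b)" for f
  \<comment> \<open>The sum over the support may be taken over any larger finite set, so that
    functions with different supports can be compared termwise.\<close>
  have h: "h f = (\<Oplus>\<^bsub>N\<^esub>b\<in>S. f b \<odot>\<^bsub>N\<^esub> g b)"
    if "f \<in> carrier ?F" "{b. f b \<noteq> \<zero>\<^bsub>R\<^esub>} \<subseteq> S" "S \<subseteq> B" "finite S" for f S
    unfolding h_def
  proof (rule N.add.finprod_mono_neutral_cong_left)
    show "(\<lambda>b. f b \<odot>\<^bsub>N\<^esub> g b) \<in> S \<rightarrow> carrier N"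
      using that(1,3) assms(3) unfolding free_module_carrier by (fastforce intro!: N.smult_closed)
    show "f b \<odot>\<^bsub>N\<^esub> g b = \<zero>\<^bsub>N\<^esub>" if "b \<in> S - {b. f b \<noteq> \<zero>\<^bsub>R\<^esub>}" for b
      using that \<open>S \<subseteq> B\<close> assms(3) by (auto simp: Pi_def subset_iff)
  qed (use that(2,4) in auto)
  have closed: "(\<lambda>b. f b \<odot>\<^bsub>N\<^esub> g b) \<in> S \<rightarrow> carrier N"
    if "f \<in> carrier ?F" "S \<subseteq> B" for f S
    using that assms(3) unfolding free_module_carrier by (fastforce intro!: N.smult_closed)
  have "lin R ?F N h"
  proof (rule linI)
    fix f assume f: "f \<in> carrier ?F"
    have sup: "{b. f b \<noteq> \<zero>\<^bsub>R\<^esub>} \<subseteq> B" "finite {b. f b \<noteq> \<zero>\<^bsub>R\<^esub>}" using f by (auto simp: free_module_carrier)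
    show "h f \<in> carrier N" unfolding h_def
      using closed[OF f sup(1)] by (intro N.finsum_closed)
    { fix g' assume g': "g' \<in> carrier ?F"
      let ?S = "{b. f b \<noteq> \<zero>\<^bsub>R\<^esub>} \<union> {b. g' b \<noteq> \<zero>\<^bsub>R\<^esub>}"
      have S: "?S \<subseteq> B" "finite ?S" using f g' by (auto simp: free_module_carrier)
      have fg: "f \<oplus>\<^bsub>?F\<^esub> g' \<in> carrier ?F"
      proof -
        interpret F: module R ?F by (rule module_free_module[OF assms(1)])
        show ?thesis using f g' by (rule F.M.a_closed)
      qed
      have "h (f \<oplus>\<^bsub>?F\<^esub> g') = (\<Oplus>\<^bsub>N\<^esub>b\<in>?S. (f b \<oplus>\<^bsub>R\<^esub> g' b) \<odot>\<^bsub>N\<^esub> g b)"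
        using S f g' by (subst h[OF fg, of ?S]) (auto simp: free_module_carrier)
      also have "\<dots> = (\<Oplus>\<^bsub>N\<^esub>b\<in>?S. f b \<odot>\<^bsub>N\<^esub> g b \<oplus>\<^bsub>N\<^esub> g' b \<odot>\<^bsub>N\<^esub> g b)"
      proof (rule N.finsum_cong'[OF HOL.refl])
        have B: "f b \<in> carrier R" "g' b \<in> carrier R" "g b \<in> carrier N" if "b \<in> ?S" for b
          using f g' S(1) that assms(3) unfolding free_module_carrier by blast+
        then show "(\<lambda>b. f b \<odot>\<^bsub>N\<^esub> g b \<oplus>\<^bsub>N\<^esub> g' b \<odot>\<^bsub>N\<^esub> g b) \<in> ?S \<rightarrow> carrier N"
          by (intro Pi_I N.a_closed N.smult_closed)
        show "(f b \<oplus>\<^bsub>R\<^esub> g' b) \<odot>\<^bsub>N\<^esub> g b = f b \<odot>\<^bsub>N\<^esub> g b \<oplus>\<^bsub>N\<^esub> g' b \<odot>\<^bsub>N\<^esub> g b" if "b \<in> ?S" for b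
          using B[OF that] by (rule N.smult_l_distr)
      qed
      also have "\<dots> = h f \<oplus>\<^bsub>N\<^esub> h g'"
        using closed[OF f S(1)] closed[OF g' S(1)] S f g'
        by (simp add: h[of f ?S] h[of g' ?S] N.finsum_addf)
      finally show "h (f \<oplus>\<^bsub>?F\<^esub> g') = h f \<oplus>\<^bsub>N\<^esub> h g'" . }
    { fix r assume r: "r \<in> carrier R"
      let ?S = "{b. f b \<noteq> \<zero>\<^bsub>R\<^esub>}"
      have rf: "r \<odot>\<^bsub>?F\<^esub> f \<in> carrier ?F"
      proof -
        interpret F: module R ?F by (rule module_free_module[OF assms(1)])
        show ?thesis using r f by (rule F.smult_closed)
      qed
      have "h (r \<odot>\<^bsub>?F\<^esub> f) = (\<Oplus>\<^bsub>N\<^esub>b\<in>?S. (r \<otimes>\<^bsub>R\<^esub> f b) \<odot>\<^bsub>N\<^esub> g b)"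
        using sup r by (subst h[OF rf, of ?S]) auto
      also have "\<dots> = (\<Oplus>\<^bsub>N\<^esub>b\<in>?S. r \<odot>\<^bsub>N\<^esub> (f b \<odot>\<^bsub>N\<^esub> g b))"
      proof (rule N.finsum_cong'[OF HOL.refl])
        have B: "f b \<in> carrier R" "g b \<in> carrier N" if "b \<in> ?S" for b
          using f sup(1) that assms(3) unfolding free_module_carrier by blast+
        then show "(\<lambda>b. r \<odot>\<^bsub>N\<^esub> (f b \<odot>\<^bsub>N\<^esub> g b)) \<in> ?S \<rightarrow> carrier N"
          using r by (intro Pi_I N.smult_closed)
        show "(r \<otimes>\<^bsub>R\<^esub> f b) \<odot>\<^bsub>N\<^esub> g b = r \<odot>\<^bsub>N\<^esub> (f b \<odot>\<^bsub>N\<^esub> g b)" if "b \<in> ?S" for b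
          using r B[OF that] by (rule N.smult_assoc1)
      qed
      also have "\<dots> = r \<odot>\<^bsub>N\<^esub> h f"
        using N.finsum_smult_ldistr[OF sup(2) r closed[OF f sup(1)]] by (simp only: h_def)
      finally show "h (r \<odot>\<^bsub>?F\<^esub> f) = r \<odot>\<^bsub>N\<^esub> h f" . }
  qed
  moreover have "h (basis_elt R b) = g b" if "b \<in> B" for b
  proof -
    have gb: "g b \<in> carrier N" using that assms(3) by auto
    have "h (basis_elt R b) = (\<Oplus>\<^bsub>N\<^esub>c\<in>{b}. basis_elt R b c \<odot>\<^bsub>N\<^esub> g c)"
      using that by (intro h basis_elt_closed assms(1)) (auto simp: basis_elt_def)
    then show ?thesis using gb by (simp add: basis_elt_def N.finsum_insert)
  qed
  ultimately show ?thesis by blast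
qed

text \<open>Linear independence is encoded by a coordinate map to the free module that sends each
  \<open>e b\<close> to the unit vector at \<open>b\<close>. Composed with maps out of the free
  module it yields the extension property at once.\<close>

definition free_basis ::
    "('r, 'x) ring_scheme \<Rightarrow> ('r, 'm, 'y) module_scheme \<Rightarrow> 'b set \<Rightarrow> ('b \<Rightarrow> 'm) \<Rightarrow> bool" where
  "free_basis R M B e \<longleftrightarrow> module R M \<and> e \<in> B \<rightarrow> carrier M \<and>
    carrier M \<subseteq> gen_submodule R M (e ` B) \<and>
    (\<exists>c. lin R M (free_module R B) c \<and> (\<forall>b\<in>B. c (e b) = basis_elt R b))"

lemma free_basis_free_module:
  assumes "cring R"
  shows "free_basis R (free_module R B) B (basis_elt R)"
  using assms module_free_module[OF assms, of B]
  by (auto simp: free_basis_def basis_elt_closed free_module_gen intro!: exI[of _ "\<lambda>x. x"] lin_id)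

lemma free_basisD:
  assumes "free_basis R M B e"
  shows "module R M" "b \<in> B \<Longrightarrow> e b \<in> carrier M" "e ` B \<subseteq> carrier M"
    "gen_submodule R M (e ` B) = carrier M"
proof -
  show *: "module R M" "b \<in> B \<Longrightarrow> e b \<in> carrier M" "e ` B \<subseteq> carrier M"
    using assms by (auto simp: free_basis_def)
  show "gen_submodule R M (e ` B) = carrier M"
    using assms gen_submodule_closed(1)[OF *(1,3)] by (auto simp: free_basis_def)
qed

lemma free_basis_ext:
  assumes "free_basis R M B e" "module R N" "\<And>b. b \<in> B \<Longrightarrow> g b \<in> carrier N"
  obtains h where "lin R M N h" "\<And>b. b \<in> B \<Longrightarrow> h (e b) = g b"
proof -
  interpret N: module R N by fact
  obtain c where c: "lin R M (free_module R B) c" "\<And>b. b \<in> B \<Longrightarrow> c (e b) = basis_elt R b"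
    using assms(1) by (auto simp: free_basis_def)
  obtain k where k: "lin R (free_module R B) N k" "\<And>b. b \<in> B \<Longrightarrow> k (basis_elt R b) = g b"
    using free_module_ext[OF N.is_cring assms(2), of g B] assms(3) by auto
  show ?thesis
    by (rule that[of "\<lambda>x. k (c x)"]) (use lin_comp[OF c(1) k(1)] c(2) k(2) in auto)
qed

lemma free_basis_eq:
  assumes "free_basis R M B e" "module R N" "lin R M N f" "lin R M N g"
    "\<And>b. b \<in> B \<Longrightarrow> f (e b) = g (e b)" "x \<in> carrier M"
  shows "f x = g x"
  using free_basisD[OF assms(1)] assms
  by (intro lin_eq_on_gen[of R M N f g "e ` B" x]) auto

text \<open>The inverse is the linear extension of the inverse bijection of bases; both composites
  fix a basis.\<close>

lemma free_basis_bij: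
  assumes M: "free_basis R M B e" and N: "free_basis R N B' e'" and bij: "bij_betw \<beta> B B'"
    and f: "lin R M N f" "\<And>b. b \<in> B \<Longrightarrow> f (e b) = e' (\<beta> b)"
  shows "bij_betw f (carrier M) (carrier N)"
proof -
  note MD = free_basisD[OF M] and ND = free_basisD[OF N]
  let ?\<gamma> = "inv_into B \<beta>"
  have \<gamma>: "?\<gamma> b' \<in> B" "\<beta> (?\<gamma> b') = b'" if "b' \<in> B'" for b'
    using bij that by (metis bij_betw_def inv_into_into, metis bij_betw_inv_into_right)
  have \<beta>: "\<beta> b \<in> B'" "?\<gamma> (\<beta> b) = b" if "b \<in> B" for b
    using bij that by (auto simp: bij_betw_def)
  obtain g where g: "lin R N M g" "\<And>b'. b' \<in> B' \<Longrightarrow> g (e' b') = e (?\<gamma> b')"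
    using free_basis_ext[OF N MD(1), of "\<lambda>b'. e (?\<gamma> b')"] \<gamma> MD(2) by metis
  have gf: "g (f x) = x" if "x \<in> carrier M" for x
    by (rule free_basis_eq[OF M MD(1) lin_comp[OF f(1) g(1)] lin_id[OF MD(1)] _ that])
       (simp add: f g \<beta>)
  have fg: "f (g x) = x" if "x \<in> carrier N" for x
    by (rule free_basis_eq[OF N ND(1) lin_comp[OF g(1) f(1)] lin_id[OF ND(1)] _ that])
       (simp add: f g \<gamma>)
  show ?thesis
    by (rule bij_betw_byWitness[where f' = g])
       (use gf fg lin_closed[OF f(1)] lin_closed[OF g(1)] in auto)
qed

text \<open>The coordinates on the submodule are those of \<open>M\<close> with the basis elements
  outside \<open>B'\<close> sent to zero. Positive parts of graded coalgebras are handled in this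
  way.\<close>

lemma free_basis_submodule:
  assumes M: "free_basis R M B e" and "B' \<subseteq> B"
  shows "free_basis R (M\<lparr>carrier := gen_submodule R M (e ` B')\<rparr>) B' e"
    and "submodule (gen_submodule R M (e ` B')) R M"
proof -
  note MD = free_basisD[OF M]
  interpret M: module R M by (rule MD)
  let ?H = "gen_submodule R M (e ` B')"
  let ?N = "M\<lparr>carrier := ?H\<rparr>"
  have sub: "e ` B' \<subseteq> carrier M" using assms MD by blast
  show H: "submodule ?H R M" by (rule gen_submodule_submodule[OF MD(1) sub])
  then have N: "module R ?N" using MD(1) by (rule submodule.submodule_is_module)
  obtain c where c: "lin R M (free_module R B') c"
      "\<And>b. b \<in> B \<Longrightarrow> c (e b) = (if b \<in> B' then basis_elt R b else \<zero>\<^bsub>free_module R B'\<^esub>)"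
  proof (rule free_basis_ext[OF M module_free_module[OF M.is_cring, of B']])
    fix b assume "b \<in> B"
    show "(if b \<in> B' then basis_elt R b else \<zero>\<^bsub>free_module R B'\<^esub>) \<in> carrier (free_module R B')"
      by (auto simp: basis_elt_closed[OF M.is_cring], auto simp: free_module_carrier)
  qed (rule that)
  have incl: "e ` B' \<subseteq> ?H" by (rule gen_submodule_incl)
  have "?H \<subseteq> gen_submodule R ?N (e ` B')"
  proof
    fix x assume "x \<in> ?H"
    with MD(1) sub show "x \<in> gen_submodule R ?N (e ` B')"
    proof (induction rule: gen_submodule_induct)
      case zero
      then show ?case using gen_submodule_closed(2)[OF N, of "e ` B'"] incl by simp
    next
      case (gen s)
      then show ?case using gen_submodule_incl[of "e ` B'" R ?N] by (rule rev_subsetD)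
    next
      case (add x y)
      then show ?case using gen_submodule_closed(3)[OF N, of "e ` B'" x y] incl by simp
    next
      case (smult r x)
      then show ?case using gen_submodule_closed(4)[OF N, of "e ` B'" r x] incl by simp
    qed
  qed
  moreover have "lin R ?N (free_module R B') c"
    using c(1) gen_submodule_closed(1)[OF MD(1) sub] by (auto simp: lin_def Pi_def subset_iff)
  ultimately show "free_basis R ?N B' e"
    using N c(2) incl assms(2) by (auto simp: free_basis_def intro!: exI[of _ c])
qed

subsection \<open>Quotient modules\<close>

lemma module_abelian_subgroup:
  assumes "module R M" "submodule N R M"
  shows "abelian_subgroup N M"
proof -
  interpret M: module R M by fact
  show ?thesis
    by (rule abelian_subgroupI3)
       (use submodule.axioms(1)[OF assms(2)] M.M.abelian_group_axioms in \<open>auto simp: additive_subgroup_def\<close>)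
qed

lemma quot_module_simps [simp]:
  "carrier (quot_module M N) = a_rcosets\<^bsub>M\<^esub> N"
  "zero (quot_module M N) = N"
  "add (quot_module M N) = set_add M"
  by (simp_all add: quot_module_def)

lemma quot_module_carrier:
  "carrier (quot_module M N) = (\<lambda>x. N +>\<^bsub>M\<^esub> x) ` carrier M"
  by (auto simp: A_RCOSETS_def')

lemma quot_module_coset:
  assumes "module R M" "submodule N R M"
  shows coset_closed: "x \<in> carrier M \<Longrightarrow> N +>\<^bsub>M\<^esub> x \<in> carrier (quot_module M N)"
    and coset_add: "x \<in> carrier M \<Longrightarrow> y \<in> carrier M \<Longrightarrow>
      (N +>\<^bsub>M\<^esub> x) \<oplus>\<^bsub>quot_module M N\<^esub> (N +>\<^bsub>M\<^esub> y) = N +>\<^bsub>M\<^esub> (x \<oplus>\<^bsub>M\<^esub> y)"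
    and coset_smult: "r \<in> carrier R \<Longrightarrow> x \<in> carrier M \<Longrightarrow>
      r \<odot>\<^bsub>quot_module M N\<^esub> (N +>\<^bsub>M\<^esub> x) = N +>\<^bsub>M\<^esub> (r \<odot>\<^bsub>M\<^esub> x)"
    and coset_eq_iff: "x \<in> carrier M \<Longrightarrow> y \<in> carrier M \<Longrightarrow>
      N +>\<^bsub>M\<^esub> x = N +>\<^bsub>M\<^esub> y \<longleftrightarrow> x \<ominus>\<^bsub>M\<^esub> y \<in> N"
    and coset_zero: "x \<in> N \<Longrightarrow> N +>\<^bsub>M\<^esub> x = N"
proof -
  interpret M: module R M by fact
  interpret S: abelian_subgroup N M by (rule module_abelian_subgroup[OF assms])
  note sub = assms(2)[unfolded submodule_iff[OF assms(1)]]
  show "x \<in> carrier M \<Longrightarrow> N +>\<^bsub>M\<^esub> x \<in> carrier (quot_module M N)"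
    unfolding quot_module_carrier by blast
  show "x \<in> carrier M \<Longrightarrow> y \<in> carrier M \<Longrightarrow>
      (N +>\<^bsub>M\<^esub> x) \<oplus>\<^bsub>quot_module M N\<^esub> (N +>\<^bsub>M\<^esub> y) = N +>\<^bsub>M\<^esub> (x \<oplus>\<^bsub>M\<^esub> y)"
    by (simp add: S.a_rcos_sum)
  show eq: "N +>\<^bsub>M\<^esub> x = N +>\<^bsub>M\<^esub> y \<longleftrightarrow> x \<ominus>\<^bsub>M\<^esub> y \<in> N" if "x \<in> carrier M" "y \<in> carrier M" for x y
  proof -
    have "N +>\<^bsub>M\<^esub> x = N +>\<^bsub>M\<^esub> y \<longleftrightarrow> x \<in> N +>\<^bsub>M\<^esub> y"
      using that S.a_repr_independence' S.a_rcos_self by metis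
    then show ?thesis using S.a_rcos_module[OF that(2,1)] by (simp add: a_minus_def)
  qed
  show "x \<in> N \<Longrightarrow> N +>\<^bsub>M\<^esub> x = N"
    by (rule S.a_rcos_const)
  show "r \<odot>\<^bsub>quot_module M N\<^esub> (N +>\<^bsub>M\<^esub> x) = N +>\<^bsub>M\<^esub> (r \<odot>\<^bsub>M\<^esub> x)"
    if r: "r \<in> carrier R" and x: "x \<in> carrier M"
  proof -
    have "N +>\<^bsub>M\<^esub> (r \<odot>\<^bsub>M\<^esub> a) = N +>\<^bsub>M\<^esub> (r \<odot>\<^bsub>M\<^esub> x)" if a: "a \<in> N +>\<^bsub>M\<^esub> x" for a
    proof -
      have ac: "a \<in> carrier M" using a x S.a_elemrcos_carrier by blast
      then have "a \<ominus>\<^bsub>M\<^esub> x \<in> N" using eq[OF ac x] a S.a_repr_independence'[OF a x] by simp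
      then have "r \<odot>\<^bsub>M\<^esub> (a \<ominus>\<^bsub>M\<^esub> x) \<in> N" using sub r by auto
      then have "(r \<odot>\<^bsub>M\<^esub> a) \<ominus>\<^bsub>M\<^esub> (r \<odot>\<^bsub>M\<^esub> x) \<in> N"
        using r ac x by (simp add: a_minus_def M.smult_r_distr M.smult_r_minus)
      then show ?thesis using eq r ac x by auto
    qed
    moreover have "x \<in> N +>\<^bsub>M\<^esub> x" by (rule S.a_rcos_self[OF x])
    ultimately have "(\<Union>a\<in>N +>\<^bsub>M\<^esub> x. N +>\<^bsub>M\<^esub> (r \<odot>\<^bsub>M\<^esub> a)) = N +>\<^bsub>M\<^esub> (r \<odot>\<^bsub>M\<^esub> x)"
      by (intro UN_constant_eq) blast+
    then show ?thesis by (simp only: quot_module_def module.simps)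
  qed
qed

lemma module_quot_module:
  assumes "module R M" "submodule N R M"
  shows "module R (quot_module M N)"
proof -
  interpret M: module R M by fact
  let ?Q = "quot_module M N"
  note co = quot_module_coset[OF assms]
  have ex: "\<exists>x\<in>carrier M. A = N +>\<^bsub>M\<^esub> x" if "A \<in> carrier ?Q" for A
    using that unfolding quot_module_carrier by blast
  have N: "N = N +>\<^bsub>M\<^esub> \<zero>\<^bsub>M\<^esub>" "zero ?Q = N +>\<^bsub>M\<^esub> \<zero>\<^bsub>M\<^esub>"
  proof -
    have "\<zero>\<^bsub>M\<^esub> \<in> N" using assms(2) by (simp add: submodule_iff[OF assms(1)])
    from co(5)[OF this] show "N = N +>\<^bsub>M\<^esub> \<zero>\<^bsub>M\<^esub>" "zero ?Q = N +>\<^bsub>M\<^esub> \<zero>\<^bsub>M\<^esub>" by (simp_all only: quot_module_simps)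
  qed
  have "abelian_group ?Q"
  proof (rule abelian_groupI)
    fix A assume "A \<in> carrier ?Q"
    then obtain x where x: "x \<in> carrier M" "A = N +>\<^bsub>M\<^esub> x" using ex by blast
    show "\<zero>\<^bsub>?Q\<^esub> \<oplus>\<^bsub>?Q\<^esub> A = A" unfolding N(2) using x by (simp only: co(2) M.zero_closed M.l_zero)
    show "\<exists>B\<in>carrier ?Q. B \<oplus>\<^bsub>?Q\<^esub> A = \<zero>\<^bsub>?Q\<^esub>"
      using x co by (intro bexI[of _ "N +>\<^bsub>M\<^esub> (\<ominus>\<^bsub>M\<^esub> x)"]) (simp_all only: N(2) co(1,2) M.a_inv_closed M.M.l_neg)
    { fix B assume "B \<in> carrier ?Q"
      then obtain y where y: "y \<in> carrier M" "B = N +>\<^bsub>M\<^esub> y" using ex by blast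
      show "A \<oplus>\<^bsub>?Q\<^esub> B \<in> carrier ?Q" using x y by (simp only: co(1,2) M.a_closed)
      show "A \<oplus>\<^bsub>?Q\<^esub> B = B \<oplus>\<^bsub>?Q\<^esub> A" using x y by (simp only: co(2) M.a_comm)
      { fix C assume "C \<in> carrier ?Q"
        then obtain z where z: "z \<in> carrier M" "C = N +>\<^bsub>M\<^esub> z" using ex by blast
        show "A \<oplus>\<^bsub>?Q\<^esub> B \<oplus>\<^bsub>?Q\<^esub> C = A \<oplus>\<^bsub>?Q\<^esub> (B \<oplus>\<^bsub>?Q\<^esub> C)"
          using x y z by (simp only: co(2) M.a_closed M.a_assoc) } }
  next
    show "\<zero>\<^bsub>?Q\<^esub> \<in> carrier ?Q" unfolding N(2) using co(1) by simp
  qed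
  then show ?thesis
  proof (rule moduleI[OF M.is_cring])
    fix r A assume r: "r \<in> carrier R" and "A \<in> carrier ?Q"
    then obtain x where x: "x \<in> carrier M" "A = N +>\<^bsub>M\<^esub> x" using ex by blast
    show "r \<odot>\<^bsub>?Q\<^esub> A \<in> carrier ?Q" using r x by (simp only: co(1,3) M.smult_closed)
    { fix s assume s: "s \<in> carrier R"
      show "(r \<oplus>\<^bsub>R\<^esub> s) \<odot>\<^bsub>?Q\<^esub> A = r \<odot>\<^bsub>?Q\<^esub> A \<oplus>\<^bsub>?Q\<^esub> s \<odot>\<^bsub>?Q\<^esub> A"
        using r s x by (simp only: co(2,3) M.smult_closed M.smult_l_distr M.R.a_closed)
      show "(r \<otimes>\<^bsub>R\<^esub> s) \<odot>\<^bsub>?Q\<^esub> A = r \<odot>\<^bsub>?Q\<^esub> (s \<odot>\<^bsub>?Q\<^esub> A)"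
        using r s x by (simp only: co(3) M.smult_closed M.smult_assoc1 M.m_closed) }
    { fix B assume "B \<in> carrier ?Q"
      then obtain y where y: "y \<in> carrier M" "B = N +>\<^bsub>M\<^esub> y" using ex by blast
      show "r \<odot>\<^bsub>?Q\<^esub> (A \<oplus>\<^bsub>?Q\<^esub> B) = r \<odot>\<^bsub>?Q\<^esub> A \<oplus>\<^bsub>?Q\<^esub> r \<odot>\<^bsub>?Q\<^esub> B"
        using r x y by (simp only: co(2,3) M.smult_closed M.a_closed M.smult_r_distr) }
  next
    fix A assume "A \<in> carrier ?Q"
    then obtain x where x: "x \<in> carrier M" "A = N +>\<^bsub>M\<^esub> x" using ex by blast
    show "\<one>\<^bsub>R\<^esub> \<odot>\<^bsub>?Q\<^esub> A = A" using x by (simp only: co(3) M.one_closed M.smult_one)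
  qed
qed

lemma lin_coset:
  assumes "module R M" "submodule N R M"
  shows "lin R M (quot_module M N) (\<lambda>x. N +>\<^bsub>M\<^esub> x)"
  by (rule linI) (simp_all only: quot_module_coset[OF assms])

lemma quot_module_lift:
  assumes "module R M" "submodule N R M" "module R P" "lin R M P f"
    "\<And>x. x \<in> N \<Longrightarrow> f x = \<zero>\<^bsub>P\<^esub>"
  obtains g where "lin R (quot_module M N) P g" "\<And>x. x \<in> carrier M \<Longrightarrow> g (N +>\<^bsub>M\<^esub> x) = f x"
proof -
  interpret M: module R M by fact
  interpret P: module R P by fact
  let ?Q = "quot_module M N"
  note co = quot_module_coset[OF assms(1,2)]
  define g where "g A = f (SOME x. x \<in> carrier M \<and> A = N +>\<^bsub>M\<^esub> x)" for A
  have g: "g (N +>\<^bsub>M\<^esub> x) = f x" if x: "x \<in> carrier M" for x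
  proof -
    define y where "y = (SOME y. y \<in> carrier M \<and> N +>\<^bsub>M\<^esub> x = N +>\<^bsub>M\<^esub> y)"
    have y: "y \<in> carrier M" "N +>\<^bsub>M\<^esub> x = N +>\<^bsub>M\<^esub> y"
      unfolding y_def using someI[of "\<lambda>y. y \<in> carrier M \<and> N +>\<^bsub>M\<^esub> x = N +>\<^bsub>M\<^esub> y" x] x by auto
    then have "f (x \<ominus>\<^bsub>M\<^esub> y) = \<zero>\<^bsub>P\<^esub>" using co(4)[OF x y(1)] assms(5) by auto
    then have "f x \<ominus>\<^bsub>P\<^esub> f y = \<zero>\<^bsub>P\<^esub>" using x y by (simp add: lin_minus[OF assms(1,3,4)])
    then have "f x = f y" using x y(1) lin_closed[OF assms(4)] module_minus_eq_zero[OF assms(3)]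
      by blast
    then show ?thesis by (simp add: g_def y_def)
  qed
  have "lin R ?Q P g"
  proof (rule linI)
    fix A assume "A \<in> carrier ?Q"
    then obtain x where x: "x \<in> carrier M" "A = N +>\<^bsub>M\<^esub> x" unfolding quot_module_carrier by auto
    show "g A \<in> carrier P" using x g lin_closed[OF assms(4)] by auto
    { fix B assume "B \<in> carrier ?Q"
      then obtain y where y: "y \<in> carrier M" "B = N +>\<^bsub>M\<^esub> y" unfolding quot_module_carrier by auto
      show "g (A \<oplus>\<^bsub>?Q\<^esub> B) = g A \<oplus>\<^bsub>P\<^esub> g B"
        using x y by (simp only: co(2) g M.a_closed lin_add[OF assms(4)]) }
    { fix r assume r: "r \<in> carrier R"
      show "g (r \<odot>\<^bsub>?Q\<^esub> A) = r \<odot>\<^bsub>P\<^esub> g A"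
        using x r by (simp only: co(3) g M.smult_closed lin_smult[OF assms(4)]) }
  qed
  then show ?thesis using g by (rule that)
qed

lemma quot_module_gen:
  assumes "module R M" "submodule N R M" "S \<subseteq> carrier M" "carrier M \<subseteq> gen_submodule R M S"
  shows "carrier (quot_module M N) = gen_submodule R (quot_module M N) ((\<lambda>x. N +>\<^bsub>M\<^esub> x) ` S)"
proof -
  have "carrier M = gen_submodule R M S"
    using gen_submodule_closed(1)[OF assms(1,3)] assms(4) by auto
  then show ?thesis
    using lin_image_gen_submodule[OF assms(1) module_quot_module[OF assms(1,2)] lin_coset[OF assms(1,2)] assms(3)]
    by (simp only: quot_module_carrier)
qed

lemma kernel_submodule:
  assumes "module R M" "module R N" "lin R M N f"
  shows "submodule {x \<in> carrier M. f x = \<zero>\<^bsub>N\<^esub>} R M"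
proof -
  interpret M: module R M by fact
  interpret N: module R N by fact
  show ?thesis unfolding submodule_iff[OF assms(1)]
    by (auto simp: lin_add[OF assms(3)] lin_smult[OF assms(3)] lin_zero[OF assms])
qed

lemma gen_quot_lift:
  assumes "module R M" "S \<subseteq> carrier M" "module R P" "lin R M P f" "\<And>s. s \<in> S \<Longrightarrow> f s = \<zero>\<^bsub>P\<^esub>"
  obtains g where "lin R (quot_module M (gen_submodule R M S)) P g"
    "\<And>x. x \<in> carrier M \<Longrightarrow> g (gen_submodule R M S +>\<^bsub>M\<^esub> x) = f x"
proof (rule quot_module_lift[OF assms(1) gen_submodule_submodule[OF assms(1,2)] assms(3,4)])
  fix x assume "x \<in> gen_submodule R M S"
  then show "f x = \<zero>\<^bsub>P\<^esub>"
    using gen_submodule_least[OF kernel_submodule[OF assms(1,3,4)], of S] assms(2,5) by auto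
qed (rule that)

text \<open>The coordinate map that sends the elements of \<open>D\<close> to zero factors through
  the quotient, so the remaining basis elements stay independent. Simplicial, cubical and
  permutahedral chains are all quotients of this kind.\<close>

lemma free_basis_quot:
  assumes M: "free_basis R M B e" and D: "D \<subseteq> B" and N: "N = gen_submodule R M (e ` D)"
  shows "free_basis R (quot_module M N) (B - D) (\<lambda>b. N +>\<^bsub>M\<^esub> e b)"
    and "\<And>b. b \<in> D \<Longrightarrow> N +>\<^bsub>M\<^esub> e b = \<zero>\<^bsub>quot_module M N\<^esub>"
    and "module R (quot_module M N)" "submodule N R M"
    and "gen_submodule R (quot_module M N) ((\<lambda>b. N +>\<^bsub>M\<^esub> e b) ` B) = carrier (quot_module M N)"
proof -
  note MD = free_basisD[OF M]
  interpret M: module R M by (rule MD)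
  let ?Q = "quot_module M N" and ?F = "free_module R (B - D)"
  have eD: "e ` D \<subseteq> carrier M" using D MD by blast
  show sub: "submodule N R M" unfolding N by (rule gen_submodule_submodule[OF MD(1) eD])
  show Q: "module R ?Q" by (rule module_quot_module[OF MD(1) sub])
  note co = quot_module_coset[OF MD(1) sub]
  show zero: "N +>\<^bsub>M\<^esub> e b = \<zero>\<^bsub>?Q\<^esub>" if "b \<in> D" for b
    using that gen_submodule_incl[of "e ` D" R M] co(5) by (auto simp: N)
  have mF: "module R ?F" by (rule module_free_module[OF M.is_cring])
  interpret F: module R ?F by (rule mF)
  obtain c where c: "lin R M ?F c" "\<And>b. b \<in> B \<Longrightarrow> c (e b) = (if b \<in> D then \<zero>\<^bsub>?F\<^esub> else basis_elt R b)"
  proof (rule free_basis_ext[OF M mF])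
    fix b assume "b \<in> B"
    then show "(if b \<in> D then \<zero>\<^bsub>?F\<^esub> else basis_elt R b) \<in> carrier ?F"
      using basis_elt_closed[OF M.is_cring, of b "B - D"] F.zero_closed by auto
  qed (rule that)
  have cD: "c s = \<zero>\<^bsub>?F\<^esub>" if "s \<in> e ` D" for s using that c(2) D by auto
  obtain g where g: "lin R ?Q ?F g" "\<And>x. x \<in> carrier M \<Longrightarrow> g (N +>\<^bsub>M\<^esub> x) = c x"
    by (rule gen_quot_lift[OF MD(1) eD mF c(1) cD, folded N], assumption) (rule that)
  show all: "gen_submodule R ?Q ((\<lambda>b. N +>\<^bsub>M\<^esub> e b) ` B) = carrier ?Q"
    using quot_module_gen[OF MD(1) sub MD(3)] MD(4) by (simp add: image_image del: quot_module_simps)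
  have sub1: "(\<lambda>b. N +>\<^bsub>M\<^esub> e b) ` (B - D) \<subseteq> carrier ?Q"
    using MD(2) by (intro image_subsetI co(1)) blast
  have "carrier ?Q \<subseteq> gen_submodule R ?Q ((\<lambda>b. N +>\<^bsub>M\<^esub> e b) ` (B - D))"
    unfolding all[symmetric]
  proof (rule gen_submodule_mono[OF Q sub1], rule image_subsetI)
    fix b assume b: "b \<in> B"
    show "N +>\<^bsub>M\<^esub> e b \<in> gen_submodule R ?Q ((\<lambda>b. N +>\<^bsub>M\<^esub> e b) ` (B - D))"
    proof (cases "b \<in> D")
      case True
      then show ?thesis using gen_submodule_closed(2)[OF Q sub1] by (simp only: zero)
    next
      case False
      then show ?thesis using b by (intro gen_submodule_incl[THEN subsetD] imageI) blast
    qed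
  qed
  then show "free_basis R ?Q (B - D) (\<lambda>b. N +>\<^bsub>M\<^esub> e b)"
    unfolding free_basis_def using Q sub1 g c(2) MD(2)
    by (intro conjI exI[of _ g] ballI) (simp_all only: image_subset_iff_funcset Diff_iff if_False HOL.refl)
qed

text \<open>Homogeneous components are defined as spans of all classes of a degree; this passes to
  the surviving basis elements, since the others have class zero.\<close>

lemma gen_submodule_image_quot:
  assumes M: "free_basis R M B e" and D: "D \<subseteq> B" and N: "N = gen_submodule R M (e ` D)" and "S \<subseteq> B"
  shows "gen_submodule R (quot_module M N) ((\<lambda>b. N +>\<^bsub>M\<^esub> e b) ` S) =
    gen_submodule R (quot_module M N) ((\<lambda>b. N +>\<^bsub>M\<^esub> e b) ` (S - D))"
proof -
  note q = free_basis_quot[OF M D N] and MD = free_basisD[OF M]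
  have cl: "(\<lambda>b. N +>\<^bsub>M\<^esub> e b) ` S \<subseteq> carrier (quot_module M N)"
    using assms(4) MD(2) by (intro image_subsetI coset_closed[OF MD(1) q(4)]) blast
  then have cl': "(\<lambda>b. N +>\<^bsub>M\<^esub> e b) ` (S - D) \<subseteq> carrier (quot_module M N)" by blast
  show ?thesis
  proof (rule gen_submodule_eqI[OF q(3) cl cl'])
    show "(\<lambda>b. N +>\<^bsub>M\<^esub> e b) ` (S - D) \<subseteq> gen_submodule R (quot_module M N) ((\<lambda>b. N +>\<^bsub>M\<^esub> e b) ` S)"
      by (rule subset_trans[OF _ gen_submodule_incl]) auto
    show "(\<lambda>b. N +>\<^bsub>M\<^esub> e b) ` S \<subseteq> gen_submodule R (quot_module M N) ((\<lambda>b. N +>\<^bsub>M\<^esub> e b) ` (S - D))"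
    proof (rule image_subsetI)
      fix b assume b: "b \<in> S"
      show "N +>\<^bsub>M\<^esub> e b \<in> gen_submodule R (quot_module M N) ((\<lambda>b. N +>\<^bsub>M\<^esub> e b) ` (S - D))"
      proof (cases "b \<in> D")
        case True
        then show ?thesis using gen_submodule_closed(2)[OF q(3) cl'] by (simp only: q(2))
      next
        case False
        then show ?thesis using b by (intro gen_submodule_incl[THEN subsetD] imageI) blast
      qed
    qed
  qed
qed

subsection \<open>Associative algebras\<close>

definition assoc_algebra ::
    "('r, 'x) ring_scheme \<Rightarrow> ('r, 'm, 'y) module_scheme \<Rightarrow> bool" where
  "assoc_algebra R A \<longleftrightarrow> module R A \<and> ring A \<and>
    (\<forall>r\<in>carrier R. \<forall>x\<in>carrier A. \<forall>y\<in>carrier A.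
      (r \<odot>\<^bsub>A\<^esub> x) \<otimes>\<^bsub>A\<^esub> y = r \<odot>\<^bsub>A\<^esub> (x \<otimes>\<^bsub>A\<^esub> y) \<and> x \<otimes>\<^bsub>A\<^esub> (r \<odot>\<^bsub>A\<^esub> y) = r \<odot>\<^bsub>A\<^esub> (x \<otimes>\<^bsub>A\<^esub> y))"

lemma assoc_algebraD:
  assumes "assoc_algebra R A"
  shows "module R A" "ring A"
    "\<And>r x y. r \<in> carrier R \<Longrightarrow> x \<in> carrier A \<Longrightarrow> y \<in> carrier A \<Longrightarrow> (r \<odot>\<^bsub>A\<^esub> x) \<otimes>\<^bsub>A\<^esub> y = r \<odot>\<^bsub>A\<^esub> (x \<otimes>\<^bsub>A\<^esub> y)"
    "\<And>r x y. r \<in> carrier R \<Longrightarrow> x \<in> carrier A \<Longrightarrow> y \<in> carrier A \<Longrightarrow> x \<otimes>\<^bsub>A\<^esub> (r \<odot>\<^bsub>A\<^esub> y) = r \<odot>\<^bsub>A\<^esub> (x \<otimes>\<^bsub>A\<^esub> y)"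
  using assms by (auto simp: assoc_algebra_def)

lemma lin_mult_left:
  assumes "assoc_algebra R A" "x \<in> carrier A"
  shows "lin R A A (\<lambda>y. x \<otimes>\<^bsub>A\<^esub> y)"
proof -
  interpret A: ring A using assoc_algebraD[OF assms(1)] by simp
  show ?thesis using assoc_algebraD(4)[OF assms(1)] assms(2) by (intro linI) (simp_all add: A.r_distr)
qed

lemma lin_mult_right:
  assumes "assoc_algebra R A" "y \<in> carrier A"
  shows "lin R A A (\<lambda>x. x \<otimes>\<^bsub>A\<^esub> y)"
proof -
  interpret A: ring A using assoc_algebraD[OF assms(1)] by simp
  show ?thesis using assoc_algebraD(3)[OF assms(1)] assms(2) by (intro linI) (simp_all add: A.l_distr)
qed

lemma bilinear_eq_on_gen:
  assumes M: "module R M" and N: "module R N" and P: "module R P"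
    and f: "\<And>y. y \<in> carrier N \<Longrightarrow> lin R M P (\<lambda>x. f x y)" "\<And>x. x \<in> carrier M \<Longrightarrow> lin R N P (f x)"
    and g: "\<And>y. y \<in> carrier N \<Longrightarrow> lin R M P (\<lambda>x. g x y)" "\<And>x. x \<in> carrier M \<Longrightarrow> lin R N P (g x)"
    and S: "S \<subseteq> carrier M" and T: "T \<subseteq> carrier N"
    and eq: "\<And>s t. s \<in> S \<Longrightarrow> t \<in> T \<Longrightarrow> f s t = g s t"
    and x: "x \<in> gen_submodule R M S" and y: "y \<in> gen_submodule R N T"
  shows "f x y = g x y"
proof -
  have yN: "y \<in> carrier N" using y gen_submodule_closed(1)[OF N T] by blast
  have *: "f s y = g s y" if "s \<in> S" for s
  proof -
    have s: "s \<in> carrier M" using that S by blast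
    show ?thesis
      by (rule lin_eq_on_gen[OF N P f(2)[OF s] g(2)[OF s] T eq[OF that] y])
  qed
  show ?thesis
    by (rule lin_eq_on_gen[OF M P f(1)[OF yN] g(1)[OF yN] S * x])
qed

lemma mult_gen_submodule:
  assumes A: "assoc_algebra R A" and S: "S \<subseteq> carrier A" and T: "T \<subseteq> carrier A"
    and H: "submodule H R A" and ST: "\<And>s t. s \<in> S \<Longrightarrow> t \<in> T \<Longrightarrow> s \<otimes>\<^bsub>A\<^esub> t \<in> H"
    and x: "x \<in> gen_submodule R A S" and y: "y \<in> gen_submodule R A T"
  shows "x \<otimes>\<^bsub>A\<^esub> y \<in> H"
proof -
  note AD = assoc_algebraD[OF A]
  have yA: "y \<in> carrier A" using y gen_submodule_closed(1)[OF AD(1) T] by blast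
  have *: "s \<otimes>\<^bsub>A\<^esub> y \<in> H" if "s \<in> S" for s
  proof -
    have s: "s \<in> carrier A" using that S by blast
    show ?thesis
      by (rule lin_gen_submodule_into[OF AD(1,1) lin_mult_left[OF A s] T H ST[OF that] y])
  qed
  show ?thesis
    by (rule lin_gen_submodule_into[OF AD(1,1) lin_mult_right[OF A yA] S H * x])
qed

definition alg_hom ::
    "('r, 'x) ring_scheme \<Rightarrow> ('r, 'm, 'y) module_scheme \<Rightarrow> ('r, 'n, 'z) module_scheme \<Rightarrow> ('m \<Rightarrow> 'n) \<Rightarrow> bool" where
  "alg_hom R A B h \<longleftrightarrow> lin R A B h \<and> h \<one>\<^bsub>A\<^esub> = \<one>\<^bsub>B\<^esub> \<and>
    (\<forall>x\<in>carrier A. \<forall>y\<in>carrier A. h (x \<otimes>\<^bsub>A\<^esub> y) = h x \<otimes>\<^bsub>B\<^esub> h y)"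

lemma alg_homD:
  assumes "alg_hom R A B h"
  shows "lin R A B h" "h \<one>\<^bsub>A\<^esub> = \<one>\<^bsub>B\<^esub>"
    "\<And>x y. x \<in> carrier A \<Longrightarrow> y \<in> carrier A \<Longrightarrow> h (x \<otimes>\<^bsub>A\<^esub> y) = h x \<otimes>\<^bsub>B\<^esub> h y"
  using assms by (auto simp: alg_hom_def)

lemma mult_hom_on_gen:
  assumes A: "assoc_algebra R A" and B: "assoc_algebra R B" and h: "lin R A B h"
    and S: "S \<subseteq> carrier A" "carrier A \<subseteq> gen_submodule R A S"
    and eq: "\<And>s t. s \<in> S \<Longrightarrow> t \<in> S \<Longrightarrow> h (s \<otimes>\<^bsub>A\<^esub> t) = h s \<otimes>\<^bsub>B\<^esub> h t"
    and xy: "x \<in> carrier A" "y \<in> carrier A"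
  shows "h (x \<otimes>\<^bsub>A\<^esub> y) = h x \<otimes>\<^bsub>B\<^esub> h y"
proof -
  note AD = assoc_algebraD[OF A] and BD = assoc_algebraD[OF B]
  have xyS: "x \<in> gen_submodule R A S" "y \<in> gen_submodule R A S" using S(2) xy by blast+
  have hc: "h z \<in> carrier B" if "z \<in> carrier A" for z using lin_closed[OF h that] .
  show ?thesis
    by (rule bilinear_eq_on_gen[OF AD(1,1) BD(1) lin_comp[OF lin_mult_right[OF A] h]
          lin_comp[OF lin_mult_left[OF A] h] lin_comp[OF h lin_mult_right[OF B hc]]
          lin_comp[OF h lin_mult_left[OF B hc]] S(1) S(1) eq xyS])
qed

lemma kernel_ideal:
  assumes A: "assoc_algebra R A" and B: "assoc_algebra R B" and h: "alg_hom R A B h"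
  shows "ideal {x \<in> carrier A. h x = \<zero>\<^bsub>B\<^esub>} A"
proof -
  note AD = assoc_algebraD[OF A] and BD = assoc_algebraD[OF B] and hD = alg_homD[OF h]
  interpret A: ring A by (rule AD)
  interpret B: ring B by (rule BD)
  have sub: "submodule {x \<in> carrier A. h x = \<zero>\<^bsub>B\<^esub>} R A" by (rule kernel_submodule[OF AD(1) BD(1) hD(1)])
  show ?thesis
    by (rule idealI[OF AD(2) submodule.axioms(1)[OF sub]])
       (auto simp: hD(3) lin_closed[OF hD(1)])
qed

text \<open>A scalar acts as multiplication by its multiple of the unit, and the ideal absorbs that
  product.\<close>

lemma ideal_submodule:
  assumes A: "assoc_algebra R A" and I: "ideal I A"
  shows "submodule I R A"
proof -
  note AD = assoc_algebraD[OF A]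
  interpret I: ideal I A by fact
  interpret M: module R A by (rule AD)
  have "r \<odot>\<^bsub>A\<^esub> x \<in> I" if "r \<in> carrier R" "x \<in> I" for r x
  proof -
    have x: "x \<in> carrier A" using that I.Icarr by blast
    have "r \<odot>\<^bsub>A\<^esub> x = (r \<odot>\<^bsub>A\<^esub> \<one>\<^bsub>A\<^esub>) \<otimes>\<^bsub>A\<^esub> x"
      using AD(3)[OF that(1) I.one_closed x] x by simp
    then show ?thesis using I.I_l_closed[of x "r \<odot>\<^bsub>A\<^esub> \<one>\<^bsub>A\<^esub>"] that by simp
  qed
  then show ?thesis
    unfolding submodule_iff[OF AD(1)] using I.a_subset by auto
qed

lemma quot_module_mult:
  assumes A: "assoc_algebra R A" and I: "ideal I A"
  shows "x \<in> carrier A \<Longrightarrow> y \<in> carrier A \<Longrightarrow>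
      (I +>\<^bsub>A\<^esub> x) \<otimes>\<^bsub>quot_module A I\<^esub> (I +>\<^bsub>A\<^esub> y) = I +>\<^bsub>A\<^esub> (x \<otimes>\<^bsub>A\<^esub> y)"
    and "\<one>\<^bsub>quot_module A I\<^esub> = I +>\<^bsub>A\<^esub> \<one>\<^bsub>A\<^esub>"
  using ideal.rcoset_mult_add[OF I] by (auto simp: quot_module_def)

lemma assoc_algebra_quot_module:
  assumes A: "assoc_algebra R A" and I: "ideal I A"
  shows "assoc_algebra R (quot_module A I)"
proof -
  note AD = assoc_algebraD[OF A]
  interpret A: ring A by (rule AD)
  interpret M: module R A by (rule AD)
  let ?Q = "quot_module A I"
  note sub = ideal_submodule[OF A I]
  note co = quot_module_coset[OF AD(1) sub] and mu = quot_module_mult[OF A I]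
  have mQ: "module R ?Q" by (rule module_quot_module[OF AD(1) sub])
  interpret Q: module R ?Q by (rule mQ)
  have ex: "\<exists>x\<in>carrier A. X = I +>\<^bsub>A\<^esub> x" if "X \<in> carrier ?Q" for X
    using that unfolding quot_module_carrier by blast
  have "monoid ?Q"
  proof (rule monoidI)
    show "\<one>\<^bsub>?Q\<^esub> \<in> carrier ?Q" unfolding mu(2) by (rule co(1)) simp
    fix X assume "X \<in> carrier ?Q"
    then obtain x where x: "x \<in> carrier A" "X = I +>\<^bsub>A\<^esub> x" using ex by blast
    show "\<one>\<^bsub>?Q\<^esub> \<otimes>\<^bsub>?Q\<^esub> X = X" "X \<otimes>\<^bsub>?Q\<^esub> \<one>\<^bsub>?Q\<^esub> = X"
      using x by (simp_all only: mu A.one_closed A.l_one A.r_one)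
    fix Y assume "Y \<in> carrier ?Q"
    then obtain y where y: "y \<in> carrier A" "Y = I +>\<^bsub>A\<^esub> y" using ex by blast
    show "X \<otimes>\<^bsub>?Q\<^esub> Y \<in> carrier ?Q" using x y by (simp only: mu co(1) A.m_closed)
    fix Z assume "Z \<in> carrier ?Q"
    then obtain z where z: "z \<in> carrier A" "Z = I +>\<^bsub>A\<^esub> z" using ex by blast
    show "X \<otimes>\<^bsub>?Q\<^esub> Y \<otimes>\<^bsub>?Q\<^esub> Z = X \<otimes>\<^bsub>?Q\<^esub> (Y \<otimes>\<^bsub>?Q\<^esub> Z)"
      using x y z by (simp only: mu A.m_closed A.m_assoc)
  qed
  moreover have "(X \<oplus>\<^bsub>?Q\<^esub> Y) \<otimes>\<^bsub>?Q\<^esub> Z = X \<otimes>\<^bsub>?Q\<^esub> Z \<oplus>\<^bsub>?Q\<^esub> Y \<otimes>\<^bsub>?Q\<^esub> Z \<and>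
      Z \<otimes>\<^bsub>?Q\<^esub> (X \<oplus>\<^bsub>?Q\<^esub> Y) = Z \<otimes>\<^bsub>?Q\<^esub> X \<oplus>\<^bsub>?Q\<^esub> Z \<otimes>\<^bsub>?Q\<^esub> Y"
    if XYZ: "X \<in> carrier ?Q" "Y \<in> carrier ?Q" "Z \<in> carrier ?Q" for X Y Z
  proof -
    obtain x y z where "x \<in> carrier A" "X = I +>\<^bsub>A\<^esub> x" "y \<in> carrier A" "Y = I +>\<^bsub>A\<^esub> y"
      "z \<in> carrier A" "Z = I +>\<^bsub>A\<^esub> z" using ex[OF XYZ(1)] ex[OF XYZ(2)] ex[OF XYZ(3)] by blast
    then show ?thesis by (simp only: mu co(2) A.m_closed A.a_closed A.l_distr A.r_distr)
  qed
  ultimately have "ring ?Q"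
    by (intro ringI Q.M.abelian_group_axioms) blast+
  moreover have "(r \<odot>\<^bsub>?Q\<^esub> X) \<otimes>\<^bsub>?Q\<^esub> Y = r \<odot>\<^bsub>?Q\<^esub> (X \<otimes>\<^bsub>?Q\<^esub> Y) \<and> X \<otimes>\<^bsub>?Q\<^esub> (r \<odot>\<^bsub>?Q\<^esub> Y) = r \<odot>\<^bsub>?Q\<^esub> (X \<otimes>\<^bsub>?Q\<^esub> Y)"
    if rXY: "r \<in> carrier R" "X \<in> carrier ?Q" "Y \<in> carrier ?Q" for r X Y
  proof -
    obtain x y where "x \<in> carrier A" "X = I +>\<^bsub>A\<^esub> x" "y \<in> carrier A" "Y = I +>\<^bsub>A\<^esub> y"
      using ex[OF rXY(2)] ex[OF rXY(3)] by blast
    then show ?thesis using rXY(1)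
      by (simp only: mu co(3) A.m_closed M.smult_closed AD(3,4))
  qed
  ultimately show ?thesis using mQ unfolding assoc_algebra_def by blast
qed

subsection \<open>Monoid algebras\<close>

lemma monoid_algebra_simps [simp]:
  "carrier (monoid_algebra R G) = carrier (free_module R (carrier G))"
  "zero (monoid_algebra R G) = zero (free_module R (carrier G))"
  "add (monoid_algebra R G) = add (free_module R (carrier G))"
  "smult (monoid_algebra R G) = smult (free_module R (carrier G))"
  "one (monoid_algebra R G) = basis_elt R \<one>\<^bsub>G\<^esub>"
  by (simp_all add: monoid_algebra_def)

text \<open>A monoid algebra differs from the underlying free module only in its product and unit;
  this carries the linear facts over.\<close>

lemma module_cong:
  fixes M N :: "('r, 'm, 'y) module_scheme"
  assumes "carrier N = carrier M" "add N = add M" "zero N = zero M" "smult N = smult M"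
  shows "module R N \<longleftrightarrow> module R M" "lin R N P h \<longleftrightarrow> lin R M P h"
    "gen_submodule R N S = gen_submodule R M S"
proof -
  have *: "add_monoid N = add_monoid M" using assms by simp
  show m: "module R N \<longleftrightarrow> module R M"
    by (simp add: module_def module_axioms_def abelian_group_def abelian_group_axioms_def abelian_monoid_def * assms)
  show "lin R N P h \<longleftrightarrow> lin R M P h" by (simp add: lin_def assms)
  show "gen_submodule R N S = gen_submodule R M S"
    by (simp add: gen_submodule_def submodule_def submodule_axioms_def * assms)
qed

lemma free_basis_monoid_algebra:
  assumes "cring R"
  shows "free_basis R (monoid_algebra R G) (carrier G) (basis_elt R)"
  using free_basis_free_module[OF assms, of "carrier G"]
  by (simp add: free_basis_def module_cong[OF monoid_algebra_simps(1,3,2,4)])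

text \<open>The product is defined by a sum over pairs in the supports with a given product.
  Rewritten over a finite rectangle, it can be compared for factors with different supports, which
  gives bilinearity.\<close>

lemma monoid_algebra_mult:
  assumes "cring R" and f: "f \<in> carrier (monoid_algebra R G)" and g: "g \<in> carrier (monoid_algebra R G)"
    and S: "finite S" "{a. f a \<noteq> \<zero>\<^bsub>R\<^esub>} \<subseteq> S" and T: "finite T" "{a. g a \<noteq> \<zero>\<^bsub>R\<^esub>} \<subseteq> T"
  shows "(f \<otimes>\<^bsub>monoid_algebra R G\<^esub> g) c =
    (\<Oplus>\<^bsub>R\<^esub>p\<in>S \<times> T. if fst p \<otimes>\<^bsub>G\<^esub> snd p = c then f (fst p) \<otimes>\<^bsub>R\<^esub> g (snd p) else \<zero>\<^bsub>R\<^esub>)"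
proof -
  interpret R: cring R by fact
  have fg: "f a \<in> carrier R" "g a \<in> carrier R" for a
    using f g by (auto simp: free_module_carrier)
  let ?P = "{(a, b). f a \<noteq> \<zero>\<^bsub>R\<^esub> \<and> g b \<noteq> \<zero>\<^bsub>R\<^esub> \<and> a \<otimes>\<^bsub>G\<^esub> b = c}"
  have "(\<Oplus>\<^bsub>R\<^esub>p\<in>?P. f (fst p) \<otimes>\<^bsub>R\<^esub> g (snd p)) =
    (\<Oplus>\<^bsub>R\<^esub>p\<in>S \<times> T. if fst p \<otimes>\<^bsub>G\<^esub> snd p = c then f (fst p) \<otimes>\<^bsub>R\<^esub> g (snd p) else \<zero>\<^bsub>R\<^esub>)"
  proof (rule R.add.finprod_mono_neutral_cong_left)
    show "finite (S \<times> T)" using S T by blast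
    show "?P \<subseteq> S \<times> T" using S T by blast
    show "(\<lambda>p. if fst p \<otimes>\<^bsub>G\<^esub> snd p = c then f (fst p) \<otimes>\<^bsub>R\<^esub> g (snd p) else \<zero>\<^bsub>R\<^esub>) \<in> S \<times> T \<rightarrow> carrier R"
      using fg by auto
    fix p assume "p \<in> S \<times> T - ?P"
    then have "f (fst p) = \<zero>\<^bsub>R\<^esub> \<or> g (snd p) = \<zero>\<^bsub>R\<^esub> \<or> fst p \<otimes>\<^bsub>G\<^esub> snd p \<noteq> c"
      by (cases p) auto
    then show "(if fst p \<otimes>\<^bsub>G\<^esub> snd p = c then f (fst p) \<otimes>\<^bsub>R\<^esub> g (snd p) else \<zero>\<^bsub>R\<^esub>) = \<zero>\<^bsub>R\<^esub>"
      using fg by auto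
  qed (auto split: prod.splits)
  then show ?thesis by (simp add: monoid_algebra_def)
qed

lemma monoid_algebra_mult_closed:
  assumes "cring R" "monoid G" and f: "f \<in> carrier (monoid_algebra R G)" and g: "g \<in> carrier (monoid_algebra R G)"
  shows "f \<otimes>\<^bsub>monoid_algebra R G\<^esub> g \<in> carrier (monoid_algebra R G)"
proof -
  interpret R: cring R by fact
  interpret G: monoid G by fact
  let ?h = "f \<otimes>\<^bsub>monoid_algebra R G\<^esub> g"
  let ?S = "{a. f a \<noteq> \<zero>\<^bsub>R\<^esub>}" and ?T = "{a. g a \<noteq> \<zero>\<^bsub>R\<^esub>}"
  have fg: "f a \<in> carrier R" "g a \<in> carrier R" for a
    using f g by (auto simp: free_module_carrier)
  have fin: "finite ?S" "finite ?T" and sub: "?S \<subseteq> carrier G" "?T \<subseteq> carrier G"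
    using f g by (auto simp: free_module_carrier)
  note eq = monoid_algebra_mult[OF assms(1) f g fin(1) order_refl fin(2) order_refl]
  have "?h c \<in> carrier R" for c
    unfolding eq using fg by (intro R.finsum_closed) auto
  moreover have supp: "c \<in> (\<lambda>p. fst p \<otimes>\<^bsub>G\<^esub> snd p) ` (?S \<times> ?T)" if "?h c \<noteq> \<zero>\<^bsub>R\<^esub>" for c
  proof (rule ccontr)
    assume "c \<notin> (\<lambda>p. fst p \<otimes>\<^bsub>G\<^esub> snd p) ` (?S \<times> ?T)"
    then have "?h c = \<zero>\<^bsub>R\<^esub>"
      unfolding eq by (intro R.add.finprod_one_eqI) auto
    with that show False by simp
  qed
  moreover have "finite {c. ?h c \<noteq> \<zero>\<^bsub>R\<^esub>}"
    by (rule finite_subset[of _ "(\<lambda>p. fst p \<otimes>\<^bsub>G\<^esub> snd p) ` (?S \<times> ?T)"]) (use supp fin in auto)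
  moreover have "(\<lambda>p. fst p \<otimes>\<^bsub>G\<^esub> snd p) ` (?S \<times> ?T) \<subseteq> carrier G"
    using sub by (clarsimp simp: subset_iff)
  ultimately show ?thesis unfolding monoid_algebra_simps(1) free_module_carrier by blast
qed

lemma monoid_algebra_mult_basis:
  assumes "cring R" "monoid G" "a \<in> carrier G" "b \<in> carrier G"
  shows "basis_elt R a \<otimes>\<^bsub>monoid_algebra R G\<^esub> basis_elt R b = basis_elt R (a \<otimes>\<^bsub>G\<^esub> b)"
proof
  fix c
  interpret R: cring R by fact
  have "(basis_elt R a \<otimes>\<^bsub>monoid_algebra R G\<^esub> basis_elt R b) c =
    (\<Oplus>\<^bsub>R\<^esub>p\<in>{a} \<times> {b}. if fst p \<otimes>\<^bsub>G\<^esub> snd p = c then basis_elt R a (fst p) \<otimes>\<^bsub>R\<^esub> basis_elt R b (snd p) else \<zero>\<^bsub>R\<^esub>)"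
    using assms
    by (intro monoid_algebra_mult) (auto simp: basis_elt_closed, auto simp: basis_elt_def split: if_splits)
  also have "\<dots> = basis_elt R (a \<otimes>\<^bsub>G\<^esub> b) c"
    by (simp add: R.finsum_insert basis_elt_def)
  finally show "(basis_elt R a \<otimes>\<^bsub>monoid_algebra R G\<^esub> basis_elt R b) c = basis_elt R (a \<otimes>\<^bsub>G\<^esub> b) c" .
qed

lemma lin_monoid_algebra_mult:
  assumes R: "cring R" and G: "monoid G" and g: "g \<in> carrier (monoid_algebra R G)"
  shows "lin R (monoid_algebra R G) (monoid_algebra R G) (\<lambda>f. f \<otimes>\<^bsub>monoid_algebra R G\<^esub> g)"
    and "lin R (monoid_algebra R G) (monoid_algebra R G) (\<lambda>f. g \<otimes>\<^bsub>monoid_algebra R G\<^esub> f)"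
proof -
  interpret R: cring R by fact
  let ?A = "monoid_algebra R G"
  interpret A: module R ?A by (rule free_basisD(1)[OF free_basis_monoid_algebra[OF R]])
  have c: "f a \<in> carrier R" "finite {a. f a \<noteq> \<zero>\<^bsub>R\<^esub>}" if "f \<in> carrier ?A" for f a
    using that by (auto simp: free_module_carrier)
  let ?i = "\<lambda>f g c p. if fst p \<otimes>\<^bsub>G\<^esub> snd p = c then f (fst p) \<otimes>\<^bsub>R\<^esub> g (snd p) else \<zero>\<^bsub>R\<^esub>"
  have ic: "?i f g c \<in> S \<times> T \<rightarrow> carrier R" if "f \<in> carrier ?A" "g \<in> carrier ?A" for f g c S T
    using c(1) that by auto
  { fix f f' assume f: "f \<in> carrier ?A" "f' \<in> carrier ?A"
    let ?S = "{a. f a \<noteq> \<zero>\<^bsub>R\<^esub>} \<union> {a. f' a \<noteq> \<zero>\<^bsub>R\<^esub>}" and ?T = "{a. g a \<noteq> \<zero>\<^bsub>R\<^esub>}"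
    have S: "finite ?S" "finite ?T" using f g c(2) by auto
    have ff: "f \<oplus>\<^bsub>?A\<^esub> f' \<in> carrier ?A" using f by (rule A.M.a_closed)
    have sub: "{a. (f \<oplus>\<^bsub>?A\<^esub> f') a \<noteq> \<zero>\<^bsub>R\<^esub>} \<subseteq> ?S" by auto
    have sub': "{a. f a \<noteq> \<zero>\<^bsub>R\<^esub>} \<subseteq> ?S" "{a. f' a \<noteq> \<zero>\<^bsub>R\<^esub>} \<subseteq> ?S" by auto
    have "((f \<oplus>\<^bsub>?A\<^esub> f') \<otimes>\<^bsub>?A\<^esub> g) c = ((f \<otimes>\<^bsub>?A\<^esub> g) \<oplus>\<^bsub>?A\<^esub> (f' \<otimes>\<^bsub>?A\<^esub> g)) c" for c
    proof -
      have "((f \<oplus>\<^bsub>?A\<^esub> f') \<otimes>\<^bsub>?A\<^esub> g) c = (\<Oplus>\<^bsub>R\<^esub>p\<in>?S \<times> ?T. ?i f g c p \<oplus>\<^bsub>R\<^esub> ?i f' g c p)"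
        unfolding monoid_algebra_mult[OF R ff g S(1) sub S(2) order_refl]
        using f g c(1) by (intro R.finsum_cong'[OF HOL.refl]) (auto simp: R.l_distr)
      also have "\<dots> = (\<Oplus>\<^bsub>R\<^esub>p\<in>?S \<times> ?T. ?i f g c p) \<oplus>\<^bsub>R\<^esub> (\<Oplus>\<^bsub>R\<^esub>p\<in>?S \<times> ?T. ?i f' g c p)"
        using ic f g by (intro R.finsum_addf)
      finally show ?thesis
        by (simp add: monoid_algebra_mult[OF R f(1) g S(1) sub'(1) S(2) order_refl]
          monoid_algebra_mult[OF R f(2) g S(1) sub'(2) S(2) order_refl])
    qed
    then have "(f \<oplus>\<^bsub>?A\<^esub> f') \<otimes>\<^bsub>?A\<^esub> g = (f \<otimes>\<^bsub>?A\<^esub> g) \<oplus>\<^bsub>?A\<^esub> (f' \<otimes>\<^bsub>?A\<^esub> g)" by blast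
    moreover
    have "(g \<otimes>\<^bsub>?A\<^esub> (f \<oplus>\<^bsub>?A\<^esub> f')) c = ((g \<otimes>\<^bsub>?A\<^esub> f) \<oplus>\<^bsub>?A\<^esub> (g \<otimes>\<^bsub>?A\<^esub> f')) c" for c
    proof -
      have "(g \<otimes>\<^bsub>?A\<^esub> (f \<oplus>\<^bsub>?A\<^esub> f')) c = (\<Oplus>\<^bsub>R\<^esub>p\<in>?T \<times> ?S. ?i g f c p \<oplus>\<^bsub>R\<^esub> ?i g f' c p)"
        unfolding monoid_algebra_mult[OF R g ff S(2) order_refl S(1) sub]
        using f g c(1) by (intro R.finsum_cong'[OF HOL.refl]) (auto simp: R.r_distr)
      also have "\<dots> = (\<Oplus>\<^bsub>R\<^esub>p\<in>?T \<times> ?S. ?i g f c p) \<oplus>\<^bsub>R\<^esub> (\<Oplus>\<^bsub>R\<^esub>p\<in>?T \<times> ?S. ?i g f' c p)"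
        using ic f g by (intro R.finsum_addf)
      finally show ?thesis
        by (simp add: monoid_algebra_mult[OF R g f(1) S(2) order_refl S(1) sub'(1)]
          monoid_algebra_mult[OF R g f(2) S(2) order_refl S(1) sub'(2)])
    qed
    then have "g \<otimes>\<^bsub>?A\<^esub> (f \<oplus>\<^bsub>?A\<^esub> f') = (g \<otimes>\<^bsub>?A\<^esub> f) \<oplus>\<^bsub>?A\<^esub> (g \<otimes>\<^bsub>?A\<^esub> f')" by blast
    ultimately have "(f \<oplus>\<^bsub>?A\<^esub> f') \<otimes>\<^bsub>?A\<^esub> g = (f \<otimes>\<^bsub>?A\<^esub> g) \<oplus>\<^bsub>?A\<^esub> (f' \<otimes>\<^bsub>?A\<^esub> g)"
      "g \<otimes>\<^bsub>?A\<^esub> (f \<oplus>\<^bsub>?A\<^esub> f') = (g \<otimes>\<^bsub>?A\<^esub> f) \<oplus>\<^bsub>?A\<^esub> (g \<otimes>\<^bsub>?A\<^esub> f')" by auto }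
  note add = this
  { fix r f assume r: "r \<in> carrier R" and f: "f \<in> carrier ?A"
    let ?S = "{a. f a \<noteq> \<zero>\<^bsub>R\<^esub>}" and ?T = "{a. g a \<noteq> \<zero>\<^bsub>R\<^esub>}"
    have S: "finite ?S" "finite ?T" using f g c(2) by auto
    have rf: "r \<odot>\<^bsub>?A\<^esub> f \<in> carrier ?A" using r f by (rule A.smult_closed)
    have sub: "{a. (r \<odot>\<^bsub>?A\<^esub> f) a \<noteq> \<zero>\<^bsub>R\<^esub>} \<subseteq> ?S" using r by auto
    have "((r \<odot>\<^bsub>?A\<^esub> f) \<otimes>\<^bsub>?A\<^esub> g) c = (r \<odot>\<^bsub>?A\<^esub> (f \<otimes>\<^bsub>?A\<^esub> g)) c" for c
    proof -
      have "((r \<odot>\<^bsub>?A\<^esub> f) \<otimes>\<^bsub>?A\<^esub> g) c = (\<Oplus>\<^bsub>R\<^esub>p\<in>?S \<times> ?T. r \<otimes>\<^bsub>R\<^esub> ?i f g c p)"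
        unfolding monoid_algebra_mult[OF R rf g S(1) sub S(2) order_refl]
        using f g c(1) r by (intro R.finsum_cong'[OF HOL.refl]) (auto simp: R.m_assoc)
      also have "\<dots> = r \<otimes>\<^bsub>R\<^esub> (\<Oplus>\<^bsub>R\<^esub>p\<in>?S \<times> ?T. ?i f g c p)"
        using S r ic[OF f g] by (intro R.finsum_rdistr[symmetric]) auto
      finally show ?thesis
        by (simp add: monoid_algebra_mult[OF R f g S(1) order_refl S(2) order_refl])
    qed
    moreover have "(g \<otimes>\<^bsub>?A\<^esub> (r \<odot>\<^bsub>?A\<^esub> f)) c = (r \<odot>\<^bsub>?A\<^esub> (g \<otimes>\<^bsub>?A\<^esub> f)) c" for c
    proof -
      have "(g \<otimes>\<^bsub>?A\<^esub> (r \<odot>\<^bsub>?A\<^esub> f)) c = (\<Oplus>\<^bsub>R\<^esub>p\<in>?T \<times> ?S. r \<otimes>\<^bsub>R\<^esub> ?i g f c p)"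
        unfolding monoid_algebra_mult[OF R g rf S(2) order_refl S(1) sub]
        using f g c(1) r by (intro R.finsum_cong'[OF HOL.refl]) (auto simp: R.m_lcomm)
      also have "\<dots> = r \<otimes>\<^bsub>R\<^esub> (\<Oplus>\<^bsub>R\<^esub>p\<in>?T \<times> ?S. ?i g f c p)"
        using S r ic[OF g f] by (intro R.finsum_rdistr[symmetric]) auto
      finally show ?thesis
        by (simp add: monoid_algebra_mult[OF R g f S(2) order_refl S(1) order_refl])
    qed
    ultimately have "(r \<odot>\<^bsub>?A\<^esub> f) \<otimes>\<^bsub>?A\<^esub> g = r \<odot>\<^bsub>?A\<^esub> (f \<otimes>\<^bsub>?A\<^esub> g)"
      "g \<otimes>\<^bsub>?A\<^esub> (r \<odot>\<^bsub>?A\<^esub> f) = r \<odot>\<^bsub>?A\<^esub> (g \<otimes>\<^bsub>?A\<^esub> f)" by blast+ }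
  note smult = this
  note cl = monoid_algebra_mult_closed[OF R G]
  show "lin R ?A ?A (\<lambda>f. f \<otimes>\<^bsub>?A\<^esub> g)"
    by (rule linI) (fact cl[OF _ g] add(1) smult(1))+
  show "lin R ?A ?A (\<lambda>f. g \<otimes>\<^bsub>?A\<^esub> f)"
    by (rule linI) (fact cl[OF g] add(2) smult(2))+
qed

text \<open>Both sides of the associative law are linear in each argument, so it is extended from
  monoid elements one argument at a time, beginning with the last.\<close>

lemma assoc_algebra_monoid_algebra:
  assumes R: "cring R" and G: "monoid G"
  shows "assoc_algebra R (monoid_algebra R G)"
proof -
  interpret G: monoid G by fact
  let ?A = "monoid_algebra R G" and ?E = "basis_elt R"
  note fb = free_basis_monoid_algebra[OF R, of G]
  note fD = free_basisD[OF fb]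
  interpret A: module R ?A by (rule fD(1))
  note cl = monoid_algebra_mult_closed[OF R G] and li = lin_monoid_algebra_mult[OF R G]
    and mb = monoid_algebra_mult_basis[OF R G]
  have E: "?E a \<in> carrier ?A" if "a \<in> carrier G" for a using fD(2)[OF that] .
  have one: "\<one>\<^bsub>?A\<^esub> = ?E \<one>\<^bsub>G\<^esub>" by simp
  have one_cl: "?E \<one>\<^bsub>G\<^esub> \<in> carrier ?A" by (rule E) simp
  have "monoid ?A"
  proof (rule monoidI)
    show "\<one>\<^bsub>?A\<^esub> \<in> carrier ?A" unfolding one by (rule one_cl)
    fix x assume x: "x \<in> carrier ?A"
    show "\<one>\<^bsub>?A\<^esub> \<otimes>\<^bsub>?A\<^esub> x = x" unfolding one
      by (rule free_basis_eq[OF fb fD(1) li(2)[OF one_cl] lin_id[OF fD(1)] _ x]) (simp add: mb)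
    show "x \<otimes>\<^bsub>?A\<^esub> \<one>\<^bsub>?A\<^esub> = x" unfolding one
      by (rule free_basis_eq[OF fb fD(1) li(1)[OF one_cl] lin_id[OF fD(1)] _ x]) (simp add: mb)
    fix y assume y: "y \<in> carrier ?A"
    show "x \<otimes>\<^bsub>?A\<^esub> y \<in> carrier ?A" by (rule cl[OF x y])
    fix z assume z: "z \<in> carrier ?A"
    have 1: "(?E a \<otimes>\<^bsub>?A\<^esub> ?E b) \<otimes>\<^bsub>?A\<^esub> z = ?E a \<otimes>\<^bsub>?A\<^esub> (?E b \<otimes>\<^bsub>?A\<^esub> z)"
      if ab: "a \<in> carrier G" "b \<in> carrier G" for a b
    proof (rule free_basis_eq[OF fb fD(1) li(2)[OF cl[OF E[OF ab(1)] E[OF ab(2)]]]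
          lin_comp[OF li(2)[OF E[OF ab(2)]] li(2)[OF E[OF ab(1)]]] _ z])
      fix c assume "c \<in> carrier G"
      then show "(?E a \<otimes>\<^bsub>?A\<^esub> ?E b) \<otimes>\<^bsub>?A\<^esub> ?E c = ?E a \<otimes>\<^bsub>?A\<^esub> (?E b \<otimes>\<^bsub>?A\<^esub> ?E c)"
        using ab by (simp add: mb G.m_assoc)
    qed
    have 2: "(?E a \<otimes>\<^bsub>?A\<^esub> y) \<otimes>\<^bsub>?A\<^esub> z = ?E a \<otimes>\<^bsub>?A\<^esub> (y \<otimes>\<^bsub>?A\<^esub> z)" if a: "a \<in> carrier G" for a
      by (rule free_basis_eq[OF fb fD(1) lin_comp[OF li(2)[OF E[OF a]] li(1)[OF z]]
          lin_comp[OF li(1)[OF z] li(2)[OF E[OF a]]] 1[OF a] y])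
    show "(x \<otimes>\<^bsub>?A\<^esub> y) \<otimes>\<^bsub>?A\<^esub> z = x \<otimes>\<^bsub>?A\<^esub> (y \<otimes>\<^bsub>?A\<^esub> z)"
      by (rule free_basis_eq[OF fb fD(1) lin_comp[OF li(1)[OF y] li(1)[OF z]] li(1)[OF cl[OF y z]] 2 x])
  qed
  then have "ring ?A"
    by (rule ringI[OF A.M.abelian_group_axioms])
       (rule lin_add[OF li(1)] lin_add[OF li(2)]; assumption)+
  then show ?thesis using fD(1) lin_smult[OF li(1)] lin_smult[OF li(2)]
    unfolding assoc_algebra_def by blast
qed

subsection \<open>Tensor products\<close>

text \<open>The last clause is the universal property: a bilinear map extends linearly to the free
  module on pairs and kills the four families of relations.\<close>

lemma tensor_prod_facts:
  assumes M: "module R M" and N: "module R N"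
  shows "module R (tensor_prod R M N)"
    and "\<And>x y. x \<in> carrier M \<Longrightarrow> y \<in> carrier N \<Longrightarrow> tensor R M N x y \<in> carrier (tensor_prod R M N)"
    and "carrier (tensor_prod R M N) \<subseteq>
      gen_submodule R (tensor_prod R M N) ((\<lambda>(x, y). tensor R M N x y) ` (carrier M \<times> carrier N))"
    and "\<And>x. x \<in> carrier M \<Longrightarrow> lin R N (tensor_prod R M N) (tensor R M N x)"
    and "\<And>y. y \<in> carrier N \<Longrightarrow> lin R M (tensor_prod R M N) (\<lambda>x. tensor R M N x y)"
    and "\<And>P \<beta>. module R P \<Longrightarrow> (\<And>x. x \<in> carrier M \<Longrightarrow> lin R N P (\<beta> x)) \<Longrightarrow>
      (\<And>y. y \<in> carrier N \<Longrightarrow> lin R M P (\<lambda>x. \<beta> x y)) \<Longrightarrow>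
      \<exists>h. lin R (tensor_prod R M N) P h \<and> (\<forall>x\<in>carrier M. \<forall>y\<in>carrier N. h (tensor R M N x y) = \<beta> x y)"
proof -
  interpret M: module R M by fact
  interpret N: module R N by fact
  let ?F = "free_module R (carrier M \<times> carrier N)" and ?E = "basis_elt R"
  have fb: "free_basis R ?F (carrier M \<times> carrier N) ?E" by (rule free_basis_free_module[OF M.is_cring])
  note FD = free_basisD[OF fb]
  interpret F: module R ?F by (rule FD)
  define S where "S =
      {?E (m \<oplus>\<^bsub>M\<^esub> m', n) \<ominus>\<^bsub>?F\<^esub> (?E (m, n) \<oplus>\<^bsub>?F\<^esub> ?E (m', n)) | m m' n.
          m \<in> carrier M \<and> m' \<in> carrier M \<and> n \<in> carrier N} \<union>
       {?E (m, n \<oplus>\<^bsub>N\<^esub> n') \<ominus>\<^bsub>?F\<^esub> (?E (m, n) \<oplus>\<^bsub>?F\<^esub> ?E (m, n')) | m n n'.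
          m \<in> carrier M \<and> n \<in> carrier N \<and> n' \<in> carrier N} \<union>
       {?E (r \<odot>\<^bsub>M\<^esub> m, n) \<ominus>\<^bsub>?F\<^esub> (r \<odot>\<^bsub>?F\<^esub> ?E (m, n)) | r m n.
          r \<in> carrier R \<and> m \<in> carrier M \<and> n \<in> carrier N} \<union>
       {?E (m, r \<odot>\<^bsub>N\<^esub> n) \<ominus>\<^bsub>?F\<^esub> (r \<odot>\<^bsub>?F\<^esub> ?E (m, n)) | r m n.
          r \<in> carrier R \<and> m \<in> carrier M \<and> n \<in> carrier N}"
  have rel: "tensor_relations R M N = gen_submodule R ?F S"
    unfolding tensor_relations_def S_def Let_def ..
  have E: "?E (x, y) \<in> carrier ?F" if "x \<in> carrier M" "y \<in> carrier N" for x y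
    using that by (intro FD(2)) blast
  have S: "S \<subseteq> carrier ?F"
    unfolding S_def
    by (intro Un_least subsetI; elim CollectE exE conjE; hypsubst)
       (intro F.M.minus_closed F.M.a_closed F.smult_closed E M.M.a_closed N.M.a_closed
          M.smult_closed N.smult_closed; assumption)+
  note sub = gen_submodule_submodule[OF FD(1) S, folded rel]
  note co = quot_module_coset[OF FD(1) sub, folded tensor_prod_def]
  show mT: "module R (tensor_prod R M N)"
    unfolding tensor_prod_def by (rule module_quot_module[OF FD(1) sub])
  have ten: "tensor R M N x y = tensor_relations R M N +>\<^bsub>?F\<^esub> ?E (x, y)" for x y
    by (simp add: tensor_def)
  show cl: "tensor R M N x y \<in> carrier (tensor_prod R M N)" if "x \<in> carrier M" "y \<in> carrier N" for x y
    unfolding ten by (rule co(1)[OF E[OF that]])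
  show "carrier (tensor_prod R M N) \<subseteq>
      gen_submodule R (tensor_prod R M N) ((\<lambda>(x, y). tensor R M N x y) ` (carrier M \<times> carrier N))"
    using quot_module_gen[OF FD(1) sub FD(3)] FD(4)
    by (simp add: image_image ten tensor_prod_def case_prod_unfold del: quot_module_simps)
  have Srel: "s \<in> S \<Longrightarrow> s \<in> tensor_relations R M N" for s
    unfolding rel using gen_submodule_incl[of S R ?F] by blast
  show "lin R N (tensor_prod R M N) (tensor R M N x)" if x: "x \<in> carrier M" for x
  proof (rule linI)
    fix y assume y: "y \<in> carrier N"
    show "tensor R M N x y \<in> carrier (tensor_prod R M N)" by (rule cl[OF x y])
    { fix z assume z: "z \<in> carrier N"
      have "?E (x, y \<oplus>\<^bsub>N\<^esub> z) \<ominus>\<^bsub>?F\<^esub> (?E (x, y) \<oplus>\<^bsub>?F\<^esub> ?E (x, z)) \<in> tensor_relations R M N"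
        using x y z by (intro Srel) (unfold S_def, blast)
      then show "tensor R M N x (y \<oplus>\<^bsub>N\<^esub> z) = tensor R M N x y \<oplus>\<^bsub>tensor_prod R M N\<^esub> tensor R M N x z"
        unfolding ten using E[OF x] y z F.M.a_closed N.M.a_closed by (simp only: co(2,4)) }
    { fix r assume r: "r \<in> carrier R"
      have "?E (x, r \<odot>\<^bsub>N\<^esub> y) \<ominus>\<^bsub>?F\<^esub> (r \<odot>\<^bsub>?F\<^esub> ?E (x, y)) \<in> tensor_relations R M N"
        using x y r by (intro Srel) (unfold S_def, blast)
      then show "tensor R M N x (r \<odot>\<^bsub>N\<^esub> y) = r \<odot>\<^bsub>tensor_prod R M N\<^esub> tensor R M N x y"
        unfolding ten using E[OF x] y r F.smult_closed N.smult_closed by (simp only: co(3,4)) }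
  qed
  show "lin R M (tensor_prod R M N) (\<lambda>x. tensor R M N x y)" if y: "y \<in> carrier N" for y
  proof (rule linI)
    fix x assume x: "x \<in> carrier M"
    show "tensor R M N x y \<in> carrier (tensor_prod R M N)" by (rule cl[OF x y])
    { fix z assume z: "z \<in> carrier M"
      have "?E (x \<oplus>\<^bsub>M\<^esub> z, y) \<ominus>\<^bsub>?F\<^esub> (?E (x, y) \<oplus>\<^bsub>?F\<^esub> ?E (z, y)) \<in> tensor_relations R M N"
        using x y z by (intro Srel) (unfold S_def, blast)
      then show "tensor R M N (x \<oplus>\<^bsub>M\<^esub> z) y = tensor R M N x y \<oplus>\<^bsub>tensor_prod R M N\<^esub> tensor R M N z y"
        unfolding ten using E[OF _ y] x z F.M.a_closed M.M.a_closed by (simp only: co(2,4)) }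
    { fix r assume r: "r \<in> carrier R"
      have "?E (r \<odot>\<^bsub>M\<^esub> x, y) \<ominus>\<^bsub>?F\<^esub> (r \<odot>\<^bsub>?F\<^esub> ?E (x, y)) \<in> tensor_relations R M N"
        using x y r by (intro Srel) (unfold S_def, blast)
      then show "tensor R M N (r \<odot>\<^bsub>M\<^esub> x) y = r \<odot>\<^bsub>tensor_prod R M N\<^esub> tensor R M N x y"
        unfolding ten using E[OF _ y] x r F.smult_closed M.smult_closed by (simp only: co(3,4)) }
  qed
  show "\<exists>h. lin R (tensor_prod R M N) P h \<and> (\<forall>x\<in>carrier M. \<forall>y\<in>carrier N. h (tensor R M N x y) = \<beta> x y)"
    if P: "module R P" and b1: "\<And>x. x \<in> carrier M \<Longrightarrow> lin R N P (\<beta> x)"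
      and b2: "\<And>y. y \<in> carrier N \<Longrightarrow> lin R M P (\<lambda>x. \<beta> x y)" for P \<beta>
  proof -
    interpret P: module R P by fact
    have bc: "\<beta> x y \<in> carrier P" if "x \<in> carrier M" "y \<in> carrier N" for x y
      by (rule lin_closed[OF b1]) (fact that)+
    obtain k where k: "lin R ?F P k" "\<And>p. p \<in> carrier M \<times> carrier N \<Longrightarrow> k (?E p) = \<beta> (fst p) (snd p)"
    proof (rule free_basis_ext[OF fb P])
      fix b assume "b \<in> carrier M \<times> carrier N"
      then show "\<beta> (fst b) (snd b) \<in> carrier P" by (intro bc) auto
    qed (rule that)
    have k': "k (?E (x, y)) = \<beta> x y" if "x \<in> carrier M" "y \<in> carrier N" for x y
      using k(2)[of "(x, y)"] that by simp
    have km: "k (x \<ominus>\<^bsub>?F\<^esub> y) = k x \<ominus>\<^bsub>P\<^esub> k y" if "x \<in> carrier ?F" "y \<in> carrier ?F" for x y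
      by (rule lin_minus[OF FD(1) P k(1) that])
    have self: "x \<ominus>\<^bsub>P\<^esub> x = \<zero>\<^bsub>P\<^esub>" if "x \<in> carrier P" for x using that by (simp add: a_minus_def P.M.r_neg)
    have "k s = \<zero>\<^bsub>P\<^esub>" if "s \<in> S" for s
      using that unfolding S_def
    proof (elim UnE CollectE exE conjE)
      fix m m' n assume "s = ?E (m \<oplus>\<^bsub>M\<^esub> m', n) \<ominus>\<^bsub>?F\<^esub> (?E (m, n) \<oplus>\<^bsub>?F\<^esub> ?E (m', n))"
        and c: "m \<in> carrier M" "m' \<in> carrier M" "n \<in> carrier N"
      then show "k s = \<zero>\<^bsub>P\<^esub>"
        using c by (simp only: km E F.M.a_closed M.M.a_closed k' lin_add[OF k(1)] lin_add[OF b2] bc P.M.a_closed self)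
    next
      fix m n n' assume "s = ?E (m, n \<oplus>\<^bsub>N\<^esub> n') \<ominus>\<^bsub>?F\<^esub> (?E (m, n) \<oplus>\<^bsub>?F\<^esub> ?E (m, n'))"
        and c: "m \<in> carrier M" "n \<in> carrier N" "n' \<in> carrier N"
      then show "k s = \<zero>\<^bsub>P\<^esub>"
        using c by (simp only: km E F.M.a_closed N.M.a_closed k' lin_add[OF k(1)] lin_add[OF b1] bc P.M.a_closed self)
    next
      fix r m n assume "s = ?E (r \<odot>\<^bsub>M\<^esub> m, n) \<ominus>\<^bsub>?F\<^esub> (r \<odot>\<^bsub>?F\<^esub> ?E (m, n))"
        and c: "r \<in> carrier R" "m \<in> carrier M" "n \<in> carrier N"
      then show "k s = \<zero>\<^bsub>P\<^esub>"
        using c by (simp only: km E F.smult_closed M.smult_closed k' lin_smult[OF k(1)] lin_smult[OF b2] bc P.smult_closed self)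
    next
      fix r m n assume "s = ?E (m, r \<odot>\<^bsub>N\<^esub> n) \<ominus>\<^bsub>?F\<^esub> (r \<odot>\<^bsub>?F\<^esub> ?E (m, n))"
        and c: "r \<in> carrier R" "m \<in> carrier M" "n \<in> carrier N"
      then show "k s = \<zero>\<^bsub>P\<^esub>"
        using c by (simp only: km E F.smult_closed N.smult_closed k' lin_smult[OF k(1)] lin_smult[OF b1] bc P.smult_closed self)
    qed
    then obtain g where g: "lin R (tensor_prod R M N) P g"
        "\<And>x. x \<in> carrier ?F \<Longrightarrow> g (tensor_relations R M N +>\<^bsub>?F\<^esub> x) = k x"
      using gen_quot_lift[OF FD(1) S P k(1)] unfolding rel tensor_prod_def by metis
    then show ?thesis unfolding ten using k' E by (intro exI[of _ g]) simp
  qed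
qed

lemmas module_tensor_prod = tensor_prod_facts(1)
lemmas tensor_closed = tensor_prod_facts(2)
lemmas tensor_prod_gen = tensor_prod_facts(3)
lemmas lin_tensor_right = tensor_prod_facts(4)
lemmas lin_tensor_left = tensor_prod_facts(5)
lemmas tensor_prod_ext = tensor_prod_facts(6)

lemma the_unique:
  assumes "P a" "\<And>x y. P x \<Longrightarrow> P y \<Longrightarrow> x = y"
  shows "P (THE x. P x)"
  using assms by (intro theI[of P a]) blast+

lemma tensor_map_facts:
  assumes M: "module R M" and N: "module R N" and f: "lin R M N f"
  shows "tensor_map R M N f \<in> linear_maps R (tensor_prod R M M) (tensor_prod R N N)"
    and "\<And>x y. x \<in> carrier M \<Longrightarrow> y \<in> carrier M \<Longrightarrow>
      tensor_map R M N f (tensor R M M x y) = tensor R N N (f x) (f y)"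
proof -
  let ?MM = "tensor_prod R M M" and ?NN = "tensor_prod R N N"
  note mM = module_tensor_prod[OF M M] and mN = module_tensor_prod[OF N N]
  have "\<exists>h. lin R ?MM ?NN h \<and> (\<forall>x\<in>carrier M. \<forall>y\<in>carrier M. h (tensor R M M x y) = tensor R N N (f x) (f y))"
    by (rule tensor_prod_ext[OF M M mN])
       (rule lin_comp[OF f lin_tensor_right[OF N N]] lin_comp[OF f lin_tensor_left[OF N N]];
        rule lin_closed[OF f]; assumption)+
  then obtain h where h: "lin R ?MM ?NN h"
      "\<And>x y. x \<in> carrier M \<Longrightarrow> y \<in> carrier M \<Longrightarrow> h (tensor R M M x y) = tensor R N N (f x) (f y)" by blast
  let ?P = "\<lambda>h. h \<in> linear_maps R ?MM ?NN \<and>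
      (\<forall>x\<in>carrier M. \<forall>y\<in>carrier M. h (tensor R M M x y) = tensor R N N (f x) (f y))"
  have "?P (restrict h (carrier ?MM))"
    using lin_restrict[OF mM h(1)] h(2) tensor_closed[OF M M] by (simp add: restrict_apply')
  moreover have "h1 = h2" if "?P h1" "?P h2" for h1 h2
  proof (rule linear_maps_eqI[OF mM mN])
    show "carrier ?MM \<subseteq> gen_submodule R ?MM ((\<lambda>(x, y). tensor R M M x y) ` (carrier M \<times> carrier M))"
      by (rule tensor_prod_gen[OF M M])
    show "(\<lambda>(x, y). tensor R M M x y) ` (carrier M \<times> carrier M) \<subseteq> carrier ?MM"
      using tensor_closed[OF M M] by auto
  qed (use that in auto)
  ultimately have "?P (THE h. ?P h)" by (rule the_unique[where P = ?P])
  then show "tensor_map R M N f \<in> linear_maps R ?MM ?NN"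
    "\<And>x y. x \<in> carrier M \<Longrightarrow> y \<in> carrier M \<Longrightarrow>
      tensor_map R M N f (tensor R M M x y) = tensor R N N (f x) (f y)"
    unfolding tensor_map_def by blast+
qed

subsection \<open>Tensor algebras\<close>

lemma monoid_free_monoid: "monoid (free_monoid S)"
  by (rule monoidI) (auto simp: free_monoid_def)

lemma free_monoid_simps [simp]:
  "carrier (free_monoid S) = lists S" "one (free_monoid S) = []" "mult (free_monoid S) = (@)"
  by (simp_all add: free_monoid_def)

text \<open>For the last clause, the universal property, a word is sent to the product of the images
  of its letters. On the monoid algebra of words this is multiplicative, so its kernel is an ideal
  that contains the relations and hence the ideal they generate.\<close>

lemma tensor_algebra_facts:
  assumes V: "module R V"
  shows "assoc_algebra R (tensor_algebra R V)"
    and "\<And>vs. vs \<in> lists (carrier V) \<Longrightarrow> tensor_word R V vs \<in> carrier (tensor_algebra R V)"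
    and "tensor_word R V [] = \<one>\<^bsub>tensor_algebra R V\<^esub>"
    and "\<And>vs ws. vs \<in> lists (carrier V) \<Longrightarrow> ws \<in> lists (carrier V) \<Longrightarrow>
      tensor_word R V (vs @ ws) = tensor_word R V vs \<otimes>\<^bsub>tensor_algebra R V\<^esub> tensor_word R V ws"
    and "lin R V (tensor_algebra R V) (\<lambda>v. tensor_word R V [v])"
    and "carrier (tensor_algebra R V) \<subseteq>
      gen_submodule R (tensor_algebra R V) (tensor_word R V ` lists (carrier V))"
    and "\<And>A f. assoc_algebra R A \<Longrightarrow> lin R V A f \<Longrightarrow>
      \<exists>h. alg_hom R (tensor_algebra R V) A h \<and> (\<forall>v\<in>carrier V. h (tensor_word R V [v]) = f v)"
proof -
  interpret V: module R V by fact
  let ?F = "monoid_algebra R (free_monoid (carrier V))" and ?E = "basis_elt R"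
  let ?T = "tensor_algebra R V" and ?W = "tensor_word R V" and ?L = "lists (carrier V)"
  have fb: "free_basis R ?F ?L ?E"
    using free_basis_monoid_algebra[OF V.is_cring, of "free_monoid (carrier V)"] by simp
  note FD = free_basisD[OF fb]
  have aF: "assoc_algebra R ?F" by (rule assoc_algebra_monoid_algebra[OF V.is_cring monoid_free_monoid])
  note aFD = assoc_algebraD[OF aF]
  interpret F: module R ?F by (rule FD)
  interpret F': ring ?F by (rule aFD)
  define S where "S =
      {?E [v \<oplus>\<^bsub>V\<^esub> w] \<ominus>\<^bsub>?F\<^esub> (?E [v] \<oplus>\<^bsub>?F\<^esub> ?E [w]) | v w. v \<in> carrier V \<and> w \<in> carrier V} \<union>
       {?E [r \<odot>\<^bsub>V\<^esub> v] \<ominus>\<^bsub>?F\<^esub> (r \<odot>\<^bsub>?F\<^esub> ?E [v]) | r v. r \<in> carrier R \<and> v \<in> carrier V}"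
  define I where "I = Idl\<^bsub>?F\<^esub> S"
  have rel: "tensor_algebra_relations R V = I"
    unfolding tensor_algebra_relations_def S_def I_def Let_def ..
  have T: "?T = quot_module ?F I" unfolding tensor_algebra_def rel ..
  have W: "?W vs = I +>\<^bsub>?F\<^esub> ?E vs" for vs unfolding tensor_word_def rel ..
  have E1: "?E [v] \<in> carrier ?F" if "v \<in> carrier V" for v using that by (intro FD(2)) simp
  have S: "S \<subseteq> carrier ?F"
    unfolding S_def
    by (intro Un_least subsetI; elim CollectE exE conjE; hypsubst)
       (intro F.M.minus_closed F.M.a_closed F.smult_closed E1 V.M.a_closed V.smult_closed; assumption)+
  have I: "ideal I ?F" unfolding I_def by (rule F'.genideal_ideal[OF S])
  have SI: "S \<subseteq> I" unfolding I_def by (rule F'.genideal_self[OF S])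
  note sub = ideal_submodule[OF aF I]
  note co = quot_module_coset[OF FD(1) sub] and mu = quot_module_mult[OF aF I]
  show aT: "assoc_algebra R ?T" unfolding T by (rule assoc_algebra_quot_module[OF aF I])
  show Wc: "?W vs \<in> carrier ?T" if "vs \<in> ?L" for vs
    unfolding W T by (rule co(1)[OF FD(2)[OF that]])
  show W0: "?W [] = \<one>\<^bsub>?T\<^esub>"
    unfolding T mu(2) by (simp add: W)
  show Wapp: "?W (vs @ ws) = ?W vs \<otimes>\<^bsub>?T\<^esub> ?W ws" if vw: "vs \<in> ?L" "ws \<in> ?L" for vs ws
  proof -
    have "?E vs \<otimes>\<^bsub>?F\<^esub> ?E ws = ?E (vs @ ws)"
      using monoid_algebra_mult_basis[OF V.is_cring monoid_free_monoid, of vs "carrier V" ws] vw by simp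
    then show ?thesis
      unfolding W T by (simp only: mu(1)[OF FD(2)[OF vw(1)] FD(2)[OF vw(2)]])
  qed
  show Wlin: "lin R V ?T (\<lambda>v. ?W [v])"
  proof (rule linI)
    fix v assume v: "v \<in> carrier V"
    show "?W [v] \<in> carrier ?T" using v by (intro Wc) simp
    { fix w assume w: "w \<in> carrier V"
      have "?E [v \<oplus>\<^bsub>V\<^esub> w] \<ominus>\<^bsub>?F\<^esub> (?E [v] \<oplus>\<^bsub>?F\<^esub> ?E [w]) \<in> I"
        using v w by (intro subsetD[OF SI]) (unfold S_def, blast)
      then show "?W [v \<oplus>\<^bsub>V\<^esub> w] = ?W [v] \<oplus>\<^bsub>?T\<^esub> ?W [w]"
        unfolding W T using E1 v w F.M.a_closed V.M.a_closed by (simp only: co(2,4)) }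
    { fix r assume r: "r \<in> carrier R"
      have "?E [r \<odot>\<^bsub>V\<^esub> v] \<ominus>\<^bsub>?F\<^esub> (r \<odot>\<^bsub>?F\<^esub> ?E [v]) \<in> I"
        using v r by (intro subsetD[OF SI]) (unfold S_def, blast)
      then show "?W [r \<odot>\<^bsub>V\<^esub> v] = r \<odot>\<^bsub>?T\<^esub> ?W [v]"
        unfolding W T using E1 v r F.smult_closed V.smult_closed by (simp only: co(3,4)) }
  qed
  have Wfun: "?W = (\<lambda>vs. I +>\<^bsub>?F\<^esub> ?E vs)" using W by blast
  show Wgen: "carrier ?T \<subseteq> gen_submodule R ?T (?W ` ?L)"
    using quot_module_gen[OF FD(1) sub FD(3)] FD(4) unfolding T Wfun by (simp add: image_image del: quot_module_simps)
  show "\<exists>h. alg_hom R ?T A h \<and> (\<forall>v\<in>carrier V. h (?W [v]) = f v)"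
    if A: "assoc_algebra R A" and f: "lin R V A f" for A f
  proof -
    note AD = assoc_algebraD[OF A]
    interpret A: ring A by (rule AD)
    have fc: "f v \<in> carrier A" if "v \<in> carrier V" for v by (rule lin_closed[OF f that])
    define m where "m vs = foldr (\<lambda>v p. f v \<otimes>\<^bsub>A\<^esub> p) vs \<one>\<^bsub>A\<^esub>" for vs
    have mc: "m vs \<in> carrier A" if "vs \<in> ?L" for vs
      using that by (induction vs) (auto simp: m_def fc)
    have mapp: "m (vs @ ws) = m vs \<otimes>\<^bsub>A\<^esub> m ws" if "vs \<in> ?L" "ws \<in> ?L" for vs ws
      using that(1)
    proof (induction vs)
      case Nil
      then show ?case using mc[OF that(2)] by (simp add: m_def)
    next
      case (Cons v vs)
      have "m (v # us) = f v \<otimes>\<^bsub>A\<^esub> m us" for us by (simp add: m_def)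
      then show ?case using Cons fc mc[OF that(2)] mc[of vs] by (simp add: A.m_assoc)
    qed
    obtain k where k: "lin R ?F A k" "\<And>vs. vs \<in> ?L \<Longrightarrow> k (?E vs) = m vs"
      by (rule free_basis_ext[OF fb AD(1), of m]) (rule mc, assumption, rule that)
    have k1: "k (?E [v]) = f v" if "v \<in> carrier V" for v
      using k(2)[of "[v]"] fc[OF that] that by (simp add: m_def)
    have kmult: "k (x \<otimes>\<^bsub>?F\<^esub> y) = k x \<otimes>\<^bsub>A\<^esub> k y" if "x \<in> carrier ?F" "y \<in> carrier ?F" for x y
    proof (rule mult_hom_on_gen[OF aF A k(1) FD(3) equalityD2[OF FD(4)] _ that])
      fix s t assume "s \<in> ?E ` ?L" "t \<in> ?E ` ?L"
      then obtain vs ws where vw: "vs \<in> ?L" "ws \<in> ?L" "s = ?E vs" "t = ?E ws" by blast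
      have "?E vs \<otimes>\<^bsub>?F\<^esub> ?E ws = ?E (vs @ ws)"
        using monoid_algebra_mult_basis[OF V.is_cring monoid_free_monoid, of vs "carrier V" ws] vw by simp
      then show "k (s \<otimes>\<^bsub>?F\<^esub> t) = k s \<otimes>\<^bsub>A\<^esub> k t"
        using vw by (simp only: k(2) mapp append_in_lists_conv)
    qed
    have kalg: "alg_hom R ?F A k"
      unfolding alg_hom_def using k(1) k(2)[of "[]"] kmult by (simp add: m_def del: monoid_algebra_simps(1))
    have km: "k (x \<ominus>\<^bsub>?F\<^esub> y) = k x \<ominus>\<^bsub>A\<^esub> k y" if "x \<in> carrier ?F" "y \<in> carrier ?F" for x y
      by (rule lin_minus[OF FD(1) AD(1) k(1) that])
    have self: "x \<ominus>\<^bsub>A\<^esub> x = \<zero>\<^bsub>A\<^esub>" if "x \<in> carrier A" for x using that by (simp add: a_minus_def A.r_neg)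
    interpret A': module R A by (rule AD)
    have "k s = \<zero>\<^bsub>A\<^esub>" if "s \<in> S" for s
      using that unfolding S_def
    proof (elim UnE CollectE exE conjE)
      fix v w assume "s = ?E [v \<oplus>\<^bsub>V\<^esub> w] \<ominus>\<^bsub>?F\<^esub> (?E [v] \<oplus>\<^bsub>?F\<^esub> ?E [w])"
        and c: "v \<in> carrier V" "w \<in> carrier V"
      then show "k s = \<zero>\<^bsub>A\<^esub>"
        using c by (simp only: km E1 F.M.a_closed V.M.a_closed k1 lin_add[OF k(1)] lin_add[OF f] fc A.a_closed self)
    next
      fix r v assume "s = ?E [r \<odot>\<^bsub>V\<^esub> v] \<ominus>\<^bsub>?F\<^esub> (r \<odot>\<^bsub>?F\<^esub> ?E [v])"
        and c: "r \<in> carrier R" "v \<in> carrier V"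
      then show "k s = \<zero>\<^bsub>A\<^esub>"
        using c by (simp only: km E1 F.smult_closed V.smult_closed k1 lin_smult[OF k(1)] lin_smult[OF f] fc A'.smult_closed self)
    qed
    then have "S \<subseteq> {x \<in> carrier ?F. k x = \<zero>\<^bsub>A\<^esub>}" using S by blast
    then have Ik: "I \<subseteq> {x \<in> carrier ?F. k x = \<zero>\<^bsub>A\<^esub>}"
      unfolding I_def by (rule F'.genideal_minimal[OF kernel_ideal[OF aF A kalg]])
    obtain g where g: "lin R ?T A g" "\<And>x. x \<in> carrier ?F \<Longrightarrow> g (I +>\<^bsub>?F\<^esub> x) = k x"
      unfolding T using quot_module_lift[OF FD(1) sub AD(1) k(1)] Ik by blast
    have gW: "g (?W vs) = m vs" if "vs \<in> ?L" for vs
      unfolding W g(2)[OF FD(2)[OF that]] by (rule k(2)[OF that])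
    have "g (x \<otimes>\<^bsub>?T\<^esub> y) = g x \<otimes>\<^bsub>A\<^esub> g y" if "x \<in> carrier ?T" "y \<in> carrier ?T" for x y
    proof (rule mult_hom_on_gen[OF aT A g(1) _ Wgen _ that])
      show "?W ` ?L \<subseteq> carrier ?T" using Wc by blast
      fix s t assume "s \<in> ?W ` ?L" "t \<in> ?W ` ?L"
      then obtain vs ws where vw: "vs \<in> ?L" "ws \<in> ?L" "s = ?W vs" "t = ?W ws" by blast
      then show "g (s \<otimes>\<^bsub>?T\<^esub> t) = g s \<otimes>\<^bsub>A\<^esub> g t"
        by (simp only: Wapp[symmetric] gW mapp append_in_lists_conv)
    qed
    then have "alg_hom R ?T A g"
      unfolding alg_hom_def W0[symmetric] using g(1) gW[of "[]"] by (simp add: m_def)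
    moreover have "g (?W [v]) = f v" if "v \<in> carrier V" for v
      using gW[of "[v]"] fc[OF that] that by (simp add: m_def)
    ultimately show ?thesis by blast
  qed
qed

text \<open>Independence comes from the universal property: the algebra map to the monoid algebra of
  words in \<open>B\<close> sends each tensor word of basis elements to that word. Spanning is an
  induction on the length, in which the first letter is expanded in the basis.\<close>

lemma free_basis_tensor_algebra:
  assumes V: "free_basis R V B e"
  shows "free_basis R (tensor_algebra R V) (lists B) (\<lambda>bs. tensor_word R V (map e bs))"
proof -
  note VD = free_basisD[OF V]
  interpret V: module R V by (rule VD)
  let ?T = "tensor_algebra R V" and ?W = "tensor_word R V" and ?L = "lists (carrier V)"
  let ?A = "monoid_algebra R (free_monoid B)"
  have aA: "assoc_algebra R ?A" by (rule assoc_algebra_monoid_algebra[OF V.is_cring monoid_free_monoid])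
  note AD = assoc_algebraD[OF aA]
  have fbA: "free_basis R ?A (lists B) (basis_elt R)"
    using free_basis_monoid_algebra[OF V.is_cring, of "free_monoid B"] by simp
  note T = tensor_algebra_facts[OF VD(1)] and TD = assoc_algebraD[OF tensor_algebra_facts(1)[OF VD(1)]]
  have me: "map e bs \<in> ?L" if "bs \<in> lists B" for bs using that VD(2) by auto
  obtain f where f: "lin R V ?A f" "\<And>b. b \<in> B \<Longrightarrow> f (e b) = basis_elt R [b]"
  proof (rule free_basis_ext[OF V AD(1)])
    fix b assume "b \<in> B"
    then show "basis_elt R [b] \<in> carrier ?A" by (intro free_basisD(2)[OF fbA]) simp
  qed (rule that)
  obtain h where h: "alg_hom R ?T ?A h" "\<And>v. v \<in> carrier V \<Longrightarrow> h (?W [v]) = f v"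
    using T(7)[OF aA f(1)] by blast
  note hD = alg_homD[OF h(1)]
  have hW: "h (?W (map e bs)) = basis_elt R bs" if "bs \<in> lists B" for bs
    using that
  proof (induction bs)
    case Nil
    then show ?case using hD(2) T(3) by simp
  next
    case (Cons b bs)
    have *: "[e b] \<in> ?L" "map e bs \<in> ?L" using me[of "[b]"] me[of bs] Cons by auto
    have "h (?W (map e (b # bs))) = h (?W [e b] \<otimes>\<^bsub>?T\<^esub> ?W (map e bs))"
      using T(4)[OF *] by simp
    also have "\<dots> = basis_elt R [b] \<otimes>\<^bsub>?A\<^esub> basis_elt R bs"
      using Cons h(2)[OF VD(2)] f(2) by (simp add: hD(3)[OF T(2)[OF *(1)] T(2)[OF *(2)]])
    also have "\<dots> = basis_elt R (b # bs)"
      using monoid_algebra_mult_basis[OF V.is_cring monoid_free_monoid, of "[b]" B bs] Cons by simp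
    finally show ?case .
  qed
  let ?S = "(\<lambda>bs. ?W (map e bs)) ` lists B"
  have S: "?S \<subseteq> carrier ?T" using T(2)[OF me] by blast
  let ?S1 = "(\<lambda>v. ?W [v]) ` e ` B"
  have S1: "?S1 \<subseteq> carrier ?T" using T(2) VD(2) by auto
  have H: "submodule (gen_submodule R ?T ?S) R ?T" by (rule gen_submodule_submodule[OF TD(1) S])
  have "?W vs \<in> gen_submodule R ?T ?S" if "vs \<in> ?L" for vs
    using that
  proof (induction vs)
    case Nil
    have "?W [] \<in> ?S" by (rule image_eqI[of _ _ "[]"]) auto
    then show ?case using gen_submodule_incl[of ?S R ?T] by blast
  next
    case (Cons v vs)
    have v: "v \<in> carrier V" and vs: "vs \<in> ?L" using Cons by auto
    have "?W [v] \<in> (\<lambda>v. ?W [v]) ` gen_submodule R V (e ` B)" using v VD(4) by blast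
    also have "\<dots> = gen_submodule R ?T ?S1" by (rule lin_image_gen_submodule[OF VD(1) TD(1) T(5) VD(3)])
    finally have *: "?W [v] \<in> gen_submodule R ?T ?S1" .
    have "?W [v] \<otimes>\<^bsub>?T\<^esub> ?W vs \<in> gen_submodule R ?T ?S"
    proof (rule mult_gen_submodule[OF T(1) S1 S H _ * Cons.IH])
      fix s t assume "s \<in> ?S1" "t \<in> ?S"
      then obtain b bs where b: "b \<in> B" "bs \<in> lists B" "s = ?W [e b]" "t = ?W (map e bs)" by blast
      then have "s \<otimes>\<^bsub>?T\<^esub> t = ?W (map e (b # bs))"
        using T(4)[of "[e b]" "map e bs"] me[of "[b]"] me[of bs] by simp
      then have "s \<otimes>\<^bsub>?T\<^esub> t \<in> ?S" using b(1,2) by (intro image_eqI[of _ _ "b # bs"]) auto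
      then show "s \<otimes>\<^bsub>?T\<^esub> t \<in> gen_submodule R ?T ?S" using gen_submodule_incl[of ?S R ?T] by blast
    qed
    then show ?case using T(4)[of "[v]" vs] v vs by simp
  qed
  then have "?W ` ?L \<subseteq> gen_submodule R ?T ?S" by blast
  from gen_submodule_mono[OF TD(1) S this] T(6)
  have "carrier ?T \<subseteq> gen_submodule R ?T ?S" by (rule subset_trans[rotated])
  moreover have "lin R ?T (free_module R (lists B)) h"
    using hD(1) by (simp add: lin_def)
  ultimately show ?thesis
    unfolding free_basis_def using TD(1) S hW by (intro conjI exI[of _ h]) auto
qed

section \<open>The cobar differential of a free graded coalgebra\<close>

lemma neg_one_pow_facts:
  assumes "cring R"
  shows "neg_one_pow R k \<in> carrier R"
    and "neg_one_pow R 0 = \<one>\<^bsub>R\<^esub>"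
    and "neg_one_pow R (k + l) = neg_one_pow R k \<otimes>\<^bsub>R\<^esub> neg_one_pow R l"
    and "neg_one_pow R (Suc k) = \<ominus>\<^bsub>R\<^esub> neg_one_pow R k"
proof -
  interpret R: cring R by fact
  show cl: "neg_one_pow R k \<in> carrier R" for k by (simp add: neg_one_pow_def)
  show "neg_one_pow R 0 = \<one>\<^bsub>R\<^esub>" by (simp add: neg_one_pow_def)
  show "neg_one_pow R (k + l) = neg_one_pow R k \<otimes>\<^bsub>R\<^esub> neg_one_pow R l"
    by (simp add: neg_one_pow_def R.nat_pow_mult)
  show "neg_one_pow R (Suc k) = \<ominus>\<^bsub>R\<^esub> neg_one_pow R k"
    using cl[of k] by (simp add: neg_one_pow_def R.r_minus)
qed

text \<open>The body of the description in \<open>cobar_diff\<close>, so that existence and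
  uniqueness become separate statements.\<close>

definition is_cobar_diff ::
    "('r, 'x) ring_scheme \<Rightarrow> ('r, 'm, 'y) dg_coalgebra_scheme
      \<Rightarrow> (('m list \<Rightarrow> 'r) set \<Rightarrow> ('m list \<Rightarrow> 'r) set) \<Rightarrow> bool" where
  "is_cobar_diff R C d \<longleftrightarrow>
    (let T = tensor_algebra R (pos_part R C); W = tensor_word R (pos_part R C);
         CC = tensor_prod R C C; ten = tensor R C C
     in d \<in> linear_maps R T T \<and>
       (\<forall>p. \<forall>x\<in>cobar_hcomp R C p. \<forall>y\<in>carrier T.
          d (x \<otimes>\<^bsub>T\<^esub> y) = (d x \<otimes>\<^bsub>T\<^esub> y) \<oplus>\<^bsub>T\<^esub> (neg_one_pow R p \<odot>\<^bsub>T\<^esub> (x \<otimes>\<^bsub>T\<^esub> d y))) \<and>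
       (\<forall>n>0. \<forall>a\<in>hcomp C n. \<forall>(k::nat) p q b c.
          (\<forall>t<k. 0 < p t \<and> 0 < q t \<and> b t \<in> hcomp C (p t) \<and> c t \<in> hcomp C (q t)) \<longrightarrow>
          coprod C a = ten a (coaug C) \<oplus>\<^bsub>CC\<^esub> ten (coaug C) a
                         \<oplus>\<^bsub>CC\<^esub> (\<Oplus>\<^bsub>CC\<^esub>t\<in>{..<k}. ten (b t) (c t)) \<longrightarrow>
          d (W [a]) = (\<ominus>\<^bsub>T\<^esub> W [diff C a])
                        \<oplus>\<^bsub>T\<^esub> (\<Oplus>\<^bsub>T\<^esub>t\<in>{..<k}. neg_one_pow R (p t) \<odot>\<^bsub>T\<^esub> W [b t, c t])))"

lemma cobar_diff_eq_The: "cobar_diff R C = (THE d. is_cobar_diff R C d)"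
  unfolding cobar_diff_def is_cobar_diff_def Let_def ..

text \<open>Instantiated twice: with simplicial chains, based on the surviving simplices, and with
  the transported coalgebra, based on words of such simplices. The last assumption supplies for each
  positive basis element one presentation of its reduced coproduct by homogeneous factors, which
  forces the value of the differential there.\<close>

locale free_graded_coalgebra =
  fixes R :: "('r, 'x) ring_scheme" and C :: "('r, 'm, 'y) dg_coalgebra_scheme"
    and B :: "'b set" and e :: "'b \<Rightarrow> 'm" and deg :: "'b \<Rightarrow> nat"
  assumes basis: "free_basis R C B e"
    and hcomp_eq: "\<And>n. hcomp C n = gen_submodule R C (e ` {b \<in> B. deg b = n})"
    and diff_lin: "lin R C C (diff C)"
    and diff_pos: "\<And>b. b \<in> B \<Longrightarrow> 0 < deg b \<Longrightarrow> diff C (e b) \<in> carrier (pos_part R C)"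
    and coprod_lin: "lin R C (tensor_prod R C C) (coprod C)"
    and coaug_hcomp: "coaug C \<in> hcomp C 0"
    and coprod_reduced: "\<And>b. b \<in> B \<Longrightarrow> 0 < deg b \<Longrightarrow>
      \<exists>(k::nat) p q l r. (\<forall>t<k. 0 < p t \<and> 0 < q t \<and> l t \<in> hcomp C (p t) \<and> r t \<in> hcomp C (q t)) \<and>
        coprod C (e b) = tensor R C C (e b) (coaug C) \<oplus>\<^bsub>tensor_prod R C C\<^esub> tensor R C C (coaug C) (e b)
          \<oplus>\<^bsub>tensor_prod R C C\<^esub> (\<Oplus>\<^bsub>tensor_prod R C C\<^esub>t\<in>{..<k}. tensor R C C (l t) (r t))"
begin

abbreviation "V \<equiv> pos_part R C"
abbreviation "T \<equiv> tensor_algebra R V"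
abbreviation "W \<equiv> tensor_word R V"
abbreviation "CC \<equiv> tensor_prod R C C"
abbreviation "Bpos \<equiv> {b \<in> B. 0 < deg b}"
abbreviation "E bs \<equiv> W (map e bs)"

definition word_deg :: "'b list \<Rightarrow> nat" where
  "word_deg bs = (\<Sum>b\<leftarrow>bs. deg b - 1)"

lemmas CD = free_basisD[OF basis]
sublocale C: module R C by (rule CD)

lemmas R_cring = C.is_cring
lemmas sgn = neg_one_pow_facts[OF R_cring]

lemma e_hcomp: "b \<in> B \<Longrightarrow> e b \<in> hcomp C (deg b)"
  unfolding hcomp_eq by (rule subsetD[OF gen_submodule_incl]) blast

lemma hcomp_closed: "hcomp C n \<subseteq> carrier C"
  unfolding hcomp_eq by (rule gen_submodule_closed(1)[OF CD(1)]) (use CD(2) in blast)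

lemma carrier_V: "carrier V = gen_submodule R C (e ` Bpos)"
proof -
  have 1: "(\<Union>n\<in>{0<..}. hcomp C n) \<subseteq> carrier C" using hcomp_closed by blast
  have 2: "e ` Bpos \<subseteq> carrier C" using CD(2) by blast
  have "gen_submodule R C (\<Union>n\<in>{0<..}. hcomp C n) = gen_submodule R C (e ` Bpos)"
  proof (rule gen_submodule_eqI[OF CD(1) 1 2])
    show "(\<Union>n\<in>{0<..}. hcomp C n) \<subseteq> gen_submodule R C (e ` Bpos)"
    proof (rule UN_least)
      fix n :: nat assume "n \<in> {0<..}"
      then have "e ` {b \<in> B. deg b = n} \<subseteq> e ` Bpos" by auto
      then have "e ` {b \<in> B. deg b = n} \<subseteq> gen_submodule R C (e ` Bpos)"
        by (rule subset_trans[OF _ gen_submodule_incl])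
      then show "hcomp C n \<subseteq> gen_submodule R C (e ` Bpos)"
        unfolding hcomp_eq by (rule gen_submodule_mono[OF CD(1) 2])
    qed
    have "e ` Bpos \<subseteq> (\<Union>n\<in>{0<..}. hcomp C n)" using e_hcomp by fastforce
    then show "e ` Bpos \<subseteq> gen_submodule R C (\<Union>n\<in>{0<..}. hcomp C n)"
      by (rule subset_trans[OF _ gen_submodule_incl])
  qed
  then show ?thesis by (simp add: pos_part_def)
qed

lemma V_eq: "V = C\<lparr>carrier := gen_submodule R C (e ` Bpos)\<rparr>"
  unfolding carrier_V[symmetric] by (simp add: pos_part_def)

lemma basis_V: "free_basis R V Bpos e"
  unfolding V_eq by (rule free_basis_submodule(1)[OF basis]) blast

lemmas VD = free_basisD[OF basis_V]

lemma V_submodule: "submodule (carrier V) R C"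
  unfolding carrier_V by (rule free_basis_submodule(2)[OF basis]) blast

lemma V_closed: "x \<in> carrier V \<Longrightarrow> x \<in> carrier C"
  using V_submodule unfolding submodule_iff[OF CD(1)] by blast

lemma V_simps: "add V = add C" "zero V = zero C" "smult V = smult C"
  by (simp_all add: pos_part_def)

lemma V_incl: "lin R V C (\<lambda>x. x)"
  by (rule linI) (simp_all add: V_closed V_simps)

lemma hcomp_V: "0 < n \<Longrightarrow> hcomp C n \<subseteq> carrier V"
  unfolding carrier_V hcomp_eq
  by (rule gen_submodule_mono[OF CD(1)]) (use CD(2) gen_submodule_incl[of "e ` Bpos" R C] in auto)

lemma diff_V: "lin R V V (diff C)"
proof -
  have "diff C x \<in> carrier V" if "x \<in> carrier V" for x
  proof (rule lin_gen_submodule_into[OF CD(1) CD(1) diff_lin _ V_submodule])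
    show "x \<in> gen_submodule R C (e ` Bpos)" using that by (simp add: carrier_V)
    show "e ` Bpos \<subseteq> carrier C" using CD(2) by blast
  qed (use diff_pos in blast)
  then show ?thesis
    by (intro linI) (simp_all add: V_simps lin_add[OF diff_lin] lin_smult[OF diff_lin] V_closed)
qed

lemmas TA = tensor_algebra_facts[OF VD(1)]
lemmas TAD = assoc_algebraD[OF TA(1)]
lemmas basis_T = free_basis_tensor_algebra[OF basis_V]
lemmas TD = free_basisD[OF basis_T]

sublocale T: ring T by (rule TAD)
sublocale T': module R T by (rule TAD)

lemma map_e_lists: "bs \<in> lists Bpos \<Longrightarrow> map e bs \<in> lists (carrier V)"
  using VD(2) by auto

lemma E_append: "bs \<in> lists Bpos \<Longrightarrow> cs \<in> lists Bpos \<Longrightarrow> E (bs @ cs) = E bs \<otimes>\<^bsub>T\<^esub> E cs"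
  using TA(4)[OF map_e_lists map_e_lists] by simp

lemma W_Cons: "v \<in> carrier V \<Longrightarrow> vs \<in> lists (carrier V) \<Longrightarrow> W (v # vs) = W [v] \<otimes>\<^bsub>T\<^esub> W vs"
  using TA(4)[of "[v]" vs] by simp

lemma W_pair: "v \<in> carrier V \<Longrightarrow> w \<in> carrier V \<Longrightarrow> W [v, w] = W [v] \<otimes>\<^bsub>T\<^esub> W [w]"
  using W_Cons[of v "[w]"] by simp

lemma W1_closed: "v \<in> carrier V \<Longrightarrow> W [v] \<in> carrier T"
  by (rule lin_closed[OF TA(5)])

text \<open>The definition admits arbitrary homogeneous letters. Expanding each letter in basis
  elements of its own degree does not change the degree of the word.\<close>

lemma cobar_hcomp_eq:
  "cobar_hcomp R C n = gen_submodule R T (E ` {bs \<in> lists Bpos. word_deg bs = n})"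
proof -
  let ?S = "\<lambda>n. E ` {bs \<in> lists Bpos. word_deg bs = n}"
  have S: "?S n \<subseteq> carrier T" for n using TD(2) by blast
  have H: "submodule (gen_submodule R T (?S n)) R T" for n by (rule gen_submodule_submodule[OF TD(1) S])
  have vsV: "vs \<in> lists (carrier V)" if "list_all2 (\<lambda>v k. v \<in> hcomp C (Suc k)) vs ks" for vs ks
    using that hcomp_V[of "Suc _"] by (induction rule: list_all2_induct) auto
  have *: "W vs \<in> gen_submodule R T (?S (sum_list ks))"
    if "list_all2 (\<lambda>v k. v \<in> hcomp C (Suc k)) vs ks" for vs ks
    using that
  proof (induction rule: list_all2_induct)
    case Nil
    have "W [] \<in> ?S 0" by (rule image_eqI[of _ _ "[]"]) (auto simp: word_deg_def)
    then show ?case using gen_submodule_incl[of "?S 0" R T] by (simp add: subset_iff)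
  next
    case (Cons v vs k ks)
    let ?S1 = "(\<lambda>v. W [v]) ` e ` {b \<in> B. deg b = Suc k}"
    have sub: "e ` {b \<in> B. deg b = Suc k} \<subseteq> carrier V" using VD(2) by auto
    have "v \<in> gen_submodule R V (e ` {b \<in> B. deg b = Suc k})"
    proof -
      have eC: "e ` {b \<in> B. deg b = Suc k} \<subseteq> carrier C" using CD(2) by blast
      have "v \<in> gen_submodule R C (e ` {b \<in> B. deg b = Suc k})" using Cons(1) unfolding hcomp_eq .
      with CD(1) eC show ?thesis
      proof (induction rule: gen_submodule_induct)
        case zero
        then show ?case using gen_submodule_closed(2)[OF VD(1) sub] by (simp add: V_simps)
      next
        case (gen s)
        then show ?case by (rule subsetD[OF gen_submodule_incl])
      next
        case (add x y)
        then show ?case using gen_submodule_closed(3)[OF VD(1) sub] by (simp add: V_simps)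
      next
        case (smult r x)
        then show ?case using gen_submodule_closed(4)[OF VD(1) sub] by (simp add: V_simps)
      qed
    qed
    then have "W [v] \<in> (\<lambda>v. W [v]) ` gen_submodule R V (e ` {b \<in> B. deg b = Suc k})" by blast
    also have "\<dots> = gen_submodule R T ?S1"
      by (rule lin_image_gen_submodule[OF VD(1) TD(1) TA(5) sub])
    finally have Wv: "W [v] \<in> gen_submodule R T ?S1" .
    have S1: "?S1 \<subseteq> carrier T" using sub W1_closed by blast
    have "W [v] \<otimes>\<^bsub>T\<^esub> W vs \<in> gen_submodule R T (?S (sum_list (k # ks)))"
    proof (rule mult_gen_submodule[OF TA(1) S1 S H _ Wv Cons(3)])
      fix s t assume "s \<in> ?S1" "t \<in> ?S (sum_list ks)"
      then obtain b bs where b: "b \<in> B" "deg b = Suc k" "bs \<in> lists Bpos" "word_deg bs = sum_list ks"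
        and st: "s = E [b]" "t = E bs" by auto
      have "s \<otimes>\<^bsub>T\<^esub> t = E (b # bs)" unfolding st using E_append[of "[b]" bs] b by simp
      moreover have "b # bs \<in> {bs \<in> lists Bpos. word_deg bs = sum_list (k # ks)}"
        using b by (auto simp: word_deg_def)
      ultimately have "s \<otimes>\<^bsub>T\<^esub> t \<in> ?S (sum_list (k # ks))" by blast
      then show "s \<otimes>\<^bsub>T\<^esub> t \<in> gen_submodule R T (?S (sum_list (k # ks)))"
        by (rule subsetD[OF gen_submodule_incl])
    qed
    then show ?case using W_Cons[of v vs] hcomp_V[of "Suc k"] Cons(1) vsV[OF Cons(2)] by auto
  qed
  have sub: "{W vs |vs ks. list_all2 (\<lambda>v k. v \<in> hcomp C (Suc k)) vs ks \<and> sum_list ks = n} \<subseteq> carrier T"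
    using TA(2) vsV by blast
  show ?thesis unfolding cobar_hcomp_def
  proof (rule gen_submodule_eqI[OF TD(1) sub S])
    show "{W vs |vs ks. list_all2 (\<lambda>v k. v \<in> hcomp C (Suc k)) vs ks \<and> sum_list ks = n}
        \<subseteq> gen_submodule R T (?S n)" using * by blast
    have "E bs \<in> {W vs |vs ks. list_all2 (\<lambda>v k. v \<in> hcomp C (Suc k)) vs ks \<and> sum_list ks = n}"
      if "bs \<in> lists Bpos" "word_deg bs = n" for bs
    proof -
      have "list_all2 (\<lambda>v k. v \<in> hcomp C (Suc k)) (map e bs) (map (\<lambda>b. deg b - 1) bs)"
        using that(1)
      proof (induction bs)
        case (Cons b bs)
        then show ?case using e_hcomp[of b] by simp
      qed simp
      then show ?thesis using that(2) unfolding word_deg_def by blast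
    qed
    then have "?S n \<subseteq> {W vs |vs ks. list_all2 (\<lambda>v k. v \<in> hcomp C (Suc k)) vs ks \<and> sum_list ks = n}"
      by blast
    then show "?S n \<subseteq> gen_submodule R T {W vs |vs ks. list_all2 (\<lambda>v k. v \<in> hcomp C (Suc k)) vs ks \<and> sum_list ks = n}"
      by (rule subset_trans[OF _ gen_submodule_incl])
  qed
qed

lemma E_cobar_hcomp: "bs \<in> lists Bpos \<Longrightarrow> E bs \<in> cobar_hcomp R C (word_deg bs)"
  unfolding cobar_hcomp_eq by (rule subsetD[OF gen_submodule_incl]) blast

lemma cobar_hcomp_closed: "cobar_hcomp R C n \<subseteq> carrier T"
  unfolding cobar_hcomp_eq by (rule gen_submodule_closed(1)[OF TD(1)]) (use TD(2) in blast)

text \<open>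
  The part of the differential coming from the reduced coproduct is obtained from the whole
  coproduct by projecting both tensor factors to positive degrees.
\<close>

lemma exists_generator_diff:
  "\<exists>\<delta>. lin R V T \<delta> \<and>
    (\<forall>n>0. \<forall>a\<in>hcomp C n. \<forall>(k::nat) p q b c.
      (\<forall>t<k. 0 < p t \<and> 0 < q t \<and> b t \<in> hcomp C (p t) \<and> c t \<in> hcomp C (q t)) \<longrightarrow>
      coprod C a = tensor R C C a (coaug C) \<oplus>\<^bsub>CC\<^esub> tensor R C C (coaug C) a
        \<oplus>\<^bsub>CC\<^esub> (\<Oplus>\<^bsub>CC\<^esub>t\<in>{..<k}. tensor R C C (b t) (c t)) \<longrightarrow>
      \<delta> a = (\<ominus>\<^bsub>T\<^esub> W [diff C a]) \<oplus>\<^bsub>T\<^esub> (\<Oplus>\<^bsub>T\<^esub>t\<in>{..<k}. neg_one_pow R (p t) \<odot>\<^bsub>T\<^esub> W [b t, c t]))"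
proof -
  interpret V: module R V by (rule VD)
  interpret CC: module R CC by (rule module_tensor_prod[OF CD(1) CD(1)])
  \<comment> \<open>\<open>\<sigma>\<close> is the projection to positive degrees with the sign
    (-1)^deg; applied to the left factor it produces the sign of the quadratic part.
    \<open>\<pi>\<close> is the unsigned projection for the right factor.\<close>
  obtain \<sigma> where \<sigma>: "lin R C V \<sigma>"
      "\<And>b. b \<in> B \<Longrightarrow> \<sigma> (e b) = (if 0 < deg b then neg_one_pow R (deg b) \<odot>\<^bsub>V\<^esub> e b else \<zero>\<^bsub>V\<^esub>)"
  proof (rule free_basis_ext[OF basis VD(1)])
    fix b assume "b \<in> B"
    then show "(if 0 < deg b then neg_one_pow R (deg b) \<odot>\<^bsub>V\<^esub> e b else \<zero>\<^bsub>V\<^esub>) \<in> carrier V"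
      using VD(2)[of b] sgn(1)[of "deg b"] by simp
  qed (rule that)
  obtain \<pi> where \<pi>: "lin R C V \<pi>" "\<And>b. b \<in> B \<Longrightarrow> \<pi> (e b) = (if 0 < deg b then e b else \<zero>\<^bsub>V\<^esub>)"
  proof (rule free_basis_ext[OF basis VD(1)])
    fix b assume "b \<in> B"
    then show "(if 0 < deg b then e b else \<zero>\<^bsub>V\<^esub>) \<in> carrier V" using VD(2)[of b] by simp
  qed (rule that)
  note \<pi>C = lin_comp[OF \<pi>(1) V_incl] and \<sigma>C = lin_comp[OF \<sigma>(1) V_incl]
  have eC: "e ` {b \<in> B. deg b = n} \<subseteq> carrier C" for n using CD(2) by blast
  have \<pi>_pos: "\<pi> x = x" if "x \<in> hcomp C n" "0 < n" for x n
    by (rule lin_eq_on_gen[OF CD(1) CD(1) \<pi>C lin_id[OF CD(1)] eC _ that(1)[unfolded hcomp_eq]])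
       (use \<pi>(2) that(2) in auto)
  have \<sigma>_pos: "\<sigma> x = neg_one_pow R n \<odot>\<^bsub>C\<^esub> x" if "x \<in> hcomp C n" "0 < n" for x n
    by (rule lin_eq_on_gen[OF CD(1) CD(1) \<sigma>C lin_scale[OF CD(1) CD(1) lin_id[OF CD(1)] sgn(1)]
          eC _ that(1)[unfolded hcomp_eq]])
       (use \<sigma>(2) that(2) in \<open>auto simp: V_simps\<close>)
  have zero: "\<pi> x = \<zero>\<^bsub>V\<^esub>" "\<sigma> x = \<zero>\<^bsub>V\<^esub>" if "x \<in> hcomp C 0" for x
  proof -
    show "\<pi> x = \<zero>\<^bsub>V\<^esub>"
      by (rule lin_eq_on_gen[OF CD(1) VD(1) \<pi>(1) lin_const_zero[OF CD(1) VD(1)] eC _ that[unfolded hcomp_eq]])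
         (use \<pi>(2) in auto)
    show "\<sigma> x = \<zero>\<^bsub>V\<^esub>"
      by (rule lin_eq_on_gen[OF CD(1) VD(1) \<sigma>(1) lin_const_zero[OF CD(1) VD(1)] eC _ that[unfolded hcomp_eq]])
         (use \<sigma>(2) in auto)
  qed
  note W\<sigma> = lin_comp[OF \<sigma>(1) TA(5)] and W\<pi> = lin_comp[OF \<pi>(1) TA(5)]
  have "\<exists>h. lin R CC T h \<and> (\<forall>x\<in>carrier C. \<forall>y\<in>carrier C. h (tensor R C C x y) = W [\<sigma> x] \<otimes>\<^bsub>T\<^esub> W [\<pi> y])"
    by (rule tensor_prod_ext[OF CD(1) CD(1) TD(1)])
       (rule lin_comp[OF W\<pi> lin_mult_left[OF TA(1)]] lin_comp[OF W\<sigma> lin_mult_right[OF TA(1)]];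
        rule lin_closed[OF W\<sigma>] lin_closed[OF W\<pi>]; assumption)+
  then obtain h where h: "lin R CC T h"
      "\<And>x y. x \<in> carrier C \<Longrightarrow> y \<in> carrier C \<Longrightarrow> h (tensor R C C x y) = W [\<sigma> x] \<otimes>\<^bsub>T\<^esub> W [\<pi> y]" by blast
  \<comment> \<open>This depends on \<open>a\<close> only through its differential and its
    coproduct, so the formula on generators follows for all presentations simultaneously.\<close>
  let ?\<delta> = "\<lambda>a. (\<ominus>\<^bsub>T\<^esub> W [diff C a]) \<oplus>\<^bsub>T\<^esub> h (coprod C a)"
  have "lin R V T ?\<delta>"
    by (rule lin_plus[OF VD(1) TD(1) lin_uminus[OF VD(1) TD(1) lin_comp[OF diff_V TA(5)]]
          lin_comp[OF lin_comp[OF V_incl coprod_lin] h(1)]])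
  moreover have "h (coprod C a) = (\<Oplus>\<^bsub>T\<^esub>t\<in>{..<k}. neg_one_pow R (p t) \<odot>\<^bsub>T\<^esub> W [b t, c t])"
    if a: "0 < n" "a \<in> hcomp C n"
      and bc: "\<forall>t<k. 0 < p t \<and> 0 < q t \<and> b t \<in> hcomp C (p t) \<and> c t \<in> hcomp C (q t)"
      and co: "coprod C a = tensor R C C a (coaug C) \<oplus>\<^bsub>CC\<^esub> tensor R C C (coaug C) a
        \<oplus>\<^bsub>CC\<^esub> (\<Oplus>\<^bsub>CC\<^esub>t\<in>{..<k}. tensor R C C (b t) (c t))"
    for n a and k :: nat and p q b c
  proof -
    have aC: "a \<in> carrier C" "coaug C \<in> carrier C" using a hcomp_closed coaug_hcomp by blast+
    have bcC: "b t \<in> carrier C" "c t \<in> carrier C" if "t < k" for t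
      using bc that hcomp_closed by blast+
    have tc: "tensor R C C x y \<in> carrier CC" if "x \<in> carrier C" "y \<in> carrier C" for x y
      by (rule tensor_closed[OF CD(1) CD(1) that])
    have V0: "W [\<zero>\<^bsub>V\<^esub>] = \<zero>\<^bsub>T\<^esub>" by (rule lin_zero[OF VD(1) TD(1) TA(5)])
    have Wc: "W [\<sigma> x] \<in> carrier T" "W [\<pi> x] \<in> carrier T" if "x \<in> carrier C" for x
      by (rule lin_closed[OF W\<sigma> that], rule lin_closed[OF W\<pi> that])
    \<comment> \<open>The coaugmentation has degree zero, so one of the projections kills each of
      the two outer summands of the coproduct.\<close>
    have 0: "h (tensor R C C a (coaug C)) = \<zero>\<^bsub>T\<^esub>" "h (tensor R C C (coaug C) a) = \<zero>\<^bsub>T\<^esub>"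
      using Wc aC by (simp_all add: h(2) zero[OF coaug_hcomp] V0)
    have sc: "(\<Oplus>\<^bsub>CC\<^esub>t\<in>{..<k}. tensor R C C (b t) (c t)) \<in> carrier CC"
      using bcC by (intro CC.finsum_closed) (auto intro: tc)
    have "h (coprod C a) = h (\<Oplus>\<^bsub>CC\<^esub>t\<in>{..<k}. tensor R C C (b t) (c t))"
      unfolding co using aC sc lin_closed[OF h(1) sc]
      by (simp add: lin_add[OF h(1)] tc 0)
    also have "\<dots> = (\<Oplus>\<^bsub>T\<^esub>t\<in>{..<k}. h (tensor R C C (b t) (c t)))"
      by (rule lin_finsum[OF CC.module_axioms TD(1) h(1)]) (use bcC tc in auto)
    also have "\<dots> = (\<Oplus>\<^bsub>T\<^esub>t\<in>{..<k}. neg_one_pow R (p t) \<odot>\<^bsub>T\<^esub> W [b t, c t])"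
    proof (rule T.finsum_cong'[OF HOL.refl])
      have V: "b t \<in> carrier V" "c t \<in> carrier V" if "t < k" for t
        using bc that hcomp_V by blast+
      have Wbc: "W [b t, c t] \<in> carrier T" if "t < k" for t using V[OF that] by (intro TA(2)) auto
      then show "(\<lambda>t. neg_one_pow R (p t) \<odot>\<^bsub>T\<^esub> W [b t, c t]) \<in> {..<k} \<rightarrow> carrier T"
        using sgn(1) by auto
      fix t assume "t \<in> {..<k}"
      then have t: "t < k" by simp
      have "h (tensor R C C (b t) (c t)) = W [neg_one_pow R (p t) \<odot>\<^bsub>V\<^esub> b t] \<otimes>\<^bsub>T\<^esub> W [c t]"
        unfolding h(2)[OF bcC[OF t]] V_simps
        using bc t \<sigma>_pos[of "b t" "p t"] \<pi>_pos[of "c t" "q t"] by simp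
      also have "\<dots> = neg_one_pow R (p t) \<odot>\<^bsub>T\<^esub> W [b t, c t]"
        using V[OF t] sgn(1)[of "p t"] W1_closed
        by (simp add: lin_smult[OF TA(5)] TAD(3) W_pair)
      finally show "h (tensor R C C (b t) (c t)) = neg_one_pow R (p t) \<odot>\<^bsub>T\<^esub> W [b t, c t]" .
    qed
    finally show ?thesis .
  qed
  ultimately show ?thesis by (intro exI[of _ ?\<delta>]) auto
qed

lemma exists_derivation:
  assumes \<delta>: "lin R V T \<delta>"
  shows "\<exists>d. lin R T T d \<and>
    (\<forall>p. \<forall>x\<in>cobar_hcomp R C p. \<forall>y\<in>carrier T.
      d (x \<otimes>\<^bsub>T\<^esub> y) = (d x \<otimes>\<^bsub>T\<^esub> y) \<oplus>\<^bsub>T\<^esub> (neg_one_pow R p \<odot>\<^bsub>T\<^esub> (x \<otimes>\<^bsub>T\<^esub> d y))) \<and>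
    (\<forall>a\<in>carrier V. d (W [a]) = \<delta> a)"
proof -
  \<comment> \<open>The graded Leibniz rule with the first letter split off, read as a recursion on
    basis words.\<close>
  define D where "D = rec_list \<zero>\<^bsub>T\<^esub> (\<lambda>b bs Dbs. (\<delta> (e b) \<otimes>\<^bsub>T\<^esub> E bs) \<oplus>\<^bsub>T\<^esub> (neg_one_pow R (deg b - 1) \<odot>\<^bsub>T\<^esub> (E [b] \<otimes>\<^bsub>T\<^esub> Dbs)))"
  have D: "D [] = \<zero>\<^bsub>T\<^esub>"
    "D (b # bs) = (\<delta> (e b) \<otimes>\<^bsub>T\<^esub> E bs) \<oplus>\<^bsub>T\<^esub> (neg_one_pow R (deg b - 1) \<odot>\<^bsub>T\<^esub> (E [b] \<otimes>\<^bsub>T\<^esub> D bs))" for b bs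
    by (simp_all add: D_def)
  have Ec: "E bs \<in> carrier T" if "bs \<in> lists Bpos" for bs using TD(2)[OF that] .
  have E1: "E [b] \<in> carrier T" if "b \<in> Bpos" for b using Ec[of "[b]"] that by simp
  have \<delta>c: "\<delta> (e b) \<in> carrier T" if "b \<in> Bpos" for b using lin_closed[OF \<delta> VD(2)[OF that]] .
  have Dc: "D bs \<in> carrier T" if "bs \<in> lists Bpos" for bs
    using that
  proof (induction bs)
    case (Cons b bs)
    have b: "b \<in> Bpos" "bs \<in> lists Bpos" using Cons(1,2) by auto
    have "D bs \<in> carrier T" using Cons b by blast
    then show ?case unfolding D
      by (intro T.a_closed T.m_closed T'.smult_closed \<delta>c[OF b(1)] E1[OF b(1)] Ec[OF b(2)] sgn(1))
  qed (simp add: D)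
  \<comment> \<open>The same rule for an arbitrary cut of a word; bilinearity then gives it for all
    homogeneous left factors.\<close>
  have DE: "D (bs @ cs) = (D bs \<otimes>\<^bsub>T\<^esub> E cs) \<oplus>\<^bsub>T\<^esub> (neg_one_pow R (word_deg bs) \<odot>\<^bsub>T\<^esub> (E bs \<otimes>\<^bsub>T\<^esub> D cs))"
    if "bs \<in> lists Bpos" "cs \<in> lists Bpos" for bs cs
    using that(1)
  proof (induction bs)
    case Nil
    then show ?case using Ec[OF that(2)] Dc[OF that(2)] by (simp add: D word_deg_def sgn(2) TA(3))
  next
    case (Cons b bs)
    have b: "b \<in> Bpos" "bs \<in> lists Bpos" using Cons(1,2) by auto
    have IH: "D (bs @ cs) = (D bs \<otimes>\<^bsub>T\<^esub> E cs) \<oplus>\<^bsub>T\<^esub> (neg_one_pow R (word_deg bs) \<odot>\<^bsub>T\<^esub> (E bs \<otimes>\<^bsub>T\<^esub> D cs))"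
      using Cons b by blast
    note cl = E1[OF b(1)] Ec[OF b(2)] Ec[OF that(2)] Dc[OF b(2)] Dc[OF that(2)] \<delta>c[OF b(1)] sgn(1)
    have Eb: "E (b # bs) = E [b] \<otimes>\<^bsub>T\<^esub> E bs" using E_append[of "[b]" bs] b by simp
    have wd: "word_deg (b # bs) = (deg b - 1) + word_deg bs" by (simp add: word_deg_def)
    show ?case
      unfolding append_Cons D(2) IH E_append[OF b(2) that(2)] Eb wd sgn(3)
      using cl
      by (simp add: T.l_distr T.r_distr T.m_assoc TAD(3,4) T'.smult_r_distr T'.smult_assoc1 T.a_assoc)
  qed
  obtain d where d: "lin R T T d" "\<And>bs. bs \<in> lists Bpos \<Longrightarrow> d (E bs) = D bs"
    by (rule free_basis_ext[OF basis_T TD(1), of D]) (rule Dc, assumption, rule that)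
  have "d (x \<otimes>\<^bsub>T\<^esub> y) = (d x \<otimes>\<^bsub>T\<^esub> y) \<oplus>\<^bsub>T\<^esub> (neg_one_pow R p \<odot>\<^bsub>T\<^esub> (x \<otimes>\<^bsub>T\<^esub> d y))"
    if x: "x \<in> cobar_hcomp R C p" and y: "y \<in> carrier T" for p x y
  proof -
    have S: "E ` {bs \<in> lists Bpos. word_deg bs = p} \<subseteq> carrier T" using Ec by blast
    have y': "y \<in> gen_submodule R T (E ` lists Bpos)" using y TD(4) by simp
    have dc: "d z \<in> carrier T" if "z \<in> carrier T" for z by (rule lin_closed[OF d(1) that])
    note l = lin_mult_left[OF TA(1)] and r = lin_mult_right[OF TA(1)]
    show ?thesis
    proof (rule bilinear_eq_on_gen[OF TD(1) TD(1) TD(1), where f = "\<lambda>x y. d (x \<otimes>\<^bsub>T\<^esub> y)"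
          and g = "\<lambda>x y. (d x \<otimes>\<^bsub>T\<^esub> y) \<oplus>\<^bsub>T\<^esub> (neg_one_pow R p \<odot>\<^bsub>T\<^esub> (x \<otimes>\<^bsub>T\<^esub> d y))",
          OF _ _ _ _ S TD(3) _ x[unfolded cobar_hcomp_eq] y'])
      fix z assume z: "z \<in> carrier T"
      show "lin R T T (\<lambda>x. d (x \<otimes>\<^bsub>T\<^esub> z))" by (rule lin_comp[OF r[OF z] d(1)])
      show "lin R T T (\<lambda>y. d (z \<otimes>\<^bsub>T\<^esub> y))" by (rule lin_comp[OF l[OF z] d(1)])
      show "lin R T T (\<lambda>x. (d x \<otimes>\<^bsub>T\<^esub> z) \<oplus>\<^bsub>T\<^esub> (neg_one_pow R p \<odot>\<^bsub>T\<^esub> (x \<otimes>\<^bsub>T\<^esub> d z)))"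
        by (rule lin_plus[OF TD(1) TD(1) lin_comp[OF d(1) r[OF z]] lin_scale[OF TD(1) TD(1) r[OF dc[OF z]] sgn(1)]])
      show "lin R T T (\<lambda>y. (d z \<otimes>\<^bsub>T\<^esub> y) \<oplus>\<^bsub>T\<^esub> (neg_one_pow R p \<odot>\<^bsub>T\<^esub> (z \<otimes>\<^bsub>T\<^esub> d y)))"
        by (rule lin_plus[OF TD(1) TD(1) l[OF dc[OF z]] lin_scale[OF TD(1) TD(1) lin_comp[OF d(1) l[OF z]] sgn(1)]])
    next
      fix s t assume "s \<in> E ` {bs \<in> lists Bpos. word_deg bs = p}" "t \<in> E ` lists Bpos"
      then obtain bs cs where b: "bs \<in> lists Bpos" "cs \<in> lists Bpos" "word_deg bs = p"
        and st: "s = E bs" "t = E cs" by blast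
      have app: "bs @ cs \<in> lists Bpos" using b by simp
      show "d (s \<otimes>\<^bsub>T\<^esub> t) = (d s \<otimes>\<^bsub>T\<^esub> t) \<oplus>\<^bsub>T\<^esub> (neg_one_pow R p \<odot>\<^bsub>T\<^esub> (s \<otimes>\<^bsub>T\<^esub> d t))"
        unfolding st E_append[OF b(1,2), symmetric] d(2)[OF app] d(2)[OF b(1)] d(2)[OF b(2)]
        using DE[OF b(1,2)] b(3) by simp
    qed
  qed
  moreover have "d (W [a]) = \<delta> a" if "a \<in> carrier V" for a
  proof (rule free_basis_eq[OF basis_V TD(1) lin_comp[OF TA(5) d(1)] \<delta> _ that])
    fix b assume b: "b \<in> Bpos"
    then have "[b] \<in> lists Bpos" by simp
    from d(2)[OF this] show "d (W [e b]) = \<delta> (e b)"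
      using \<delta>c[OF b] E1[OF b] sgn(1)[of "deg b - 1"] by (simp add: D TA(3))
  qed
  ultimately show ?thesis using d(1) by blast
qed

text \<open>The Leibniz rule for the product of the unit with itself gives
  \<open>d \<one> = d \<one> \<oplus> d \<one>\<close>, so the unit goes to zero, and it reduces
  words to letters. On letters both maps satisfy the formula for the same presentation of the
  coproduct.\<close>

lemma is_cobar_diff_unique:
  assumes d1: "is_cobar_diff R C d1" and d2: "is_cobar_diff R C d2"
  shows "d1 = d2"
proof -
  have lin: "d1 \<in> linear_maps R T T" "d2 \<in> linear_maps R T T"
    by (rule d1[unfolded is_cobar_diff_def Let_def, THEN conjunct1],
        rule d2[unfolded is_cobar_diff_def Let_def, THEN conjunct1])
  have der: "d (x \<otimes>\<^bsub>T\<^esub> y) = (d x \<otimes>\<^bsub>T\<^esub> y) \<oplus>\<^bsub>T\<^esub> (neg_one_pow R p \<odot>\<^bsub>T\<^esub> (x \<otimes>\<^bsub>T\<^esub> d y))"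
    if "is_cobar_diff R C d" "x \<in> cobar_hcomp R C p" "y \<in> carrier T" for d x y p
    by (rule that(1)[unfolded is_cobar_diff_def Let_def, THEN conjunct2, THEN conjunct1, rule_format, OF that(2,3)])
  have one: "d \<one>\<^bsub>T\<^esub> = \<zero>\<^bsub>T\<^esub>" if d: "is_cobar_diff R C d" for d
  proof -
    have "lin R T T d"
      using d[unfolded is_cobar_diff_def Let_def, THEN conjunct1] by (simp add: linear_maps_iff)
    then have dc: "d \<one>\<^bsub>T\<^esub> \<in> carrier T" by (rule lin_closed) simp
    have "\<one>\<^bsub>T\<^esub> \<in> cobar_hcomp R C 0" using E_cobar_hcomp[of "[]"] by (simp add: TA(3) word_deg_def)
    from der[OF d this T.one_closed] dc have "d \<one>\<^bsub>T\<^esub> = d \<one>\<^bsub>T\<^esub> \<oplus>\<^bsub>T\<^esub> d \<one>\<^bsub>T\<^esub>"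
      by (simp add: sgn(2))
    then show ?thesis using dc by simp
  qed
  have gen: "d1 (W [e b]) = d2 (W [e b])" if b: "b \<in> Bpos" for b
  proof -
    have b': "b \<in> B" "0 < deg b" using b by auto
    obtain k :: nat and p q l r where kp: "\<forall>t<k. 0 < p t \<and> 0 < q t \<and> l t \<in> hcomp C (p t) \<and> r t \<in> hcomp C (q t)"
      and co: "coprod C (e b) = tensor R C C (e b) (coaug C) \<oplus>\<^bsub>CC\<^esub> tensor R C C (coaug C) (e b)
          \<oplus>\<^bsub>CC\<^esub> (\<Oplus>\<^bsub>CC\<^esub>t\<in>{..<k}. tensor R C C (l t) (r t))"
      using coprod_reduced[OF b'] by (elim exE conjE) (rule that)
    have G: "d (W [e b]) = (\<ominus>\<^bsub>T\<^esub> W [diff C (e b)])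
        \<oplus>\<^bsub>T\<^esub> (\<Oplus>\<^bsub>T\<^esub>t\<in>{..<k}. neg_one_pow R (p t) \<odot>\<^bsub>T\<^esub> W [l t, r t])" if "is_cobar_diff R C d" for d
      by (rule that[unfolded is_cobar_diff_def Let_def, THEN conjunct2, THEN conjunct2, rule_format,
          OF b'(2) e_hcomp[OF b'(1)] kp[rule_format] co])
    show ?thesis by (simp only: G[OF d1] G[OF d2])
  qed
  have "d1 (E bs) = d2 (E bs)" if "bs \<in> lists Bpos" for bs
    using that
  proof (induction bs)
    case Nil
    then show ?case using one[OF d1] one[OF d2] by (simp add: TA(3))
  next
    case (Cons b bs)
    have b: "b \<in> Bpos" "bs \<in> lists Bpos" "[b] \<in> lists Bpos" using Cons(1,2) by auto
    have IH: "d1 (E bs) = d2 (E bs)" using Cons b by blast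
    have Eb: "E (b # bs) = E [b] \<otimes>\<^bsub>T\<^esub> E bs" using E_append[OF b(3,2)] by simp
    show ?case
      unfolding Eb der[OF d1 E_cobar_hcomp[OF b(3)] TD(2)[OF b(2)]]
        der[OF d2 E_cobar_hcomp[OF b(3)] TD(2)[OF b(2)]] IH
      using gen[OF b(1)] by simp
  qed
  then show ?thesis
    by (intro linear_maps_eqI[OF TD(1) TD(1) lin TD(3) equalityD2[OF TD(4)]]) blast
qed

lemma is_cobar_diff_cobar_diff: "is_cobar_diff R C (cobar_diff R C)"
proof -
  obtain \<delta> where \<delta>: "lin R V T \<delta>"
    "\<forall>n>0. \<forall>a\<in>hcomp C n. \<forall>(k::nat) p q b c.
      (\<forall>t<k. 0 < p t \<and> 0 < q t \<and> b t \<in> hcomp C (p t) \<and> c t \<in> hcomp C (q t)) \<longrightarrow>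
      coprod C a = tensor R C C a (coaug C) \<oplus>\<^bsub>CC\<^esub> tensor R C C (coaug C) a
        \<oplus>\<^bsub>CC\<^esub> (\<Oplus>\<^bsub>CC\<^esub>t\<in>{..<k}. tensor R C C (b t) (c t)) \<longrightarrow>
      \<delta> a = (\<ominus>\<^bsub>T\<^esub> W [diff C a]) \<oplus>\<^bsub>T\<^esub> (\<Oplus>\<^bsub>T\<^esub>t\<in>{..<k}. neg_one_pow R (p t) \<odot>\<^bsub>T\<^esub> W [b t, c t])"
    using exists_generator_diff by (elim exE conjE) (rule that)
  obtain d where d: "lin R T T d"
    "\<forall>p. \<forall>x\<in>cobar_hcomp R C p. \<forall>y\<in>carrier T.
      d (x \<otimes>\<^bsub>T\<^esub> y) = (d x \<otimes>\<^bsub>T\<^esub> y) \<oplus>\<^bsub>T\<^esub> (neg_one_pow R p \<odot>\<^bsub>T\<^esub> (x \<otimes>\<^bsub>T\<^esub> d y))"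
    "\<forall>a\<in>carrier V. d (W [a]) = \<delta> a"
    using exists_derivation[OF \<delta>(1)] by (elim exE conjE) (rule that)
  let ?d = "restrict d (carrier T)"
  have hc: "x \<in> carrier T" if "x \<in> cobar_hcomp R C p" for x p using that cobar_hcomp_closed by blast
  have W1: "W [a] \<in> carrier T" if "a \<in> hcomp C n" "0 < n" for a n
    using W1_closed hcomp_V that by blast
  have "is_cobar_diff R C ?d"
    unfolding is_cobar_diff_def Let_def
  proof (intro conjI allI ballI impI)
    show "?d \<in> linear_maps R T T" by (rule lin_restrict[OF TD(1) d(1)])
    fix p x y assume x: "x \<in> cobar_hcomp R C p" and y: "y \<in> carrier T"
    show "?d (x \<otimes>\<^bsub>T\<^esub> y) = ?d x \<otimes>\<^bsub>T\<^esub> y \<oplus>\<^bsub>T\<^esub> neg_one_pow R p \<odot>\<^bsub>T\<^esub> (x \<otimes>\<^bsub>T\<^esub> ?d y)"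
      using d(2)[rule_format, OF x y] y hc[OF x] by simp
  next
    fix n a and k :: nat and p q b c
    assume a: "0 < n" "a \<in> hcomp C n"
      and bc: "\<forall>t<k. 0 < p t \<and> 0 < q t \<and> b t \<in> hcomp C (p t) \<and> c t \<in> hcomp C (q t)"
      and co: "coprod C a = tensor R C C a (coaug C) \<oplus>\<^bsub>CC\<^esub> tensor R C C (coaug C) a
        \<oplus>\<^bsub>CC\<^esub> (\<Oplus>\<^bsub>CC\<^esub>t\<in>{..<k}. tensor R C C (b t) (c t))"
    have aV: "a \<in> carrier V" using a hcomp_V by blast
    have "?d (W [a]) = \<delta> a" using d(3) aV W1[OF a(2,1)] by simp
    also have "\<dots> = (\<ominus>\<^bsub>T\<^esub> W [diff C a]) \<oplus>\<^bsub>T\<^esub> (\<Oplus>\<^bsub>T\<^esub>t\<in>{..<k}. neg_one_pow R (p t) \<odot>\<^bsub>T\<^esub> W [b t, c t])"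
      by (rule \<delta>(2)[rule_format, OF a bc[rule_format] co])
    finally show "?d (W [a]) = (\<ominus>\<^bsub>T\<^esub> W [diff C a]) \<oplus>\<^bsub>T\<^esub> (\<Oplus>\<^bsub>T\<^esub>t\<in>{..<k}. neg_one_pow R (p t) \<odot>\<^bsub>T\<^esub> W [b t, c t])" .
  qed
  then show ?thesis
    unfolding cobar_diff_eq_The using is_cobar_diff_unique
    by (rule the_unique[where P = "is_cobar_diff R C"])
qed

lemma cobar_diff_linear_maps: "cobar_diff R C \<in> linear_maps R T T"
  by (rule is_cobar_diff_cobar_diff[unfolded is_cobar_diff_def Let_def, THEN conjunct1])

lemma lin_cobar_diff: "lin R T T (cobar_diff R C)"
  using cobar_diff_linear_maps by (simp add: linear_maps_iff)

lemma cobar_diff_mult: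
  "x \<in> cobar_hcomp R C p \<Longrightarrow> y \<in> carrier T \<Longrightarrow>
    cobar_diff R C (x \<otimes>\<^bsub>T\<^esub> y) =
      (cobar_diff R C x \<otimes>\<^bsub>T\<^esub> y) \<oplus>\<^bsub>T\<^esub> (neg_one_pow R p \<odot>\<^bsub>T\<^esub> (x \<otimes>\<^bsub>T\<^esub> cobar_diff R C y))"
  by (rule is_cobar_diff_cobar_diff[unfolded is_cobar_diff_def Let_def, THEN conjunct2, THEN conjunct1, rule_format])

lemma cobar_diff_one: "cobar_diff R C \<one>\<^bsub>T\<^esub> = \<zero>\<^bsub>T\<^esub>"
proof -
  have dc: "cobar_diff R C \<one>\<^bsub>T\<^esub> \<in> carrier T" by (rule lin_closed[OF lin_cobar_diff]) simp
  have "\<one>\<^bsub>T\<^esub> \<in> cobar_hcomp R C 0" using E_cobar_hcomp[of "[]"] by (simp add: TA(3) word_deg_def)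
  from cobar_diff_mult[OF this T.one_closed] dc
  have "cobar_diff R C \<one>\<^bsub>T\<^esub> = cobar_diff R C \<one>\<^bsub>T\<^esub> \<oplus>\<^bsub>T\<^esub> cobar_diff R C \<one>\<^bsub>T\<^esub>"
    by (simp add: sgn(2))
  then show ?thesis using dc by simp
qed

text \<open>The description numbers the summands of the reduced coproduct by an initial segment of
  the naturals. Renumbering allows any finite index set, in particular a set of subsets.\<close>

lemma cobar_diff_generator:
  assumes "finite J" and a: "0 < n" "a \<in> hcomp C n"
    and bc: "\<And>j. j \<in> J \<Longrightarrow> 0 < p j \<and> 0 < q j \<and> b j \<in> hcomp C (p j) \<and> c j \<in> hcomp C (q j)"
    and co: "coprod C a = tensor R C C a (coaug C) \<oplus>\<^bsub>CC\<^esub> tensor R C C (coaug C) a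
        \<oplus>\<^bsub>CC\<^esub> (\<Oplus>\<^bsub>CC\<^esub>j\<in>J. tensor R C C (b j) (c j))"
  shows "cobar_diff R C (W [a]) =
    (\<ominus>\<^bsub>T\<^esub> W [diff C a]) \<oplus>\<^bsub>T\<^esub> (\<Oplus>\<^bsub>T\<^esub>j\<in>J. neg_one_pow R (p j) \<odot>\<^bsub>T\<^esub> W [b j, c j])"
proof -
  interpret CC: module R CC by (rule module_tensor_prod[OF CD(1) CD(1)])
  obtain u where u: "bij_betw u {..<card J} J"
    using ex_bij_betw_nat_finite[OF assms(1)] by (auto simp: atLeast0LessThan)
  have uJ: "u ` {..<card J} = J" "inj_on u {..<card J}" "\<And>t. t < card J \<Longrightarrow> u t \<in> J"
    using u by (auto simp: bij_betw_def)
  have bcC: "b j \<in> carrier C" "c j \<in> carrier C" "b j \<in> carrier V" "c j \<in> carrier V" if "j \<in> J" for j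
    using bc[OF that] hcomp_closed hcomp_V by blast+
  have t: "(\<lambda>j. tensor R C C (b j) (c j)) \<in> J \<rightarrow> carrier CC"
    using bcC by (auto intro: tensor_closed[OF CD(1) CD(1)])
  have W2: "(\<lambda>j. neg_one_pow R (p j) \<odot>\<^bsub>T\<^esub> W [b j, c j]) \<in> J \<rightarrow> carrier T"
    using bcC sgn(1) by (auto intro!: TA(2) T'.smult_closed)
  have s1: "(\<Oplus>\<^bsub>CC\<^esub>j\<in>J. tensor R C C (b j) (c j)) = (\<Oplus>\<^bsub>CC\<^esub>t\<in>{..<card J}. tensor R C C (b (u t)) (c (u t)))"
    using CC.finsum_reindex[of "\<lambda>j. tensor R C C (b j) (c j)" u "{..<card J}"] t uJ by simp
  have s2: "(\<Oplus>\<^bsub>T\<^esub>j\<in>J. neg_one_pow R (p j) \<odot>\<^bsub>T\<^esub> W [b j, c j]) =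
      (\<Oplus>\<^bsub>T\<^esub>t\<in>{..<card J}. neg_one_pow R (p (u t)) \<odot>\<^bsub>T\<^esub> W [b (u t), c (u t)])"
    using T.finsum_reindex[of "\<lambda>j. neg_one_pow R (p j) \<odot>\<^bsub>T\<^esub> W [b j, c j]" u "{..<card J}"] W2 uJ by simp
  have k: "\<forall>t<card J. 0 < p (u t) \<and> 0 < q (u t) \<and> b (u t) \<in> hcomp C (p (u t)) \<and> c (u t) \<in> hcomp C (q (u t))"
    using bc uJ(3) by blast
  show ?thesis
    unfolding s2
    by (rule is_cobar_diff_cobar_diff[unfolded is_cobar_diff_def Let_def, THEN conjunct2, THEN conjunct2,
        rule_format, OF a k[rule_format] co[unfolded s1]])
qed

end

text \<open>The same renumbering, for use in verifying the locale assumption on the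
  coproduct.\<close>

lemma coprod_reduced_finite:
  assumes C: "module R C" and J: "finite J"
    and lr: "\<And>j. j \<in> J \<Longrightarrow> 0 < p j \<and> 0 < q j \<and> l j \<in> hcomp C (p j) \<and> r j \<in> hcomp C (q j)"
    and cl: "\<And>n. hcomp C n \<subseteq> carrier C"
    and co: "coprod C a = tensor R C C a (coaug C) \<oplus>\<^bsub>tensor_prod R C C\<^esub> tensor R C C (coaug C) a
        \<oplus>\<^bsub>tensor_prod R C C\<^esub> (\<Oplus>\<^bsub>tensor_prod R C C\<^esub>j\<in>J. tensor R C C (l j) (r j))"
  shows "\<exists>(k::nat) p q l r. (\<forall>t<k. 0 < p t \<and> 0 < q t \<and> l t \<in> hcomp C (p t) \<and> r t \<in> hcomp C (q t)) \<and>
        coprod C a = tensor R C C a (coaug C) \<oplus>\<^bsub>tensor_prod R C C\<^esub> tensor R C C (coaug C) a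
          \<oplus>\<^bsub>tensor_prod R C C\<^esub> (\<Oplus>\<^bsub>tensor_prod R C C\<^esub>t\<in>{..<k}. tensor R C C (l t) (r t))"
proof -
  let ?CC = "tensor_prod R C C"
  interpret CC: module R ?CC by (rule module_tensor_prod[OF C C])
  obtain u where u: "bij_betw u {..<card J} J"
    using ex_bij_betw_nat_finite[OF J] by (auto simp: atLeast0LessThan)
  have uJ: "u ` {..<card J} = J" "inj_on u {..<card J}" "\<And>t. t < card J \<Longrightarrow> u t \<in> J"
    using u by (auto simp: bij_betw_def)
  have "l j \<in> carrier C" "r j \<in> carrier C" if "j \<in> J" for j using lr[OF that] cl by blast+
  then have t: "(\<lambda>j. tensor R C C (l j) (r j)) \<in> J \<rightarrow> carrier ?CC"
    by (auto intro: tensor_closed[OF C C])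
  have s1: "(\<Oplus>\<^bsub>?CC\<^esub>j\<in>J. tensor R C C (l j) (r j)) = (\<Oplus>\<^bsub>?CC\<^esub>t\<in>{..<card J}. tensor R C C (l (u t)) (r (u t)))"
    using CC.finsum_reindex[of "\<lambda>j. tensor R C C (l j) (r j)" u "{..<card J}"] t uJ by simp
  have k: "\<forall>t<card J. 0 < p (u t) \<and> 0 < q (u t) \<and> l (u t) \<in> hcomp C (p (u t)) \<and> r (u t) \<in> hcomp C (q (u t))"
    using lr uJ(3) by blast
  show ?thesis
    by (intro exI conjI) (rule k, rule co[unfolded s1])
qed

section \<open>The cubical loop set\<close>

declare loop_eq.trans [trans]

lemma loop_eq_join: "loop_eq X u w \<Longrightarrow> loop_eq X v w \<Longrightarrow> loop_eq X u v"
  by (rule loop_eq.trans[OF _ loop_eq.sym])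

text \<open>The recursion of \<open>iter_face\<close> peels off the outermost operator; this peels
  off the one that is applied first.\<close>

lemma iter_face_append: "iter_face f (js @ [j]) n x = iter_face f js (n - 1) (f n j x)"
  by (induction js) (auto simp: diff_diff_left)

lemma front_face_self: "front_face X n n x = x"
  by (simp add: front_face_def)

lemma front_face_Suc: "i < n \<Longrightarrow> front_face X n i x = face X (Suc i) (Suc i) (front_face X n (Suc i) x)"
  by (simp add: front_face_def upt_conv_Cons Suc_diff_Suc del: upt_Suc)

lemma front_face_last:
  "i \<le> n \<Longrightarrow> front_face X (Suc n) i y = front_face X n i (face X (Suc n) (Suc n) y)"
  using iter_face_append[of "face X" "[Suc i..<Suc n]" "Suc n" "Suc n" y]
  by (simp add: front_face_def)

lemma back_face_0: "back_face X n 0 x = x"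
  by (simp add: back_face_def)

lemma back_face_Suc: "back_face X n (Suc i) x = back_face X (n - 1) i (face X n i x)"
  using iter_face_append[of "face X" "[0..<i]" i n x] by (simp add: back_face_def)

text \<open>Validity is defined by reading degeneracies from the innermost one outwards, whereas
  faces and degeneracies of letters recurse on the outermost one.\<close>

lemma letter_valid_Cons:
  "letter_valid X (k # ks, n, x) \<longleftrightarrow>
    letter_valid X (ks, n, x) \<and> 1 \<le> k \<and> k \<le> n + length ks \<and> (\<forall>j\<in>set ks. j \<le> k)"
  by (auto simp: sorted_append nth_append All_less_Suc)

lemma letter_valid_Nil: "letter_valid X ([], n, x) \<longleftrightarrow> 1 \<le> n \<and> x \<in> simp X n"
  by simp

declare letter_valid.simps [simp del]
lemmas letter_valid_simps [simp] = letter_valid_Nil letter_valid_Cons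

section \<open>Validity and dimension of letters and words\<close>

lemma length_insert_degen: "length (insert_degen i js) = Suc (length js)"
  by (induction js) auto

lemma set_insert_degen: "set (insert_degen i js) \<subseteq> insert i (set js \<union> Suc ` set js)"
  by (induction js) auto

lemma insert_degen_top: "\<forall>j\<in>set js. j \<le> i \<Longrightarrow> insert_degen i js = i # js"
  by (cases js) auto

lemma letter_dim_ge: "letter_valid X (js, n, x) \<Longrightarrow> 1 \<le> n"
  by (induction js) auto

lemma letter_dim_degen: "letter_valid X g \<Longrightarrow> letter_dim (letter_degen i g) = Suc (letter_dim g)"
  by (cases g) (auto simp: length_insert_degen dest: letter_dim_ge)

lemma letter_dim_Cons: "letter_valid X (js, n, x) \<Longrightarrow> letter_dim (k # js, n, x) = Suc (letter_dim (js, n, x))"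
  by (auto dest: letter_dim_ge)

lemma letter_degen_valid_aux:
  "letter_valid X (js, n, x) \<Longrightarrow> 1 \<le> i \<Longrightarrow> i \<le> n + length js \<Longrightarrow> letter_valid X (insert_degen i js, n, x)"
proof (induction js)
  case (Cons k ks)
  show ?case
  proof (cases "k \<le> i")
    case True
    then show ?thesis using Cons.prems by auto
  next
    case False
    have "letter_valid X (insert_degen i ks, n, x)" using Cons False by auto
    moreover have "\<forall>j\<in>set (insert_degen i ks). j \<le> Suc k"
      using set_insert_degen[of i ks] Cons.prems False by fastforce
    ultimately show ?thesis using False Cons.prems by (auto simp: length_insert_degen)
  qed
qed auto

lemma letter_degen_valid:
  "letter_valid X g \<Longrightarrow> 1 \<le> i \<Longrightarrow> i \<le> Suc (letter_dim g) \<Longrightarrow> letter_valid X (letter_degen i g)"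
  by (cases g) (auto dest: letter_dim_ge intro!: letter_degen_valid_aux)

lemma letter_degen_top: "letter_valid X (k # ks, n, x) \<Longrightarrow> letter_degen k (ks, n, x) = (k # ks, n, x)"
  by (simp add: insert_degen_top)

lemma word_valid_simps [simp]:
  "word_valid X []" "word_valid X (g # w) \<longleftrightarrow> letter_valid X g \<and> word_valid X w"
  "word_valid X (u @ v) \<longleftrightarrow> word_valid X u \<and> word_valid X v"
  by (auto simp: word_valid_def)

lemma word_dim_simps [simp]:
  "word_dim [] = 0" "word_dim (g # w) = letter_dim g + word_dim w"
  "word_dim (u @ v) = word_dim u + word_dim v"
  by (auto simp: word_dim_def)

lemma word_face_append:
  "1 \<le> i \<Longrightarrow> i \<le> word_dim u \<Longrightarrow> word_face X eps i (u @ v) = word_face X eps i u @ v"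
  "word_dim u < i \<Longrightarrow> word_face X eps i (u @ v) = u @ word_face X eps (i - word_dim u) v"
proof (induction u arbitrary: i)
  case (Cons g u)
  { case 1
    then show ?case using Cons.IH(1)[of "i - letter_dim g"] by auto
  next
    case 2
    then show ?case using Cons.IH(2)[of "i - letter_dim g"] by (auto simp: diff_diff_left) }
qed auto

locale reduced_sset = simplicial_set X for X :: "'a sset" +
  assumes reduced: "reduced 2 (simp X)"
begin

abbreviation "wD \<equiv> word_degen X"
abbreviation "wF \<equiv> word_face X"
abbreviation "lF \<equiv> letter_face X"

lemma simp_unique: "n \<le> 2 \<Longrightarrow> x \<in> simp X n \<Longrightarrow> y \<in> simp X n \<Longrightarrow> x = y"
  using reduced by (auto simp: reduced_def)

lemma base_simplex_closed: "base_simplex X n \<in> simp X n"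
proof (induction n)
  case 0
  have "\<exists>!x. x \<in> simp X 0" using reduced by (auto simp: reduced_def)
  then show ?case using theI'[of "\<lambda>x. x \<in> simp X 0"] by simp
next
  case (Suc n)
  then show ?case by (simp add: degen_closed)
qed

text \<open>\<open>base_simplex\<close> is built with \<open>s_0\<close> only, but the simplicial
  identities make all its degeneracies agree. Hence above dimension 1 it is also a last degeneracy,
  and all its faces are base simplices.\<close>

lemma degen_base_simplex: "i \<le> n \<Longrightarrow> degen X n i (base_simplex X n) = base_simplex X (Suc n)"
proof (induction n arbitrary: i)
  case (Suc n)
  show ?case
  proof (cases i)
    case (Suc j)
    then have j: "j \<le> n" using Suc.prems by simp
    have "degen X (Suc n) i (base_simplex X (Suc n)) = degen X (Suc n) (Suc j) (degen X n 0 (base_simplex X n))"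
      using Suc by simp
    also have "\<dots> = degen X (Suc n) 0 (degen X n j (base_simplex X n))"
      using degen_degen[OF base_simplex_closed, of 0 j n] j by simp
    finally show ?thesis using Suc.IH[OF j] by simp
  qed simp
qed simp

lemma front_face_closed: "i \<le> n \<Longrightarrow> x \<in> simp X n \<Longrightarrow> front_face X n i x \<in> simp X i"
proof (induction rule: inc_induct)
  case base
  then show ?case by (simp add: front_face_self)
next
  case (step i)
  then show ?case by (simp add: front_face_Suc face_closed)
qed

lemma back_face_closed: "x \<in> simp X n \<Longrightarrow> i \<le> n \<Longrightarrow> back_face X n i x \<in> simp X (n - i)"
proof (induction i arbitrary: n x)
  case (Suc i)
  then obtain m where "n = Suc m" by (cases n) auto
  then show ?case using Suc by (auto simp: back_face_Suc face_closed)
qed (simp add: back_face_0)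

lemma front_face_degen:
  assumes "x \<in> simp X n" "i \<le> n"
  shows "front_face X (Suc n) i (degen X n n x) = front_face X n i x"
  using assms face_degen_same[of x n n "Suc n"] by (simp add: front_face_last)

text \<open>A last degeneracy repeats the last vertex, so it is inherited by the back face as a last
  degeneracy. This makes both the Alexander-Whitney map and the lower cubical faces respect the
  relation on last degeneracies.\<close>

lemma back_face_degen:
  "x \<in> simp X n \<Longrightarrow> i \<le> n \<Longrightarrow>
    back_face X (Suc n) i (degen X n n x) = degen X (n - i) (n - i) (back_face X n i x)"
proof (induction i arbitrary: n x)
  case (Suc i)
  then obtain m where m: "n = Suc m" by (cases n) auto
  have y: "face X n i x \<in> simp X m" using Suc m by (simp add: face_closed)
  have "back_face X (Suc n) (Suc i) (degen X n n x) = back_face X n i (face X (Suc n) i (degen X n n x))"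
    by (simp add: back_face_Suc)
  also have "face X (Suc n) i (degen X n n x) = degen X m m (face X n i x)"
    using face_degen_less[of x m i n] Suc m by simp
  also have "back_face X n i \<dots> = degen X (m - i) (m - i) (back_face X m i (face X n i x))"
    using Suc.IH[OF y] Suc.prems m by simp
  finally show ?case using m by (simp add: back_face_Suc)
qed (simp add: back_face_0)

abbreviation "unit_letter \<equiv> ([], 1, base_simplex X 1) :: 'a letter"

lemma unit_letter_valid: "letter_valid X unit_letter"
  using base_simplex_closed[of 1] by simp

lemma word_degen_valid:
  "word_valid X w \<Longrightarrow> 1 \<le> i \<Longrightarrow> i \<le> Suc (word_dim w) \<Longrightarrow> word_valid X (wD i w)"
proof (induction w arbitrary: i)
  case Nil
  then show ?case using letter_degen_valid[OF unit_letter_valid, of i] by simp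
next
  case (Cons g w)
  then show ?case by (auto simp: letter_degen_valid intro!: Cons.IH)
qed

lemma word_dim_degen:
  "word_valid X w \<Longrightarrow> 1 \<le> i \<Longrightarrow> i \<le> Suc (word_dim w) \<Longrightarrow> word_dim (wD i w) = Suc (word_dim w)"
proof (induction w arbitrary: i)
  case Nil
  then show ?case by simp
next
  case (Cons g w)
  then show ?case by (auto simp: letter_dim_degen simp del: letter_degen.simps intro!: Cons.IH)
qed

lemma letter_face_facts:
  "letter_valid X (js, n, x) \<Longrightarrow> 1 \<le> i \<Longrightarrow> i \<le> letter_dim (js, n, x) \<Longrightarrow>
    word_valid X (lF eps i (js, n, x)) \<and>
    Suc (word_dim (lF eps i (js, n, x))) = letter_dim (js, n, x)"
proof (induction js arbitrary: i)
  case Nil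
  then obtain m where m: "n = Suc m" "1 \<le> m" by (cases n) auto
  then show ?case
    using Nil front_face_closed[of i n x] back_face_closed[of x n i] face_closed[of x m i] by auto
next
  case (Cons k ks)
  have g: "letter_valid X (ks, n, x)" "1 \<le> k" "k \<le> n + length ks" using Cons.prems by auto
  note d = letter_dim_Cons[OF g(1), of k] letter_dim_ge[OF g(1)]
  consider "i = k" | "i < k" | "k < i" by linarith
  then show ?case
  proof cases
    case 1
    then show ?thesis using g d by simp
  next
    case 2
    then have "i \<le> letter_dim (ks, n, x)" using g d by simp
    note IH = Cons.IH[OF g(1) Cons.prems(2) this]
    then have "1 \<le> k - 1" "k - 1 \<le> Suc (word_dim (lF eps i (ks, n, x)))"
      using 2 Cons.prems g d by auto
    with IH show ?thesis using 2 d by (simp add: word_degen_valid word_dim_degen del: letter_dim.simps)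
  next
    case 3
    then have "i - 1 \<le> letter_dim (ks, n, x)" "1 \<le> i - 1" using g d Cons.prems by auto
    note IH = Cons.IH[OF g(1) this(2,1)]
    then have "k \<le> Suc (word_dim (lF eps (i - 1) (ks, n, x)))"
      using 3 Cons.prems g d by auto
    with IH g(2) show ?thesis using 3 d by (simp add: word_degen_valid word_dim_degen del: letter_dim.simps)
  qed
qed

lemma word_face_facts:
  "word_valid X w \<Longrightarrow> 1 \<le> i \<Longrightarrow> i \<le> word_dim w \<Longrightarrow>
    word_valid X (wF eps i w) \<and> Suc (word_dim (wF eps i w)) = word_dim w"
proof (induction w arbitrary: i)
  case (Cons g w)
  show ?case
  proof (cases "i \<le> letter_dim g")
    case True
    then show ?thesis
      using letter_face_facts[of "fst g" "fst (snd g)" "snd (snd g)" i eps] Cons.prems by auto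
  next
    case False
    then show ?thesis using Cons.IH[of "i - letter_dim g"] Cons.prems by auto
  qed
qed simp

section \<open>The congruence on words and degeneracies of products\<close>

lemma loop_eq_valid_dim: "loop_eq X u v \<Longrightarrow> word_valid X u \<and> word_valid X v \<and> word_dim u = word_dim v"
proof (induction rule: loop_eq.induct)
  case (last_degen n x)
  then show ?case by (auto simp: degen_closed)
next
  case (shift g h)
  then show ?case
    by (simp add: letter_degen_valid letter_dim_degen del: letter_degen.simps)
next
  case (degen u v i)
  then show ?case by (auto simp: word_degen_valid word_dim_degen)
next
  case (degen_degen u i j)
  then show ?case by (simp add: word_degen_valid word_dim_degen)
qed auto

lemmas loop_eq_valid = loop_eq_valid_dim[THEN conjunct1] loop_eq_valid_dim[THEN conjunct2, THEN conjunct1]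
lemmas loop_eq_dim = loop_eq_valid_dim[THEN conjunct2, THEN conjunct2]

lemma loop_eq_append_left: "word_valid X w \<Longrightarrow> loop_eq X u v \<Longrightarrow> loop_eq X (w @ u) (w @ v)"
  by (intro loop_eq.mult loop_eq.refl)

lemma loop_eq_append_right: "word_valid X w \<Longrightarrow> loop_eq X u v \<Longrightarrow> loop_eq X (u @ w) (v @ w)"
  by (intro loop_eq.mult loop_eq.refl)

lemma loop_eq_Cons: "letter_valid X g \<Longrightarrow> loop_eq X u v \<Longrightarrow> loop_eq X (g # u) (g # v)"
  using loop_eq_append_left[of "[g]" u v] by simp

lemma unit_letter_eq: "word_valid X v \<Longrightarrow> loop_eq X (unit_letter # v) v"
  using loop_eq_append_right[OF _ loop_eq.unit[OF base_simplex_closed], of v] by simp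

lemma unit_letter_eq_last: "letter_valid X g \<Longrightarrow> loop_eq X [g, unit_letter] [g]"
  using loop_eq_append_left[OF _ loop_eq.unit[OF base_simplex_closed], of "[g]"] by simp

text \<open>At the index \<open>Suc (letter_dim h)\<close> the operator could act as the last
  degeneracy of \<open>h\<close> or as the first one of the next letter. \<open>word_degen\<close>
  makes the second choice whenever there is a next letter, passing over letters of dimension 0; the
  relation \<open>shift\<close> identifies the two at each step.\<close>

lemma degen_head:
  "letter_valid X h \<Longrightarrow> word_valid X v \<Longrightarrow> 1 \<le> i \<Longrightarrow> i \<le> Suc (letter_dim h) \<Longrightarrow>
    loop_eq X (letter_degen i h # v) (wD i (h # v))"
proof (induction v arbitrary: h i)
  case Nil
  then show ?case by (simp add: loop_eq.refl letter_degen_valid del: letter_degen.simps)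
next
  case (Cons h' v)
  show ?case
  proof (cases "i \<le> letter_dim h")
    case True
    then show ?thesis using Cons.prems
      by (simp add: loop_eq.refl letter_degen_valid del: letter_degen.simps)
  next
    case False
    then have i: "i = Suc (letter_dim h)" using Cons.prems by simp
    have v: "letter_valid X h'" "word_valid X v" using Cons.prems by auto
    have "loop_eq X ([letter_degen i h, h'] @ v) ([h, letter_degen 1 h'] @ v)"
      unfolding i by (intro loop_eq_append_right loop_eq.shift v Cons.prems)
    also have "loop_eq X ([h, letter_degen 1 h'] @ v) (h # wD 1 (h' # v))"
      using Cons.IH[of h' 1] Cons.prems v by (simp add: loop_eq_Cons del: letter_degen.simps word_degen.simps)
    finally show ?thesis using i by simp
  qed
qed

text \<open>At the border index \<open>Suc (word_dim u)\<close> the operator on \<open>u @ v\<close>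
  acts inside \<open>v\<close> when \<open>v\<close> is non-empty, while the one on \<open>u\<close>
  acts inside \<open>u\<close>; \<open>degen_head\<close> reconciles them.\<close>

lemma degen_append_left:
  "word_valid X u \<Longrightarrow> word_valid X v \<Longrightarrow> 1 \<le> i \<Longrightarrow> i \<le> Suc (word_dim u) \<Longrightarrow>
    loop_eq X (wD i (u @ v)) (wD i u @ v)"
proof (induction u arbitrary: i)
  case Nil
  then have i: "i = 1" by simp
  show ?case
  proof (cases v)
    case Nil
    then show ?thesis using i word_degen_valid[of "[]" 1] by (simp add: loop_eq.refl)
  next
    case (Cons h w)
    have h: "letter_valid X h" "word_valid X w" using Nil.prems Cons by auto
    have v1: "letter_valid X (letter_degen 1 h)" using h by (simp add: letter_degen_valid del: letter_degen.simps)
    have "loop_eq X (wD 1 (h # w)) (letter_degen 1 h # w)"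
      using degen_head[OF h, of 1] by - (rule loop_eq.sym, simp)
    \<comment> \<open>The degeneracy of an empty left part is that of the unit letter. Inserting
      this letter makes \<open>shift\<close> applicable.\<close>
    also have "loop_eq X (letter_degen 1 h # w) ([unit_letter, letter_degen 1 h] @ w)"
      using loop_eq.sym[OF unit_letter_eq, of "letter_degen 1 h # w"] h v1 by (simp del: letter_degen.simps)
    also have "loop_eq X ([unit_letter, letter_degen 1 h] @ w) ([letter_degen 1 unit_letter, h] @ w)"
      using loop_eq.shift[OF unit_letter_valid h(1)] h(2)
      by - (rule loop_eq_append_right, simp, rule loop_eq.sym, simp)
    finally show ?thesis using i Cons by simp
  qed
next
  case (Cons g u)
  show ?case
  proof (cases "i \<le> letter_dim g")
    case True
    then show ?thesis using Cons.prems
      by (simp add: loop_eq.refl letter_degen_valid del: letter_degen.simps)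
  next
    case False
    show ?thesis
    proof (cases u)
      case Nil
      then have "i = Suc (letter_dim g)" using False Cons.prems by simp
      then show ?thesis using loop_eq.sym[OF degen_head[of g v i]] Cons.prems Nil
        by (auto simp del: letter_degen.simps)
    next
      case (Cons h w)
      then show ?thesis using False Cons.prems Cons.IH[of "i - letter_dim g"]
        by (simp add: loop_eq_Cons)
    qed
  qed
qed

lemma degen_append_right:
  "word_valid X u \<Longrightarrow> word_valid X v \<Longrightarrow> word_dim u < i \<Longrightarrow> i \<le> Suc (word_dim (u @ v)) \<Longrightarrow>
    loop_eq X (wD i (u @ v)) (u @ wD (i - word_dim u) v)"
proof (induction u arbitrary: i)
  case Nil
  then show ?case by (simp add: loop_eq.refl word_degen_valid)
next
  case (Cons g u)
  show ?case
  proof (cases "u @ v = []")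
    case True
    then have i: "i = Suc (letter_dim g)" using Cons.prems by simp
    have g: "letter_valid X g" using Cons.prems by simp
    have dg: "letter_valid X (letter_degen i g)" using letter_degen_valid[OF g] i by simp
    \<comment> \<open>Here the right part is empty and its degeneracy is that of a unit letter, so
      such a letter is appended and \<open>shift\<close> moves the degeneracy onto it.\<close>
    have "loop_eq X [letter_degen i g] [letter_degen i g, unit_letter]"
      by (rule loop_eq.sym[OF unit_letter_eq_last[OF dg]])
    also have "loop_eq X [letter_degen i g, unit_letter] [g, letter_degen 1 unit_letter]"
      unfolding i by (rule loop_eq.shift[OF g unit_letter_valid])
    finally show ?thesis using True i by simp
  next
    case False
    then show ?thesis
      using Cons.prems Cons.IH[of "i - letter_dim g"] by (auto simp: diff_diff_left intro!: loop_eq_Cons)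
  qed
qed

text \<open>The cubical identities between faces and degeneracies of a letter. They hold only up to
  the congruence, because a letter stores its degeneracies in sorted order. If the new one is
  outermost, the identity is the definition of the face; otherwise the induction hypothesis is
  followed by an exchange of two degeneracies.\<close>

lemma letter_face_degen:
  "letter_valid X (js, n, x) \<Longrightarrow> 1 \<le> i \<Longrightarrow> i \<le> Suc (letter_dim (js, n, x)) \<Longrightarrow>
    1 \<le> j \<Longrightarrow> j \<le> Suc (letter_dim (js, n, x)) \<Longrightarrow>
    loop_eq X (lF eps j (letter_degen i (js, n, x)))
      (if j = i then [(js, n, x)]
       else if j < i then wD (i - 1) (lF eps j (js, n, x))
       else wD i (lF eps (j - 1) (js, n, x)))"
proof (induction js arbitrary: i j)
  case Nil
  have "word_valid X (lF eps j (letter_degen i ([], n, x)))"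
    using letter_face_facts[of "[i]" n x j eps] Nil by auto
  then show ?case by (auto simp: loop_eq.refl)
next
  case (Cons k ks)
  let ?g = "(ks, n, x)"
  have g: "letter_valid X ?g" "1 \<le> k" "k \<le> n + length ks" and k: "\<forall>j\<in>set ks. j \<le> k"
    using Cons.prems by auto
  note dd = letter_dim_Cons[OF g(1), of k] letter_dim_ge[OF g(1)]
  then have kd: "k \<le> Suc (letter_dim ?g)" using g by simp
  have valid: "letter_valid X (letter_degen i (k # ks, n, x))"
    using letter_degen_valid[OF Cons.prems(1-3)] .
  have F: "word_valid X (lF eps l ?g)" "Suc (word_dim (lF eps l ?g)) = letter_dim ?g"
    if "1 \<le> l" "l \<le> letter_dim ?g" for l
    using letter_face_facts[OF g(1) that] by auto
  show ?case
  proof (cases "k \<le> i")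
    case True
    have "word_valid X (lF eps j (letter_degen i (k # ks, n, x)))"
      using letter_face_facts[of "i # k # ks" n x j eps] valid Cons.prems True dd letter_dim_Cons[OF Cons.prems(1)]
      by (auto simp del: letter_dim.simps)
    then show ?thesis using True by (auto simp: loop_eq.refl)
  next
    case False
    then have ik: "i < k" by simp
    then have id: "i \<le> Suc (letter_dim ?g)" using kd by simp
    have dg: "letter_degen i (k # ks, n, x) = (Suc k # insert_degen i ks, n, x)" using ik by simp
    have IH: "loop_eq X (lF eps l (letter_degen i ?g))
      (if l = i then [?g]
       else if l < i then wD (i - 1) (lF eps l ?g)
       else wD i (lF eps (l - 1) ?g))"
      if "1 \<le> l" "l \<le> Suc (letter_dim ?g)" for l
      by (rule Cons.IH[OF g(1) Cons.prems(2) id that])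
    have ddeg: "loop_eq X (wD a (wD b w)) (wD (Suc b) (wD a w))"
      if "word_valid X w" "1 \<le> a" "a \<le> b" "b \<le> Suc (word_dim w)" for a b w
      using that by (rule loop_eq.degen_degen)
    have cong: "loop_eq X (wD a u) (wD a v)"
      if "loop_eq X u v" "1 \<le> a" "a \<le> Suc (word_dim v)" for a u v
      using loop_eq.degen[of X u v a] that loop_eq_dim[OF that(1)] by simp
    \<comment> \<open>Insertion of \<open>i\<close> below \<open>k\<close> raises the outermost
      degeneracy to \<open>Suc k\<close>, and the face index is compared with that one
      first.\<close>
    consider "j = Suc k" | "j = i" | "j < i" | "i < j" "j \<le> k" | "Suc k < j" by linarith
    then show ?thesis
    proof cases
      case 1
      have "word_valid X [letter_degen i ?g]"
        using letter_degen_valid[OF g(1) Cons.prems(2) id] by simp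
      then show ?thesis using 1 ik by (simp add: loop_eq.refl)
    next
      case 2
      have "lF eps j (letter_degen i (k # ks, n, x)) = wD k (lF eps i (letter_degen i ?g))"
        unfolding dg using 2 ik by simp
      also have "loop_eq X \<dots> (wD k [?g])"
        using IH[OF Cons.prems(2) id] kd g(2) by (intro cong) auto
      finally show ?thesis using 2 letter_degen_top[OF Cons.prems(1)] by (simp del: letter_degen.simps)
    next
      case 3
      have jd: "j \<le> letter_dim ?g" using 3 ik kd by simp
      have "lF eps j (letter_degen i (k # ks, n, x)) = wD k (lF eps j (letter_degen i ?g))"
        unfolding dg using 3 ik by simp
      also have "loop_eq X \<dots> (wD k (wD (i - 1) (lF eps j ?g)))"
        using IH[OF Cons.prems(4)] jd 3 kd g(2) ik F[OF Cons.prems(4) jd] Cons.prems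
        by (intro cong) (auto simp: word_dim_degen)
      also have "loop_eq X \<dots> (wD (i - 1) (wD (k - 1) (lF eps j ?g)))"
        using ddeg[OF F(1)[OF Cons.prems(4) jd], of "i - 1" "k - 1"] F(2)[OF Cons.prems(4) jd] 3 kd ik Cons.prems
        by - (rule loop_eq.sym, simp)
      finally show ?thesis using 3 ik by simp
    next
      case 4
      have jd: "1 \<le> j - 1" "j - 1 \<le> letter_dim ?g" "j \<le> Suc (letter_dim ?g)" using 4 kd Cons.prems by auto
      have "lF eps j (letter_degen i (k # ks, n, x)) = wD k (lF eps j (letter_degen i ?g))"
        unfolding dg using 4 by simp
      also have "loop_eq X \<dots> (wD k (wD i (lF eps (j - 1) ?g)))"
        using IH[OF Cons.prems(4) jd(3)] 4 kd g(2) F[OF jd(1,2)] Cons.prems jd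
        by (intro cong) (auto simp: word_dim_degen)
      also have "loop_eq X \<dots> (wD i (wD (k - 1) (lF eps (j - 1) ?g)))"
        using ddeg[OF F(1)[OF jd(1,2)], of i "k - 1"] F(2)[OF jd(1,2)] 4 kd ik Cons.prems
        by - (rule loop_eq.sym, simp)
      finally have "loop_eq X (lF eps j (letter_degen i (k # ks, n, x)))
        (wD i (wD (k - 1) (lF eps (j - 1) ?g)))" .
      moreover have "j - Suc 0 < k" using 4 by simp
      ultimately show ?thesis using 4 by simp
    next
      case 5
      have jd: "1 \<le> j - 1" "j - 1 \<le> Suc (letter_dim ?g)" "1 \<le> j - 2" "j - 2 \<le> letter_dim ?g"
        using 5 kd Cons.prems dd by auto
      have "letter_dim (k # ks, n, x) = Suc (letter_dim ?g)" by (rule dd(1))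
      then have kk: "Suc k \<le> Suc (letter_dim ?g)" using 5 Cons.prems(5) by linarith
      have "lF eps j (letter_degen i (k # ks, n, x)) = wD (Suc k) (lF eps (j - 1) (letter_degen i ?g))"
        unfolding dg using 5 by simp
      also have "loop_eq X \<dots> (wD (Suc k) (wD i (lF eps (j - 2) ?g)))"
      proof (rule cong)
        have "j - 1 \<noteq> i" "\<not> j - 1 < i" "j - 1 - 1 = j - 2" using 5 ik by auto
        then show "loop_eq X (lF eps (j - 1) (letter_degen i ?g)) (wD i (lF eps (j - 2) ?g))"
          using IH[OF jd(1,2)] by (simp only: if_False)
        have "i \<le> Suc (word_dim (lF eps (j - 2) ?g))" using kk F(2)[OF jd(3,4)] ik by linarith
        from word_dim_degen[OF F(1)[OF jd(3,4)] Cons.prems(2) this]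
        show "Suc k \<le> Suc (word_dim (wD i (lF eps (j - 2) ?g)))"
          using F(2)[OF jd(3,4)] kk by linarith
      qed simp
      also have "loop_eq X \<dots> (wD i (wD k (lF eps (j - 2) ?g)))"
        by (rule loop_eq.sym, rule ddeg[OF F(1)[OF jd(3,4)] Cons.prems(2)])
           (use F(2)[OF jd(3,4)] kk ik in linarith)+
      also have "wD k (lF eps (j - 2) ?g) = lF eps (j - 1) (k # ks, n, x)"
      proof -
        have "j - 1 \<noteq> k" "\<not> j - 1 < k" "j - 1 - 1 = j - 2" using 5 by auto
        then show ?thesis by (simp only: letter_face.simps if_False)
      qed
      finally show ?thesis using 5 ik by simp
    qed
  qed
qed

text \<open>Inside one letter this is \<open>letter_face_degen\<close>. The append lemmas are needed
  because a face changes the dimension of the first part, so \<open>word_degen\<close> may cut the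
  resulting word at a different place.\<close>

lemma word_face_degen:
  "word_valid X u \<Longrightarrow> 1 \<le> i \<Longrightarrow> i \<le> Suc (word_dim u) \<Longrightarrow> 1 \<le> j \<Longrightarrow> j \<le> Suc (word_dim u) \<Longrightarrow>
    loop_eq X (wF eps j (wD i u))
      (if j = i then u
       else if j < i then wD (i - 1) (wF eps j u)
       else wD i (wF eps (j - 1) u))"
proof (induction u arbitrary: i j)
  case Nil
  have "loop_eq X [unit_letter] []" by (rule loop_eq.unit[OF base_simplex_closed])
  then show ?case using Nil by simp
next
  case (Cons g u)
  obtain js n x where gj: "g = (js, n, x)" by (cases g)
  have g: "letter_valid X g" and u: "word_valid X u" using Cons.prems by auto
  note gd = letter_dim_degen[OF g]
  have F: "word_valid X (lF eps l g)" "Suc (word_dim (lF eps l g)) = letter_dim g"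
    if "1 \<le> l" "l \<le> letter_dim g" for l
    using letter_face_facts[of js n x l eps] that g gj by auto
  have FW: "word_valid X (wF eps l u)" "Suc (word_dim (wF eps l u)) = word_dim u"
    if "1 \<le> l" "l \<le> word_dim u" for l
    using word_face_facts[OF u that] by auto
  show ?case
  proof (cases "i \<le> letter_dim g \<or> u = []")
    case True
    then have i: "i \<le> Suc (letter_dim g)" using Cons.prems by auto
    have eq: "wD i (g # u) = letter_degen i g # u" using True by simp
    show ?thesis
    proof (cases "j \<le> Suc (letter_dim g)")
      case j: True
      have "wF eps j (wD i (g # u)) = lF eps j (letter_degen i g) @ u"
        unfolding eq using j by (simp add: gd del: letter_degen.simps)
      also have "loop_eq X \<dots> ((if j = i then [g]
         else if j < i then wD (i - 1) (lF eps j g)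
         else wD i (lF eps (j - 1) g)) @ u)"
        using letter_face_degen[of js n x i j eps] g gj i j Cons.prems u
        by (intro loop_eq_append_right) (auto simp del: letter_dim.simps letter_degen.simps)
      also have "loop_eq X \<dots> (if j = i then g # u
         else if j < i then wD (i - 1) (lF eps j g @ u)
         else wD i (lF eps (j - 1) g @ u))"
      proof -
        consider "j = i" | "j < i" | "i < j" by linarith
        then show ?thesis
        proof cases
          case 1
          then show ?thesis using g u by (simp add: loop_eq.refl)
        next
          case 2
          then have jd: "j \<le> letter_dim g" using i by simp
          have "1 \<le> i - 1" "i - 1 \<le> Suc (word_dim (lF eps j g))"
            using 2 i F(2)[OF Cons.prems(4) jd] Cons.prems by auto
          from loop_eq.sym[OF degen_append_left[OF F(1)[OF Cons.prems(4) jd] u this]] 2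
          show ?thesis by simp
        next
          case 3
          then have jd: "j - 1 \<le> letter_dim g" "1 \<le> j - 1" using j Cons.prems by auto
          have "i \<le> Suc (word_dim (lF eps (j - 1) g))"
            using 3 j F(2)[OF jd(2,1)] by auto
          from loop_eq.sym[OF degen_append_left[OF F(1)[OF jd(2,1)] u Cons.prems(2) this]] 3
          show ?thesis by simp
        qed
      qed
      also have "(if j = i then g # u
         else if j < i then wD (i - 1) (lF eps j g @ u)
         else wD i (lF eps (j - 1) g @ u)) =
         (if j = i then g # u
         else if j < i then wD (i - 1) (wF eps j (g # u))
         else wD i (wF eps (j - 1) (g # u)))"
        using i j by (auto simp del: word_degen.simps)
      finally show ?thesis .
    next
      case j: False
      then have ne: "u \<noteq> []" using Cons.prems by auto
      then have i': "i \<le> letter_dim g" using True by simp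
      let ?l = "j - letter_dim g - 1"
      have l: "1 \<le> ?l" "?l \<le> word_dim u" using j Cons.prems by auto
      have "word_valid X (letter_degen i g # wF eps ?l u)"
        using FW(1)[OF l] letter_degen_valid[OF g Cons.prems(2) i] by simp
      moreover have "\<not> j - Suc 0 \<le> letter_dim g" using j by simp
      ultimately show ?thesis unfolding eq using j i' by (simp add: gd loop_eq.refl del: letter_degen.simps)
    qed
  next
    case False
    then have i: "letter_dim g < i" and ne: "u \<noteq> []" by auto
    have eq: "wD i (g # u) = g # wD (i - letter_dim g) u" using False by simp
    show ?thesis
    proof (cases "j \<le> letter_dim g")
      case True
      \<comment> \<open>The face lowers the dimension of the first letter by one, so the degeneracy
        of the rest sits at \<open>i - 1\<close> in the new word.\<close>
      have "loop_eq X (wD (i - 1) (lF eps j g @ u))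
        (lF eps j g @ wD (i - 1 - word_dim (lF eps j g)) u)"
        using F[OF Cons.prems(4) True] u i Cons.prems by (intro degen_append_right) auto
      moreover have "i - 1 - word_dim (lF eps j g) = i - letter_dim g"
        using F(2)[OF Cons.prems(4) True] by auto
      ultimately show ?thesis unfolding eq using True i by - (rule loop_eq.sym, simp)
    next
      case j: False
      let ?i = "i - letter_dim g" and ?j = "j - letter_dim g"
      have ij: "1 \<le> ?i" "?i \<le> Suc (word_dim u)" "1 \<le> ?j" "?j \<le> Suc (word_dim u)"
        using i j Cons.prems by auto
      have "wF eps j (wD i (g # u)) = g # wF eps ?j (wD ?i u)"
        unfolding eq using j by simp
      also have "loop_eq X \<dots> (g # (if ?j = ?i then u
       else if ?j < ?i then wD (?i - 1) (wF eps ?j u)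
       else wD ?i (wF eps (?j - 1) u)))"
        by (rule loop_eq_Cons[OF g Cons.IH[OF u ij]])
      also have "loop_eq X \<dots> (if j = i then g # u
         else if j < i then wD (i - 1) (g # wF eps ?j u)
         else wD i (g # wF eps (?j - 1) u))"
      proof -
        consider "j = i" | "j < i" | "i < j" by linarith
        then show ?thesis
        proof cases
          case 1
          then show ?thesis using g u by (simp add: loop_eq.refl)
        next
          case 2
          then have l: "?j \<le> word_dim u" using i j Cons.prems by auto
          have "loop_eq X (wD (i - 1) ([g] @ wF eps ?j u))
              ([g] @ wD (i - 1 - word_dim [g]) (wF eps ?j u))"
            using g FW[OF ij(3) l] 2 i j Cons.prems by (intro degen_append_right) auto
          moreover have "i - 1 - word_dim [g] = ?i - 1" by simp
          ultimately have "loop_eq X ([g] @ wD (?i - 1) (wF eps ?j u))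
            (wD (i - 1) ([g] @ wF eps ?j u))" by (metis loop_eq.sym)
          moreover have "j \<noteq> i" "?j \<noteq> ?i" "?j < ?i" using 2 i j by auto
          ultimately show ?thesis using 2 by (simp only: if_True if_False append_Cons append_Nil)
        next
          case 3
          then have l: "1 \<le> ?j - 1" "?j - 1 \<le> word_dim u" using i j Cons.prems by auto
          have "loop_eq X (wD i ([g] @ wF eps (?j - 1) u))
              ([g] @ wD (i - word_dim [g]) (wF eps (?j - 1) u))"
            using g FW[OF l] 3 i j Cons.prems by (intro degen_append_right) auto
          moreover have "i - word_dim [g] = ?i" by simp
          ultimately have "loop_eq X ([g] @ wD ?i (wF eps (?j - 1) u))
            (wD i ([g] @ wF eps (?j - 1) u))" by (metis loop_eq.sym)
          moreover have "j \<noteq> i" "?j \<noteq> ?i" "\<not> ?j < ?i" "\<not> j < i" using 3 i j by auto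
          ultimately show ?thesis by (simp only: if_False append_Cons append_Nil)
        qed
      qed
      also have "(if j = i then g # u
         else if j < i then wD (i - 1) (g # wF eps ?j u)
         else wD i (g # wF eps (?j - 1) u)) =
         (if j = i then g # u
         else if j < i then wD (i - 1) (wF eps j (g # u))
         else wD i (wF eps (j - 1) (g # u)))"
        using i j by (auto simp: diff_commute)
      finally show ?thesis .
    qed
  qed
qed

section \<open>Faces respect the congruence\<close>

lemma degen_cong:
  assumes "loop_eq X u v" "1 \<le> a" "a \<le> Suc (word_dim v)"
  shows "loop_eq X (wD a u) (wD a v)"
  using loop_eq.degen[of X u v a] assms loop_eq_dim[OF assms(1)] by simp

text \<open>This is what makes the faces of \<open>loop_cubes\<close> well defined. Faces are
  defined on representatives, so every rule has to be checked: \<open>last_degen\<close> by the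
  simplicial identities, the rules about degeneracies by \<open>word_face_degen\<close>, and
  \<open>shift\<close> by comparing the positions of the face relative to the moved
  degeneracy.\<close>

lemma word_face_cong:
  "loop_eq X u v \<Longrightarrow> 1 \<le> k \<Longrightarrow> k \<le> word_dim u \<Longrightarrow> loop_eq X (wF eps k u) (wF eps k v)"
proof (induction arbitrary: k rule: loop_eq.induct)
  case (refl u)
  then show ?case using word_face_facts[OF refl.hyps refl.prems] by (simp add: loop_eq.refl)
next
  case (sym u v)
  then show ?case using loop_eq_dim by (metis loop_eq.sym)
next
  case (trans u v w)
  then show ?case using loop_eq_dim by (metis loop_eq.trans)
next
  case (mult u u' v v')
  note d = loop_eq_dim[OF mult.hyps(1)]
  show ?case
  proof (cases "k \<le> word_dim u")
    case True
    then show ?thesis using mult.IH(1)[of k] mult.prems mult.hyps(2) d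
      by (simp add: word_face_append loop_eq.mult)
  next
    case False
    then show ?thesis using mult.IH(2)[of "k - word_dim u"] mult.prems mult.hyps(1) d
      by (simp add: word_face_append loop_eq.mult)
  qed
next
  case (unit x)
  then show ?case by simp
next
  case (last_degen n x)
  have k: "k \<le> n" using last_degen by simp
  obtain m where m: "n = Suc m" using last_degen by (cases n) auto
  show ?case
  proof (cases "k = n")
    case True
    show ?thesis
    proof (cases eps)
      case True
      then show ?thesis using \<open>k = n\<close> last_degen face_degen_same[of x n n n] by (simp add: loop_eq.refl)
    next
      case False
      have 1: "front_face X (Suc n) n (degen X n n x) = x"
        using front_face_degen[OF last_degen.hyps(2)] by (simp add: front_face_self)
      have 2: "back_face X (Suc n) n (degen X n n x) \<in> simp X 1"
        using back_face_closed[of "degen X n n x" "Suc n" n] last_degen by (simp add: degen_closed)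
      \<comment> \<open>For the lower face that undoes the degeneracy, the front part is
        \<open>x\<close> and the back part is a 1-simplex, hence the unit.\<close>
      have "loop_eq X ([([], n, x)] @ [([], 1, back_face X (Suc n) n (degen X n n x))]) ([([], n, x)] @ [])"
        by (rule loop_eq_append_left[OF _ loop_eq.unit[OF 2]]) (use last_degen in simp)
      then show ?thesis using False \<open>k = n\<close> 1 last_degen by (simp add: loop_eq.sym)
    qed
  next
    case False
    then have kn: "k < n" using k by simp
    show ?thesis
    proof (cases eps)
      case True
      have y: "face X n k x \<in> simp X m" using face_closed[of x m k] last_degen kn m by simp
      have "face X (Suc n) k (degen X n n x) = degen X m m (face X n k x)"
        using face_degen_less[of x m k n] last_degen kn m by simp
      moreover have "loop_eq X [letter_degen m ([], m, face X n k x)] [([], Suc m, degen X m m (face X n k x))]"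
        using y kn m last_degen.prems by (intro loop_eq.last_degen) auto
      ultimately show ?thesis using True kn m last_degen.prems by simp
    next
      case False
      let ?f = "front_face X n k x" and ?b = "back_face X n k x"
      have fb: "?f \<in> simp X k" "?b \<in> simp X (n - k)"
        using front_face_closed back_face_closed last_degen kn by auto
      have 1: "front_face X (Suc n) k (degen X n n x) = ?f"
        using front_face_degen[OF last_degen.hyps(2)] kn by simp
      have 2: "back_face X (Suc n) k (degen X n n x) = degen X (n - k) (n - k) ?b"
        using back_face_degen[OF last_degen.hyps(2)] kn by simp
      \<comment> \<open>The front face forgets the last degeneracy and the back face keeps it, so
        the relation is applied to the back part alone.\<close>
      have "loop_eq X [letter_degen (n - k) ([], n - k, ?b)] [([], Suc (n - k), degen X (n - k) (n - k) ?b)]"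
        using fb kn by (intro loop_eq.last_degen) auto
      then have "loop_eq X ([([], k, ?f)] @ [letter_degen (n - k) ([], n - k, ?b)])
          ([([], k, ?f)] @ [([], Suc (n - k), degen X (n - k) (n - k) ?b)])"
        using fb last_degen by (intro loop_eq_append_left) auto
      moreover have "n - Suc 0 - (k - Suc 0) = n - k" using last_degen.prems by simp
      moreover have "\<not> n - Suc 0 \<le> k - Suc 0" using kn last_degen.prems by simp
      ultimately show ?thesis using False kn 1 2 last_degen.prems by (simp add: Suc_diff_le)
    qed
  qed
next
  case (shift g h)
  obtain js n x where g: "g = (js, n, x)" by (cases g)
  obtain ks m y where h: "h = (ks, m, y)" by (cases h)
  let ?G = "letter_degen (Suc (letter_dim g)) g" and ?H = "letter_degen 1 h"
  note dG = letter_dim_degen[OF shift(1)]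
  have FG: "loop_eq X (lF eps l ?G) (if l = Suc (letter_dim g) then [g] else wD (letter_dim g) (lF eps l g))"
    if "1 \<le> l" "l \<le> Suc (letter_dim g)" for l
    using letter_face_degen[of js n x "Suc (letter_dim g)" l eps] shift(1) that unfolding g
    by (auto simp del: letter_degen.simps letter_dim.simps)
  have FH: "loop_eq X (lF eps l ?H) (if l = 1 then [h] else wD 1 (lF eps (l - 1) h))"
    if "1 \<le> l" "l \<le> Suc (letter_dim h)" for l
    using letter_face_degen[of ks m y 1 l eps] shift(2) that unfolding h
    by (auto simp del: letter_degen.simps letter_dim.simps)
  consider "k \<le> letter_dim g" | "k = Suc (letter_dim g)" | "Suc (letter_dim g) < k" by linarith
  then show ?case
  proof cases
    case 1
    \<comment> \<open>After the face, \<open>letter_dim g\<close> is the border index between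
      \<open>?w\<close> and \<open>h\<close>, where the two append lemmas move the degeneracy
      across.\<close>
    have F: "word_valid X (lF eps k g)" "Suc (word_dim (lF eps k g)) = letter_dim g"
      using letter_face_facts[of js n x k eps] shift 1 g by auto
    let ?w = "lF eps k g"
    have "wF eps k [?G, h] = lF eps k ?G @ [h]"
      using 1 by (simp add: dG del: letter_degen.simps)
    also have "loop_eq X \<dots> (wD (letter_dim g) ?w @ [h])"
      using FG[OF shift.prems(1)] 1 shift(2) by (intro loop_eq_append_right) auto
    also have "loop_eq X \<dots> (wD (letter_dim g) (?w @ [h]))"
      using F shift 1 by (intro loop_eq.sym[OF degen_append_left]) auto
    also have "loop_eq X \<dots> (?w @ wD (letter_dim g - word_dim ?w) [h])"
      using F shift 1 by (intro degen_append_right) auto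
    also have "letter_dim g - word_dim ?w = 1" using F(2) by auto
    finally show ?thesis using 1 by simp
  next
    case 2
    have "loop_eq X (lF eps k ?G @ [h]) ([g] @ [h])"
      using FG[of k] 2 shift by (intro loop_eq_append_right) auto
    also have "loop_eq X ([g] @ [h]) ([g] @ lF eps 1 ?H)"
      using FH[of 1] shift by - (rule loop_eq_append_left, simp, rule loop_eq.sym, simp)
    finally show ?thesis using 2 letter_dim_degen[OF shift(2)]
      by (simp add: dG del: letter_degen.simps)
  next
    case 3
    let ?l = "k - Suc (letter_dim g)"
    have kd: "k \<le> Suc (letter_dim g + letter_dim h)"
      using shift.prems by (simp add: dG del: letter_degen.simps)
    then have l: "1 \<le> ?l" "?l \<le> letter_dim h" using 3 by auto
    have F: "word_valid X (lF eps ?l h)" "Suc (word_dim (lF eps ?l h)) = letter_dim h"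
      using letter_face_facts[of ks m y ?l eps] shift l h by auto
    let ?w = "lF eps ?l h"
    have GG: "letter_valid X ?G" using letter_degen_valid[OF shift(1)] by simp
    have "loop_eq X ([?G] @ ?w) (wD (Suc (letter_dim g)) [g] @ ?w)"
      using loop_eq.refl[of X "[?G] @ ?w"] GG F by (simp del: letter_degen.simps)
    also have "loop_eq X \<dots> (wD (Suc (letter_dim g)) ([g] @ ?w))"
      using F shift by (intro loop_eq.sym[OF degen_append_left]) auto
    also have "loop_eq X \<dots> ([g] @ wD (Suc (letter_dim g) - word_dim [g]) ?w)"
      using F shift by (intro degen_append_right) auto
    also have "Suc (letter_dim g) - word_dim [g] = 1" by simp
    also have "loop_eq X ([g] @ wD 1 ?w) ([g] @ lF eps (Suc ?l) ?H)"
      using FH[of "Suc ?l"] l shift 3 by - (rule loop_eq_append_left, simp, rule loop_eq.sym, simp)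
    finally have "loop_eq X ([?G] @ ?w) ([g] @ lF eps (Suc ?l) ?H)" .
    moreover have "Suc ?l = k - letter_dim g" "k - letter_dim g \<le> Suc (letter_dim h)" using 3 kd by auto
    ultimately show ?thesis using 3 letter_dim_degen[OF shift(2)]
      by (simp add: dG del: letter_degen.simps)
  qed
next
  case (degen u v i)
  note uv = loop_eq_valid[OF degen.hyps(1)] loop_eq_dim[OF degen.hyps(1)]
  have k: "k \<le> Suc (word_dim u)" using degen uv by (simp add: word_dim_degen)
  note FU = word_face_degen[OF uv(1) degen.hyps(2,3) degen.prems(1) k, of eps]
  have FV: "loop_eq X (wF eps k (wD i v))
      (if k = i then v else if k < i then wD (i - 1) (wF eps k v)
       else wD i (wF eps (k - 1) v))"
    using word_face_degen[OF uv(2), of i k eps] degen.hyps degen.prems k uv(3) by simp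
  have "loop_eq X (if k = i then u else if k < i then wD (i - 1) (wF eps k u)
       else wD i (wF eps (k - 1) u))
     (if k = i then v else if k < i then wD (i - 1) (wF eps k v)
       else wD i (wF eps (k - 1) v))"
  proof -
    consider "k = i" | "k < i" | "i < k" by linarith
    then show ?thesis
    proof cases
      case 1
      then show ?thesis using degen.hyps(1) by simp
    next
      case 2
      then have kd: "k \<le> word_dim u" using degen.hyps by simp
      then have "Suc (word_dim (wF eps k v)) = word_dim u"
        using word_face_facts[OF uv(2) degen.prems(1)] uv(3) by simp
      then show ?thesis using 2 degen.IH[OF degen.prems(1) kd] degen.hyps degen.prems
        by (auto intro!: degen_cong)
    next
      case 3
      then have kd: "1 \<le> k - 1" "k - 1 \<le> word_dim u" using degen.hyps k by auto
      then have "Suc (word_dim (wF eps (k - 1) v)) = word_dim u"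
        using word_face_facts[OF uv(2) kd(1)] uv(3) by simp
      then show ?thesis using 3 degen.IH[OF kd] degen.hyps degen.prems k
        by (auto intro!: degen_cong)
    qed
  qed
  then show ?case using FU FV by (metis loop_eq.sym loop_eq.trans)
next
  case (degen_degen u i j)
  note u = degen_degen.hyps(1) and ij = degen_degen.hyps(2-4)
  have dj: "word_valid X (wD j u)" "word_dim (wD j u) = Suc (word_dim u)"
    using word_degen_valid[OF u] word_dim_degen[OF u] ij by auto
  have di: "word_valid X (wD i u)" "word_dim (wD i u) = Suc (word_dim u)"
    using word_degen_valid[OF u] word_dim_degen[OF u] ij by auto
  have k: "k \<le> Suc (Suc (word_dim u))" using degen_degen.prems(2) word_dim_degen[OF dj(1), of i] dj ij by simp
  have L: "loop_eq X (wF eps k (wD i (wD j u)))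
    (if k = i then wD j u
     else if k < i then wD (i - 1) (wF eps k (wD j u))
     else wD i (wF eps (k - 1) (wD j u)))"
    using word_face_degen[OF dj(1), of i k eps] dj(2) ij k degen_degen.prems(1) by simp
  have Rr: "loop_eq X (wF eps k (wD (Suc j) (wD i u)))
    (if k = Suc j then wD i u
     else if k < Suc j then wD j (wF eps k (wD i u))
     else wD (Suc j) (wF eps (k - 1) (wD i u)))"
    by (rule word_face_degen[OF di(1), of "Suc j" k eps, unfolded diff_Suc_1])
       (use di(2) ij k degen_degen.prems(1) in linarith)+
  have DD: "loop_eq X (wD a (wD b w)) (wD (Suc b) (wD a w))"
    if "word_valid X w" "1 \<le> a" "a \<le> b" "b \<le> Suc (word_dim w)" for a b w
    using that by (rule loop_eq.degen_degen)
  have FI: "loop_eq X (wF eps l (wD i u))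
      (if l = i then u else if l < i then wD (i - 1) (wF eps l u)
       else wD i (wF eps (l - 1) u))" if "1 \<le> l" "l \<le> Suc (word_dim u)" for l
    using word_face_degen[OF u, of i l eps] ij that by simp
  have FJ: "loop_eq X (wF eps l (wD j u))
      (if l = j then u else if l < j then wD (j - 1) (wF eps l u)
       else wD j (wF eps (l - 1) u))" if "1 \<le> l" "l \<le> Suc (word_dim u)" for l
    using word_face_degen[OF u, of j l eps] ij that by simp
  have FI_gr: "loop_eq X (wF eps l (wD i u)) (wD i (wF eps (l - 1) u))"
    if "i < l" "l \<le> Suc (word_dim u)" for l
    using FI[of l] that by simp
  have FJ_less: "loop_eq X (wF eps l (wD j u)) (wD (j - 1) (wF eps l u))"
    if "1 \<le> l" "l < j" for l
    using FJ[of l] that ij by simp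
  have FJ_gr: "loop_eq X (wF eps l (wD j u)) (wD j (wF eps (l - 1) u))"
    if "j < l" "l \<le> Suc (word_dim u)" for l
    using FJ[of l] that by simp
  have F: "word_valid X (wF eps l u)" "Suc (word_dim (wF eps l u)) = word_dim u"
    if "1 \<le> l" "l \<le> word_dim u" for l
    using word_face_facts[OF u that] by auto
  have WD: "word_dim (wD a w) = Suc (word_dim w)" if "word_valid X w" "1 \<le> a" "a \<le> Suc (word_dim w)" for a w
    by (rule word_dim_degen[OF that])
  \<comment> \<open>The face either cancels one of the two degeneracies or passes both. In the
    latter case both sides become two degeneracies of the same face of \<open>u\<close>, and
    \<open>degen_degen\<close> exchanges them.\<close>
  consider "k < i" | "k = i" | "i < k" "k \<le> j" | "k = Suc j" | "Suc j < k" using ij by linarith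
  then show ?case
  proof cases
    case 1
    have l: "k \<le> word_dim u" using 1 ij by simp
    note Fk = F[OF degen_degen.prems(1) l]
    have "loop_eq X (wF eps k (wD i (wD j u)))
        (wD (i - 1) (wF eps k (wD j u)))" using L 1 by simp
    also have "loop_eq X \<dots> (wD (i - 1) (wD (j - 1) (wF eps k u)))"
      using FJ[of k] 1 ij l degen_degen.prems Fk by (intro degen_cong) (auto simp: WD)
    also have "loop_eq X \<dots> (wD j (wD (i - 1) (wF eps k u)))"
      using DD[OF Fk(1), of "i - 1" "j - 1"] 1 ij l degen_degen.prems Fk by simp
    also have "loop_eq X \<dots> (wD j (wF eps k (wD i u)))"
    proof (rule loop_eq.sym, rule degen_cong)
      show "loop_eq X (wF eps k (wD i u)) (wD (i - 1) (wF eps k u))"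
        using FI[of k] 1 ij l degen_degen.prems by simp
    qed (use 1 ij l degen_degen.prems Fk in \<open>auto simp: WD\<close>)
    finally show ?thesis by (rule loop_eq_join) (use Rr 1 ij in simp)
  next
    case 2
    have "loop_eq X (wF eps k (wD i u)) u" using FI[of k] 2 ij by simp
    then have "loop_eq X (wD j (wF eps k (wD i u))) (wD j u)"
      using ij by (intro degen_cong) auto
    from loop_eq_join[OF _ loop_eq.trans[OF _ this]] show ?thesis using L Rr 2 ij by simp
  next
    case 3
    have l: "1 \<le> k - 1" "k - 1 \<le> word_dim u" using 3 ij by auto
    note Fk = F[OF l]
    have "loop_eq X (wF eps k (wD i (wD j u)))
        (wD i (wF eps (k - 1) (wD j u)))" using L 3 by simp
    also have "loop_eq X \<dots> (wD i (wD (j - 1) (wF eps (k - 1) u)))"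
    proof (rule degen_cong[OF FJ_less[OF l(1)] ij(1)])
      show "i \<le> Suc (word_dim (wD (j - 1) (wF eps (k - 1) u)))"
        using 3 ij Fk by (subst WD) linarith+
    qed (use 3 in linarith)
    also have "loop_eq X \<dots> (wD j (wD i (wF eps (k - 1) u)))"
      using DD[OF Fk(1) ij(1), of "j - 1"] 3 ij Fk(2) by simp
    also have "loop_eq X \<dots> (wD j (wF eps k (wD i u)))"
    proof (rule loop_eq.sym, rule degen_cong)
      show "loop_eq X (wF eps k (wD i u)) (wD i (wF eps (k - 1) u))"
        using FI_gr[of k] 3 ij by simp
    qed (use 3 ij l degen_degen.prems Fk in \<open>auto simp: WD\<close>)
    finally show ?thesis by (rule loop_eq_join) (use Rr 3 ij in simp)
  next
    case 4
    have "loop_eq X (wF eps (k - 1) (wD j u)) u" using FJ[of "k - 1"] 4 ij by simp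
    then have "loop_eq X (wD i (wF eps (k - 1) (wD j u))) (wD i u)"
      using ij by (intro degen_cong) auto
    from loop_eq_join[OF loop_eq.trans[OF _ this]] show ?thesis using L Rr 4 ij by simp
  next
    case 5
    have l: "1 \<le> k - 2" "k - 2 \<le> word_dim u" using 5 ij k by auto
    note Fk = F[OF l]
    have k2: "k - 1 - 1 = k - 2" by simp
    have "loop_eq X (wF eps k (wD i (wD j u)))
        (wD i (wF eps (k - 1) (wD j u)))" using L 5 ij by simp
    also have "loop_eq X \<dots> (wD i (wD j (wF eps (k - 2) u)))"
    proof (rule degen_cong[OF FJ_gr[of "k - 1", unfolded k2] ij(1)])
      show "i \<le> Suc (word_dim (wD j (wF eps (k - 2) u)))"
        using 5 ij Fk l k by (subst WD) linarith+
    qed (use 5 k in linarith)+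
    also have "loop_eq X \<dots> (wD (Suc j) (wD i (wF eps (k - 2) u)))"
      by (rule DD[OF Fk(1) ij(1,2)]) (use 5 k Fk(2) in linarith)
    also have "loop_eq X \<dots> (wD (Suc j) (wF eps (k - 1) (wD i u)))"
    proof (rule loop_eq.sym, rule degen_cong)
      show "loop_eq X (wF eps (k - 1) (wD i u)) (wD i (wF eps (k - 2) u))"
        by (rule FI_gr[of "k - 1", unfolded k2]) (use 5 k ij in linarith)+
      have w: "i \<le> Suc (word_dim (wF eps (k - 2) u))" using 5 k ij Fk(2) by linarith
      show "Suc j \<le> Suc (word_dim (wD i (wF eps (k - 2) u)))"
        using WD[OF Fk(1) ij(1) w] 5 k Fk(2) by linarith
    qed simp
    finally show ?thesis by (rule loop_eq_join) (use Rr 5 ij in simp)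
  qed
qed

end

subsection \<open>Normal forms of words\<close>

text \<open>The condition \<open>0 < m\<close> keeps the degeneracy of the vertex out: that
  1-simplex is the unit of the monoid and not a degenerate factor.\<close>

definition last_degenerate :: "'a sset \<Rightarrow> nat \<Rightarrow> 'a \<Rightarrow> bool" where
  "last_degenerate X n x \<longleftrightarrow> (\<exists>m y. 0 < m \<and> n = Suc m \<and> y \<in> simp X m \<and> x = degen X m m y)"

fun letter_degenerate :: "'a sset \<Rightarrow> 'a letter \<Rightarrow> bool" where
  "letter_degenerate X (js, n, x) \<longleftrightarrow> js \<noteq> [] \<or> last_degenerate X n x"

definition word_degenerate :: "'a sset \<Rightarrow> 'a letter list \<Rightarrow> bool" where
  "word_degenerate X w \<longleftrightarrow> (\<exists>g\<in>set w. letter_degenerate X g)"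

text \<open>The normal form of a non-degenerate word, in which letters over 1-simplices are units.
  On degenerate words it carries no information, since it forgets the stored degeneracies.\<close>

definition word_simplices :: "'a letter list \<Rightarrow> (nat \<times> 'a) list" where
  "word_simplices w = map snd (filter (\<lambda>g. fst (snd g) \<noteq> 1) w)"

abbreviation plain_word :: "(nat \<times> 'a) list \<Rightarrow> 'a letter list" where
  "plain_word xs \<equiv> map (Pair []) xs"

lemma word_degenerate_simps [simp]:
  "\<not> word_degenerate X []" "word_degenerate X (g # w) \<longleftrightarrow> letter_degenerate X g \<or> word_degenerate X w"
  "word_degenerate X (u @ v) \<longleftrightarrow> word_degenerate X u \<or> word_degenerate X v"
  by (auto simp: word_degenerate_def)

lemma word_simplices_append: "word_simplices (u @ v) = word_simplices u @ word_simplices v"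
  by (simp add: word_simplices_def)

lemma insert_degen_ne: "insert_degen i js \<noteq> []"
  by (cases js) auto

lemma word_degenerate_word_degen: "word_degenerate X (word_degen X i w)"
proof (induction w arbitrary: i)
  case (Cons g w)
  then show ?case by (cases g) (auto simp: insert_degen_ne)
qed simp

lemma not_last_degenerate_1: "\<not> last_degenerate X (Suc 0) x"
  by (auto simp: last_degenerate_def)

text \<open>The rule \<open>unit\<close> removes a non-degenerate letter that
  \<open>word_simplices\<close> ignores, and \<open>last_degen\<close>, \<open>shift\<close>,
  \<open>degen\<close> and \<open>degen_degen\<close> relate degenerate words to degenerate words.
  Hence different normal forms are never congruent.\<close>

lemma loop_eq_invariant:
  "loop_eq X u v \<Longrightarrow> (word_degenerate X u \<longleftrightarrow> word_degenerate X v) \<and>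
    (\<not> word_degenerate X u \<longrightarrow> word_simplices u = word_simplices v)"
proof (induction rule: loop_eq.induct)
  case (unit x)
  then show ?case by (simp add: word_simplices_def not_last_degenerate_1)
next
  case (last_degen n x)
  then show ?case by (auto simp: last_degenerate_def)
next
  case (shift g h)
  then show ?case by (cases g; cases h) (auto simp: insert_degen_ne)
next
  case (degen u v i)
  then show ?case by (simp add: word_degenerate_word_degen)
next
  case (degen_degen u i j)
  then show ?case by (simp add: word_degenerate_word_degen)
qed (auto simp: word_simplices_append)

lemma word_dim_plain_word: "word_dim (plain_word xs) = bar_dim xs"
  by (induction xs) (auto simp: bar_dim_def)

context reduced_sset
begin

lemma degenerate_letter:
  assumes g: "letter_valid X g" "letter_degenerate X g"
  shows "\<exists>i h. letter_valid X h \<and> 1 \<le> i \<and> i \<le> Suc (letter_dim h) \<and> loop_eq X [g] [letter_degen i h]"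
proof -
  obtain js n x where gj: "g = (js, n, x)" by (cases g)
  show ?thesis
  proof (cases js)
    case (Cons k ks)
    then have "letter_valid X (ks, n, x)" "1 \<le> k" "k \<le> Suc (letter_dim (ks, n, x))"
      using g gj letter_dim_ge[of X ks n x] by auto
    moreover have "loop_eq X [g] [letter_degen k (ks, n, x)]"
      using g gj Cons letter_degen_top[of X k ks n x] by (simp add: loop_eq.refl)
    ultimately show ?thesis by blast
  next
    case Nil
    then obtain m y where m: "0 < m" "n = Suc m" "y \<in> simp X m" "x = degen X m m y"
      using g gj by (auto simp: last_degenerate_def)
    have "loop_eq X [g] [letter_degen m ([], m, y)]"
      using loop_eq.sym[OF loop_eq.last_degen[OF m(1,3)]] gj Nil m by simp
    moreover have "letter_valid X ([], m, y)" "m \<le> Suc (letter_dim ([], m, y))" "1 \<le> m" using m by auto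
    ultimately show ?thesis by blast
  qed
qed

text \<open>A degeneracy of one letter is a degeneracy of the whole word, at the index shifted by
  the dimension of the letters before it. Syntactic degeneracy therefore means lying in the image of
  a degeneracy operator.\<close>

lemma degenerate_word:
  assumes w: "word_valid X w" "word_degenerate X w"
  shows "\<exists>i v. word_valid X v \<and> 1 \<le> i \<and> i \<le> Suc (word_dim v) \<and> loop_eq X w (wD i v)"
proof -
  obtain g where "g \<in> set w" "letter_degenerate X g" using w(2) by (auto simp: word_degenerate_def)
  then obtain a b where w': "w = a @ g # b" by (meson split_list)
  have v: "word_valid X a" "letter_valid X g" "word_valid X b" using w(1) w' by auto
  obtain i h where h: "letter_valid X h" "1 \<le> i" "i \<le> Suc (letter_dim h)" "loop_eq X [g] [letter_degen i h]"
    using degenerate_letter[OF v(2) \<open>letter_degenerate X g\<close>] by blast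
  let ?i = "word_dim a + i"
  have "loop_eq X (a @ [g] @ b) (a @ [letter_degen i h] @ b)"
    by (intro loop_eq_append_left loop_eq_append_right v h)
  also have "loop_eq X (a @ [letter_degen i h] @ b) (a @ wD i (h # b))"
    using degen_head[OF h(1) v(3) h(2,3)] v by (intro loop_eq_append_left) simp_all
  also have "loop_eq X (a @ wD i (h # b)) (wD ?i (a @ h # b))"
    using loop_eq.sym[OF degen_append_right[of a "h # b" ?i]] v h by simp
  finally show ?thesis using w' v h by (intro exI[of _ ?i] exI[of _ "a @ h # b"]) simp
qed

lemma word_normal_form:
  "word_valid X w \<Longrightarrow> \<not> word_degenerate X w \<Longrightarrow> loop_eq X w (plain_word (word_simplices w))"
proof (induction w)
  case Nil
  then show ?case by (simp add: word_simplices_def loop_eq.refl)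
next
  case (Cons g w)
  obtain n x where g: "g = ([], n, x)" using Cons.prems by (cases g) auto
  have IH: "loop_eq X w (plain_word (word_simplices w))" using Cons by simp
  show ?case
  proof (cases "n = 1")
    case True
    then have "x \<in> simp X 1" using Cons.prems g by simp
    then have "loop_eq X ([g] @ w) ([] @ plain_word (word_simplices w))"
      using loop_eq.unit g True IH by (intro loop_eq.mult) auto
    then show ?thesis using g True by (simp add: word_simplices_def)
  next
    case False
    then show ?thesis using loop_eq_Cons[OF _ IH, of g] Cons.prems g by (simp add: word_simplices_def)
  qed
qed

subsection \<open>The structure of the loop set\<close>

abbreviation "Q \<equiv> loop_cubes X"

lemma loop_class_eq_iff: "word_valid X u \<Longrightarrow> loop_class X u = loop_class X v \<longleftrightarrow> loop_eq X u v"
proof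
  assume "word_valid X u" "loop_class X u = loop_class X v"
  then have "u \<in> loop_class X v" using loop_eq.refl[of X u] by (auto simp: loop_class_def)
  then show "loop_eq X u v" by (auto simp: loop_class_def intro: loop_eq.sym)
next
  assume uv: "loop_eq X u v"
  have "loop_eq X u w \<longleftrightarrow> loop_eq X v w" for w
    using loop_eq.trans[OF uv, of w] loop_eq.trans[OF loop_eq.sym[OF uv], of w] by blast
  then show "loop_class X u = loop_class X v" by (simp add: loop_class_def)
qed

lemma loop_class_eqI: "loop_eq X u v \<Longrightarrow> loop_class X u = loop_class X v"
  using loop_class_eq_iff loop_eq_valid by blast

lemma loop_class_mem: "word_valid X u \<Longrightarrow> u \<in> loop_class X u"
  by (simp add: loop_class_def loop_eq.refl)

lemma cubes_loop: "cubes Q n = {loop_class X u | u. word_valid X u \<and> word_dim u = n}"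
  by (simp add: loop_cubes_def)

lemma loop_class_cubes: "word_valid X u \<Longrightarrow> word_dim u = n \<Longrightarrow> loop_class X u \<in> cubes Q n"
  by (auto simp: cubes_loop)

text \<open>The operator on classes is a union over all representatives; by
  \<open>word_face_cong\<close> it is a union of equal sets.\<close>

lemma cface_loop:
  assumes "word_valid X u" "1 \<le> i" "i \<le> word_dim u"
  shows "cface Q eps n i (loop_class X u) = loop_class X (wF eps i u)"
proof -
  have "(\<Union>v\<in>loop_class X u. loop_class X (wF eps i v)) = loop_class X (wF eps i u)"
  proof (rule UN_constant_eq)
    show "u \<in> loop_class X u" by (rule loop_class_mem[OF assms(1)])
    show "\<forall>v\<in>loop_class X u. loop_class X (wF eps i v) = loop_class X (wF eps i u)"
      using word_face_cong[OF _ assms(2,3)] loop_class_eqI unfolding loop_class_def by blast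
  qed
  then show ?thesis by (simp add: loop_cubes_def)
qed

lemma cdegen_loop:
  assumes "word_valid X u" "1 \<le> i" "i \<le> Suc (word_dim u)"
  shows "cdegen Q n i (loop_class X u) = loop_class X (wD i u)"
proof -
  have "(\<Union>v\<in>loop_class X u. loop_class X (wD i v)) = loop_class X (wD i u)"
  proof (rule UN_constant_eq)
    show "u \<in> loop_class X u" by (rule loop_class_mem[OF assms(1)])
    show "\<forall>v\<in>loop_class X u. loop_class X (wD i v) = loop_class X (wD i u)"
      using loop_eq.degen[OF _ assms(2,3)] loop_class_eqI unfolding loop_class_def by blast
  qed
  then show ?thesis by (simp add: loop_cubes_def)
qed

end

section \<open>Chains of a cubical set\<close>

definition cube_degenerate :: "'q cset \<Rightarrow> nat \<Rightarrow> 'q \<Rightarrow> bool" where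
  "cube_degenerate Q n c \<longleftrightarrow>
    (\<exists>m i a. n = Suc m \<and> a \<in> cubes Q m \<and> 1 \<le> i \<and> i \<le> Suc m \<and> c = cdegen Q m i a)"

text \<open>The axioms collect closure and the identities between faces and degeneracies, which make
  boundary and coproduct vanish on degenerate cubes.\<close>

locale cubical_set =
  fixes Q :: "'q cset"
  assumes cface_closed: "\<lbrakk>a \<in> cubes Q (Suc n); 1 \<le> i; i \<le> Suc n\<rbrakk> \<Longrightarrow> cface Q eps (Suc n) i a \<in> cubes Q n"
    and cdegen_closed: "\<lbrakk>a \<in> cubes Q n; 1 \<le> i; i \<le> Suc n\<rbrakk> \<Longrightarrow> cdegen Q n i a \<in> cubes Q (Suc n)"
    and cface_cdegen_same:
      "\<lbrakk>a \<in> cubes Q n; 1 \<le> i; i \<le> Suc n\<rbrakk> \<Longrightarrow> cface Q eps (Suc n) i (cdegen Q n i a) = a"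
    and cface_cdegen_less:
      "\<lbrakk>a \<in> cubes Q (Suc n); 1 \<le> j; j < i; i \<le> Suc (Suc n)\<rbrakk> \<Longrightarrow>
        cface Q eps (Suc (Suc n)) j (cdegen Q (Suc n) i a) = cdegen Q n (i - 1) (cface Q eps (Suc n) j a)"
    and cface_cdegen_greater:
      "\<lbrakk>a \<in> cubes Q (Suc n); 1 \<le> i; i < j; j \<le> Suc (Suc n)\<rbrakk> \<Longrightarrow>
        cface Q eps (Suc (Suc n)) j (cdegen Q (Suc n) i a) = cdegen Q n i (cface Q eps (Suc n) (j - 1) a)"
begin

lemma cface_closed': "a \<in> cubes Q n \<Longrightarrow> 1 \<le> i \<Longrightarrow> i \<le> n \<Longrightarrow> cface Q eps n i a \<in> cubes Q (n - 1)"
  using cface_closed[of a "n - 1" i eps] by (cases n) auto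

lemma cface_degenerate:
  assumes a: "a \<in> cubes Q m" "1 \<le> i" "i \<le> Suc m" and j: "1 \<le> j" "j \<le> Suc m" "j \<noteq> i"
  shows "cube_degenerate Q m (cface Q eps (Suc m) j (cdegen Q m i a))"
proof -
  obtain n where m: "m = Suc n" using a j by (cases m) auto
  show ?thesis
  proof (cases "j < i")
    case True
    then show ?thesis
      using cface_cdegen_less[of a n j i eps] cface_closed[of a n j eps] a j m unfolding cube_degenerate_def
      by (intro exI[of _ n] exI[of _ "i - 1"] exI[of _ "cface Q eps (Suc n) j a"]) auto
  next
    case False
    then show ?thesis
      using cface_cdegen_greater[of a n i j eps] cface_closed[of a n "j - 1" eps] a j m unfolding cube_degenerate_def
      by (intro exI[of _ n] exI[of _ i] exI[of _ "cface Q eps (Suc n) (j - 1) a"]) auto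
  qed
qed

text \<open>Faces are applied from the largest index down, so the face \<open>j\<close> meets a cube
  of dimension \<open>n - length js\<close>. The later entries all exceed \<open>j\<close>, which
  leaves room for it.\<close>

lemma sorted_list_bound:
  assumes "sorted (j # js)" "distinct (j # js)" "set (j # js) \<subseteq> {1..n}"
  shows "j \<le> n - length js" "length js < n"
proof -
  have "set js \<subseteq> {Suc j..n}"
  proof
    fix x assume "x \<in> set js"
    then have "j \<le> x" "j \<noteq> x" "x \<le> n" using assms by auto
    then show "x \<in> {Suc j..n}" by simp
  qed
  then have "card (set js) \<le> n - j" using card_mono[of "{Suc j..n}" "set js"] by simp
  then have "length js \<le> n - j" using assms(2) by (simp add: distinct_card)
  then show "j \<le> n - length js" "length js < n" using assms(3) by auto
qed

lemma iter_face_closed: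
  assumes "a \<in> cubes Q n"
  shows "sorted js \<Longrightarrow> distinct js \<Longrightarrow> set js \<subseteq> {1..n} \<Longrightarrow>
    iter_face (cface Q eps) js n a \<in> cubes Q (n - length js)"
proof (induction js)
  case (Cons j js)
  note b = sorted_list_bound[OF Cons.prems]
  have "iter_face (cface Q eps) js n a \<in> cubes Q (n - length js)" using Cons by simp
  then show ?case using cface_closed'[of _ "n - length js" j eps] b Cons.prems by simp
qed (use assms in simp)

lemma cface_set_closed:
  assumes "a \<in> cubes Q n" "B \<subseteq> {1..n}"
  shows "cface_set Q eps B n a \<in> cubes Q (n - card B)"
  using iter_face_closed[OF assms(1), of "sorted_list_of_set B" eps] assms(2) finite_subset[OF assms(2)]
  by (simp add: cface_set_def)

text \<open>While the faces descend, the degeneracy index stays at \<open>i\<close> as long as they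
  are larger than \<open>i\<close> and drops by one for each smaller face. The last conjunct records
  how a still smaller face index compares with the current degeneracy index, so that the induction
  can continue.\<close>

lemma iter_face_degenerate:
  assumes a: "a \<in> cubes Q m" "1 \<le> i" "i \<le> Suc m"
  shows "sorted js \<Longrightarrow> distinct js \<Longrightarrow> set js \<subseteq> {1..Suc m} \<Longrightarrow> i \<notin> set js \<Longrightarrow>
    \<exists>l b. iter_face (cface Q eps) js (Suc m) (cdegen Q m i a) = cdegen Q (m - length js) l b \<and>
      length js \<le> m \<and> b \<in> cubes Q (m - length js) \<and> 1 \<le> l \<and> l \<le> Suc (m - length js) \<and>
      (\<forall>j. (\<forall>k\<in>set js. j < k) \<longrightarrow> (j < i \<longrightarrow> j < l) \<and> (i < j \<longrightarrow> l = i))"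
proof (induction js)
  case Nil
  then show ?case using a by auto
next
  case (Cons j js)
  have "sorted js" "distinct js" "set js \<subseteq> {1..Suc m}" "i \<notin> set js" using Cons.prems by auto
  from Cons.IH[OF this] obtain l b where lb:
    "iter_face (cface Q eps) js (Suc m) (cdegen Q m i a) = cdegen Q (m - length js) l b"
    "length js \<le> m" "b \<in> cubes Q (m - length js)" "1 \<le> l" "l \<le> Suc (m - length js)"
    "\<And>j. (\<forall>k\<in>set js. j < k) \<Longrightarrow> (j < i \<longrightarrow> j < l) \<and> (i < j \<longrightarrow> l = i)" by blast
  have jk: "\<forall>k\<in>set js. j < k"
  proof
    fix k assume "k \<in> set js"
    then have "j \<le> k" "j \<noteq> k" using Cons.prems by auto
    then show "j < k" by simp
  qed
  note bnd = sorted_list_bound[OF Cons.prems(1-3)]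
  have ji: "j \<noteq> i" "1 \<le> j" using Cons.prems by auto
  let ?n = "m - length js"
  have jn: "j \<le> Suc ?n" using bnd lb(2) by simp
  \<comment> \<open>\<open>i\<close> and the face indices are distinct elements of
    \<open>{1..Suc m}\<close>. Counting them leaves \<open>b\<close> with dimension at least 1, as
    the cubical identities require.\<close>
  have card: "card (insert i (set (j # js))) \<le> Suc m"
    using card_mono[of "{1..Suc m}" "insert i (set (j # js))"] Cons.prems a by simp
  have "card (insert i (set (j # js))) = Suc (Suc (length js))"
    using Cons.prems by (auto simp: distinct_card)
  then have len: "Suc (length js) \<le> m" using card by simp
  then obtain p where p: "?n = Suc p" by (metis Suc_diff_Suc Suc_le_lessD)
  have p': "m - length (j # js) = p" using p by simp
  have S: "Suc m - length js = Suc ?n" using lb(2) by simp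
  show ?case
  proof (cases "j < i")
    case True
    then have jl: "j < l" using lb(6)[OF jk] by simp
    have "iter_face (cface Q eps) (j # js) (Suc m) (cdegen Q m i a) = cdegen Q p (l - 1) (cface Q eps (Suc p) j b)"
      using cface_cdegen_less[of b p j l eps] lb p jl ji S by simp
    moreover have "cface Q eps (Suc p) j b \<in> cubes Q p"
      using cface_closed[of b p j eps] lb p jl ji by simp
    moreover have "(k < i \<longrightarrow> k < l - 1) \<and> (i < k \<longrightarrow> l - 1 = i)" if "\<forall>k'\<in>set (j # js). k < k'" for k
      using that jl True by auto
    ultimately show ?thesis unfolding p' using len jl lb p ji
      by (intro exI[of _ "l - 1"] exI[of _ "cface Q eps (Suc p) j b"]) auto
  next
    case False
    then have jl: "l = i" "i < j" using lb(6)[OF jk] ji by auto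
    have "iter_face (cface Q eps) (j # js) (Suc m) (cdegen Q m i a) = cdegen Q p i (cface Q eps (Suc p) (j - 1) b)"
      using cface_cdegen_greater[of b p i j eps] lb p jl ji S jn a by simp
    moreover have "cface Q eps (Suc p) (j - 1) b \<in> cubes Q p"
      using cface_closed[of b p "j - 1" eps] lb p jl ji jn a by simp
    moreover have "(k < i \<longrightarrow> k < i) \<and> (i < k \<longrightarrow> i = i)" for k by simp
    ultimately show ?thesis unfolding p' using len jl lb p ji jn a
      by (intro exI[of _ i] exI[of _ "cface Q eps (Suc p) (j - 1) b"]) auto
  qed
qed

lemma cface_set_degenerate:
  assumes a: "a \<in> cubes Q m" "1 \<le> i" "i \<le> Suc m" and B: "B \<subseteq> {1..Suc m}" "i \<notin> B"
  shows "cube_degenerate Q (Suc m - card B) (cface_set Q eps B (Suc m) (cdegen Q m i a))"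
proof -
  have fin: "finite B" using finite_subset[OF B(1)] by simp
  obtain l b where lb: "cface_set Q eps B (Suc m) (cdegen Q m i a) = cdegen Q (m - card B) l b"
      "card B \<le> m" "b \<in> cubes Q (m - card B)" "1 \<le> l" "l \<le> Suc (m - card B)"
    using iter_face_degenerate[OF a, of "sorted_list_of_set B" eps] B fin
    unfolding cface_set_def by auto
  then show ?thesis unfolding cube_degenerate_def
    by (intro exI[of _ "m - card B"] exI[of _ l] exI[of _ b]) (auto simp: Suc_diff_le)
qed

end

lemma (in reduced_sset) cubical_set_loop: "cubical_set Q"
proof
  have ex: "\<exists>u. word_valid X u \<and> word_dim u = n \<and> a = loop_class X u" if "a \<in> cubes Q n" for a n
    using that unfolding cubes_loop by blast
  { fix a n i eps assume a: "a \<in> cubes Q (Suc n)" and i: "1 \<le> i" "i \<le> Suc n"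
    obtain u where u: "word_valid X u" "word_dim u = Suc n" "a = loop_class X u" using ex[OF a] by blast
    show "cface Q eps (Suc n) i a \<in> cubes Q n"
      using word_face_facts[OF u(1) i(1), of eps] cface_loop[OF u(1) i(1), of eps "Suc n"] u i
      by (auto intro!: loop_class_cubes) }
  { fix a n i assume a: "a \<in> cubes Q n" and i: "1 \<le> i" "i \<le> Suc n"
    obtain u where u: "word_valid X u" "word_dim u = n" "a = loop_class X u" using ex[OF a] by blast
    have v: "word_valid X (wD i u)" "word_dim (wD i u) = Suc n"
      using word_degen_valid[OF u(1)] word_dim_degen[OF u(1)] u(2) i by auto
    have eq: "cdegen Q n i a = loop_class X (wD i u)" using cdegen_loop[OF u(1)] u i by simp
    show "cdegen Q n i a \<in> cubes Q (Suc n)" unfolding eq by (rule loop_class_cubes[OF v])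
    show "cface Q eps (Suc n) i (cdegen Q n i a) = a" for eps
    proof -
      have "loop_class X (wF eps i (wD i u)) = loop_class X u"
        using word_face_degen[OF u(1), of i i eps] i u(2) by (intro loop_class_eqI) simp
      then show ?thesis unfolding eq using cface_loop[OF v(1) i(1)] v(2) i u(3) by simp
    qed }
  { fix a n i j eps assume a: "a \<in> cubes Q (Suc n)"
    obtain u where u: "word_valid X u" "word_dim u = Suc n" "a = loop_class X u" using ex[OF a] by blast
    { fix i j assume ij: "1 \<le> j" "j \<le> Suc (Suc n)" "1 \<le> i" "i \<le> Suc (Suc n)"
      have v: "word_valid X (wD i u)" "word_dim (wD i u) = Suc (Suc n)"
        using word_degen_valid[OF u(1)] word_dim_degen[OF u(1)] u(2) ij by auto
      have "cface Q eps (Suc (Suc n)) j (cdegen Q (Suc n) i a) = loop_class X (wF eps j (wD i u))"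
        using cdegen_loop[OF u(1) ij(3)] cface_loop[OF v(1) ij(1)] u ij v by simp
      also have "\<dots> = loop_class X (if j = i then u else if j < i then wD (i - 1) (wF eps j u)
          else wD i (wF eps (j - 1) u))"
        using word_face_degen[OF u(1), of i j eps] ij u(2) by (intro loop_class_eqI) simp
      finally have "cface Q eps (Suc (Suc n)) j (cdegen Q (Suc n) i a) =
        loop_class X (if j = i then u else if j < i then wD (i - 1) (wF eps j u)
          else wD i (wF eps (j - 1) u))" . }
    note * = this
    have F: "word_valid X (wF eps l u)" "word_dim (wF eps l u) = n"
        "cface Q eps (Suc n) l a = loop_class X (wF eps l u)" if "1 \<le> l" "l \<le> Suc n" for l
      using word_face_facts[OF u(1) that(1), of eps] cface_loop[OF u(1) that(1)] u that by auto
    { assume ij: "1 \<le> j" "j < i" "i \<le> Suc (Suc n)"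
      have l: "1 \<le> i - 1" "i - 1 \<le> Suc n" "j \<le> Suc n" using ij by auto
      have "cface Q eps (Suc (Suc n)) j (cdegen Q (Suc n) i a) = loop_class X (wD (i - 1) (wF eps j u))"
        using *[of j i] ij by simp
      also have "\<dots> = cdegen Q n (i - 1) (cface Q eps (Suc n) j a)"
        unfolding F(3)[OF ij(1) l(3)] using cdegen_loop[OF F(1)[OF ij(1) l(3)] l(1)] F(2)[OF ij(1) l(3)] l by simp
      finally show "cface Q eps (Suc (Suc n)) j (cdegen Q (Suc n) i a) = cdegen Q n (i - 1) (cface Q eps (Suc n) j a)" . }
    { assume ij: "1 \<le> i" "i < j" "j \<le> Suc (Suc n)"
      have l: "1 \<le> j - 1" "j - 1 \<le> Suc n" "i \<le> Suc n" using ij by auto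
      have "cface Q eps (Suc (Suc n)) j (cdegen Q (Suc n) i a) = loop_class X (wD i (wF eps (j - 1) u))"
        using *[of j i] ij by simp
      also have "\<dots> = cdegen Q n i (cface Q eps (Suc n) (j - 1) a)"
        unfolding F(3)[OF l(1,2)] using cdegen_loop[OF F(1)[OF l(1,2)] ij(1)] F(2)[OF l(1,2)] l by simp
      finally show "cface Q eps (Suc (Suc n)) j (cdegen Q (Suc n) i a) = cdegen Q n i (cface Q eps (Suc n) (j - 1) a)" . } }
qed

subsection \<open>Records with the same module structure\<close>

text \<open>Chains and cobar constructions extend a module record by further fields, so one module
  occurs under several record types. This relation transports bases, spans and tensor products
  between them.\<close>

definition same_module :: "('r, 'm, 'y) module_scheme \<Rightarrow> ('r, 'm, 'z) module_scheme \<Rightarrow> bool" where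
  "same_module M N \<longleftrightarrow> carrier M = carrier N \<and> add M = add N \<and> zero M = zero N \<and> smult M = smult N"

lemma same_module_module:
  assumes MN: "same_module M N" and M: "module R M"
  shows "module R N"
proof -
  interpret M: module R M by fact
  note eq = MN[unfolded same_module_def]
  have ops: "carrier N = carrier M" "x \<oplus>\<^bsub>N\<^esub> y = x \<oplus>\<^bsub>M\<^esub> y" "\<zero>\<^bsub>N\<^esub> = \<zero>\<^bsub>M\<^esub>" "r \<odot>\<^bsub>N\<^esub> x = r \<odot>\<^bsub>M\<^esub> x" for x y r
    using eq by auto
  have "abelian_group N"
    by (rule abelian_groupI) (auto simp: ops M.a_ac intro: M.M.l_neg bexI[of _ "\<ominus>\<^bsub>M\<^esub> _"])
  then show ?thesis
    by (rule moduleI[OF M.is_cring])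
       (simp_all add: ops M.smult_l_distr M.smult_r_distr M.smult_assoc1)
qed

lemma same_module_lin:
  assumes "same_module M N"
  shows "lin R M P h \<longleftrightarrow> lin R N P h" "lin R P' M h' \<longleftrightarrow> lin R P' N h'"
  using assms by (auto simp: same_module_def lin_def)

lemma same_module_gen_submodule:
  assumes "same_module M N" "module R M"
  shows "gen_submodule R M S = gen_submodule R N S"
  using assms(1)
  unfolding gen_submodule_def submodule_iff[OF assms(2)] submodule_iff[OF same_module_module[OF assms]]
  by (simp add: same_module_def)

lemma same_module_free_basis:
  assumes "same_module M N" "free_basis R M B e"
  shows "free_basis R N B e"
proof -
  note D = free_basisD[OF assms(2)]
  have c: "carrier M = carrier N" using assms(1) by (simp add: same_module_def)
  obtain k where k: "lin R M (free_module R B) k" "\<forall>b\<in>B. k (e b) = basis_elt R b"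
    using assms(2) unfolding free_basis_def by blast
  have k': "lin R N (free_module R B) k" by (rule same_module_lin(1)[OF assms(1), THEN iffD1, OF k(1)])
  show ?thesis
    using assms(2) same_module_module[OF assms(1) D(1)] k' k(2)
    unfolding free_basis_def same_module_gen_submodule[OF assms(1) D(1)] c
    by blast
qed

lemma same_module_tensor:
  assumes "same_module M N"
  shows "tensor_prod R M M = tensor_prod R N N" "tensor R M M = tensor R N N"
proof -
  have "tensor_relations R M M = tensor_relations R N N"
    using assms unfolding tensor_relations_def by (simp add: same_module_def)
  then show "tensor_prod R M M = tensor_prod R N N" "tensor R M M = tensor R N N"
    using assms by (simp_all add: tensor_prod_def tensor_def same_module_def fun_eq_iff)
qed

text \<open>Values may be prescribed on all classes as long as those in \<open>D\<close> receive
  zero; the descriptions of boundaries and coproducts have this form.\<close>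

lemma free_quot_ext:
  assumes M: "free_basis R M B e" and D: "D \<subseteq> B" and N: "N = gen_submodule R M (e ` D)"
    and P: "module R P" and g: "\<And>b. b \<in> B \<Longrightarrow> g b \<in> carrier P" "\<And>b. b \<in> D \<Longrightarrow> g b = \<zero>\<^bsub>P\<^esub>"
  shows "\<exists>h. h \<in> linear_maps R (quot_module M N) P \<and> (\<forall>b\<in>B. h (N +>\<^bsub>M\<^esub> e b) = g b)"
proof -
  note MD = free_basisD[OF M] and q = free_basis_quot[OF M D N]
  obtain k where k: "lin R M P k" "\<And>b. b \<in> B \<Longrightarrow> k (e b) = g b"
    by (rule free_basis_ext[OF M P g(1)]) (assumption, rule that)
  have eD: "e ` D \<subseteq> carrier M" using MD(2) D by blast
  have kD: "k s = \<zero>\<^bsub>P\<^esub>" if "s \<in> e ` D" for s using that k(2) g(2) D by auto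
  obtain h where h: "lin R (quot_module M N) P h" "\<And>x. x \<in> carrier M \<Longrightarrow> h (N +>\<^bsub>M\<^esub> x) = k x"
    by (rule gen_quot_lift[OF MD(1) eD P k(1) kD, folded N], assumption) (rule that)
  have "restrict h (carrier (quot_module M N)) \<in> linear_maps R (quot_module M N) P"
    by (rule lin_restrict[OF q(3) h(1)])
  moreover have "restrict h (carrier (quot_module M N)) (N +>\<^bsub>M\<^esub> e b) = g b" if "b \<in> B" for b
    using h(2)[OF MD(2)[OF that]] k(2)[OF that] coset_closed[OF MD(1) q(4) MD(2)[OF that]]
    by (simp only: restrict_apply if_True)
  ultimately show ?thesis by blast
qed

lemma linear_maps_eq_on_quot:
  assumes M: "free_basis R M B e" and D: "D \<subseteq> B" and N: "N = gen_submodule R M (e ` D)"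
    and P: "module R P" and fg: "f \<in> linear_maps R (quot_module M N) P" "g \<in> linear_maps R (quot_module M N) P"
    and eq: "\<And>b. b \<in> B \<Longrightarrow> f (N +>\<^bsub>M\<^esub> e b) = g (N +>\<^bsub>M\<^esub> e b)"
  shows "f = g"
proof (rule linear_maps_eqI[OF free_basis_quot(3)[OF M D N] P fg])
  show "(\<lambda>b. N +>\<^bsub>M\<^esub> e b) ` B \<subseteq> carrier (quot_module M N)"
    by (intro image_subsetI coset_closed[OF free_basisD(1)[OF M] free_basis_quot(4)[OF M D N]] free_basisD(2)[OF M])
  show "carrier (quot_module M N) \<subseteq> gen_submodule R (quot_module M N) ((\<lambda>b. N +>\<^bsub>M\<^esub> e b) ` B)"
    using free_basis_quot(5)[OF M D N] by (rule equalityD2)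
qed (use eq in blast)

subsection \<open>Cubical chains\<close>

lemma cube_chains_simps [simp]:
  "carrier (cube_chains R Q) = carrier (cube_module R Q)"
  "add (cube_chains R Q) = add (cube_module R Q)"
  "zero (cube_chains R Q) = zero (cube_module R Q)"
  "smult (cube_chains R Q) = smult (cube_module R Q)"
  "hcomp (cube_chains R Q) n = gen_submodule R (cube_module R Q) {cube_class R Q n a | a. a \<in> cubes Q n}"
  "diff (cube_chains R Q) = cube_boundary R Q"
  "coprod (cube_chains R Q) = cube_coprod R Q"
  "coaug (cube_chains R Q) = cube_class R Q 0 (THE a. a \<in> cubes Q 0)"
  by (simp_all add: cube_chains_def module.extend_def dg_module.extend_def dg_module.fields_def dg_coalgebra.fields_def)

lemma same_module_cube_chains: "same_module (cube_module R Q) (cube_chains R Q)"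
  by (simp add: same_module_def)

lemma shuff_closed: "cring R \<Longrightarrow> shuff R A B \<in> carrier R"
proof -
  assume "cring R"
  then interpret R: cring R .
  show ?thesis by (simp add: shuff_def)
qed

locale cubical_chains = cubical_set Q for Q :: "'q cset" +
  fixes R :: "('r, 'x) ring_scheme"
  assumes R_cring: "cring R"
begin

sublocale R: cring R by (rule R_cring)

abbreviation "K \<equiv> cube_module R Q"
abbreviation "all_cubes \<equiv> (SIGMA n:UNIV. cubes Q n)"
abbreviation "degenerate_cubes \<equiv> {(n, a). a \<in> cubes Q n \<and> cube_degenerate Q n a}"
abbreviation "cls \<equiv> cube_class R Q"

lemmas sgn = neg_one_pow_facts[OF R_cring]

lemma cube_relations_eq:
  "cube_relations R Q = gen_submodule R (free_module R all_cubes) (basis_elt R ` degenerate_cubes)"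
proof -
  have "{basis_elt R (Suc n, cdegen Q n i a) | n i a. a \<in> cubes Q n \<and> 1 \<le> i \<and> i \<le> Suc n}
    = basis_elt R ` degenerate_cubes"
    unfolding cube_degenerate_def using cdegen_closed by fastforce
  then show ?thesis by (simp only: cube_relations_def)
qed

lemmas K_quot = free_basis_free_module[OF R_cring, of all_cubes]

lemma degenerate_subset: "degenerate_cubes \<subseteq> all_cubes" by auto

lemmas K_facts = free_basis_quot[OF K_quot degenerate_subset cube_relations_eq, folded cube_module_def]

lemma cls_eq: "cube_relations R Q +>\<^bsub>free_module R all_cubes\<^esub> basis_elt R p = cls (fst p) (snd p)"
  by (simp add: cube_class_def)

lemma basis_K: "free_basis R K (all_cubes - degenerate_cubes) (\<lambda>p. cls (fst p) (snd p))"
  using K_facts(1) by (simp only: cls_eq)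

lemma K_module: "module R K" by (rule K_facts(3))

sublocale K: module R K by (rule K_module)

lemma cls_degenerate: "a \<in> cubes Q n \<Longrightarrow> cube_degenerate Q n a \<Longrightarrow> cls n a = \<zero>\<^bsub>K\<^esub>"
  using K_facts(2)[of "(n, a)"] by (simp add: cls_eq)

lemma cls_closed: "a \<in> cubes Q n \<Longrightarrow> cls n a \<in> carrier K"
  unfolding cube_module_def cube_class_def
  by (rule coset_closed[OF module_free_module[OF R_cring] K_facts(4)[unfolded cube_module_def] basis_elt_closed[OF R_cring]]) simp

lemma K_ext:
  assumes "module R P" "\<And>n a. a \<in> cubes Q n \<Longrightarrow> g n a \<in> carrier P"
    "\<And>n a. a \<in> cubes Q n \<Longrightarrow> cube_degenerate Q n a \<Longrightarrow> g n a = \<zero>\<^bsub>P\<^esub>"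
  shows "\<exists>h. h \<in> linear_maps R K P \<and> (\<forall>n. \<forall>a\<in>cubes Q n. h (cls n a) = g n a)"
proof -
  have "\<exists>h. h \<in> linear_maps R K P \<and> (\<forall>p\<in>all_cubes. h (cls (fst p) (snd p)) = g (fst p) (snd p))"
    by (rule free_quot_ext[OF K_quot degenerate_subset cube_relations_eq assms(1),
          of "\<lambda>p. g (fst p) (snd p)", folded cube_module_def, unfolded cls_eq])
       (use assms(2,3) in auto)
  then show ?thesis by (elim exE conjE) (rule exI, erule conjI, auto)
qed

lemma K_linear_maps_eq:
  assumes "module R P" "f \<in> linear_maps R K P" "g \<in> linear_maps R K P"
    "\<And>n a. a \<in> cubes Q n \<Longrightarrow> f (cls n a) = g (cls n a)"
  shows "f = g"
  by (rule linear_maps_eq_on_quot[OF K_quot degenerate_subset cube_relations_eq assms(1),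
        folded cube_module_def, unfolded cls_eq, OF assms(2,3)])
     (use assms(4) in auto)

definition boundary_term :: "nat \<Rightarrow> 'q \<Rightarrow> nat \<Rightarrow> (nat \<times> 'q \<Rightarrow> 'r) set" where
  "boundary_term n a i = neg_one_pow R (i - 1) \<odot>\<^bsub>K\<^esub>
    (cls (n - 1) (cface Q True n i a) \<ominus>\<^bsub>K\<^esub> cls (n - 1) (cface Q False n i a))"

lemma boundary_term_closed: "a \<in> cubes Q n \<Longrightarrow> 1 \<le> i \<Longrightarrow> i \<le> n \<Longrightarrow> boundary_term n a i \<in> carrier K"
  unfolding boundary_term_def
  by (intro K.smult_closed sgn(1) K.M.minus_closed cls_closed cface_closed')

text \<open>In the degenerate direction both faces give back the underlying cube and cancel; in
  every other direction both faces are degenerate.\<close>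

lemma boundary_term_degenerate:
  assumes "a \<in> cubes Q n" "cube_degenerate Q n a" "1 \<le> i" "i \<le> n"
  shows "boundary_term n a i = \<zero>\<^bsub>K\<^esub>"
proof -
  obtain m j b where m: "n = Suc m" "b \<in> cubes Q m" "1 \<le> j" "j \<le> Suc m" "a = cdegen Q m j b"
    using assms(2) by (auto simp: cube_degenerate_def)
  have "cls m (cface Q True n i a) = cls m (cface Q False n i a)"
  proof (cases "i = j")
    case True
    then show ?thesis using cface_cdegen_same[OF m(2-4)] m by simp
  next
    case False
    have "cls m (cface Q eps n i a) = \<zero>\<^bsub>K\<^esub>" for eps
      using cface_degenerate[OF m(2-4), of i eps] cface_closed[of a m i eps] False assms m
      by (intro cls_degenerate) auto
    then show ?thesis by simp
  qed
  moreover have "cls m (cface Q False n i a) \<in> carrier K"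
    using cls_closed[OF cface_closed'[OF assms(1,3,4)]] m by simp
  ultimately show ?thesis using sgn(1) m(1) by (simp add: boundary_term_def a_minus_def K.M.r_neg)
qed

lemma K_the:
  assumes P: "module R P" and d: "d = (THE h. h \<in> linear_maps R K P \<and> (\<forall>n. \<forall>a\<in>cubes Q n. h (cls n a) = g n a))"
    and cl: "\<And>n a. a \<in> cubes Q n \<Longrightarrow> g n a \<in> carrier P"
    and deg: "\<And>n a. a \<in> cubes Q n \<Longrightarrow> cube_degenerate Q n a \<Longrightarrow> g n a = \<zero>\<^bsub>P\<^esub>"
  shows "d \<in> linear_maps R K P \<and> (\<forall>n. \<forall>a\<in>cubes Q n. d (cls n a) = g n a)"
proof -
  let ?F = "\<lambda>h. h \<in> linear_maps R K P \<and> (\<forall>n. \<forall>a\<in>cubes Q n. h (cls n a) = g n a)"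
  have "\<exists>h. ?F h" by (rule K_ext[OF P cl deg])
  then obtain h where h: "?F h" ..
  show ?thesis unfolding d
  proof (rule the_unique[where P = ?F, OF h])
    fix f g assume f: "?F f" and g: "?F g"
    show "f = g"
      by (rule K_linear_maps_eq[OF P conjunct1[OF f] conjunct1[OF g]])
         (simp only: conjunct2[OF f, rule_format] conjunct2[OF g, rule_format])
  qed
qed

lemma cube_boundary_facts:
  "cube_boundary R Q \<in> linear_maps R K K \<and>
    (\<forall>n. \<forall>a\<in>cubes Q n. cube_boundary R Q (cls n a) = (\<Oplus>\<^bsub>K\<^esub>i\<in>{1..n}. boundary_term n a i))"
proof (rule K_the[OF K_module])
  fix n a assume a: "a \<in> cubes Q n"
  then show "(\<Oplus>\<^bsub>K\<^esub>i\<in>{1..n}. boundary_term n a i) \<in> carrier K"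
    by (intro K.finsum_closed Pi_I boundary_term_closed) auto
  assume "cube_degenerate Q n a"
  then show "(\<Oplus>\<^bsub>K\<^esub>i\<in>{1..n}. boundary_term n a i) = \<zero>\<^bsub>K\<^esub>"
    using a by (intro K.add.finprod_one_eqI boundary_term_degenerate) auto
qed (simp only: cube_boundary_def Let_def boundary_term_def)

lemma cube_boundary_lin: "lin R K K (cube_boundary R Q)"
  using cube_boundary_facts by (simp add: linear_maps_iff)

lemma cube_boundary_cls:
  "a \<in> cubes Q n \<Longrightarrow> cube_boundary R Q (cls n a) = (\<Oplus>\<^bsub>K\<^esub>i\<in>{1..n}. boundary_term n a i)"
  using cube_boundary_facts by blast

abbreviation "KK \<equiv> tensor_prod R K K"

definition coprod_term :: "nat \<Rightarrow> 'q \<Rightarrow> nat set \<Rightarrow> ((nat \<times> 'q \<Rightarrow> 'r) set \<times> (nat \<times> 'q \<Rightarrow> 'r) set \<Rightarrow> 'r) set" where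
  "coprod_term n a A = shuff R A ({1..n} - A) \<odot>\<^bsub>KK\<^esub> tensor R K K
    (cls (card A) (cface_set Q False ({1..n} - A) n a))
    (cls (card ({1..n} - A)) (cface_set Q True A n a))"

lemma KK_module: "module R KK" by (rule module_tensor_prod[OF K_module K_module])

sublocale KK: module R KK by (rule KK_module)

lemma card_compl: "A \<subseteq> {1..n} \<Longrightarrow> card ({1..n} - A) = n - card A" "A \<subseteq> {1..n} \<Longrightarrow> n - card ({1..n} - A) = card A"
proof -
  assume A: "A \<subseteq> {1..n}"
  show 1: "card ({1..n} - A) = n - card A" using A by (simp add: card_Diff_subset finite_subset)
  have "card A \<le> n" using card_mono[OF _ A] by simp
  then show "n - card ({1..n} - A) = card A" using 1 by simp
qed

lemma face_set_cubes:
  assumes "a \<in> cubes Q n" "A \<subseteq> {1..n}"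
  shows "cface_set Q eps ({1..n} - A) n a \<in> cubes Q (card A)"
    "cface_set Q eps A n a \<in> cubes Q (card ({1..n} - A))"
  using cface_set_closed[OF assms(1), of "{1..n} - A" eps] cface_set_closed[OF assms, of eps]
    card_compl[OF assms(2)] by auto

lemma coprod_term_closed: "a \<in> cubes Q n \<Longrightarrow> A \<subseteq> {1..n} \<Longrightarrow> coprod_term n a A \<in> carrier KK"
  unfolding coprod_term_def
  by (intro KK.smult_closed shuff_closed R_cring tensor_closed K_module cls_closed face_set_cubes)

text \<open>The degenerate direction lies in \<open>A\<close> or in its complement, and the tensor
  factor that retains this direction is degenerate.\<close>

lemma coprod_term_degenerate:
  assumes "a \<in> cubes Q n" "cube_degenerate Q n a" "A \<subseteq> {1..n}"
  shows "coprod_term n a A = \<zero>\<^bsub>KK\<^esub>"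
proof -
  obtain m j b where m: "n = Suc m" "b \<in> cubes Q m" "1 \<le> j" "j \<le> Suc m" "a = cdegen Q m j b"
    using assms(2) by (auto simp: cube_degenerate_def)
  note fc = face_set_cubes[OF assms(1,3)]
  let ?B = "{1..n} - A"
  let ?l = "cls (card A) (cface_set Q False ?B n a)" and ?r = "cls (card ?B) (cface_set Q True A n a)"
  have lr: "?l \<in> carrier K" "?r \<in> carrier K" using fc by (auto intro: cls_closed)
  have "tensor R K K ?l ?r = \<zero>\<^bsub>KK\<^esub>"
  proof (cases "j \<in> A")
    case True
    have "cube_degenerate Q (Suc m - card ?B) (cface_set Q False ?B (Suc m) (cdegen Q m j b))"
      using True m by (intro cface_set_degenerate) auto
    then have "cube_degenerate Q (card A) (cface_set Q False ?B n a)"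
      using m card_compl[OF assms(3)] by simp
    then have "?l = \<zero>\<^bsub>K\<^esub>" by (rule cls_degenerate[OF fc(1)])
    then show ?thesis using lin_zero[OF K_module KK_module lin_tensor_left[OF K_module K_module lr(2)]] by simp
  next
    case False
    have "cube_degenerate Q (Suc m - card A) (cface_set Q True A (Suc m) (cdegen Q m j b))"
      using False m assms(3) by (intro cface_set_degenerate) auto
    then have "cube_degenerate Q (card ?B) (cface_set Q True A n a)"
      using m card_compl[OF assms(3)] by simp
    then have "?r = \<zero>\<^bsub>K\<^esub>" by (rule cls_degenerate[OF fc(2)])
    then show ?thesis using lin_zero[OF K_module KK_module lin_tensor_right[OF K_module K_module lr(1)]] by simp
  qed
  then show ?thesis by (simp add: coprod_term_def shuff_closed[OF R_cring])
qed

lemma cube_coprod_facts: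
  "cube_coprod R Q \<in> linear_maps R K KK \<and>
    (\<forall>n. \<forall>a\<in>cubes Q n. cube_coprod R Q (cls n a) = (\<Oplus>\<^bsub>KK\<^esub>A\<in>Pow {1..n}. coprod_term n a A))"
proof (rule K_the[OF KK_module])
  fix n a assume a: "a \<in> cubes Q n"
  then show "(\<Oplus>\<^bsub>KK\<^esub>A\<in>Pow {1..n}. coprod_term n a A) \<in> carrier KK"
    by (intro KK.finsum_closed Pi_I coprod_term_closed) auto
  assume "cube_degenerate Q n a"
  then show "(\<Oplus>\<^bsub>KK\<^esub>A\<in>Pow {1..n}. coprod_term n a A) = \<zero>\<^bsub>KK\<^esub>"
    using a by (intro KK.add.finprod_one_eqI coprod_term_degenerate) auto
qed (simp only: cube_coprod_def Let_def coprod_term_def)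

lemma cube_coprod_lin: "lin R K KK (cube_coprod R Q)"
  using cube_coprod_facts by (simp add: linear_maps_iff)

lemma cube_coprod_cls:
  "a \<in> cubes Q n \<Longrightarrow> cube_coprod R Q (cls n a) = (\<Oplus>\<^bsub>KK\<^esub>A\<in>Pow {1..n}. coprod_term n a A)"
  using cube_coprod_facts by blast

end

section \<open>Simplicial chains\<close>

lemma simp_chains_simps [simp]:
  "carrier (simp_chains R X) = carrier (simp_module R X)"
  "add (simp_chains R X) = add (simp_module R X)"
  "zero (simp_chains R X) = zero (simp_module R X)"
  "smult (simp_chains R X) = smult (simp_module R X)"
  "hcomp (simp_chains R X) n = gen_submodule R (simp_module R X) {simp_class R X n x | x. x \<in> simp X n}"
  "diff (simp_chains R X) = simp_boundary R X"
  "coprod (simp_chains R X) = alexander_whitney R X"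
  "coaug (simp_chains R X) = simp_class R X 0 (base_simplex X 0)"
  by (simp_all add: simp_chains_def module.extend_def dg_module.extend_def dg_module.fields_def dg_coalgebra.fields_def)

lemma same_module_simp_chains: "same_module (simp_module R X) (simp_chains R X)"
  by (simp add: same_module_def)

locale simplicial_chains = reduced_sset X for X :: "'a sset" +
  fixes R :: "('r, 'x) ring_scheme"
  assumes R_cring: "cring R"
begin

sublocale R: cring R by (rule R_cring)

abbreviation "SM \<equiv> simp_module R X"
abbreviation "SC \<equiv> simp_chains R X"
abbreviation "all_simplices \<equiv> (SIGMA n:UNIV. simp X n)"
abbreviation "zero_simplices \<equiv>
  {(n, x). x \<in> simp X n \<and> (0 < n \<and> x = base_simplex X n \<or> last_degenerate X n x)}"
abbreviation "sc \<equiv> simp_class R X"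

lemmas sgn = neg_one_pow_facts[OF R_cring]

lemma simp_relations_eq:
  "simp_relations R X = gen_submodule R (free_module R all_simplices) (basis_elt R ` zero_simplices)"
proof -
  have "{basis_elt R (n, base_simplex X n) | n. 0 < n} \<union>
     {basis_elt R (Suc n, degen X n n x) | n x. 0 < n \<and> x \<in> simp X n} = basis_elt R ` zero_simplices"
    unfolding last_degenerate_def using base_simplex_closed degen_closed by fastforce
  then show ?thesis by (simp only: simp_relations_def)
qed

lemmas SM_quot = free_basis_free_module[OF R_cring, of all_simplices]

lemma zero_subset: "zero_simplices \<subseteq> all_simplices" by auto

lemmas SM_facts = free_basis_quot[OF SM_quot zero_subset simp_relations_eq, folded simp_module_def]

lemma sc_eq: "simp_relations R X +>\<^bsub>free_module R all_simplices\<^esub> basis_elt R p = sc (fst p) (snd p)"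
  by (simp add: simp_class_def)

lemma basis_SM: "free_basis R SM (all_simplices - zero_simplices) (\<lambda>p. sc (fst p) (snd p))"
  using SM_facts(1) by (simp only: sc_eq)

lemma SM_module: "module R SM" by (rule SM_facts(3))

sublocale SM: module R SM by (rule SM_module)

lemma sc_closed: "x \<in> simp X n \<Longrightarrow> sc n x \<in> carrier SM"
  unfolding simp_module_def simp_class_def
  by (rule coset_closed[OF module_free_module[OF R_cring] SM_facts(4)[unfolded simp_module_def] basis_elt_closed[OF R_cring]]) simp

lemma sc_base: "0 < n \<Longrightarrow> sc n (base_simplex X n) = \<zero>\<^bsub>SM\<^esub>"
  using SM_facts(2)[of "(n, base_simplex X n)"] base_simplex_closed by (simp add: sc_eq)

lemma sc_degenerate: "x \<in> simp X n \<Longrightarrow> last_degenerate X n x \<Longrightarrow> sc n x = \<zero>\<^bsub>SM\<^esub>"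
  using SM_facts(2)[of "(n, x)"] by (simp add: sc_eq)

lemma sc_one: "x \<in> simp X 1 \<Longrightarrow> sc 1 x = \<zero>\<^bsub>SM\<^esub>"
  using sc_base[of 1] simp_unique[of 1 x "base_simplex X 1"] base_simplex_closed[of 1] by simp

lemma sc_degen: "0 < n \<Longrightarrow> y \<in> simp X n \<Longrightarrow> sc (Suc n) (degen X n n y) = \<zero>\<^bsub>SM\<^esub>"
  by (rule sc_degenerate) (auto simp: last_degenerate_def degen_closed)

lemma degen_in_simp1: "y \<in> simp X 0 \<Longrightarrow> degen X 0 0 y \<in> simp X 1"
  using degen_closed[of y 0 0] by simp

text \<open>For \<open>n = 0\<close> the degeneracy is the 1-simplex, which vanishes as a base
  simplex rather than as a last degeneracy.\<close>

lemma sc_degen': "y \<in> simp X n \<Longrightarrow> sc (Suc n) (degen X n n y) = \<zero>\<^bsub>SM\<^esub>"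
  using sc_degen sc_one degen_in_simp1 by (cases n) auto

lemma SM_ext:
  assumes "module R P" "\<And>n x. x \<in> simp X n \<Longrightarrow> g n x \<in> carrier P"
    "\<And>n. 0 < n \<Longrightarrow> g n (base_simplex X n) = \<zero>\<^bsub>P\<^esub>"
    "\<And>n y. 0 < n \<Longrightarrow> y \<in> simp X n \<Longrightarrow> g (Suc n) (degen X n n y) = \<zero>\<^bsub>P\<^esub>"
  shows "\<exists>h. h \<in> linear_maps R SM P \<and> (\<forall>n. \<forall>x\<in>simp X n. h (sc n x) = g n x)"
proof -
  have "\<exists>h. h \<in> linear_maps R SM P \<and> (\<forall>p\<in>all_simplices. h (sc (fst p) (snd p)) = g (fst p) (snd p))"
    by (rule free_quot_ext[OF SM_quot zero_subset simp_relations_eq assms(1),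
          of "\<lambda>p. g (fst p) (snd p)", folded simp_module_def, unfolded sc_eq])
       (use assms(2-4) in \<open>auto simp: last_degenerate_def\<close>)
  then show ?thesis by (elim exE conjE) (rule exI, erule conjI, auto)
qed

lemma SM_linear_maps_eq:
  assumes "module R P" "f \<in> linear_maps R SM P" "g \<in> linear_maps R SM P"
    "\<And>n x. x \<in> simp X n \<Longrightarrow> f (sc n x) = g (sc n x)"
  shows "f = g"
  by (rule linear_maps_eq_on_quot[OF SM_quot zero_subset simp_relations_eq assms(1),
        folded simp_module_def, unfolded sc_eq, OF assms(2,3)])
     (use assms(4) in auto)

section \<open>The simplicial boundary\<close>

lemma face_base_simplex: "i \<le> Suc n \<Longrightarrow> face X (Suc n) i (base_simplex X (Suc n)) = base_simplex X n"
proof -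
  assume i: "i \<le> Suc n"
  define j where "j = (if i = Suc n then n else i)"
  have "base_simplex X (Suc n) = degen X n j (base_simplex X n)"
    using i by (intro degen_base_simplex[symmetric]) (auto simp: j_def)
  then show ?thesis using face_degen_same[OF base_simplex_closed, of j n i] i by (auto simp: j_def)
qed

lemma front_face_base: "i \<le> n \<Longrightarrow> front_face X n i (base_simplex X n) = base_simplex X i"
proof (induction rule: inc_induct)
  case base
  then show ?case by (simp add: front_face_self)
next
  case (step i)
  then show ?case by (simp add: front_face_Suc face_base_simplex del: base_simplex.simps)
qed

definition simp_boundary_sum :: "nat \<Rightarrow> 'a \<Rightarrow> (nat \<times> 'a \<Rightarrow> 'r) set" where
  "simp_boundary_sum n x = (\<Oplus>\<^bsub>SM\<^esub>i\<in>{..n}. neg_one_pow R i \<odot>\<^bsub>SM\<^esub> sc (n - 1) (face X n i x))"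

lemma simp_boundary_term_closed:
  "x \<in> simp X n \<Longrightarrow> 0 < n \<Longrightarrow> i \<le> n \<Longrightarrow> neg_one_pow R i \<odot>\<^bsub>SM\<^esub> sc (n - 1) (face X n i x) \<in> carrier SM"
  using face_closed[of x "n - 1" i] by (intro SM.smult_closed sgn(1) sc_closed) simp

text \<open>In dimension 1 the two faces are the vertex with opposite signs; above that every face
  is again a base simplex of positive dimension.\<close>

lemma simp_boundary_sum_base: "0 < n \<Longrightarrow> simp_boundary_sum n (base_simplex X n) = \<zero>\<^bsub>SM\<^esub>"
proof -
  assume n: "0 < n"
  then obtain m where m: "n = Suc m" by (cases n) auto
  show ?thesis
  proof (cases m)
    case 0
    let ?c = "sc 0 (base_simplex X 0)"
    have c: "?c \<in> carrier SM" by (rule sc_closed[OF base_simplex_closed])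
    have "simp_boundary_sum n (base_simplex X n) = (\<Oplus>\<^bsub>SM\<^esub>i\<in>{..Suc 0}. neg_one_pow R i \<odot>\<^bsub>SM\<^esub> ?c)"
      unfolding simp_boundary_sum_def m 0
      using c sgn(1) face_base_simplex[of _ 0] by (intro SM.finsum_cong'[OF HOL.refl]) auto
    also have "\<dots> = neg_one_pow R (Suc 0) \<odot>\<^bsub>SM\<^esub> ?c \<oplus>\<^bsub>SM\<^esub> neg_one_pow R 0 \<odot>\<^bsub>SM\<^esub> ?c"
      using c sgn(1) by (subst SM.finsum_Suc) auto
    also have "\<dots> = \<zero>\<^bsub>SM\<^esub>" using c by (simp add: sgn(2,4) SM.smult_l_minus SM.M.l_neg)
    finally show ?thesis .
  next
    case (Suc k)
    then have "sc m (face X n i (base_simplex X n)) = \<zero>\<^bsub>SM\<^esub>" if "i \<le> n" for i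
      using that m by (simp add: face_base_simplex sc_base del: base_simplex.simps)
    then show ?thesis unfolding simp_boundary_sum_def using m sgn(1)
      by (intro SM.add.finprod_one_eqI) simp
  qed
qed

text \<open>The last two faces of \<open>s_n y\<close> both equal \<open>y\<close> and have opposite
  signs; the others are last degeneracies, or the 1-simplex when \<open>n = 1\<close>.\<close>

lemma simp_boundary_sum_degen: "0 < n \<Longrightarrow> y \<in> simp X n \<Longrightarrow> simp_boundary_sum (Suc n) (degen X n n y) = \<zero>\<^bsub>SM\<^esub>"
proof -
  assume n: "0 < n" and y: "y \<in> simp X n"
  then obtain m where m: "n = Suc m" by (cases n) auto
  let ?x = "degen X n n y" and ?f = "\<lambda>i. neg_one_pow R i \<odot>\<^bsub>SM\<^esub> sc n (face X (Suc n) i (degen X n n y))"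
  have x: "?x \<in> simp X (Suc n)" using y by (simp add: degen_closed)
  have cl: "?f i \<in> carrier SM" if "i \<le> Suc n" for i
    using simp_boundary_term_closed[OF x _ that] by simp
  have low: "?f i = \<zero>\<^bsub>SM\<^esub>" if "i \<le> m" for i
  proof -
    have "face X (Suc n) i ?x = degen X m m (face X n i y)"
      using face_degen_less[of y m i n] y m that by simp
    moreover have "face X n i y \<in> simp X m" using face_closed[of y m i] y m that by simp
    ultimately show ?thesis using sc_degen' m sgn(1) by simp
  qed
  have "(\<Oplus>\<^bsub>SM\<^esub>i\<in>{..m}. ?f i) = \<zero>\<^bsub>SM\<^esub>" by (rule SM.add.finprod_one_eqI) (use low in simp)
  moreover have "?f n = neg_one_pow R n \<odot>\<^bsub>SM\<^esub> sc n y" "?f (Suc n) = neg_one_pow R (Suc n) \<odot>\<^bsub>SM\<^esub> sc n y"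
    using face_degen_same[OF y, of n n] face_degen_same[OF y, of n "Suc n"] by simp_all
  moreover have "simp_boundary_sum (Suc n) ?x = ?f (Suc n) \<oplus>\<^bsub>SM\<^esub> (?f n \<oplus>\<^bsub>SM\<^esub> (\<Oplus>\<^bsub>SM\<^esub>i\<in>{..m}. ?f i))"
    unfolding simp_boundary_sum_def diff_Suc_1 m
    using cl unfolding m by (subst SM.finsum_Suc, force, subst SM.finsum_Suc, force) simp
  ultimately show ?thesis
    using sc_closed[OF y] sgn(1)[of n] by (simp add: sgn(4) SM.smult_l_minus SM.M.l_neg)
qed

lemma simp_boundary_facts:
  "simp_boundary R X \<in> linear_maps R SM SM \<and>
    (\<forall>x\<in>simp X 0. simp_boundary R X (sc 0 x) = \<zero>\<^bsub>SM\<^esub>) \<and>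
    (\<forall>n>0. \<forall>x\<in>simp X n. simp_boundary R X (sc n x) = simp_boundary_sum n x)"
proof -
  let ?P = "\<lambda>h. h \<in> linear_maps R SM SM \<and> (\<forall>x\<in>simp X 0. h (sc 0 x) = \<zero>\<^bsub>SM\<^esub>) \<and>
      (\<forall>n>0. \<forall>x\<in>simp X n. h (sc n x) = simp_boundary_sum n x)"
  have "\<exists>h. h \<in> linear_maps R SM SM \<and>
    (\<forall>n. \<forall>x\<in>simp X n. h (sc n x) = (if n = 0 then \<zero>\<^bsub>SM\<^esub> else simp_boundary_sum n x))"
  proof (rule SM_ext[OF SM_module])
    fix n x assume "x \<in> simp X n"
    then show "(if n = 0 then \<zero>\<^bsub>SM\<^esub> else simp_boundary_sum n x) \<in> carrier SM"
      unfolding simp_boundary_sum_def using simp_boundary_term_closed by (auto intro!: SM.finsum_closed)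
  qed (simp_all add: simp_boundary_sum_base simp_boundary_sum_degen del: base_simplex.simps)
  then obtain h where h: "h \<in> linear_maps R SM SM" and h':
    "\<And>n x. x \<in> simp X n \<Longrightarrow> h (sc n x) = (if n = 0 then \<zero>\<^bsub>SM\<^esub> else simp_boundary_sum n x)" by blast
  have Ph: "?P h" using h h' by simp
  have eq: "simp_boundary R X = (THE h. ?P h)"
    unfolding simp_boundary_def Let_def simp_boundary_sum_def ..
  show ?thesis unfolding eq
  proof (rule the_unique[where P = ?P, OF Ph])
    fix f g assume f: "?P f" and g: "?P g"
    show "f = g"
    proof (rule SM_linear_maps_eq[OF SM_module conjunct1[OF f] conjunct1[OF g]])
      fix n x assume x: "x \<in> simp X n"
      show "f (sc n x) = g (sc n x)"
        using conjunct2[OF f] conjunct2[OF g] x by (cases "n = 0") simp_all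
    qed
  qed
qed

lemma simp_boundary_lin: "lin R SM SM (simp_boundary R X)"
  using simp_boundary_facts by (simp add: linear_maps_iff)

lemma simp_boundary_sc: "0 < n \<Longrightarrow> x \<in> simp X n \<Longrightarrow> simp_boundary R X (sc n x) = simp_boundary_sum n x"
  using simp_boundary_facts by blast

section \<open>The Alexander-Whitney coproduct\<close>

abbreviation "SS \<equiv> tensor_prod R SM SM"

lemma SS_module: "module R SS" by (rule module_tensor_prod[OF SM_module SM_module])

sublocale SS: module R SS by (rule SS_module)

definition aw_term :: "nat \<Rightarrow> 'a \<Rightarrow> nat \<Rightarrow> ((nat \<times> 'a \<Rightarrow> 'r) set \<times> (nat \<times> 'a \<Rightarrow> 'r) set \<Rightarrow> 'r) set" where
  "aw_term n x i = tensor R SM SM (sc i (front_face X n i x)) (sc (n - i) (back_face X n i x))"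

lemma aw_term_closed: "x \<in> simp X n \<Longrightarrow> i \<le> n \<Longrightarrow> aw_term n x i \<in> carrier SS"
  unfolding aw_term_def
  by (intro tensor_closed SM_module sc_closed front_face_closed back_face_closed)

lemma tensor_zero:
  assumes "x \<in> carrier SM"
  shows "tensor R SM SM \<zero>\<^bsub>SM\<^esub> x = \<zero>\<^bsub>SS\<^esub>" "tensor R SM SM x \<zero>\<^bsub>SM\<^esub> = \<zero>\<^bsub>SS\<^esub>"
  by (rule lin_zero[OF SM_module SS_module lin_tensor_left[OF SM_module SM_module assms]],
      rule lin_zero[OF SM_module SS_module lin_tensor_right[OF SM_module SM_module assms]])

text \<open>For \<open>i = 0\<close> the back factor is the whole base simplex; otherwise the front
  factor is a base simplex of positive dimension.\<close>

lemma aw_term_base: "0 < n \<Longrightarrow> i \<le> n \<Longrightarrow> aw_term n (base_simplex X n) i = \<zero>\<^bsub>SS\<^esub>"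
proof (cases "i = 0")
  case True
  assume "0 < n"
  then show ?thesis
    unfolding aw_term_def True
    using tensor_zero(2)[OF sc_closed[OF front_face_closed[OF _ base_simplex_closed]], of 0 n] sc_base
    by (simp add: back_face_0)
next
  case False
  assume "i \<le> n"
  then show ?thesis
    unfolding aw_term_def front_face_base[OF \<open>i \<le> n\<close>]
    using tensor_zero(1)[OF sc_closed[OF back_face_closed[OF base_simplex_closed]], of i n] sc_base False
    by simp
qed

text \<open>The back face inherits the last degeneracy except for \<open>i = Suc n\<close>, where
  the front face is the whole degenerate simplex.\<close>

lemma aw_term_degen:
  assumes n: "0 < n" and y: "y \<in> simp X n" and i: "i \<le> Suc n"
  shows "aw_term (Suc n) (degen X n n y) i = \<zero>\<^bsub>SS\<^esub>"
proof -
  have x: "degen X n n y \<in> simp X (Suc n)" using y by (simp add: degen_closed)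
  have f: "sc i (front_face X (Suc n) i (degen X n n y)) \<in> carrier SM"
    by (rule sc_closed[OF front_face_closed[OF i x]])
  have b: "sc (Suc n - i) (back_face X (Suc n) i (degen X n n y)) \<in> carrier SM"
    by (rule sc_closed[OF back_face_closed[OF x i]])
  show ?thesis
  proof (cases "i = Suc n")
    case True
    then have "sc i (front_face X (Suc n) i (degen X n n y)) = \<zero>\<^bsub>SM\<^esub>"
      using sc_degen[OF n y] by (simp add: front_face_self)
    then show ?thesis unfolding aw_term_def using tensor_zero(1)[OF b] by simp
  next
    case False
    then have i': "i \<le> n" using i by simp
    have "sc (Suc n - i) (back_face X (Suc n) i (degen X n n y)) = \<zero>\<^bsub>SM\<^esub>"
      using back_face_degen[OF y i'] sc_degen'[OF back_face_closed[OF y i']] i' by (simp add: Suc_diff_le)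
    then show ?thesis unfolding aw_term_def using tensor_zero(2)[OF f] by simp
  qed
qed

lemma alexander_whitney_facts:
  "alexander_whitney R X \<in> linear_maps R SM SS \<and>
    (\<forall>n. \<forall>x\<in>simp X n. alexander_whitney R X (sc n x) = (\<Oplus>\<^bsub>SS\<^esub>i\<in>{..n}. aw_term n x i))"
proof -
  let ?P = "\<lambda>h. h \<in> linear_maps R SM SS \<and> (\<forall>n. \<forall>x\<in>simp X n. h (sc n x) = (\<Oplus>\<^bsub>SS\<^esub>i\<in>{..n}. aw_term n x i))"
  have "\<exists>h. ?P h"
  proof (rule SM_ext[OF SS_module])
    fix n x assume "x \<in> simp X n"
    then show "(\<Oplus>\<^bsub>SS\<^esub>i\<in>{..n}. aw_term n x i) \<in> carrier SS"
      by (intro SS.finsum_closed Pi_I aw_term_closed) auto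
  next
    fix n :: nat assume "0 < n"
    then show "(\<Oplus>\<^bsub>SS\<^esub>i\<in>{..n}. aw_term n (base_simplex X n) i) = \<zero>\<^bsub>SS\<^esub>"
      by (intro SS.add.finprod_one_eqI aw_term_base) auto
  next
    fix n y assume "0 < n" "y \<in> simp X n"
    then show "(\<Oplus>\<^bsub>SS\<^esub>i\<in>{..Suc n}. aw_term (Suc n) (degen X n n y) i) = \<zero>\<^bsub>SS\<^esub>"
      by (intro SS.add.finprod_one_eqI aw_term_degen) auto
  qed
  then obtain h where h: "?P h" ..
  have eq: "alexander_whitney R X = (THE h. ?P h)"
    unfolding alexander_whitney_def Let_def aw_term_def ..
  show ?thesis unfolding eq
  proof (rule the_unique[where P = ?P, OF h])
    fix f g assume f: "?P f" and g: "?P g"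
    show "f = g"
      by (rule SM_linear_maps_eq[OF SS_module conjunct1[OF f] conjunct1[OF g]])
         (simp only: conjunct2[OF f, rule_format] conjunct2[OF g, rule_format])
  qed
qed

lemma alexander_whitney_lin: "lin R SM SS (alexander_whitney R X)"
  using alexander_whitney_facts by (simp add: linear_maps_iff)

lemma alexander_whitney_sc:
  "x \<in> simp X n \<Longrightarrow> alexander_whitney R X (sc n x) = (\<Oplus>\<^bsub>SS\<^esub>i\<in>{..n}. aw_term n x i)"
  using alexander_whitney_facts by blast

text \<open>There is only one vertex, so the terms for 0 and \<open>n\<close> contain the
  coaugmentation; in the others both factors have positive degree.\<close>

lemma alexander_whitney_reduced:
  assumes "x \<in> simp X n" "0 < n"
  shows "alexander_whitney R X (sc n x) =
    tensor R SM SM (sc n x) (sc 0 (base_simplex X 0)) \<oplus>\<^bsub>SS\<^esub> tensor R SM SM (sc 0 (base_simplex X 0)) (sc n x)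
      \<oplus>\<^bsub>SS\<^esub> (\<Oplus>\<^bsub>SS\<^esub>i\<in>{1..<n}. tensor R SM SM (sc i (front_face X n i x)) (sc (n - i) (back_face X n i x)))"
proof -
  have set: "{..n} = insert n (insert 0 {1..<n})" using assms by auto
  have cl: "aw_term n x i \<in> carrier SS" if "i \<le> n" for i by (rule aw_term_closed[OF assms(1) that])
  have cls: "aw_term n x \<in> {1..<n} \<rightarrow> carrier SS" using cl by auto
  have "(\<Oplus>\<^bsub>SS\<^esub>i\<in>{..n}. aw_term n x i) = aw_term n x n \<oplus>\<^bsub>SS\<^esub> (aw_term n x 0 \<oplus>\<^bsub>SS\<^esub> (\<Oplus>\<^bsub>SS\<^esub>i\<in>{1..<n}. aw_term n x i))"
    unfolding set using cl cls assms(2)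
    by (subst SS.finsum_insert, simp, simp, force, force, subst SS.finsum_insert) auto
  also have "\<dots> = aw_term n x n \<oplus>\<^bsub>SS\<^esub> aw_term n x 0 \<oplus>\<^bsub>SS\<^esub> (\<Oplus>\<^bsub>SS\<^esub>i\<in>{1..<n}. aw_term n x i)"
    using cl[of n] cl[of 0] SS.finsum_closed[OF cls] by (simp add: SS.a_assoc)
  finally have *: "alexander_whitney R X (sc n x) =
      aw_term n x n \<oplus>\<^bsub>SS\<^esub> aw_term n x 0 \<oplus>\<^bsub>SS\<^esub> (\<Oplus>\<^bsub>SS\<^esub>i\<in>{1..<n}. aw_term n x i)"
    using alexander_whitney_sc[OF assms(1)] by simp
  have b: "back_face X n n x = base_simplex X 0" "front_face X n 0 x = base_simplex X 0"
    using back_face_closed[OF assms(1), of n] front_face_closed[OF _ assms(1), of 0] base_simplex_closed[of 0]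
    by (auto intro!: simp_unique[of 0] simp del: base_simplex.simps)
  have "aw_term n x n = tensor R SM SM (sc n x) (sc 0 (base_simplex X 0))"
    "aw_term n x 0 = tensor R SM SM (sc 0 (base_simplex X 0)) (sc n x)"
    unfolding aw_term_def b by (simp_all add: front_face_self back_face_0)
  then show ?thesis using * by (simp only: aw_term_def)
qed

text \<open>Here 2-reducedness enters: dimensions 1 and 2 contain only the base simplex and
  contribute nothing. From dimension 3 on the base simplex is itself a last degeneracy, so the two
  families of relations merge into one condition.\<close>

lemma nonzero_simplex_iff:
  assumes "0 < n"
  shows "(n, x) \<in> all_simplices - zero_simplices \<longleftrightarrow> 3 \<le> n \<and> x \<in> simp X n \<and> \<not> last_degenerate X n x"
proof -
  have "x = base_simplex X 1" if "x \<in> simp X 1"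
    using simp_unique[of 1 x] base_simplex_closed[of 1] that by simp
  moreover have "last_degenerate X 2 x" if "x \<in> simp X 2"
    unfolding last_degenerate_def
    using simp_unique[of 2 x "degen X 1 1 (base_simplex X 1)"] degen_closed[OF base_simplex_closed, of 1 1] that
      base_simplex_closed[of 1]
    by (intro exI[of _ 1] exI[of _ "base_simplex X 1"]) (simp add: numeral_2_eq_2)
  moreover have "last_degenerate X n (base_simplex X n)" if n3: "3 \<le> n"
  proof -
    obtain m where m: "n = Suc m" "0 < m" using n3 by (cases n) auto
    have "base_simplex X n = degen X m m (base_simplex X m)"
      unfolding m by (rule degen_base_simplex[symmetric]) simp
    then show ?thesis using m base_simplex_closed[of m] unfolding last_degenerate_def by blast
  qed
  moreover have "n = 1 \<or> n = 2 \<or> 3 \<le> n" using assms by auto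
  ultimately show ?thesis by auto
qed

section \<open>Simplicial chains as a free graded coalgebra\<close>

lemma SC_module: "module R SC"
  by (rule same_module_module[OF same_module_simp_chains SM_module])

lemma SC_hcomp: "hcomp SC n = gen_submodule R SC {sc n x | x. x \<in> simp X n}"
  by (simp add: same_module_gen_submodule[OF same_module_simp_chains SM_module])

lemma sc_hcomp: "x \<in> simp X n \<Longrightarrow> sc n x \<in> hcomp SC n"
  unfolding SC_hcomp by (rule subsetD[OF gen_submodule_incl]) blast

lemma hcomp_pos_part: "0 < n \<Longrightarrow> hcomp SC n \<subseteq> carrier (pos_part R SC)"
proof -
  assume "0 < n"
  then have "hcomp SC n \<subseteq> (\<Union>n\<in>{0<..}. hcomp SC n)" by blast
  also have "\<dots> \<subseteq> carrier (pos_part R SC)"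
  proof -
    have "carrier (pos_part R SC) = gen_submodule R SC (\<Union>n\<in>{0<..}. hcomp SC n)"
      by (simp add: pos_part_def)
    then show ?thesis by (simp only: gen_submodule_incl)
  qed
  finally show ?thesis .
qed

lemma SC_hcomp_basis:
  "hcomp SC n = gen_submodule R SC ((\<lambda>p. sc (fst p) (snd p)) ` {p \<in> all_simplices - zero_simplices. fst p = n})"
proof -
  have 1: "{sc n x | x. x \<in> simp X n} = (\<lambda>p. sc (fst p) (snd p)) ` {p \<in> all_simplices. fst p = n}"
    by (auto simp: image_iff)
  have 2: "{p \<in> all_simplices. fst p = n} - zero_simplices = {p \<in> all_simplices - zero_simplices. fst p = n}"
    by auto
  have "gen_submodule R SM ((\<lambda>p. sc (fst p) (snd p)) ` {p \<in> all_simplices. fst p = n}) =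
     gen_submodule R SM ((\<lambda>p. sc (fst p) (snd p)) ` ({p \<in> all_simplices. fst p = n} - zero_simplices))"
    by (rule gen_submodule_image_quot[OF SM_quot zero_subset simp_relations_eq, folded simp_module_def,
        unfolded sc_eq]) auto
  then show ?thesis
    unfolding SC_hcomp 1 2 same_module_gen_submodule[OF same_module_simp_chains SM_module, symmetric] by simp
qed

lemma simp_boundary_pos:
  assumes "x \<in> simp X n" "2 \<le> n"
  shows "simp_boundary R X (sc n x) \<in> hcomp SC (n - 1)"
proof -
  have n: "0 < n" using assms(2) by simp
  have sub: "{sc (n - 1) y | y. y \<in> simp X (n - 1)} \<subseteq> carrier SC" using sc_closed by auto
  have H: "submodule (hcomp SC (n - 1)) R SM"
    unfolding simp_chains_simps using sub by (intro gen_submodule_submodule[OF SM_module]) simp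
  have "neg_one_pow R i \<odot>\<^bsub>SM\<^esub> sc (n - 1) (face X n i x) \<in> hcomp SC (n - 1)" if "i \<le> n" for i
  proof -
    have "face X n i x \<in> simp X (n - 1)" using face_closed[of x "n - 1" i] assms that n by simp
    then show ?thesis using sc_hcomp H sgn(1) unfolding submodule_iff[OF SM_module] by blast
  qed
  then show ?thesis unfolding simp_boundary_sc[OF n assms(1)] simp_boundary_sum_def
    by (intro finsum_gen_submodule[OF SM_module H]) simp
qed

sublocale SC: free_graded_coalgebra R SC "all_simplices - zero_simplices" "\<lambda>p. sc (fst p) (snd p)" fst
proof
  show "free_basis R SC (all_simplices - zero_simplices) (\<lambda>p. sc (fst p) (snd p))"
    by (rule same_module_free_basis[OF same_module_simp_chains basis_SM])
  show "hcomp SC n = gen_submodule R SC ((\<lambda>p. sc (fst p) (snd p)) ` {p \<in> all_simplices - zero_simplices. fst p = n})" for n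
    by (rule SC_hcomp_basis)
  show "lin R SC SC (diff SC)"
    using simp_boundary_lin
    by (simp add: same_module_lin[OF same_module_simp_chains])
  show "diff SC (sc (fst p) (snd p)) \<in> carrier (pos_part R SC)"
    if "p \<in> all_simplices - zero_simplices" "0 < fst p" for p
  proof -
    have "3 \<le> fst p" "snd p \<in> simp X (fst p)"
      using nonzero_simplex_iff[OF that(2), of "snd p"] that(1) by auto
    then show ?thesis
      using simp_boundary_pos[of "snd p" "fst p"] hcomp_pos_part[of "fst p - 1"] by auto
  qed
  show "lin R SC (tensor_prod R SC SC) (coprod SC)"
    using alexander_whitney_lin
    by (simp add: same_module_tensor[OF same_module_simp_chains, symmetric] same_module_lin(1)[OF same_module_simp_chains])
  show "coaug SC \<in> hcomp SC 0" using sc_hcomp[OF base_simplex_closed[of 0]] by simp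
  show "\<exists>(k::nat) p q l r. (\<forall>t<k. 0 < p t \<and> 0 < q t \<and> l t \<in> hcomp SC (p t) \<and> r t \<in> hcomp SC (q t)) \<and>
        coprod SC (sc (fst b) (snd b)) = tensor R SC SC (sc (fst b) (snd b)) (coaug SC)
          \<oplus>\<^bsub>tensor_prod R SC SC\<^esub> tensor R SC SC (coaug SC) (sc (fst b) (snd b))
          \<oplus>\<^bsub>tensor_prod R SC SC\<^esub> (\<Oplus>\<^bsub>tensor_prod R SC SC\<^esub>t\<in>{..<k}. tensor R SC SC (l t) (r t))"
    if b: "b \<in> all_simplices - zero_simplices" "0 < fst b" for b
  proof (rule coprod_reduced_finite[OF SC_module])
    let ?n = "fst b" and ?x = "snd b"
    have x: "?x \<in> simp X ?n" using b by auto
    show "finite {1..<?n}" by simp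
    show "0 < i \<and> 0 < ?n - i \<and> sc i (front_face X ?n i ?x) \<in> hcomp SC i \<and>
        sc (?n - i) (back_face X ?n i ?x) \<in> hcomp SC (?n - i)" if "i \<in> {1..<?n}" for i
      using that x by (intro conjI sc_hcomp front_face_closed back_face_closed) auto
    show "hcomp SC n \<subseteq> carrier SC" for n
      unfolding SC_hcomp by (rule gen_submodule_closed(1)[OF SC_module]) (use sc_closed in auto)
    show "coprod SC (sc ?n ?x) = tensor R SC SC (sc ?n ?x) (coaug SC)
          \<oplus>\<^bsub>tensor_prod R SC SC\<^esub> tensor R SC SC (coaug SC) (sc ?n ?x)
          \<oplus>\<^bsub>tensor_prod R SC SC\<^esub> (\<Oplus>\<^bsub>tensor_prod R SC SC\<^esub>i\<in>{1..<?n}.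
            tensor R SC SC (sc i (front_face X ?n i ?x)) (sc (?n - i) (back_face X ?n i ?x)))"
      using alexander_whitney_reduced[OF x b(2)]
      by (simp add: same_module_tensor[OF same_module_simp_chains, symmetric] del: base_simplex.simps)
  qed
qed

end

section \<open>The first identification\<close>

lemma cobar_simps [simp]:
  "carrier (cobar R C) = carrier (tensor_algebra R (pos_part R C))"
  "add (cobar R C) = add (tensor_algebra R (pos_part R C))"
  "zero (cobar R C) = zero (tensor_algebra R (pos_part R C))"
  "smult (cobar R C) = smult (tensor_algebra R (pos_part R C))"
  "mult (cobar R C) = mult (tensor_algebra R (pos_part R C))"
  "one (cobar R C) = one (tensor_algebra R (pos_part R C))"
  "hcomp (cobar R C) n = cobar_hcomp R C n"
  "diff (cobar R C) = cobar_diff R C"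
  by (simp_all add: cobar_def module.extend_def dg_module.fields_def)

lemma same_module_cobar: "same_module (tensor_algebra R (pos_part R C)) (cobar R C)"
  by (simp add: same_module_def)

fun simplex_face :: "'a sset \<Rightarrow> bool \<Rightarrow> nat \<Rightarrow> (nat \<times> 'a) list \<Rightarrow> (nat \<times> 'a) list" where
  "simplex_face X eps i [] = []"
| "simplex_face X eps i ((n, x) # xs) =
    (if i \<le> n - 1 then (if eps then [(n - 1, face X n i x)]
       else [(i, front_face X n i x), (n - i, back_face X n i x)]) @ xs
     else (n, x) # simplex_face X eps (i - (n - 1)) xs)"

lemma word_face_plain_word: "word_face X eps i (plain_word xs) = plain_word (simplex_face X eps i xs)"
  by (induction X eps i xs rule: simplex_face.induct) auto

lemma simplex_face_Cons:
  "i \<le> fst p - 1 \<Longrightarrow> simplex_face X eps i (p # xs) = simplex_face X eps i [p] @ xs"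
  "fst p - 1 < i \<Longrightarrow> simplex_face X eps i (p # xs) = p # simplex_face X eps (i - (fst p - 1)) xs"
  by (cases p; simp)+

lemma bar_dim_simps [simp]:
  "bar_dim [] = 0" "bar_dim (p # xs) = fst p - 1 + bar_dim xs" "bar_dim (xs @ ys) = bar_dim xs + bar_dim ys"
  by (auto simp: bar_dim_def case_prod_unfold)

lemma bar_word_plain: "bar_word X xs = loop_class X (plain_word xs)"
proof -
  have "(\<lambda>(n, x). ([], n, x)) = Pair ([] :: nat list)" by (auto simp: fun_eq_iff)
  then show ?thesis by (simp add: bar_word_def)
qed

lemma (in abelian_group) finsum_delta:
  assumes "finite A" "j \<in> A" "y \<in> carrier G"
  shows "(\<Oplus>\<^bsub>G\<^esub>i\<in>A. if i = j then y else \<zero>\<^bsub>G\<^esub>) = y"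
  using finsum_singleton[of j A "\<lambda>_. y"] assms by (simp add: eq_commute[of j])

context simplicial_chains
begin

sublocale QC: cubical_chains "loop_cubes X" R
  by (intro cubical_chains.intro cubical_chains_axioms.intro cubical_set_loop R_cring)

abbreviation "S_pos \<equiv> {p \<in> all_simplices - zero_simplices. 0 < fst p}"
abbreviation "scp p \<equiv> sc (fst p) (snd p)"
abbreviation "good xs \<equiv> word_valid X (plain_word xs)"

text \<open>A 1-simplex is the unit of the loop monoid but zero as a chain. Dropping such entries
  makes the tensor word correspond to the cube even for words with unit letters, which arise as
  faces.\<close>

definition tw :: "(nat \<times> 'a) list \<Rightarrow> ((nat \<times> 'a \<Rightarrow> 'r) set list \<Rightarrow> 'r) set" where
  "tw xs = SC.W (map scp (filter (\<lambda>p. 2 \<le> fst p) xs))"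

lemma S_pos_iff: "p \<in> S_pos \<longleftrightarrow> 3 \<le> fst p \<and> snd p \<in> simp X (fst p) \<and> \<not> last_degenerate X (fst p) (snd p)"
  using nonzero_simplex_iff[of "fst p" "snd p"] by (cases "0 < fst p") auto

lemma good_iff: "good xs \<longleftrightarrow> (\<forall>p\<in>set xs. 1 \<le> fst p \<and> snd p \<in> simp X (fst p))"
  by (induction xs) auto

lemma lists_S_posD:
  "xs \<in> lists S_pos \<Longrightarrow> p \<in> set xs \<Longrightarrow> 3 \<le> fst p \<and> snd p \<in> simp X (fst p) \<and> \<not> last_degenerate X (fst p) (snd p)"
  by (rule S_pos_iff[THEN iffD1], rule in_listsD[THEN bspec])

lemma S_pos_good: "xs \<in> lists S_pos \<Longrightarrow> good xs"
  unfolding good_iff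
proof
  fix p assume "xs \<in> lists S_pos" "p \<in> set xs"
  from lists_S_posD[OF this] show "1 \<le> fst p \<and> snd p \<in> simp X (fst p)" by simp
qed

lemma sc_V: "0 < n \<Longrightarrow> x \<in> simp X n \<Longrightarrow> sc n x \<in> carrier SC.V"
  using sc_hcomp hcomp_pos_part by blast

lemma tw_lists: "good xs \<Longrightarrow> map scp (filter (\<lambda>p. 2 \<le> fst p) xs) \<in> lists (carrier SC.V)"
  unfolding good_iff by (auto intro!: sc_V)

lemma tw_closed: "good xs \<Longrightarrow> tw xs \<in> carrier SC.T"
  unfolding tw_def by (rule SC.TA(2)[OF tw_lists])

lemma tw_append: "good xs \<Longrightarrow> good ys \<Longrightarrow> tw (xs @ ys) = tw xs \<otimes>\<^bsub>SC.T\<^esub> tw ys"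
  unfolding tw_def filter_append map_append by (rule SC.TA(4)[OF tw_lists tw_lists])

lemma tw_Cons: "good (p # xs) \<Longrightarrow> tw (p # xs) = tw [p] \<otimes>\<^bsub>SC.T\<^esub> tw xs"
  using tw_append[of "[p]" xs] by simp

lemma tw_Nil: "tw [] = \<one>\<^bsub>SC.T\<^esub>"
  by (simp add: tw_def SC.TA(3))

lemma tw_one: "x \<in> simp X 1 \<Longrightarrow> tw [(1, x)] = \<one>\<^bsub>SC.T\<^esub>"
  by (simp add: tw_def SC.TA(3))

lemma tw_single: "2 \<le> n \<Longrightarrow> tw [(n, x)] = SC.W [sc n x]"
  by (simp add: tw_def)

lemma tw_S_pos: "xs \<in> lists S_pos \<Longrightarrow> tw xs = SC.E xs"
proof -
  assume xs: "xs \<in> lists S_pos"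
  have "filter (\<lambda>p. 2 \<le> fst p) xs = xs"
  proof (intro filter_True ballI)
    fix p assume "p \<in> set xs"
    from lists_S_posD[OF xs this] show "2 \<le> fst p" by simp
  qed
  then show ?thesis by (simp add: tw_def)
qed

lemma cobar_word_tw: "simplex_list X xs \<Longrightarrow> cobar_word R X xs = tw xs"
proof -
  assume "simplex_list X xs"
  then have "filter (\<lambda>p. 2 \<le> fst p) xs = xs" by (intro filter_True) (auto simp: simplex_list_def)
  then show ?thesis by (simp add: tw_def cobar_word_def case_prod_unfold)
qed

lemma word_deg_bar_dim: "SC.word_deg xs = bar_dim xs"
  by (induction xs) (auto simp: SC.word_deg_def)

lemma W0: "SC.W [\<zero>\<^bsub>SM\<^esub>] = \<zero>\<^bsub>SC.T\<^esub>"
  using lin_zero[OF SC.VD(1) SC.TD(1) SC.TA(5)] by (simp add: SC.V_simps)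

lemma last_degenerate_2: "x \<in> simp X 2 \<Longrightarrow> last_degenerate X 2 x"
  using nonzero_simplex_iff[of 2 x] last_degenerate_def[of X 2 x]
    simp_unique[of 2 x "degen X 1 1 (base_simplex X 1)"] degen_closed[OF base_simplex_closed, of 1 1] base_simplex_closed[of 1]
  by (auto simp: numeral_2_eq_2 simp del: base_simplex.simps)

lemma tw_degenerate:
  "good xs \<Longrightarrow> word_degenerate X (plain_word xs) \<Longrightarrow> tw xs = \<zero>\<^bsub>SC.T\<^esub>"
proof (induction xs)
  case (Cons p xs)
  have p: "1 \<le> fst p" "snd p \<in> simp X (fst p)" using Cons.prems(1)[unfolded good_iff] by auto
  have g: "good [p]" "good xs" using Cons.prems by auto
  show ?case
  proof (cases "last_degenerate X (fst p) (snd p)")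
    case True
    then have "2 \<le> fst p" using p not_last_degenerate_1[of X "snd p"] by (cases "fst p = 1") auto
    then have "tw [p] = \<zero>\<^bsub>SC.T\<^esub>"
      using tw_single[of "fst p" "snd p"] sc_degenerate[OF p(2) True] by (simp add: W0)
    then show ?thesis using tw_Cons[OF Cons.prems(1)] tw_closed[OF g(2)] by simp
  next
    case False
    then have "word_degenerate X (plain_word xs)" using Cons.prems(2) by (cases p) auto
    then have "tw xs = \<zero>\<^bsub>SC.T\<^esub>" using Cons.IH[OF g(2)] by simp
    then show ?thesis using tw_Cons[OF Cons.prems(1)] tw_closed[OF g(1)] by simp
  qed
qed simp

lemma plain_word_nondegenerate:
  assumes "good xs" "\<not> word_degenerate X (plain_word xs)"
  shows "filter (\<lambda>p. 2 \<le> fst p) xs \<in> lists S_pos"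
    "loop_eq X (plain_word xs) (plain_word (filter (\<lambda>p. 2 \<le> fst p) xs))"
proof -
  have *: "p \<in> S_pos" if p: "p \<in> set xs" "2 \<le> fst p" for p
  proof -
    have ps: "snd p \<in> simp X (fst p)" using assms(1) p by (auto simp: good_iff)
    have nd: "\<not> last_degenerate X (fst p) (snd p)"
      using assms(2) p(1) unfolding word_degenerate_def by (cases p) force
    have "fst p \<noteq> 2" using last_degenerate_2[of "snd p"] ps nd by auto
    then show ?thesis unfolding S_pos_iff using p ps nd by simp
  qed
  show "filter (\<lambda>p. 2 \<le> fst p) xs \<in> lists S_pos"
  proof (rule in_listsI, rule ballI)
    fix p assume "p \<in> set (filter (\<lambda>p. 2 \<le> fst p) xs)"
    then have "p \<in> set xs" "2 \<le> fst p" by auto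
    then show "p \<in> S_pos" by (rule *)
  qed
  have "word_simplices (plain_word xs) = filter (\<lambda>p. fst p \<noteq> 1) xs"
    by (induction xs) (auto simp: word_simplices_def)
  also have "\<dots> = filter (\<lambda>p. 2 \<le> fst p) xs"
    using assms(1) by (intro filter_cong) (auto simp: good_iff)
  finally show "loop_eq X (plain_word xs) (plain_word (filter (\<lambda>p. 2 \<le> fst p) xs))"
    using word_normal_form[OF assms] by simp
qed

lemma good_cube: "good xs \<Longrightarrow> bar_word X xs \<in> cubes Q (bar_dim xs)"
  unfolding bar_word_plain by (rule loop_class_cubes) (simp_all add: word_dim_plain_word)

text \<open>If the class is a degeneracy, the invariant makes every representative degenerate.
  Conversely, \<open>degenerate_word\<close> moves the degeneracy of a letter to the whole
  word.\<close>

lemma cube_degenerate_iff: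
  assumes "word_valid X u"
  shows "cube_degenerate Q (word_dim u) (loop_class X u) \<longleftrightarrow> word_degenerate X u"
proof
  assume "cube_degenerate Q (word_dim u) (loop_class X u)"
  then obtain m i c where c: "word_dim u = Suc m" "c \<in> cubes Q m" "1 \<le> i" "i \<le> Suc m"
      "loop_class X u = cdegen Q m i c" by (auto simp: cube_degenerate_def)
  then obtain v where v: "word_valid X v" "word_dim v = m" "c = loop_class X v" by (auto simp: cubes_loop)
  then have "loop_eq X u (wD i v)"
    using c cdegen_loop[OF v(1) c(3), of m] loop_class_eq_iff[OF assms] by simp
  then show "word_degenerate X u"
    using loop_eq_invariant[of X u "wD i v"] word_degenerate_word_degen by blast
next
  assume "word_degenerate X u"
  then obtain i v where v: "word_valid X v" "1 \<le> i" "i \<le> Suc (word_dim v)" "loop_eq X u (wD i v)"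
    using degenerate_word[OF assms] by blast
  have "loop_class X u = cdegen Q (word_dim v) i (loop_class X v)"
    using loop_class_eqI[OF v(4)] cdegen_loop[OF v(1-3)] by simp
  moreover have "word_dim u = Suc (word_dim v)"
    using loop_eq_dim[OF v(4)] word_dim_degen[OF v(1-3)] by simp
  ultimately show "cube_degenerate Q (word_dim u) (loop_class X u)"
    unfolding cube_degenerate_def using v loop_class_cubes[OF v(1) HOL.refl] by blast
qed

abbreviation "cube_of xs \<equiv> (bar_dim xs, bar_word X xs)"

text \<open>Injectivity reads the simplices off the class by the invariant; surjectivity is the
  normal form, with its unit letters removed.\<close>

lemma bar_word_bij:
  "bij_betw cube_of (lists S_pos) (QC.all_cubes - QC.degenerate_cubes)"
proof -
  have nd: "\<not> word_degenerate X (plain_word xs)" if "xs \<in> lists S_pos" for xs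
    using lists_S_posD[OF that] unfolding word_degenerate_def by auto
  have sx: "word_simplices (plain_word xs) = xs" if "xs \<in> lists S_pos" for xs
  proof -
    have "filter (\<lambda>g. fst (snd g) \<noteq> 1) (plain_word xs) = plain_word xs"
      using lists_S_posD[OF that] by (intro filter_True) force
    then show ?thesis by (simp add: word_simplices_def comp_def)
  qed
  show ?thesis
    unfolding bij_betw_def
  proof
    show "inj_on cube_of (lists S_pos)"
    proof (rule inj_onI)
      fix xs ys assume xy: "xs \<in> lists S_pos" "ys \<in> lists S_pos"
        "cube_of xs = (bar_dim ys, bar_word X ys)"
      then have "loop_eq X (plain_word xs) (plain_word ys)"
        using loop_class_eq_iff[OF S_pos_good[OF xy(1)]] by (simp add: bar_word_plain)
      then have "word_simplices (plain_word xs) = word_simplices (plain_word ys)"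
        using loop_eq_invariant nd[OF xy(1)] by blast
      then show "xs = ys" using sx xy by simp
    qed
    show "cube_of ` lists S_pos = QC.all_cubes - QC.degenerate_cubes"
    proof
      show "cube_of ` lists S_pos \<subseteq> QC.all_cubes - QC.degenerate_cubes"
      proof (rule image_subsetI)
        fix xs assume xs: "xs \<in> lists S_pos"
        have "\<not> cube_degenerate Q (bar_dim xs) (bar_word X xs)"
          using cube_degenerate_iff[OF S_pos_good[OF xs]] nd[OF xs] by (simp add: bar_word_plain word_dim_plain_word)
        then show "cube_of xs \<in> QC.all_cubes - QC.degenerate_cubes"
          using good_cube[OF S_pos_good[OF xs]] by simp
      qed
      show "QC.all_cubes - QC.degenerate_cubes \<subseteq> cube_of ` lists S_pos"
      proof
        fix p assume p: "p \<in> QC.all_cubes - QC.degenerate_cubes"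
        then obtain n c where pc: "p = (n, c)" "c \<in> cubes Q n" "\<not> cube_degenerate Q n c" by auto
        then obtain u where u: "word_valid X u" "word_dim u = n" "c = loop_class X u" by (auto simp: cubes_loop)
        then have du: "\<not> word_degenerate X u" using cube_degenerate_iff[OF u(1)] pc by simp
        let ?ys = "word_simplices u"
        have eq: "loop_eq X u (plain_word ?ys)" by (rule word_normal_form[OF u(1) du])
        then have ys: "good ?ys" "\<not> word_degenerate X (plain_word ?ys)"
          using loop_eq_valid(2)[OF eq] loop_eq_invariant[OF eq] du by auto
        let ?xs = "filter (\<lambda>p. 2 \<le> fst p) ?ys"
        have xs: "?xs \<in> lists S_pos" by (rule plain_word_nondegenerate(1)[OF ys])
        have eq': "loop_eq X u (plain_word ?xs)"
          using eq plain_word_nondegenerate(2)[OF ys] by (rule loop_eq.trans)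
        have "p = (bar_dim ?xs, bar_word X ?xs)"
          using pc u loop_class_eqI[OF eq'] loop_eq_dim[OF eq'] by (simp add: bar_word_plain word_dim_plain_word)
        then show "p \<in> cube_of ` lists S_pos" using xs by blast
      qed
    qed
  qed
qed

lemma simplex_face_good:
  assumes "good xs" "1 \<le> i" "i \<le> bar_dim xs"
  shows "good (simplex_face X eps i xs)" "bar_dim (simplex_face X eps i xs) = bar_dim xs - 1"
    "cface Q eps n i (bar_word X xs) = bar_word X (simplex_face X eps i xs)"
proof -
  have d: "i \<le> word_dim (plain_word xs)" using assms by (simp add: word_dim_plain_word)
  note F = word_face_facts[OF assms(1,2) d, of eps, unfolded word_face_plain_word word_dim_plain_word]
  show "good (simplex_face X eps i xs)" "bar_dim (simplex_face X eps i xs) = bar_dim xs - 1" using F by auto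
  show "cface Q eps n i (bar_word X xs) = bar_word X (simplex_face X eps i xs)"
    unfolding bar_word_plain cface_loop[OF assms(1,2) d] word_face_plain_word ..
qed

definition face_term :: "(nat \<times> 'a) list \<Rightarrow> nat \<Rightarrow> ((nat \<times> 'a \<Rightarrow> 'r) set list \<Rightarrow> 'r) set" where
  "face_term xs i = neg_one_pow R (i - 1) \<odot>\<^bsub>SC.T\<^esub> (tw (simplex_face X True i xs) \<ominus>\<^bsub>SC.T\<^esub> tw (simplex_face X False i xs))"

lemma face_term_closed: "good xs \<Longrightarrow> 1 \<le> i \<Longrightarrow> i \<le> bar_dim xs \<Longrightarrow> face_term xs i \<in> carrier SC.T"
  unfolding face_term_def
  by (intro SC.T'.smult_closed sgn(1) SC.T.minus_closed tw_closed simplex_face_good(1))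

text \<open>
  The simplex (i, front) or (n - i, back) of dimension 1 is zero in the chains but the unit as a
  letter; this accounts for the outer faces of the simplicial boundary.
\<close>

lemma tw_split:
  assumes x: "x \<in> simp X n" and n: "3 \<le> n" and i: "1 \<le> i" "i < n"
  shows "tw [(i, front_face X n i x), (n - i, back_face X n i x)] =
    SC.W [sc i (front_face X n i x), sc (n - i) (back_face X n i x)]
      \<oplus>\<^bsub>SC.T\<^esub> ((if i = 1 then tw [(n - 1, face X n 0 x)] else \<zero>\<^bsub>SC.T\<^esub>)
      \<oplus>\<^bsub>SC.T\<^esub> (if i = n - 1 then tw [(n - 1, face X n n x)] else \<zero>\<^bsub>SC.T\<^esub>))"
proof -
  let ?f = "front_face X n i x" and ?b = "back_face X n i x"
  have f: "?f \<in> simp X i" and b: "?b \<in> simp X (n - i)"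
    using front_face_closed[of i n x] back_face_closed[of x n i] x i by auto
  have fb: "sc i ?f \<in> carrier SC.V" "sc (n - i) ?b \<in> carrier SC.V"
    using i by (auto intro!: sc_V f b)
  have Wf: "SC.W [sc i ?f] \<in> carrier SC.T" "SC.W [sc (n - i) ?b] \<in> carrier SC.T"
    using SC.W1_closed fb by auto
  \<comment> \<open>Since \<open>n \<ge> 3\<close>, at most one of the two factors has dimension
    1.\<close>
  consider "i = 1" | "i = n - 1" "i \<noteq> 1" | "2 \<le> i" "2 \<le> n - i" "i \<noteq> 1" "i \<noteq> n - 1" using i by linarith
  then show ?thesis
  proof cases
    case 1
    have "sc i ?f = \<zero>\<^bsub>SM\<^esub>" using sc_one[of ?f] f 1 by simp
    then have "SC.W [sc i ?f, sc (n - i) ?b] = \<zero>\<^bsub>SC.T\<^esub>"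
      using SC.W_pair[OF fb] Wf by (simp add: W0)
    moreover have "back_face X n i x = face X n 0 x" using 1 by (simp add: back_face_Suc back_face_0)
    moreover have "tw [(i, ?f), (n - i, ?b)] = tw [(n - 1, ?b)]" using 1 n by (simp add: tw_def)
    moreover have "tw [(n - 1, ?b)] \<in> carrier SC.T"
      using tw_closed[of "[(n - 1, ?b)]"] b 1 n by simp
    moreover have "Suc 0 \<noteq> n - Suc 0" using n by simp
    ultimately show ?thesis using 1 n by simp
  next
    case 2
    have "sc (n - i) ?b = \<zero>\<^bsub>SM\<^esub>" using sc_one[of ?b] b 2 n by simp
    then have "SC.W [sc i ?f, sc (n - i) ?b] = \<zero>\<^bsub>SC.T\<^esub>"
      using SC.W_pair[OF fb] Wf by (simp add: W0)
    moreover have "front_face X n i x = face X n n x"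
      using 2 n front_face_Suc[of i n X x] by (simp add: front_face_self)
    moreover have "tw [(i, ?f), (n - i, ?b)] = tw [(n - 1, ?f)]" using 2 n by (simp add: tw_def)
    moreover have "tw [(n - 1, ?f)] \<in> carrier SC.T"
      using tw_closed[of "[(n - 1, ?f)]"] f 2 n by simp
    ultimately show ?thesis using 2 n by simp
  next
    case 3
    have "SC.W [sc i ?f, sc (n - i) ?b] \<in> carrier SC.T" using SC.TA(2) fb by simp
    then show ?thesis using 3 by (simp add: tw_def)
  qed
qed

text \<open>Upper faces give the inner terms of the boundary with the sign (-1)^(i-1) = -(-1)^i,
  which is the sign of its negative. Lower faces give the reduced coproduct and, by
  \<open>tw_split\<close>, the two outer terms of the boundary.\<close>

lemma cobar_diff_single_3:
  assumes x: "x \<in> simp X n" and n: "3 \<le> n"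
  shows "cobar_diff R SC (tw [(n, x)]) = (\<Oplus>\<^bsub>SC.T\<^esub>i\<in>{1..<n}. face_term [(n, x)] i)"
proof -
  have n0: "0 < n" using n by simp
  let ?b = "\<lambda>i. neg_one_pow R i \<odot>\<^bsub>SC.T\<^esub> tw [(n - 1, face X n i x)]"
  let ?w = "\<lambda>i. SC.W [sc i (front_face X n i x), sc (n - i) (back_face X n i x)]"
  let ?a = "\<lambda>i. neg_one_pow R i \<odot>\<^bsub>SC.T\<^esub> ?w i"
  \<comment> \<open>The lower faces with a unit factor. Their signs match those of the negated outer
    faces, as (-1)^1 = -(-1)^0 and (-1)^(n-1) = -(-1)^n.\<close>
  let ?d0 = "\<lambda>i. if i = 1 then \<ominus>\<^bsub>SC.T\<^esub> ?b 0 else \<zero>\<^bsub>SC.T\<^esub>" and ?dn = "\<lambda>i. if i = n - 1 then \<ominus>\<^bsub>SC.T\<^esub> ?b n else \<zero>\<^bsub>SC.T\<^esub>"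
  have fcl: "face X n i x \<in> simp X (n - 1)" if "i \<le> n" for i using face_closed[of x "n - 1" i] x n0 that by simp
  have twf: "tw [(n - 1, face X n i x)] \<in> carrier SC.T" if "i \<le> n" for i
    using tw_closed[of "[(n - 1, face X n i x)]"] fcl[OF that] n by simp
  have bcl: "?b i \<in> carrier SC.T" if "i \<le> n" for i using twf[OF that] sgn(1) by simp
  have wcl: "?w i \<in> carrier SC.T" if "i \<in> {1..<n}" for i
    using that x by (intro SC.TA(2)) (auto intro!: sc_V front_face_closed back_face_closed)
  have acl: "?a i \<in> carrier SC.T" if "i \<in> {1..<n}" for i using wcl[OF that] sgn(1) by simp
  have twfb: "tw [(i, front_face X n i x), (n - i, back_face X n i x)] \<in> carrier SC.T" if "i \<in> {1..<n}" for i
    using that x by (intro tw_closed) (auto intro!: front_face_closed back_face_closed)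
  have "cobar_diff R SC (SC.W [sc n x]) = (\<ominus>\<^bsub>SC.T\<^esub> SC.W [diff SC (sc n x)]) \<oplus>\<^bsub>SC.T\<^esub> (\<Oplus>\<^bsub>SC.T\<^esub>i\<in>{1..<n}. ?a i)"
  proof (rule SC.cobar_diff_generator[OF _ n0 sc_hcomp[OF x], where q = "\<lambda>i. n - i"])
    show "0 < i \<and> 0 < n - i \<and> sc i (front_face X n i x) \<in> hcomp SC i \<and>
        sc (n - i) (back_face X n i x) \<in> hcomp SC (n - i)" if "i \<in> {1..<n}" for i
      using that x by (intro conjI sc_hcomp front_face_closed back_face_closed) auto
    show "coprod SC (sc n x) = tensor R SC SC (sc n x) (coaug SC)
          \<oplus>\<^bsub>tensor_prod R SC SC\<^esub> tensor R SC SC (coaug SC) (sc n x)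
          \<oplus>\<^bsub>tensor_prod R SC SC\<^esub> (\<Oplus>\<^bsub>tensor_prod R SC SC\<^esub>i\<in>{1..<n}.
            tensor R SC SC (sc i (front_face X n i x)) (sc (n - i) (back_face X n i x)))"
      using alexander_whitney_reduced[OF x n0]
      by (simp add: same_module_tensor[OF same_module_simp_chains, symmetric] del: base_simplex.simps)
  qed simp
  moreover have "SC.W [diff SC (sc n x)] = ?b n \<oplus>\<^bsub>SC.T\<^esub> (?b 0 \<oplus>\<^bsub>SC.T\<^esub> (\<Oplus>\<^bsub>SC.T\<^esub>i\<in>{1..<n}. ?b i))"
  proof -
    have V: "lin R SC.V SC.T (\<lambda>v. SC.W [v])" by (rule SC.TA(5))
    have scV: "sc (n - 1) (face X n i x) \<in> carrier SC.V" if "i \<le> n" for i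
      using fcl[OF that] n by (intro sc_V) auto
    \<comment> \<open>The boundary is a sum formed in all chains, whereas letters are linear only on
      the positive part; the two finite sums agree but belong to different records.\<close>
    have eqs: "finsum SM f A = finsum SC.V f A" if "f \<in> A \<rightarrow> carrier SC.V" for f :: "nat \<Rightarrow> _" and A
    proof -
      interpret V: module R SC.V by (rule SC.VD(1))
      show ?thesis
      proof (cases "finite A")
        case True
        then show ?thesis using that
        proof (induction A)
          case (insert a A)
          have c: "f a \<in> carrier SC.V" "f \<in> A \<rightarrow> carrier SC.V" using insert.prems by auto
          have "f a \<in> carrier SM" "f \<in> A \<rightarrow> carrier SM" using c SC.V_closed by (auto simp: Pi_iff)
          then show ?case using insert c by (simp add: SM.finsum_insert V.finsum_insert SC.V_simps)
        qed (simp add: SC.V_simps)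
      qed (simp add: SM.finsum_infinite V.finsum_infinite SC.V_simps)
    qed
    have cl: "(\<lambda>i. neg_one_pow R i \<odot>\<^bsub>SM\<^esub> sc (n - 1) (face X n i x)) \<in> {..n} \<rightarrow> carrier SC.V"
      using scV module.smult_closed[OF SC.VD(1) sgn(1)] by (auto simp: SC.V_simps)
    have "SC.W [diff SC (sc n x)] = SC.W [\<Oplus>\<^bsub>SC.V\<^esub>i\<in>{..n}. neg_one_pow R i \<odot>\<^bsub>SM\<^esub> sc (n - 1) (face X n i x)]"
      using simp_boundary_sc[OF n0 x] eqs[OF cl] by (simp add: simp_boundary_sum_def)
    also have "\<dots> = (\<Oplus>\<^bsub>SC.T\<^esub>i\<in>{..n}. SC.W [neg_one_pow R i \<odot>\<^bsub>SM\<^esub> sc (n - 1) (face X n i x)])"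
      by (rule lin_finsum[OF SC.VD(1) SC.TD(1) V cl])
    also have "\<dots> = (\<Oplus>\<^bsub>SC.T\<^esub>i\<in>{..n}. ?b i)"
    proof (rule SC.T.finsum_cong'[OF HOL.refl])
      fix i assume "i \<in> {..n}"
      then have i: "i \<le> n" by simp
      show "SC.W [neg_one_pow R i \<odot>\<^bsub>SM\<^esub> sc (n - 1) (face X n i x)] = ?b i"
        using lin_smult[OF V sgn(1) scV[OF i]] n by (simp add: SC.V_simps tw_single)
    qed (use bcl in auto)
    also have "{..n} = insert n (insert 0 {1..<n})" using n by auto
    also have "(\<Oplus>\<^bsub>SC.T\<^esub>i\<in>insert n (insert 0 {1..<n}). ?b i) = ?b n \<oplus>\<^bsub>SC.T\<^esub> (?b 0 \<oplus>\<^bsub>SC.T\<^esub> (\<Oplus>\<^bsub>SC.T\<^esub>i\<in>{1..<n}. ?b i))"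
      using bcl n by (subst SC.T.finsum_insert, simp, simp, force, force, subst SC.T.finsum_insert) auto
    finally show ?thesis .
  qed
  moreover have "(\<Oplus>\<^bsub>SC.T\<^esub>i\<in>{1..<n}. face_term [(n, x)] i) =
     (\<Oplus>\<^bsub>SC.T\<^esub>i\<in>{1..<n}. (\<ominus>\<^bsub>SC.T\<^esub> ?b i) \<oplus>\<^bsub>SC.T\<^esub> (?a i \<oplus>\<^bsub>SC.T\<^esub> (?d0 i \<oplus>\<^bsub>SC.T\<^esub> ?dn i)))"
  proof (rule SC.T.finsum_cong'[OF HOL.refl])
    show "(\<lambda>i. (\<ominus>\<^bsub>SC.T\<^esub> ?b i) \<oplus>\<^bsub>SC.T\<^esub> (?a i \<oplus>\<^bsub>SC.T\<^esub> (?d0 i \<oplus>\<^bsub>SC.T\<^esub> ?dn i))) \<in> {1..<n} \<rightarrow> carrier SC.T"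
      using bcl acl by (auto simp del: One_nat_def)
    fix i assume i: "i \<in> {1..<n}"
    then obtain k where k: "i = Suc k" by (cases i) auto
    have i': "i \<le> n" "1 \<le> i" "i < n" using i by auto
    let ?u = "tw [(n - 1, face X n i x)]" and ?v = "tw [(i, front_face X n i x), (n - i, back_face X n i x)]"
    have s: "neg_one_pow R i = \<ominus>\<^bsub>R\<^esub> neg_one_pow R k" unfolding k by (rule sgn(4))
    have "face_term [(n, x)] i = neg_one_pow R k \<odot>\<^bsub>SC.T\<^esub> (?u \<ominus>\<^bsub>SC.T\<^esub> ?v)"
    proof -
      have "Suc k \<le> n - Suc 0" using i k by auto
      then show ?thesis using k by (simp add: face_term_def)
    qed
    also have "\<dots> = (\<ominus>\<^bsub>SC.T\<^esub> ?b i) \<oplus>\<^bsub>SC.T\<^esub> neg_one_pow R i \<odot>\<^bsub>SC.T\<^esub> ?v"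
      using twf[OF i'(1)] twfb[OF i] sgn(1)[of k] unfolding s
      by (simp add: a_minus_def SC.T'.smult_r_distr SC.T'.smult_r_minus SC.T'.smult_l_minus)
    also have "neg_one_pow R i \<odot>\<^bsub>SC.T\<^esub> ?v = ?a i \<oplus>\<^bsub>SC.T\<^esub> (?d0 i \<oplus>\<^bsub>SC.T\<^esub> ?dn i)"
    proof -
      have "neg_one_pow R 1 = \<ominus>\<^bsub>R\<^esub> neg_one_pow R 0" using sgn(4)[of 0] by simp
      then have e0: "neg_one_pow R 1 \<odot>\<^bsub>SC.T\<^esub> tw [(n - 1, face X n 0 x)] = \<ominus>\<^bsub>SC.T\<^esub> ?b 0"
        using twf[of 0] sgn(1)[of 0] by (simp add: SC.T'.smult_l_minus)
      have "neg_one_pow R n = \<ominus>\<^bsub>R\<^esub> neg_one_pow R (n - 1)" using sgn(4)[of "n - 1"] n0 by simp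
      then have en: "neg_one_pow R (n - 1) \<odot>\<^bsub>SC.T\<^esub> tw [(n - 1, face X n n x)] = \<ominus>\<^bsub>SC.T\<^esub> ?b n"
        using twf[of n] sgn(1)[of "n - 1"] by (simp add: SC.T'.smult_l_minus)
      have "neg_one_pow R i \<odot>\<^bsub>SC.T\<^esub> (if i = 1 then tw [(n - 1, face X n 0 x)] else \<zero>\<^bsub>SC.T\<^esub>) = ?d0 i"
        using e0 sgn(1) by (simp del: One_nat_def)
      moreover have "neg_one_pow R i \<odot>\<^bsub>SC.T\<^esub> (if i = n - 1 then tw [(n - 1, face X n n x)] else \<zero>\<^bsub>SC.T\<^esub>) = ?dn i"
        using en sgn(1) by (simp del: One_nat_def)
      moreover have "(if i = 1 then tw [(n - 1, face X n 0 x)] else \<zero>\<^bsub>SC.T\<^esub>) \<in> carrier SC.T"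
        "(if i = n - 1 then tw [(n - 1, face X n n x)] else \<zero>\<^bsub>SC.T\<^esub>) \<in> carrier SC.T"
        using twf by simp_all
      ultimately show ?thesis
        unfolding tw_split[OF x n i'(2,3)] using wcl[OF i] sgn(1)[of i]
        by (simp only: SC.T'.smult_r_distr SC.T.a_closed)
    qed
    finally show "face_term [(n, x)] i = (\<ominus>\<^bsub>SC.T\<^esub> ?b i) \<oplus>\<^bsub>SC.T\<^esub> (?a i \<oplus>\<^bsub>SC.T\<^esub> (?d0 i \<oplus>\<^bsub>SC.T\<^esub> ?dn i))" .
  qed
  moreover have "\<dots> = (\<ominus>\<^bsub>SC.T\<^esub> (\<Oplus>\<^bsub>SC.T\<^esub>i\<in>{1..<n}. ?b i)) \<oplus>\<^bsub>SC.T\<^esub> ((\<Oplus>\<^bsub>SC.T\<^esub>i\<in>{1..<n}. ?a i) \<oplus>\<^bsub>SC.T\<^esub> ((\<ominus>\<^bsub>SC.T\<^esub> ?b 0) \<oplus>\<^bsub>SC.T\<^esub> (\<ominus>\<^bsub>SC.T\<^esub> ?b n)))"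
  proof -
    have cl: "?b \<in> {1..<n} \<rightarrow> carrier SC.T" "(\<lambda>i. \<ominus>\<^bsub>SC.T\<^esub> ?b i) \<in> {1..<n} \<rightarrow> carrier SC.T" "?a \<in> {1..<n} \<rightarrow> carrier SC.T"
      "?d0 \<in> {1..<n} \<rightarrow> carrier SC.T" "?dn \<in> {1..<n} \<rightarrow> carrier SC.T"
      "(\<lambda>i. ?d0 i \<oplus>\<^bsub>SC.T\<^esub> ?dn i) \<in> {1..<n} \<rightarrow> carrier SC.T"
      "(\<lambda>i. ?a i \<oplus>\<^bsub>SC.T\<^esub> (?d0 i \<oplus>\<^bsub>SC.T\<^esub> ?dn i)) \<in> {1..<n} \<rightarrow> carrier SC.T"
      using bcl acl by (auto simp del: One_nat_def)
    have b0: "\<ominus>\<^bsub>SC.T\<^esub> ?b 0 \<in> carrier SC.T" "\<ominus>\<^bsub>SC.T\<^esub> ?b n \<in> carrier SC.T" using bcl[of 0] bcl[of n] by simp_all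
    have "(\<Oplus>\<^bsub>SC.T\<^esub>i\<in>{1..<n}. ?d0 i) = \<ominus>\<^bsub>SC.T\<^esub> ?b 0"
      by (rule SC.T.finsum_delta[OF _ _ b0(1)]) (use n in auto)
    moreover have "(\<Oplus>\<^bsub>SC.T\<^esub>i\<in>{1..<n}. ?dn i) = \<ominus>\<^bsub>SC.T\<^esub> ?b n"
      by (rule SC.T.finsum_delta[OF _ _ b0(2)]) (use n in auto)
    moreover have "(\<Oplus>\<^bsub>SC.T\<^esub>i\<in>{1..<n}. \<ominus>\<^bsub>SC.T\<^esub> ?b i) = \<ominus>\<^bsub>SC.T\<^esub> (\<Oplus>\<^bsub>SC.T\<^esub>i\<in>{1..<n}. ?b i)"
      by (rule lin_finsum[OF SC.TD(1) SC.TD(1) lin_uminus[OF SC.TD(1) SC.TD(1) lin_id[OF SC.TD(1)]] cl(1), symmetric])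
    ultimately show ?thesis using cl by (simp only: SC.T.finsum_addf)
  qed
  moreover have "(\<Oplus>\<^bsub>SC.T\<^esub>i\<in>{1..<n}. ?b i) \<in> carrier SC.T" "(\<Oplus>\<^bsub>SC.T\<^esub>i\<in>{1..<n}. ?a i) \<in> carrier SC.T"
    using bcl acl by (auto intro!: SC.T.finsum_closed)
  ultimately show ?thesis
    using n bcl[of 0] bcl[of n] by (simp add: tw_single SC.T.minus_add SC.T.a_ac)
qed

end

lemma lin_inv_into:
  assumes M: "module R M" and N: "module R N" and f: "lin R M N f" and bij: "bij_betw f (carrier M) (carrier N)"
  shows "lin R N M (inv_into (carrier M) f)"
proof -
  interpret M: module R M by fact
  interpret N: module R N by fact
  let ?g = "inv_into (carrier M) f"
  have g: "?g y \<in> carrier M" "f (?g y) = y" if "y \<in> carrier N" for y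
    using bij that by (auto simp: bij_betw_def inv_into_into f_inv_into_f)
  have gf: "?g (f x) = x" if "x \<in> carrier M" for x
    using bij that by (simp add: bij_betw_def)
  show ?thesis
  proof (rule linI)
    fix x assume x: "x \<in> carrier N"
    show "?g x \<in> carrier M" by (rule g(1)[OF x])
    { fix y assume y: "y \<in> carrier N"
      have "x \<oplus>\<^bsub>N\<^esub> y = f (?g x \<oplus>\<^bsub>M\<^esub> ?g y)" using g[OF x] g[OF y] by (simp add: lin_add[OF f])
      then show "?g (x \<oplus>\<^bsub>N\<^esub> y) = ?g x \<oplus>\<^bsub>M\<^esub> ?g y" using gf g(1)[OF x] g(1)[OF y] by simp }
    { fix r assume r: "r \<in> carrier R"
      have "r \<odot>\<^bsub>N\<^esub> x = f (r \<odot>\<^bsub>M\<^esub> ?g x)" using g[OF x] r by (simp add: lin_smult[OF f])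
      then show "?g (r \<odot>\<^bsub>N\<^esub> x) = r \<odot>\<^bsub>M\<^esub> ?g x" using gf g(1)[OF x] r by simp }
  qed
qed

context simplicial_chains
begin

lemma tw_hcomp: "good xs \<Longrightarrow> tw xs \<in> cobar_hcomp R SC (bar_dim xs)"
proof -
  assume g: "good xs"
  let ?ys = "filter (\<lambda>p. 2 \<le> fst p) xs"
  have "list_all2 (\<lambda>v k. v \<in> hcomp SC (Suc k)) (map scp ?ys) (map (\<lambda>p. fst p - 1) ?ys)"
    using g unfolding good_iff by (induction xs) (auto simp del: simp_chains_simps intro!: sc_hcomp)
  moreover have "sum_list (map (\<lambda>p. fst p - 1) ?ys) = bar_dim xs"
    using g unfolding good_iff by (induction xs) auto
  ultimately have "tw xs \<in> {SC.W vs | vs ks. list_all2 (\<lambda>v k. v \<in> hcomp SC (Suc k)) vs ks \<and> sum_list ks = bar_dim xs}"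
    unfolding tw_def by blast
  then show ?thesis unfolding cobar_hcomp_def by (rule subsetD[OF gen_submodule_incl])
qed

text \<open>In dimension 1 the word is the unit. In dimension 2 the chain is zero, and both faces of
  the corresponding 1-cube are the unit and cancel.\<close>

lemma cobar_diff_single:
  assumes x: "x \<in> simp X n" and n: "1 \<le> n"
  shows "cobar_diff R SC (tw [(n, x)]) = (\<Oplus>\<^bsub>SC.T\<^esub>i\<in>{1..n - 1}. face_term [(n, x)] i)"
proof -
  consider "n = 1" | "n = 2" | "3 \<le> n" using n by linarith
  then show ?thesis
  proof cases
    case 1
    then show ?thesis using tw_one[of x] x SC.cobar_diff_one by simp
  next
    case 2
    have "word_degenerate X (plain_word [(n, x)])" using last_degenerate_2[of x] x 2 by simp
    then have "tw [(n, x)] = \<zero>\<^bsub>SC.T\<^esub>" using x n by (intro tw_degenerate) auto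
    then have "cobar_diff R SC (tw [(n, x)]) = \<zero>\<^bsub>SC.T\<^esub>"
      using lin_zero[OF SC.TD(1) SC.TD(1) SC.lin_cobar_diff] by simp
    moreover have "face_term [(n, x)] 1 = \<zero>\<^bsub>SC.T\<^esub>"
      using 2 sgn(1)[of 0] by (simp add: face_term_def tw_def SC.TA(3) a_minus_def SC.T.r_neg)
    ultimately show ?thesis using 2 by (simp add: SC.T.finsum_insert)
  next
    case 3
    then have "{1..n - 1} = {1..<n}" by auto
    then show ?thesis using cobar_diff_single_3[OF x 3] by simp
  qed
qed

lemma face_term_append:
  assumes "good (p # ys)" "1 \<le> i" "i \<le> fst p - 1"
  shows "face_term (p # ys) i = face_term [p] i \<otimes>\<^bsub>SC.T\<^esub> tw ys"
proof -
  have g: "good [p]" "good ys" using assms(1) by auto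
  have i: "i \<le> bar_dim [p]" using assms(3) by simp
  note F = simplex_face_good(1)[OF g(1) assms(2) i]
  have ty: "tw ys \<in> carrier SC.T" by (rule tw_closed[OF g(2)])
  note L = lin_mult_right[OF SC.TA(1) ty]
  have "tw (simplex_face X eps i (p # ys)) = tw (simplex_face X eps i [p]) \<otimes>\<^bsub>SC.T\<^esub> tw ys" for eps
    by (subst simplex_face_Cons(1)[OF assms(3)]) (rule tw_append[OF F g(2)])
  then show ?thesis
    unfolding face_term_def
    by (simp only: lin_smult[OF L sgn(1) SC.T.minus_closed[OF tw_closed[OF F] tw_closed[OF F]]]
      lin_minus[OF SC.TD(1) SC.TD(1) L tw_closed[OF F] tw_closed[OF F]])
qed

text \<open>Moving the face index past the first letter multiplies the cubical sign by (-1) to the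
  dimension of that letter, which is the Leibniz sign.\<close>

lemma face_term_shift:
  assumes "good (p # ys)" "1 \<le> j" "j \<le> bar_dim ys"
  shows "face_term (p # ys) (j + (fst p - 1)) =
    neg_one_pow R (fst p - 1) \<odot>\<^bsub>SC.T\<^esub> (tw [p] \<otimes>\<^bsub>SC.T\<^esub> face_term ys j)"
proof -
  have g: "good [p]" "good ys" using assms(1) by auto
  let ?m = "fst p - 1"
  note F = simplex_face_good(1)[OF g(2) assms(2,3)]
  have tp: "tw [p] \<in> carrier SC.T" by (rule tw_closed[OF g(1)])
  note L = lin_mult_left[OF SC.TA(1) tp]
  have "tw (simplex_face X eps (j + ?m) (p # ys)) = tw [p] \<otimes>\<^bsub>SC.T\<^esub> tw (simplex_face X eps j ys)" for eps
  proof -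
    have "good (p # simplex_face X eps j ys)" using g F[of eps] by simp
    moreover have "simplex_face X eps (j + ?m) (p # ys) = p # simplex_face X eps j ys"
      using simplex_face_Cons(2)[of p "j + ?m" X eps ys] assms(2) by simp
    ultimately show ?thesis by (simp only: tw_Cons)
  qed
  moreover have "j + ?m - 1 = ?m + (j - 1)" using assms(2) by simp
  ultimately show ?thesis
    unfolding face_term_def using tw_closed[OF F] tp sgn(1)
    by (simp add: sgn(3) SC.T'.smult_assoc1 lin_smult[OF L] lin_minus[OF SC.TD(1) SC.TD(1) L])
qed

text \<open>The face indices of a word are those of its first letter together with the shifted ones
  of the rest; these are the two summands of the Leibniz rule.\<close>

lemma cobar_diff_tw:
  "good xs \<Longrightarrow> cobar_diff R SC (tw xs) = (\<Oplus>\<^bsub>SC.T\<^esub>i\<in>{1..bar_dim xs}. face_term xs i)"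
proof (induction xs)
  case Nil
  then show ?case by (simp add: tw_Nil SC.cobar_diff_one)
next
  case (Cons p ys)
  have g: "good [p]" "good ys" using Cons.prems by auto
  have p: "snd p \<in> simp X (fst p)" "1 \<le> fst p" using g(1)[unfolded good_iff] by auto
  let ?m = "fst p - 1" and ?k = "bar_dim ys"
  have tp: "tw [p] \<in> cobar_hcomp R SC ?m" using tw_hcomp[OF g(1)] by simp
  note ty = tw_closed[OF g(2)] and tp' = tw_closed[OF g(1)]
  note L = lin_mult_left[OF SC.TA(1) tp'] and Rr = lin_mult_right[OF SC.TA(1) ty]
  have f1: "face_term [p] \<in> {1..?m} \<rightarrow> carrier SC.T"
    using face_term_closed[OF g(1)] by auto
  have f2: "face_term ys \<in> {1..?k} \<rightarrow> carrier SC.T"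
    using face_term_closed[OF g(2)] by auto
  have f: "face_term (p # ys) \<in> {1..?m + ?k} \<rightarrow> carrier SC.T"
    using face_term_closed[OF Cons.prems] by auto
  have "cobar_diff R SC (tw (p # ys)) = cobar_diff R SC (tw [p] \<otimes>\<^bsub>SC.T\<^esub> tw ys)"
    by (simp only: tw_Cons[OF Cons.prems])
  also have "\<dots> = (cobar_diff R SC (tw [p]) \<otimes>\<^bsub>SC.T\<^esub> tw ys) \<oplus>\<^bsub>SC.T\<^esub>
      (neg_one_pow R ?m \<odot>\<^bsub>SC.T\<^esub> (tw [p] \<otimes>\<^bsub>SC.T\<^esub> cobar_diff R SC (tw ys)))"
    by (rule SC.cobar_diff_mult[OF tp ty])
  also have "cobar_diff R SC (tw [p]) \<otimes>\<^bsub>SC.T\<^esub> tw ys = (\<Oplus>\<^bsub>SC.T\<^esub>i\<in>{1..?m}. face_term (p # ys) i)"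
  proof -
    have "cobar_diff R SC (tw [p]) = (\<Oplus>\<^bsub>SC.T\<^esub>i\<in>{1..?m}. face_term [p] i)"
      using cobar_diff_single[OF p] by simp
    then have "cobar_diff R SC (tw [p]) \<otimes>\<^bsub>SC.T\<^esub> tw ys = (\<Oplus>\<^bsub>SC.T\<^esub>i\<in>{1..?m}. face_term [p] i \<otimes>\<^bsub>SC.T\<^esub> tw ys)"
      using lin_finsum[OF SC.TD(1) SC.TD(1) Rr f1] by simp
    also have "\<dots> = (\<Oplus>\<^bsub>SC.T\<^esub>i\<in>{1..?m}. face_term (p # ys) i)"
      using f face_term_append[OF Cons.prems] by (intro SC.T.finsum_cong'[OF HOL.refl]) auto
    finally show ?thesis .
  qed
  also have "neg_one_pow R ?m \<odot>\<^bsub>SC.T\<^esub> (tw [p] \<otimes>\<^bsub>SC.T\<^esub> cobar_diff R SC (tw ys)) =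
      (\<Oplus>\<^bsub>SC.T\<^esub>i\<in>(\<lambda>j. j + ?m) ` {1..?k}. face_term (p # ys) i)"
  proof -
    have c: "(\<lambda>j. tw [p] \<otimes>\<^bsub>SC.T\<^esub> face_term ys j) \<in> {1..?k} \<rightarrow> carrier SC.T"
      using f2 tp' by auto
    have im: "(\<lambda>j. j + ?m) ` {1..?k} \<subseteq> {1..?m + ?k}" by auto
    have "tw [p] \<otimes>\<^bsub>SC.T\<^esub> cobar_diff R SC (tw ys) = (\<Oplus>\<^bsub>SC.T\<^esub>j\<in>{1..?k}. tw [p] \<otimes>\<^bsub>SC.T\<^esub> face_term ys j)"
      using Cons.IH[OF g(2)] lin_finsum[OF SC.TD(1) SC.TD(1) L f2] by simp
    then have "neg_one_pow R ?m \<odot>\<^bsub>SC.T\<^esub> (tw [p] \<otimes>\<^bsub>SC.T\<^esub> cobar_diff R SC (tw ys)) =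
        (\<Oplus>\<^bsub>SC.T\<^esub>j\<in>{1..?k}. neg_one_pow R ?m \<odot>\<^bsub>SC.T\<^esub> (tw [p] \<otimes>\<^bsub>SC.T\<^esub> face_term ys j))"
      using SC.T'.finsum_smult_ldistr[OF finite_atLeastAtMost sgn(1) c] by simp
    also have "\<dots> = (\<Oplus>\<^bsub>SC.T\<^esub>j\<in>{1..?k}. face_term (p # ys) (j + ?m))"
    proof (rule SC.T.finsum_cong'[OF HOL.refl])
      show "(\<lambda>j. face_term (p # ys) (j + ?m)) \<in> {1..?k} \<rightarrow> carrier SC.T" using f by auto
      fix j assume "j \<in> {1..?k}"
      then show "neg_one_pow R ?m \<odot>\<^bsub>SC.T\<^esub> (tw [p] \<otimes>\<^bsub>SC.T\<^esub> face_term ys j) = face_term (p # ys) (j + ?m)"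
        using face_term_shift[OF Cons.prems, of j] by simp
    qed
    also have "\<dots> = (\<Oplus>\<^bsub>SC.T\<^esub>i\<in>(\<lambda>j. j + ?m) ` {1..?k}. face_term (p # ys) i)"
      using f im by (intro SC.T.finsum_reindex[symmetric]) auto
    finally show ?thesis .
  qed
  also have "(\<Oplus>\<^bsub>SC.T\<^esub>i\<in>{1..?m}. face_term (p # ys) i) \<oplus>\<^bsub>SC.T\<^esub> (\<Oplus>\<^bsub>SC.T\<^esub>i\<in>(\<lambda>j. j + ?m) ` {1..?k}. face_term (p # ys) i) =
      (\<Oplus>\<^bsub>SC.T\<^esub>i\<in>{1..?m} \<union> (\<lambda>j. j + ?m) ` {1..?k}. face_term (p # ys) i)"
    using f by (intro SC.T.finsum_Un_disjoint[symmetric]) auto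
  also have "{1..?m} \<union> (\<lambda>j. j + ?m) ` {1..?k} = {1..?m + ?k}"
  proof -
    have *: "i \<in> (\<lambda>j. j + ?m) ` {1..?k}" if "?m < i" "i \<le> ?m + ?k" for i
      using that by (intro image_eqI[of _ _ "i - ?m"]) auto
    show ?thesis
    proof (intro equalityI subsetI)
      fix i assume "i \<in> {1..?m + ?k}"
      then show "i \<in> {1..?m} \<union> (\<lambda>j. j + ?m) ` {1..?k}" using *[of i] by (cases "i \<le> ?m") simp_all
    qed auto
  qed
  finally show ?case by simp
qed

text \<open>Given by its values on the basis. Membership in \<open>linear_maps\<close> fixes it off
  the carrier too, so that it can be equal to the description \<open>loop_ident\<close>.\<close>

definition iota :: "((nat \<times> 'a \<Rightarrow> 'r) set list \<Rightarrow> 'r) set \<Rightarrow> (nat \<times> 'a letter list set \<Rightarrow> 'r) set" where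
  "iota = (SOME f. f \<in> linear_maps R (cobar R SC) (cube_chains R Q) \<and>
    (\<forall>xs\<in>lists S_pos. f (SC.E xs) = QC.cls (bar_dim xs) (bar_word X xs)))"

lemma iota_facts:
  shows iota_linear_maps: "iota \<in> linear_maps R (cobar R SC) (cube_chains R Q)"
    and iota_E: "xs \<in> lists S_pos \<Longrightarrow> iota (SC.E xs) = QC.cls (bar_dim xs) (bar_word X xs)"
proof -
  have "\<exists>f. f \<in> linear_maps R (cobar R SC) (cube_chains R Q) \<and>
    (\<forall>xs\<in>lists S_pos. f (SC.E xs) = QC.cls (bar_dim xs) (bar_word X xs))"
  proof -
    obtain h where h: "lin R SC.T QC.K h"
        "\<And>xs. xs \<in> lists S_pos \<Longrightarrow> h (SC.E xs) = QC.cls (bar_dim xs) (bar_word X xs)"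
    proof (rule free_basis_ext[OF SC.basis_T QC.K_module])
      fix xs assume "xs \<in> lists S_pos"
      then show "QC.cls (bar_dim xs) (bar_word X xs) \<in> carrier QC.K"
        by (intro QC.cls_closed good_cube S_pos_good)
    qed (rule that)
    let ?h = "restrict h (carrier SC.T)"
    have "?h \<in> linear_maps R SC.T QC.K" by (rule lin_restrict[OF SC.TD(1) h(1)])
    then have "?h \<in> linear_maps R (cobar R SC) (cube_chains R Q)"
      by (simp add: linear_maps_def)
    moreover have "?h (SC.E xs) = QC.cls (bar_dim xs) (bar_word X xs)" if "xs \<in> lists S_pos" for xs
      using h(2)[OF that] SC.TD(2)[OF that] by simp
    ultimately show ?thesis by blast
  qed
  from someI_ex[OF this] show "iota \<in> linear_maps R (cobar R SC) (cube_chains R Q)"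
    "xs \<in> lists S_pos \<Longrightarrow> iota (SC.E xs) = QC.cls (bar_dim xs) (bar_word X xs)"
    unfolding iota_def[symmetric] by blast+
qed

lemma iota_lin: "lin R SC.T QC.K iota"
  using iota_linear_maps by (simp add: linear_maps_iff lin_def)

text \<open>Faces of basis words may be degenerate or contain unit letters, so the values on the
  basis must be extended to such words. Degenerate words give zero on both sides, and dropping units
  changes neither side.\<close>

lemma iota_tw: "good xs \<Longrightarrow> iota (tw xs) = QC.cls (bar_dim xs) (bar_word X xs)"
proof -
  assume g: "good xs"
  show ?thesis
  proof (cases "word_degenerate X (plain_word xs)")
    case True
    have "QC.cls (bar_dim xs) (bar_word X xs) = \<zero>\<^bsub>QC.K\<^esub>"
      using cube_degenerate_iff[OF g] True
      by (intro QC.cls_degenerate good_cube[OF g]) (simp add: bar_word_plain word_dim_plain_word)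
    moreover have "iota (tw xs) = \<zero>\<^bsub>QC.K\<^esub>"
      unfolding tw_degenerate[OF g True] by (rule lin_zero[OF SC.TD(1) QC.K_module iota_lin])
    ultimately show ?thesis by simp
  next
    case False
    let ?ys = "filter (\<lambda>p. 2 \<le> fst p) xs"
    note ys = plain_word_nondegenerate[OF g False]
    have "tw xs = SC.E ?ys" by (simp add: tw_def)
    moreover have "bar_word X xs = bar_word X ?ys"
      unfolding bar_word_plain by (rule loop_class_eqI[OF ys(2)])
    moreover have "bar_dim xs = bar_dim ?ys"
      using loop_eq_dim[OF ys(2)] by (simp add: word_dim_plain_word)
    ultimately show ?thesis using iota_E[OF ys(1)] by simp
  qed
qed

lemma iota_bij: "bij_betw iota (carrier SC.T) (carrier QC.K)"
  by (rule free_basis_bij[OF SC.basis_T QC.basis_K bar_word_bij iota_lin]) (simp add: iota_E)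

text \<open>On a basis word both differentials are sums over the same faces, which
  \<open>iota_tw\<close> matches term by term.\<close>

lemma iota_diff: "x \<in> carrier SC.T \<Longrightarrow> iota (cobar_diff R SC x) = cube_boundary R Q (iota x)"
proof (rule free_basis_eq[OF SC.basis_T QC.K_module lin_comp[OF SC.lin_cobar_diff iota_lin]
      lin_comp[OF iota_lin QC.cube_boundary_lin]])
  fix xs assume xs: "xs \<in> lists S_pos"
  have g: "good xs" by (rule S_pos_good[OF xs])
  have ft: "face_term xs \<in> {1..bar_dim xs} \<rightarrow> carrier SC.T" using face_term_closed[OF g] by auto
  have "iota (cobar_diff R SC (SC.E xs)) = (\<Oplus>\<^bsub>QC.K\<^esub>i\<in>{1..bar_dim xs}. iota (face_term xs i))"
    unfolding tw_S_pos[OF xs, symmetric] cobar_diff_tw[OF g]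
    by (rule lin_finsum[OF SC.TD(1) QC.K_module iota_lin ft])
  also have "\<dots> = (\<Oplus>\<^bsub>QC.K\<^esub>i\<in>{1..bar_dim xs}. QC.boundary_term (bar_dim xs) (bar_word X xs) i)"
  proof (rule QC.K.finsum_cong'[OF HOL.refl])
    show "QC.boundary_term (bar_dim xs) (bar_word X xs) \<in> {1..bar_dim xs} \<rightarrow> carrier QC.K"
      using QC.boundary_term_closed[OF good_cube[OF g]] by auto
    fix i assume "i \<in> {1..bar_dim xs}"
    then have i: "1 \<le> i" "i \<le> bar_dim xs" by auto
    note F = simplex_face_good[OF g i]
    note T = tw_closed[OF F(1)]
    have "iota (tw (simplex_face X eps i xs)) = QC.cls (bar_dim xs - 1) (cface Q eps (bar_dim xs) i (bar_word X xs))" for eps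
      using iota_tw[OF F(1)[of eps]] F(2)[of eps] F(3)[of eps "bar_dim xs"] by simp
    then show "iota (face_term xs i) = QC.boundary_term (bar_dim xs) (bar_word X xs) i"
      unfolding face_term_def QC.boundary_term_def
      by (simp only: lin_smult[OF iota_lin sgn(1) SC.T.minus_closed[OF T T]]
          lin_minus[OF SC.TD(1) QC.K_module iota_lin T T])
  qed
  also have "\<dots> = cube_boundary R Q (iota (SC.E xs))"
    unfolding iota_E[OF xs] by (rule QC.cube_boundary_cls[OF good_cube[OF g], symmetric])
  finally show "iota (cobar_diff R SC (SC.E xs)) = cube_boundary R Q (iota (SC.E xs))" .
qed

lemma iota_hcomp: "iota ` cobar_hcomp R SC n = hcomp (cube_chains R Q) n"
proof -
  let ?L = "{xs \<in> lists S_pos. SC.word_deg xs = n}"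
  let ?S = "{p \<in> QC.all_cubes. fst p = n}"
  have sub: "SC.E ` ?L \<subseteq> carrier SC.T" using SC.TD(2) by blast
  have "iota ` cobar_hcomp R SC n = gen_submodule R QC.K (iota ` SC.E ` ?L)"
    unfolding SC.cobar_hcomp_eq by (rule lin_image_gen_submodule[OF SC.TD(1) QC.K_module iota_lin sub])
  also have "iota ` SC.E ` ?L = (\<lambda>p. QC.cls (fst p) (snd p)) ` cube_of ` ?L"
    unfolding image_image by (rule image_cong) (simp_all add: iota_E)
  also have "cube_of ` ?L = ?S - QC.degenerate_cubes"
  proof -
    have "cube_of ` lists S_pos = QC.all_cubes - QC.degenerate_cubes"
      using bar_word_bij by (simp add: bij_betw_def)
    then have "{p \<in> cube_of ` lists S_pos. fst p = n} =
        {p \<in> QC.all_cubes - QC.degenerate_cubes. fst p = n}" by (rule arg_cong)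
    moreover have "cube_of ` ?L =
        {p \<in> cube_of ` lists S_pos. fst p = n}"
    proof -
      have "f ` {x \<in> L. g x = n} = {p \<in> f ` L. fst p = n}"
        if "\<And>x. fst (f x) = g x" for f :: "(nat \<times> 'a) list \<Rightarrow> nat \<times> 'a letter list set" and g L
        using that by auto
      from this[of "cube_of" bar_dim "lists S_pos"] show ?thesis
        by (simp only: word_deg_bar_dim fst_conv)
    qed
    moreover have "{p \<in> QC.all_cubes - QC.degenerate_cubes. fst p = n} = ?S - QC.degenerate_cubes" by blast
    ultimately show ?thesis by simp
  qed
  also have "gen_submodule R QC.K ((\<lambda>p. QC.cls (fst p) (snd p)) ` (?S - QC.degenerate_cubes)) =
      gen_submodule R QC.K ((\<lambda>p. QC.cls (fst p) (snd p)) ` ?S)"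
    by (rule gen_submodule_image_quot[OF QC.K_quot QC.degenerate_subset QC.cube_relations_eq,
          folded cube_module_def, unfolded QC.cls_eq, symmetric]) blast
  also have "(\<lambda>p. QC.cls (fst p) (snd p)) ` ?S = {QC.cls n a | a. a \<in> cubes Q n}"
    by (auto simp: image_iff)
  finally show ?thesis by simp
qed

lemma iota_dg_iso: "dg_iso R (cobar R SC) (cube_chains R Q) iota"
  unfolding dg_iso_def
proof (intro conjI)
  show "iota \<in> linear_maps R (cobar R SC) (cube_chains R Q)" by (rule iota_linear_maps)
  show "bij_betw iota (carrier (cobar R SC)) (carrier (cube_chains R Q))" using iota_bij by simp
  show "\<forall>n. iota ` hcomp (cobar R SC) n = hcomp (cube_chains R Q) n"
    by (simp only: cobar_simps iota_hcomp HOL.simp_thms)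
  show "diff (cobar R SC) \<in> carrier (cobar R SC) \<rightarrow> carrier (cobar R SC)"
    using lin_closed[OF SC.lin_cobar_diff] by simp
  show "diff (cube_chains R Q) \<in> carrier (cube_chains R Q) \<rightarrow> carrier (cube_chains R Q)"
    using lin_closed[OF QC.cube_boundary_lin] by simp
  show "\<forall>x\<in>carrier (cobar R SC). iota (diff (cobar R SC) x) = diff (cube_chains R Q) (iota x)"
    using iota_diff by simp
qed

lemma simplex_list_good: "simplex_list X xs \<Longrightarrow> good xs"
  unfolding good_iff by (fastforce simp: simplex_list_def)

lemma S_pos_simplex_list: "xs \<in> lists S_pos \<Longrightarrow> simplex_list X xs"
  unfolding simplex_list_def
proof (rule ballI)
  fix p assume "xs \<in> lists S_pos" "p \<in> set xs"
  from lists_S_posD[OF this] show "case p of (n, x) \<Rightarrow> 2 \<le> n \<and> x \<in> simp X n" by (simp add: case_prod_unfold)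
qed

text \<open>The prescribed values include all basis words, so only one linear map can satisfy the
  description.\<close>

lemma loop_ident_eq: "loop_ident R X = iota"
  unfolding loop_ident_def
proof (rule the_equality)
  show "dg_iso R (cobar R SC) (cube_chains R Q) iota \<and>
      (\<forall>xs. simplex_list X xs \<longrightarrow>
        iota (cobar_word R X xs) = cube_class R Q (bar_dim xs) (bar_word X xs))"
    using iota_dg_iso iota_tw[OF simplex_list_good] by (simp add: cobar_word_tw)
  fix f assume f: "dg_iso R (cobar R SC) (cube_chains R Q) f \<and>
      (\<forall>xs. simplex_list X xs \<longrightarrow>
        f (cobar_word R X xs) = cube_class R Q (bar_dim xs) (bar_word X xs))"
  have "f \<in> linear_maps R (cobar R SC) (cube_chains R Q)" using f by (simp add: dg_iso_def)
  then have f1: "f \<in> linear_maps R SC.T QC.K" by (simp add: linear_maps_def)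
  have i1: "iota \<in> linear_maps R SC.T QC.K" using iota_linear_maps by (simp add: linear_maps_def)
  show "f = iota"
  proof (rule linear_maps_eqI[OF SC.TD(1) QC.K_module f1 i1 SC.TD(3) equalityD2[OF SC.TD(4)]])
    fix s assume "s \<in> SC.E ` lists S_pos"
    then obtain xs where xs: "xs \<in> lists S_pos" "s = SC.E xs" by blast
    have "s = cobar_word R X xs"
      using cobar_word_tw[OF S_pos_simplex_list[OF xs(1)]] tw_S_pos[OF xs(1)] xs(2) by simp
    then show "f s = iota s"
      using f S_pos_simplex_list[OF xs(1)] iota_E[OF xs(1)] xs(2) by simp
  qed
qed

end

section \<open>Signs of elementary shuffles\<close>

lemma neg_one_pow_parity:
  assumes "cring R"
  shows "neg_one_pow R k = (if even k then \<one>\<^bsub>R\<^esub> else \<ominus>\<^bsub>R\<^esub> \<one>\<^bsub>R\<^esub>)"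
proof (induction k)
  case (Suc k)
  interpret R: cring R by fact
  show ?case using Suc by (simp add: neg_one_pow_facts(4)[OF assms])
qed (simp add: neg_one_pow_facts(2)[OF assms])

lemma sorted_list_of_set_interval: "sorted_list_of_set {1..n} = [1..<Suc n]"
  by (metis atLeastLessThanSuc_atLeastAtMost sorted_list_of_set_range)

lemma sorted_list_of_set_remove:
  assumes "1 \<le> j" "j \<le> n"
  shows "sorted_list_of_set ({1..n} - {j}) = [1..<j] @ [Suc j..<Suc n]"
proof -
  have "set ([1..<j] @ [Suc j..<Suc n]) = {1..n} - {j}" using assms by auto
  moreover have "sorted ([1..<j] @ [Suc j..<Suc n])" "distinct ([1..<j] @ [Suc j..<Suc n])"
    by (auto simp: sorted_append)
  ultimately show ?thesis using sorted_list_of_set.idem_if_sorted_distinct by metis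
qed

lemma shuff_trivial:
  "shuff R {1..n} {} = \<one>\<^bsub>R\<^esub>" "shuff R {} {1..n} = \<one>\<^bsub>R\<^esub>"
proof -
  have "shuff_perm {1..n} {} = id" "shuff_perm {} {1..n} = id"
    by (auto simp: shuff_perm_def Let_def fun_eq_iff sorted_list_of_set_interval[unfolded One_nat_def] simp del: upt_Suc)
  then show "shuff R {1..n} {} = \<one>\<^bsub>R\<^esub>" "shuff R {} {1..n} = \<one>\<^bsub>R\<^esub>" by (simp_all add: shuff_def)
qed

lemma sign_transpose_comp:
  assumes "permutation p"
  shows "permutation (transpose j (Suc j) \<circ> p)" "sign (transpose j (Suc j) \<circ> p) = - sign p"
  using assms by (simp_all add: permutation_compose permutation_swap_id sign_compose sign_swap_id)

text \<open>The shuffle is a cycle of length \<open>j\<close>, a product of \<open>j - 1\<close>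
  adjacent transpositions.\<close>

lemma shuff_singleton_left:
  assumes R: "cring R" and j: "1 \<le> j" "j \<le> n"
  shows "shuff R {j} ({1..n} - {j}) = neg_one_pow R (j - 1)"
proof -
  \<comment> \<open>The cycle that brings \<open>j\<close> to the front. Raising \<open>j\<close> by
    one composes it with one adjacent transposition.\<close>
  let ?c = "\<lambda>j i. if i = 1 then j else if 2 \<le> i \<and> i \<le> j then i - 1 else (i::nat)"
  have c: "permutation (?c (Suc k)) \<and> sign (?c (Suc k)) = (- 1) ^ k" for k
  proof (induction k)
    case 0
    have "?c (Suc 0) = id" by (auto simp: fun_eq_iff)
    then show ?case by (simp add: permutation_id)
  next
    case (Suc k)
    have "?c (Suc (Suc k)) = transpose (Suc k) (Suc (Suc k)) \<circ> ?c (Suc k)"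
      by (auto simp: fun_eq_iff transpose_def)
    then show ?case using Suc sign_transpose_comp[of "?c (Suc k)" "Suc k"] by simp
  qed
  have "shuff_perm {j} ({1..n} - {j}) i = ?c j i" for i
  proof -
    have l: "sorted_list_of_set {j} @ sorted_list_of_set ({1..n} - {j}) = j # [1..<j] @ [Suc j..<Suc n]"
      using sorted_list_of_set_remove[OF j] by simp
    have len: "length (j # [1..<j] @ [Suc j..<Suc n]) = n" using j by simp
    have "(j # [1..<j] @ [Suc j..<Suc n]) ! (i - 1) = ?c j i" if "1 \<le> i" "i \<le> n"
      using that j by (auto simp: nth_Cons' nth_append simp del: upt_Suc)
    then show ?thesis unfolding shuff_perm_def l Let_def len using j by auto
  qed
  then have "shuff_perm {j} ({1..n} - {j}) = ?c j" by blast
  moreover have "Suc (j - 1) = j" using j by simp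
  ultimately have "sign (shuff_perm {j} ({1..n} - {j})) = (- 1) ^ (j - 1)"
    using c[of "j - 1"] by (simp only:)
  then show ?thesis
    by (simp add: shuff_def neg_one_pow_parity[OF R] minus_one_power_iff)
qed

text \<open>The shuffle is a cycle of length \<open>n - j + 1\<close>, a product of
  \<open>n - j\<close> adjacent transpositions.\<close>

lemma shuff_singleton_right:
  assumes R: "cring R" and j: "1 \<le> j" "j \<le> n"
  shows "shuff R ({1..n} - {j}) {j} = neg_one_pow R (n - j)"
proof -
  \<comment> \<open>The cycle that sends \<open>j\<close> to the end. The induction starts from the
    identity at \<open>j = n\<close> and lowers \<open>j\<close>.\<close>
  let ?d = "\<lambda>j i. if i < j \<or> n < i then i else if i < n then Suc i else (j::nat)"
  have d: "k < n \<Longrightarrow> permutation (?d (n - k)) \<and> sign (?d (n - k)) = (- 1) ^ k" for k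
  proof (induction k)
    case 0
    have "?d n = id" by (auto simp: fun_eq_iff)
    then show ?case by (simp only: minus_nat.diff_0 sign_id permutation_id power_0)
  next
    case (Suc k)
    have e: "n - k = Suc (n - Suc k)" using Suc.prems by simp
    have "?d (n - Suc k) = transpose (n - Suc k) (n - k) \<circ> ?d (n - k)"
      unfolding e using Suc.prems by (auto simp: fun_eq_iff transpose_def)
    then show ?case using Suc sign_transpose_comp[of "?d (n - k)" "n - Suc k"] unfolding e by simp
  qed
  have "shuff_perm ({1..n} - {j}) {j} i = ?d j i" for i
  proof -
    have l: "sorted_list_of_set ({1..n} - {j}) @ sorted_list_of_set {j} = [1..<j] @ [Suc j..<Suc n] @ [j]"
      using sorted_list_of_set_remove[OF j] by simp
    have len: "length ([1..<j] @ [Suc j..<Suc n] @ [j]) = n" using j by simp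
    have "([1..<j] @ [Suc j..<Suc n] @ [j]) ! (i - 1) = ?d j i" if "1 \<le> i" "i \<le> n"
      using that j by (auto simp: nth_append nth_Cons' simp del: upt_Suc)
    then show ?thesis unfolding shuff_perm_def l Let_def len using j by auto
  qed
  then have "shuff_perm ({1..n} - {j}) {j} = ?d j" by blast
  moreover have "n - (n - j) = j" "n - j < n" using j by simp_all
  ultimately have "sign (shuff_perm ({1..n} - {j}) {j}) = (- 1) ^ (n - j)"
    using d[of "n - j"] by (simp only:)
  then show ?thesis
    by (simp add: shuff_def neg_one_pow_parity[OF R] minus_one_power_iff)
qed

section \<open>The coalgebra structure on the cobar construction\<close>

context simplicial_chains
begin

abbreviation "kappa \<equiv> inv_into (carrier SC.T) iota"
abbreviation "CT \<equiv> cobar_coalgebra R X"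
abbreviation "TT \<equiv> tensor_prod R SC.T SC.T"
abbreviation "tens \<equiv> tensor R SC.T SC.T"
abbreviation "proper n \<equiv> {A. A \<noteq> {} \<and> A \<subset> {1..n::nat}}"

definition kc :: "nat \<Rightarrow> 'a letter list set \<Rightarrow> ((nat \<times> 'a \<Rightarrow> 'r) set list \<Rightarrow> 'r) set" where
  "kc n a = kappa (QC.cls n a)"

lemma kappa_lin: "lin R QC.K SC.T kappa"
  by (rule lin_inv_into[OF SC.TD(1) QC.K_module iota_lin iota_bij])

lemma kappa_iota: "x \<in> carrier SC.T \<Longrightarrow> kappa (iota x) = x"
  using iota_bij by (simp add: bij_betw_def)

lemma iota_kappa: "x \<in> carrier QC.K \<Longrightarrow> iota (kappa x) = x"
  using iota_bij by (simp add: bij_betw_def f_inv_into_f)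

lemma kc_closed: "a \<in> cubes Q n \<Longrightarrow> kc n a \<in> carrier SC.T"
  unfolding kc_def by (rule lin_closed[OF kappa_lin QC.cls_closed])

lemma kc_bar_word: "good xs \<Longrightarrow> kc (bar_dim xs) (bar_word X xs) = tw xs"
  unfolding kc_def by (metis iota_tw kappa_iota tw_closed)

lemma kc_hcomp: "a \<in> cubes Q n \<Longrightarrow> kc n a \<in> cobar_hcomp R SC n"
proof -
  assume a: "a \<in> cubes Q n"
  have "QC.cls n a \<in> {QC.cls n a | a. a \<in> cubes Q n}" using a by blast
  then have "QC.cls n a \<in> hcomp (cube_chains R Q) n"
    unfolding cube_chains_simps by (rule subsetD[OF gen_submodule_incl])
  then obtain x where "x \<in> cobar_hcomp R SC n" "QC.cls n a = iota x" using iota_hcomp by blast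
  moreover have "x \<in> carrier SC.T" using SC.cobar_hcomp_closed calculation(1) by blast
  ultimately show ?thesis unfolding kc_def using kappa_iota by simp
qed

lemma cobar_coalgebra_simps [simp]:
  "carrier CT = carrier SC.T" "add CT = add SC.T" "zero CT = zero SC.T" "smult CT = smult SC.T"
  "mult CT = mult SC.T" "one CT = one SC.T"
  "hcomp CT n = cobar_hcomp R SC n" "diff CT = cobar_diff R SC"
  "coprod CT w = tensor_map R (cube_chains R Q) (cobar R SC) kappa (cube_coprod R Q (iota w))"
  "coaug CT = kappa (QC.cls 0 (THE a. a \<in> cubes Q 0))"
  by (simp_all add: cobar_coalgebra_def Let_def loop_ident_eq cobar_def module.extend_def
      dg_module.extend_def dg_module.fields_def dg_coalgebra.fields_def)

lemma same_module_CT: "same_module SC.T CT"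
  by (simp add: same_module_def)

lemma CT_module: "module R CT" by (rule same_module_module[OF same_module_CT SC.TD(1)])

lemma CT_tensor: "tensor_prod R CT CT = TT" "tensor R CT CT = tens"
  by (rule same_module_tensor[OF same_module_CT, symmetric])+

lemma TT_module: "module R TT" by (rule module_tensor_prod[OF SC.TD(1) SC.TD(1)])

sublocale TT: module R TT by (rule TT_module)

lemma tens_closed: "x \<in> carrier SC.T \<Longrightarrow> y \<in> carrier SC.T \<Longrightarrow> tens x y \<in> carrier TT"
  by (rule tensor_closed[OF SC.TD(1) SC.TD(1)])

lemma tensor_map_kappa:
  shows tensor_map_kappa_lin: "lin R QC.KK TT (tensor_map R (cube_chains R Q) (cobar R SC) kappa)"
    and tensor_map_kappa_tensor: "x \<in> carrier QC.K \<Longrightarrow> y \<in> carrier QC.K \<Longrightarrow>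
      tensor_map R (cube_chains R Q) (cobar R SC) kappa (tensor R QC.K QC.K x y) = tens (kappa x) (kappa y)"
proof -
  note mK = same_module_module[OF same_module_cube_chains[of R Q] QC.K_module]
  note mT = same_module_module[OF same_module_cobar[of R SC] SC.TD(1)]
  have l: "lin R (cube_chains R Q) (cobar R SC) kappa"
    using kappa_lin by (simp add: lin_def)
  note F = tensor_map_facts[OF mK mT l]
  note tK = same_module_tensor[OF same_module_cube_chains[of R Q], symmetric]
    and tT = same_module_tensor[OF same_module_cobar[of R SC], symmetric]
  show "lin R QC.KK TT (tensor_map R (cube_chains R Q) (cobar R SC) kappa)"
    using F(1) by (simp add: linear_maps_iff tK tT)
  show "x \<in> carrier QC.K \<Longrightarrow> y \<in> carrier QC.K \<Longrightarrow>
      tensor_map R (cube_chains R Q) (cobar R SC) kappa (tensor R QC.K QC.K x y) = tens (kappa x) (kappa y)"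
    using F(2)[of x y] by (simp add: tK tT)
qed

text \<open>Dimension 0 forces every letter to be a 1-simplex without degeneracies, hence a
  unit.\<close>

lemma cubes_0: "cubes Q 0 = {loop_class X []}"
proof -
  have "loop_eq X u []" if "word_valid X u" "word_dim u = 0" for u
    using that
  proof (induction u)
    case (Cons g u)
    obtain js n x where g: "g = (js, n, x)" by (cases g)
    then have v: "letter_valid X g" "word_valid X u" and d: "letter_dim g = 0" "word_dim u = 0"
      using Cons.prems by (auto simp: word_valid_def word_dim_def)
    have "1 \<le> n" "length js + n \<le> 1" using v(1) d(1) g by (simp_all only: letter_valid.simps letter_dim.simps diff_is_0_eq)
    then have "length js = 0" "n = 1" by linarith+
    then have "js = []" "n = 1" "x \<in> simp X 1" using v g by auto
    then have "loop_eq X ([g] @ u) ([] @ [])"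
      using Cons.IH[OF v(2) d(2)] g by (intro loop_eq.mult) (auto intro: loop_eq.unit[unfolded One_nat_def])
    then show ?case by simp
  qed (simp add: loop_eq.refl)
  then show ?thesis unfolding cubes_loop using loop_class_eqI by fastforce
qed

lemma coaug_CT: "coaug CT = \<one>\<^bsub>SC.T\<^esub>" "a \<in> cubes Q 0 \<Longrightarrow> kc 0 a = \<one>\<^bsub>SC.T\<^esub>"
proof -
  have k: "kc 0 (loop_class X []) = \<one>\<^bsub>SC.T\<^esub>"
    using kc_bar_word[of "[]"] by (simp add: bar_word_plain tw_Nil)
  then show "a \<in> cubes Q 0 \<Longrightarrow> kc 0 a = \<one>\<^bsub>SC.T\<^esub>" by (simp add: cubes_0)
  show "coaug CT = \<one>\<^bsub>SC.T\<^esub>" using k by (simp add: cubes_0 kc_def)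
qed

abbreviation "lface n a A \<equiv> kc (card A) (cface_set Q False ({1..n} - A) n a)"
abbreviation "rface n a A \<equiv> kc (card ({1..n} - A)) (cface_set Q True A n a)"

lemma lface_rface_hcomp:
  assumes "a \<in> cubes Q n" "A \<subseteq> {1..n}"
  shows "lface n a A \<in> cobar_hcomp R SC (card A)" "rface n a A \<in> cobar_hcomp R SC (card ({1..n} - A))"
    "lface n a A \<in> carrier SC.T" "rface n a A \<in> carrier SC.T"
  using QC.face_set_cubes[OF assms] by (blast intro: kc_hcomp kc_closed)+

text \<open>For \<open>A\<close> full or empty one factor is a vertex, that is the unit, and the
  shuffle is trivial; these are the two outer terms. Elsewhere the sign is absorbed into the left
  factor, since the cobar differential expects a sum of plain tensors.\<close>

lemma coprod_CT:
  assumes a: "a \<in> cubes Q n" and n: "0 < n"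
  shows "coprod CT (kc n a) = tens (kc n a) (coaug CT) \<oplus>\<^bsub>TT\<^esub> tens (coaug CT) (kc n a)
    \<oplus>\<^bsub>TT\<^esub> (\<Oplus>\<^bsub>TT\<^esub>A\<in>proper n. tens (shuff R A ({1..n} - A) \<odot>\<^bsub>SC.T\<^esub> lface n a A) (rface n a A))"
proof -
  let ?t = "\<lambda>A. tens (shuff R A ({1..n} - A) \<odot>\<^bsub>SC.T\<^esub> lface n a A) (rface n a A)"
  note sh = shuff_closed[OF R_cring]
  have tc: "?t A \<in> carrier TT" if "A \<subseteq> {1..n}" for A
    using lface_rface_hcomp[OF a that] sh by (intro tens_closed SC.T'.smult_closed)
  have "coprod CT (kc n a) = tensor_map R (cube_chains R Q) (cobar R SC) kappa (\<Oplus>\<^bsub>QC.KK\<^esub>A\<in>Pow {1..n}. QC.coprod_term n a A)"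
    using QC.cube_coprod_cls[OF a] iota_kappa[OF QC.cls_closed[OF a]] by (simp add: kc_def)
  also have "\<dots> = (\<Oplus>\<^bsub>TT\<^esub>A\<in>Pow {1..n}. tensor_map R (cube_chains R Q) (cobar R SC) kappa (QC.coprod_term n a A))"
    by (rule lin_finsum[OF QC.KK_module TT_module tensor_map_kappa_lin]) (use QC.coprod_term_closed[OF a] in auto)
  also have "\<dots> = (\<Oplus>\<^bsub>TT\<^esub>A\<in>Pow {1..n}. ?t A)"
  proof (rule TT.finsum_cong'[OF HOL.refl])
    fix A assume "A \<in> Pow {1..n}"
    then have A: "A \<subseteq> {1..n}" by simp
    note fs = QC.face_set_cubes[OF a A]
    note cl = QC.cls_closed[OF fs(1)] QC.cls_closed[OF fs(2)]
    show "tensor_map R (cube_chains R Q) (cobar R SC) kappa (QC.coprod_term n a A) = ?t A"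
      unfolding QC.coprod_term_def
        lin_smult[OF tensor_map_kappa_lin sh tensor_closed[OF QC.K_module QC.K_module cl]] tensor_map_kappa_tensor[OF cl]
        kc_def[symmetric]
      by (rule lin_smult[OF lin_tensor_left[OF SC.TD(1) SC.TD(1)] sh, symmetric])
         (use lface_rface_hcomp[OF a A] in blast)+
  qed (use tc in auto)
  also have "Pow {1..n} = insert {1..n} (insert {} (proper n))" by auto
  also have "(\<Oplus>\<^bsub>TT\<^esub>A\<in>insert {1..n} (insert {} (proper n)). ?t A) = ?t {1..n} \<oplus>\<^bsub>TT\<^esub> (?t {} \<oplus>\<^bsub>TT\<^esub> (\<Oplus>\<^bsub>TT\<^esub>A\<in>proper n. ?t A))"
  proof -
    have fin: "finite (proper n)" by (rule finite_subset[of _ "Pow {1..n}"]) auto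
    have ne: "{1..n} \<noteq> {}" using n by simp
    have "?t \<in> proper n \<rightarrow> carrier TT" using tc by auto
    then show ?thesis using tc[of "{}"] tc[of "{1..n}"] fin ne
      by (subst TT.finsum_insert, simp, simp, force, force, subst TT.finsum_insert) auto
  qed
  also have "?t {1..n} = tens (kc n a) (coaug CT)"
  proof -
    have "cface_set Q True {1..n} n a \<in> cubes Q 0"
      using QC.face_set_cubes(2)[OF a order_refl] by simp
    then show ?thesis
      using kc_closed[OF a] coaug_CT by (simp add: shuff_trivial[unfolded One_nat_def] shuff_trivial cface_set_def)
  qed
  also have "?t {} = tens (coaug CT) (kc n a)"
  proof -
    have "cface_set Q False {1..n} n a \<in> cubes Q 0"
      using QC.face_set_cubes(1)[OF a empty_subsetI] by simp
    then show ?thesis using coaug_CT by (simp add: shuff_trivial[unfolded One_nat_def] shuff_trivial cface_set_def)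
  qed
  also have "tens (kc n a) (coaug CT) \<oplus>\<^bsub>TT\<^esub> (tens (coaug CT) (kc n a) \<oplus>\<^bsub>TT\<^esub> (\<Oplus>\<^bsub>TT\<^esub>A\<in>proper n. ?t A)) =
     tens (kc n a) (coaug CT) \<oplus>\<^bsub>TT\<^esub> tens (coaug CT) (kc n a) \<oplus>\<^bsub>TT\<^esub> (\<Oplus>\<^bsub>TT\<^esub>A\<in>proper n. ?t A)"
    unfolding coaug_CT(1)
  proof (rule TT.a_assoc[symmetric])
    show "(\<Oplus>\<^bsub>TT\<^esub>A\<in>proper n. ?t A) \<in> carrier TT" by (rule TT.finsum_closed) (use tc in auto)
  qed (intro tens_closed kc_closed[OF a] SC.T.one_closed)+
  finally show ?thesis .
qed

lemma proper_facts:
  assumes "A \<in> proper n"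
  shows "A \<subseteq> {1..n}" "0 < card A" "0 < card ({1..n} - A)" "finite A"
proof -
  show sub: "A \<subseteq> {1..n}" using assms by auto
  then show fin: "finite A" by (rule finite_subset) simp
  show "0 < card A" using assms fin by (auto simp: card_gt_0_iff)
  show "0 < card ({1..n} - A)" using assms by (auto simp: card_gt_0_iff)
qed

lemma coprod_CT_hcomp:
  assumes a: "a \<in> cubes Q n" and A: "A \<in> proper n"
  shows "0 < card A \<and> 0 < card ({1..n} - A) \<and>
    shuff R A ({1..n} - A) \<odot>\<^bsub>SC.T\<^esub> lface n a A \<in> hcomp CT (card A) \<and> rface n a A \<in> hcomp CT (card ({1..n} - A))"
proof -
  note P = proper_facts[OF A]
  note H = lface_rface_hcomp[OF a P(1)]
  have sub: "SC.E ` {bs \<in> lists S_pos. SC.word_deg bs = card A} \<subseteq> carrier SC.T" using SC.TD(2) by blast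
  have "shuff R A ({1..n} - A) \<odot>\<^bsub>SC.T\<^esub> lface n a A \<in> cobar_hcomp R SC (card A)"
    using H(1) unfolding SC.cobar_hcomp_eq
    by (rule gen_submodule_closed(4)[OF SC.TD(1) sub shuff_closed[OF R_cring]])
  then show ?thesis using P H by simp
qed

text \<open>A surviving simplex has dimension at least 3, so each letter contributes at least 2.
  This is how 2-reducedness of the simplicial set becomes 1-reducedness of the loop set.\<close>

lemma bar_dim_ge_2:
  assumes xs: "xs \<in> lists S_pos" "0 < bar_dim xs"
  shows "2 \<le> bar_dim xs"
proof (cases xs)
  case (Cons p ys)
  then show ?thesis using lists_S_posD[OF xs(1), of p] by auto
qed (use xs(2) in simp)

text \<open>Only the coproduct and the coaugmentation are transported; module, degrees and
  differential are those of the first cobar construction, so its basis is used again. The reduced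
  coproduct is indexed by the non-empty proper subsets of the directions.\<close>

sublocale CT: free_graded_coalgebra R CT "lists S_pos" SC.E bar_dim
proof
  show "free_basis R CT (lists S_pos) SC.E"
    by (rule same_module_free_basis[OF same_module_CT SC.basis_T])
  show "hcomp CT n = gen_submodule R CT (SC.E ` {b \<in> lists S_pos. bar_dim b = n})" for n
    using SC.cobar_hcomp_eq[of n]
    by (simp only: cobar_coalgebra_simps word_deg_bar_dim same_module_gen_submodule[OF same_module_CT SC.TD(1)])
  show "lin R CT CT (diff CT)"
    using SC.lin_cobar_diff by (simp add: lin_def)
  show "diff CT (SC.E xs) \<in> carrier (pos_part R CT)" if xs: "xs \<in> lists S_pos" "0 < bar_dim xs" for xs
  proof -
    have g: "good xs" by (rule S_pos_good[OF xs(1)])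
    \<comment> \<open>Degrees start at 2, so the differential of a positive element still has
      positive degree.\<close>
    have d: "0 < bar_dim xs - 1" using bar_dim_ge_2[OF xs] by simp
    have sub: "SC.E ` {bs \<in> lists S_pos. SC.word_deg bs = bar_dim xs - 1} \<subseteq> carrier SC.T" using SC.TD(2) by blast
    have H: "submodule (cobar_hcomp R SC (bar_dim xs - 1)) R SC.T"
      unfolding SC.cobar_hcomp_eq by (rule gen_submodule_submodule[OF SC.TD(1) sub])
    have Hm: "x \<ominus>\<^bsub>SC.T\<^esub> y \<in> cobar_hcomp R SC (bar_dim xs - 1)"
      if "x \<in> cobar_hcomp R SC (bar_dim xs - 1)" "y \<in> cobar_hcomp R SC (bar_dim xs - 1)" for x y
      using SC.T'.submoduleE(3,5)[OF H] that by (simp add: a_minus_def)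
    have "face_term xs i \<in> cobar_hcomp R SC (bar_dim xs - 1)" if "i \<in> {1..bar_dim xs}" for i
    proof -
      have i: "1 \<le> i" "i \<le> bar_dim xs" using that by auto
      have "tw (simplex_face X eps i xs) \<in> cobar_hcomp R SC (bar_dim xs - 1)" for eps
        using tw_hcomp[OF simplex_face_good(1)[OF g i]] simplex_face_good(2)[OF g i] by simp
      then show ?thesis unfolding face_term_def
        by (intro SC.T'.submoduleE(4)[OF H sgn(1)] Hm)
    qed
    then have "cobar_diff R SC (SC.E xs) \<in> cobar_hcomp R SC (bar_dim xs - 1)"
      unfolding tw_S_pos[OF xs(1), symmetric] cobar_diff_tw[OF g]
      by (intro finsum_gen_submodule[OF SC.TD(1) H])
    moreover have "carrier (pos_part R CT) = gen_submodule R CT (\<Union>n\<in>{0<..}. hcomp CT n)"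
      by (simp add: pos_part_def)
    moreover have "hcomp CT (bar_dim xs - 1) \<subseteq> (\<Union>n\<in>{0<..}. hcomp CT n)" using d by blast
    ultimately show ?thesis using gen_submodule_incl[of "\<Union>n\<in>{0<..}. hcomp CT n" R CT] by auto
  qed
  show "lin R CT (tensor_prod R CT CT) (coprod CT)"
    unfolding CT_tensor same_module_lin(1)[OF same_module_CT, symmetric]
    using lin_comp[OF iota_lin lin_comp[OF QC.cube_coprod_lin tensor_map_kappa_lin]] by (simp add: lin_def Pi_iff)
  show "coaug CT \<in> hcomp CT 0"
    using tw_hcomp[of "[]"] unfolding coaug_CT(1) by (simp add: tw_Nil)
  show "\<exists>(k::nat) p q l r. (\<forall>t<k. 0 < p t \<and> 0 < q t \<and> l t \<in> hcomp CT (p t) \<and> r t \<in> hcomp CT (q t)) \<and>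
        coprod CT (SC.E xs) = tensor R CT CT (SC.E xs) (coaug CT) \<oplus>\<^bsub>tensor_prod R CT CT\<^esub> tensor R CT CT (coaug CT) (SC.E xs)
          \<oplus>\<^bsub>tensor_prod R CT CT\<^esub> (\<Oplus>\<^bsub>tensor_prod R CT CT\<^esub>t\<in>{..<k}. tensor R CT CT (l t) (r t))"
    if xs: "xs \<in> lists S_pos" "0 < bar_dim xs" for xs
  proof -
    have g: "good xs" by (rule S_pos_good[OF xs(1)])
    have E: "SC.E xs = kc (bar_dim xs) (bar_word X xs)"
      using kc_bar_word[OF g] tw_S_pos[OF xs(1)] by simp
    show ?thesis
    proof (rule coprod_reduced_finite[OF CT_module])
      show "finite (proper (bar_dim xs))" by (rule finite_subset[of _ "Pow {1..bar_dim xs}"]) auto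
      show "hcomp CT n \<subseteq> carrier CT" for n using SC.cobar_hcomp_closed by simp
      show "coprod CT (SC.E xs) = tensor R CT CT (SC.E xs) (coaug CT) \<oplus>\<^bsub>tensor_prod R CT CT\<^esub> tensor R CT CT (coaug CT) (SC.E xs)
          \<oplus>\<^bsub>tensor_prod R CT CT\<^esub> (\<Oplus>\<^bsub>tensor_prod R CT CT\<^esub>A\<in>proper (bar_dim xs). tensor R CT CT
            (shuff R A ({1..bar_dim xs} - A) \<odot>\<^bsub>SC.T\<^esub> lface (bar_dim xs) (bar_word X xs) A) (rface (bar_dim xs) (bar_word X xs) A))"
        unfolding CT_tensor E by (rule coprod_CT[OF good_cube[OF g] xs(2)])
    qed (rule coprod_CT_hcomp[OF good_cube[OF g]])
  qed
qed

end

section \<open>Multipermutahedral words and their chains\<close>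

text \<open>The bound \<open>2 \<le> r\<close> matters: the 1-cube is the degeneracy of a vertex,
  but its desuspension is the unit of the monoid and must survive.\<close>

fun cell_degenerate :: "'q cset \<Rightarrow> 'q perm_cell \<Rightarrow> bool" where
  "cell_degenerate Q (Cube r a) \<longleftrightarrow> 2 \<le> r \<and> cube_degenerate Q r a"
| "cell_degenerate Q (Rho M N u s b) \<longleftrightarrow> True"

definition cells_degenerate :: "'q cset \<Rightarrow> 'q perm_cell list \<Rightarrow> bool" where
  "cells_degenerate Q w \<longleftrightarrow> (\<exists>c\<in>set w. cell_degenerate Q c)"

abbreviation "nonunit \<equiv> filter (\<lambda>c. cell_size c \<noteq> 1)"
abbreviation "cube_cells \<equiv> map (\<lambda>(r, a). Cube r a)"

lemma cells_simps [simp]: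
  "cells_valid Q []" "cells_valid Q (c # w) \<longleftrightarrow> cell_valid Q c \<and> cells_valid Q w"
  "cells_valid Q (u @ v) \<longleftrightarrow> cells_valid Q u \<and> cells_valid Q v"
  "\<not> cells_degenerate Q []" "cells_degenerate Q (c # w) \<longleftrightarrow> cell_degenerate Q c \<or> cells_degenerate Q w"
  "cells_degenerate Q (u @ v) \<longleftrightarrow> cells_degenerate Q u \<or> cells_degenerate Q v"
  "cells_degree [] = 0" "cells_degree (c # w) = cell_size c - 1 + cells_degree w"
  "cells_degree (u @ v) = cells_degree u + cells_degree v"
  by (auto simp: cells_valid_def cells_degenerate_def cells_degree_def)

lemma cell_size_pos: "cell_valid Q c \<Longrightarrow> 1 \<le> cell_size c"
  by (induction c) auto

locale perm_set = cubical_set Q for Q :: "'q cset" +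
  fixes e assumes unit_cube: "cubes Q 1 = {e}"
begin

text \<open>The rule \<open>unit\<close> only removes a cell of size 1, which \<open>nonunit\<close>
  ignores. The other defining relations have a degenerate word on each side, either through
  \<open>Rho\<close> or through a degenerate cube of dimension at least 2.\<close>

lemma perm_eq_invariant:
  "perm_eq Q u v \<Longrightarrow> cells_valid Q u \<and> cells_valid Q v \<and> cells_degree u = cells_degree v \<and>
    (cells_degenerate Q u \<longleftrightarrow> cells_degenerate Q v) \<and> (\<not> cells_degenerate Q u \<longrightarrow> nonunit u = nonunit v)"
proof (induction rule: perm_eq.induct)
  case (rho u u' M N s b)
  then have "cell_valid Q u" "cell_valid Q u'" "cell_size u - 1 = cell_size u' - 1" by auto
  \<comment> \<open>Equal degrees give equal sizes only because sizes are at least 1 under truncated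
    subtraction.\<close>
  then have "cell_size u = cell_size u'" using cell_size_pos[of Q u] cell_size_pos[of Q u'] by simp
  then show ?case using rho by auto
next
  case (unit_left e' r a j)
  then have "cube_degenerate Q (Suc r) (cdegen Q r j a)" "cdegen Q r j a \<in> cubes Q (Suc r)"
    using cdegen_closed[of a r j] unfolding cube_degenerate_def by auto
  then show ?case using unit_left by (auto simp: card_Diff_singleton)
next
  case (unit_right e' r a j)
  then have "cube_degenerate Q (Suc r) (cdegen Q r j a)" "cdegen Q r j a \<in> cubes Q (Suc r)"
    using cdegen_closed[of a r j] unfolding cube_degenerate_def by auto
  then show ?case using unit_right by (auto simp: card_Diff_singleton)
next
  case (shift e' r a s b)
  then show ?case by (auto simp: card_Diff_singleton)
qed (auto simp: Int_commute Un_commute)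

lemma perm_class_eqI: "perm_eq Q u v \<Longrightarrow> perm_class Q u = perm_class Q v"
  unfolding perm_class_def by (blast intro: perm_eq.sym perm_eq.trans)

lemma perm_class_eqD: "cells_valid Q v \<Longrightarrow> perm_class Q u = perm_class Q v \<Longrightarrow> perm_eq Q u v"
  using perm_eq.refl[of Q v] by (auto simp: perm_class_def)

lemma perm_monoid_carrier: "perm_class Q u \<in> carrier (perm_monoid Q)" if "cells_valid Q u"
  using that by (auto simp: perm_monoid_def)

lemma perm_monoid_mult:
  assumes "cells_valid Q u" "cells_valid Q v"
  shows "perm_class Q u \<otimes>\<^bsub>perm_monoid Q\<^esub> perm_class Q v = perm_class Q (u @ v)"
proof -
  have *: "perm_class Q (u' @ v') = perm_class Q (u @ v)" if "u' \<in> perm_class Q u" "v' \<in> perm_class Q v" for u' v'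
    using perm_class_eqI[OF perm_eq.mult, of u u' v v'] that unfolding perm_class_def[of _ u] perm_class_def[of _ v] by simp
  have ne: "perm_class Q u \<noteq> {}" "perm_class Q v \<noteq> {}"
    unfolding perm_class_def using perm_eq.refl[OF assms(1)] perm_eq.refl[OF assms(2)] by blast+
  have "(\<Union>u'\<in>perm_class Q u. \<Union>v'\<in>perm_class Q v. perm_class Q (u' @ v')) =
      (\<Union>u'\<in>perm_class Q u. \<Union>v'\<in>perm_class Q v. perm_class Q (u @ v))"
    by (intro SUP_cong HOL.refl *)
  then show ?thesis using ne by (simp add: perm_monoid_def)
qed

lemma monoid_perm_monoid: "monoid (perm_monoid Q)"
proof -
  have ex: "\<exists>u. cells_valid Q u \<and> x = perm_class Q u" if "x \<in> carrier (perm_monoid Q)" for x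
    using that by (auto simp: perm_monoid_def)
  have one: "\<one>\<^bsub>perm_monoid Q\<^esub> = perm_class Q []" by (simp add: perm_monoid_def)
  show ?thesis
  proof (rule monoidI)
    fix x y assume "x \<in> carrier (perm_monoid Q)" "y \<in> carrier (perm_monoid Q)"
    then obtain u v where uv: "cells_valid Q u" "x = perm_class Q u" "cells_valid Q v" "y = perm_class Q v"
      using ex by metis
    show "x \<otimes>\<^bsub>perm_monoid Q\<^esub> y \<in> carrier (perm_monoid Q)"
      using uv by (simp add: perm_monoid_mult perm_monoid_carrier)
    show "\<one>\<^bsub>perm_monoid Q\<^esub> \<otimes>\<^bsub>perm_monoid Q\<^esub> x = x" "x \<otimes>\<^bsub>perm_monoid Q\<^esub> \<one>\<^bsub>perm_monoid Q\<^esub> = x"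
      using uv unfolding one by (simp_all add: perm_monoid_mult)
    fix z assume "z \<in> carrier (perm_monoid Q)"
    then obtain w where "cells_valid Q w" "z = perm_class Q w" using ex by metis
    then show "x \<otimes>\<^bsub>perm_monoid Q\<^esub> y \<otimes>\<^bsub>perm_monoid Q\<^esub> z = x \<otimes>\<^bsub>perm_monoid Q\<^esub> (y \<otimes>\<^bsub>perm_monoid Q\<^esub> z)"
      using uv by (simp add: perm_monoid_mult)
  qed (simp add: one perm_monoid_carrier)
qed

lemma perm_degenerate_iff:
  assumes w: "cells_valid Q w"
  shows "perm_class Q w \<in> perm_degenerate Q \<longleftrightarrow> cells_degenerate Q w"
proof
  assume "perm_class Q w \<in> perm_degenerate Q"
  then obtain u v M N c s b where d: "perm_class Q w = perm_class Q (u @ [Rho M N c s b] @ v)"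
      "cells_valid Q (u @ [c, Cube s b] @ v)" "cell_valid Q (Rho M N c s b)"
    unfolding perm_degenerate_def by blast
  then have "perm_eq Q w (u @ [Rho M N c s b] @ v)" by (intro perm_class_eqD) auto
  from perm_eq_invariant[OF this] show "cells_degenerate Q w" by simp
next
  assume "cells_degenerate Q w"
  then obtain c where c: "c \<in> set w" "cell_degenerate Q c" unfolding cells_degenerate_def by blast
  then obtain u v where w': "w = u @ [c] @ v" using split_list[of c w] by auto
  show "perm_class Q w \<in> perm_degenerate Q"
  proof (cases c)
    case (Cube r a)
    then obtain m i a' where m: "r = Suc m" "a' \<in> cubes Q m" "1 \<le> i" "i \<le> Suc m" "a = cdegen Q m i a'" "1 \<le> m"
      using c(2) by (auto simp: cube_degenerate_def)
    \<comment> \<open>By \<open>unit_left\<close>, a degenerate cube of dimension at least 2 is the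
      permutahedral degeneracy of the unit and a smaller cube.\<close>
    let ?c = "Rho {i} ({1..Suc m} - {i}) (Cube 1 e) m a'"
    have e: "e \<in> cubes Q 1" using unit_cube by simp
    have "perm_eq Q [?c] [c]" unfolding Cube m(1,5) by (rule perm_eq.unit_left) (use e m in auto)
    from perm_eq.mult[OF perm_eq.refl perm_eq.mult[OF this perm_eq.refl]] w
    have "perm_eq Q (u @ [?c] @ v) w" unfolding w' by simp
    moreover have "cells_valid Q (u @ [Cube 1 e, Cube m a'] @ v)" "cell_valid Q ?c"
      using w m e unfolding w' by (auto simp: card_Diff_singleton)
    ultimately show ?thesis unfolding perm_degenerate_def using perm_class_eqI by blast
  next
    case (Rho M N c' s b)
    then have "cells_valid Q (u @ [c', Cube s b] @ v)" "cell_valid Q (Rho M N c' s b)"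
      using w unfolding w' by auto
    then show ?thesis unfolding perm_degenerate_def w' Rho by blast
  qed
qed

lemma perm_eq_nonunit:
  "cells_valid Q w \<Longrightarrow> \<not> cells_degenerate Q w \<Longrightarrow> perm_eq Q w (nonunit w)"
proof (induction w)
  case (Cons c w)
  then obtain r a where c: "c = Cube r a" by (cases c) auto
  have "perm_eq Q [c] (nonunit [c])"
    using Cons.prems c by (auto intro: perm_eq.refl perm_eq.unit[unfolded One_nat_def])
  then have "perm_eq Q ([c] @ w) (nonunit [c] @ nonunit w)"
    using Cons by (intro perm_eq.mult) auto
  then show ?case by (simp split: if_splits)
qed (simp add: perm_eq.refl)

abbreviation "good_cubes \<equiv> {(r, a). 1 \<le> r \<and> a \<in> cubes Q r}"
abbreviation "nondeg_cubes \<equiv> {(r, a). 2 \<le> r \<and> a \<in> cubes Q r \<and> \<not> cube_degenerate Q r a}"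

lemma cube_cells_valid: "cells_valid Q (cube_cells w) \<longleftrightarrow> w \<in> lists good_cubes"
  by (induction w) auto

text \<open>A non-degenerate word consists of cubes only. Removing its units gives the normal form,
  which the invariant recovers from the class.\<close>

lemma perm_class_bij:
  "bij_betw (\<lambda>w. perm_class Q (cube_cells w)) (lists nondeg_cubes) (carrier (perm_monoid Q) - perm_degenerate Q)"
proof -
  have nd: "cells_valid Q (cube_cells w)" "\<not> cells_degenerate Q (cube_cells w)" "nonunit (cube_cells w) = cube_cells w"
    if "w \<in> lists nondeg_cubes" for w
    using that by (induction w) auto
  have inj: "w = w'" if "cube_cells w = cube_cells w'" for w w' :: "(nat \<times> 'q) list"
  proof -
    have "inj (\<lambda>(r, a). Cube r a :: 'q perm_cell)" by (auto simp: inj_def)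
    then show ?thesis using that map_injective by blast
  qed
  have ex: "\<exists>w. w \<in> lists nondeg_cubes \<and> nonunit u = cube_cells w" if "cells_valid Q u" "\<not> cells_degenerate Q u" for u
    using that
  proof (induction u)
    case (Cons c u)
    then obtain w where w: "w \<in> lists nondeg_cubes" "nonunit u = cube_cells w" by auto
    obtain r a where c: "c = Cube r a" using Cons.prems by (cases c) auto
    show ?case
    proof (cases "r = 1")
      case True
      then show ?thesis using w c by (intro exI[of _ w]) simp
    next
      case False
      then have "2 \<le> r" using Cons.prems c by auto
      then show ?thesis using w Cons.prems c by (intro exI[of _ "(r, a) # w"]) simp
    qed
  next
    case Nil
    show ?case by (intro exI[of _ "[]"]) simp
  qed
  show ?thesis
  proof (rule bij_betw_imageI)
    show "inj_on (\<lambda>w. perm_class Q (cube_cells w)) (lists nondeg_cubes)"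
    proof (rule inj_onI)
      fix w w' assume w: "w \<in> lists nondeg_cubes" "w' \<in> lists nondeg_cubes"
        and eq: "perm_class Q (cube_cells w) = perm_class Q (cube_cells w')"
      have "perm_eq Q (cube_cells w) (cube_cells w')" by (rule perm_class_eqD[OF nd(1)[OF w(2)] eq])
      then have "nonunit (cube_cells w) = nonunit (cube_cells w')"
        using perm_eq_invariant nd(2)[OF w(1)] by blast
      then have "cube_cells w = cube_cells w'" unfolding nd(3)[OF w(1)] nd(3)[OF w(2)] .
      then show "w = w'" by (rule inj)
    qed
    show "(\<lambda>w. perm_class Q (cube_cells w)) ` lists nondeg_cubes = carrier (perm_monoid Q) - perm_degenerate Q"
    proof
      show "(\<lambda>w. perm_class Q (cube_cells w)) ` lists nondeg_cubes \<subseteq> carrier (perm_monoid Q) - perm_degenerate Q"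
      proof
        fix x assume "x \<in> (\<lambda>w. perm_class Q (cube_cells w)) ` lists nondeg_cubes"
        then obtain w where "w \<in> lists nondeg_cubes" "x = perm_class Q (cube_cells w)" by (rule imageE)
        then show "x \<in> carrier (perm_monoid Q) - perm_degenerate Q"
          using perm_monoid_carrier[OF nd(1)] perm_degenerate_iff[OF nd(1)] nd(2) by simp
      qed
      show "carrier (perm_monoid Q) - perm_degenerate Q \<subseteq> (\<lambda>w. perm_class Q (cube_cells w)) ` lists nondeg_cubes"
      proof
        fix x assume "x \<in> carrier (perm_monoid Q) - perm_degenerate Q"
        then obtain u where u: "cells_valid Q u" "x = perm_class Q u" "x \<notin> perm_degenerate Q"
          by (auto simp: perm_monoid_def)
        then have nu: "\<not> cells_degenerate Q u" using perm_degenerate_iff by blast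
        from ex[OF u(1) nu] obtain w where "w \<in> lists nondeg_cubes" "nonunit u = cube_cells w" by blast
        then show "x \<in> (\<lambda>w. perm_class Q (cube_cells w)) ` lists nondeg_cubes"
          using perm_class_eqI[OF perm_eq_nonunit[OF u(1) nu]] u(2) by (intro image_eqI) simp_all
      qed
    qed
  qed
qed

end

section \<open>Permutahedral chains as an algebra\<close>

locale perm_chain_set = perm_set Q e for Q :: "'q cset" and e +
  fixes R :: "('r, 'x) ring_scheme"
  assumes R_cring: "cring R"
begin

abbreviation "PM \<equiv> perm_module R Q"
abbreviation "pc \<equiv> perm_chain R Q"

lemma perm_degenerate_sub: "perm_degenerate Q \<subseteq> carrier (perm_monoid Q)"
  by (force simp: perm_degenerate_def perm_monoid_def)

lemmas PM_quot = free_basis_quot[OF free_basis_monoid_algebra[OF R_cring] perm_degenerate_sub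
    perm_relations_def[of R Q], folded perm_module_def]
lemmas basis_PM = PM_quot(1)

text \<open>The relations are introduced as a submodule. A product with a degenerate word is
  degenerate, so they form an ideal and the quotient is an algebra.\<close>

lemma perm_relations_ideal: "ideal (perm_relations R Q) (monoid_algebra R (perm_monoid Q))"
proof -
  let ?A = "monoid_algebra R (perm_monoid Q)" and ?G = "perm_monoid Q" and ?D = "perm_degenerate Q"
  note A = assoc_algebra_monoid_algebra[OF R_cring monoid_perm_monoid]
  note B = free_basis_monoid_algebra[OF R_cring, of ?G]
  note AD = assoc_algebraD[OF A]
  have ex: "\<exists>u. cells_valid Q u \<and> x = perm_class Q u" if "x \<in> carrier ?G" for x
    using that by (auto simp: perm_monoid_def)
  have DG: "a \<otimes>\<^bsub>?G\<^esub> b \<in> ?D" if ab: "a \<in> carrier ?G" "b \<in> carrier ?G" "a \<in> ?D \<or> b \<in> ?D" for a b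
  proof -
    obtain u v where uv: "cells_valid Q u" "a = perm_class Q u" "cells_valid Q v" "b = perm_class Q v"
      using ab ex by metis
    then show ?thesis using ab(3) by (auto simp: perm_monoid_mult perm_degenerate_iff)
  qed
  have sub: "basis_elt R ` ?D \<subseteq> carrier ?A" "basis_elt R ` carrier ?G \<subseteq> carrier ?A"
    using free_basisD(3)[OF B] perm_degenerate_sub by blast+
  have gen: "x \<in> gen_submodule R ?A (basis_elt R ` carrier ?G)" if "x \<in> carrier ?A" for x
    using B that unfolding free_basis_def by blast
  have H: "submodule (perm_relations R Q) R ?A" by (rule PM_quot(4))
  have in_rel: "basis_elt R a \<in> perm_relations R Q" if "a \<in> ?D" for a
    unfolding perm_relations_def by (rule subsetD[OF gen_submodule_incl imageI[OF that]])
  have st: "basis_elt R a \<otimes>\<^bsub>?A\<^esub> basis_elt R b \<in> perm_relations R Q"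
    if "a \<in> carrier ?G" "b \<in> carrier ?G" "a \<in> ?D \<or> b \<in> ?D" for a b
    unfolding monoid_algebra_mult_basis[OF R_cring monoid_perm_monoid that(1,2)] by (rule in_rel[OF DG[OF that]])
  show ?thesis
  proof (rule idealI[OF AD(2) submodule.axioms(1)[OF H]])
    fix a x assume a: "a \<in> perm_relations R Q" and x: "x \<in> carrier ?A"
    note a' = a[unfolded perm_relations_def]
    show "x \<otimes>\<^bsub>?A\<^esub> a \<in> perm_relations R Q"
    proof (rule mult_gen_submodule[OF A sub(2,1) H _ gen[OF x] a'], elim imageE)
      fix s t b c assume "s = basis_elt R b" "t = basis_elt R c" "b \<in> carrier ?G" "c \<in> ?D"
      then show "s \<otimes>\<^bsub>?A\<^esub> t \<in> perm_relations R Q" using st[of b c] subsetD[OF perm_degenerate_sub, of c] by simp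
    qed
    show "a \<otimes>\<^bsub>?A\<^esub> x \<in> perm_relations R Q"
    proof (rule mult_gen_submodule[OF A sub(1,2) H _ a' gen[OF x]], elim imageE)
      fix s t b c assume "s = basis_elt R b" "t = basis_elt R c" "b \<in> ?D" "c \<in> carrier ?G"
      then show "s \<otimes>\<^bsub>?A\<^esub> t \<in> perm_relations R Q" using st[of b c] subsetD[OF perm_degenerate_sub, of b] by simp
    qed
  qed
qed

lemma PM_algebra: "assoc_algebra R PM"
  unfolding perm_module_def
  by (rule assoc_algebra_quot_module[OF assoc_algebra_monoid_algebra[OF R_cring monoid_perm_monoid] perm_relations_ideal])

lemmas PMD = assoc_algebraD[OF PM_algebra]

sublocale PM: ring PM by (rule PMD)
sublocale PM': module R PM by (rule PMD)

lemma basis_closed: "cells_valid Q w \<Longrightarrow> basis_elt R (perm_class Q w) \<in> carrier (monoid_algebra R (perm_monoid Q))"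
  using basis_elt_closed[OF R_cring perm_monoid_carrier] by simp

lemma pc_closed: "cells_valid Q w \<Longrightarrow> pc w \<in> carrier PM"
  unfolding perm_chain_def perm_module_def
  by (rule coset_closed[OF free_basisD(1)[OF free_basis_monoid_algebra[OF R_cring]] PM_quot(4) basis_closed])

lemma pc_append: "cells_valid Q u \<Longrightarrow> cells_valid Q v \<Longrightarrow> pc (u @ v) = pc u \<otimes>\<^bsub>PM\<^esub> pc v"
  unfolding perm_chain_def perm_module_def
  by (simp only: quot_module_mult(1)[OF assoc_algebra_monoid_algebra[OF R_cring monoid_perm_monoid] perm_relations_ideal
        basis_closed basis_closed] monoid_algebra_mult_basis[OF R_cring monoid_perm_monoid perm_monoid_carrier perm_monoid_carrier]
        perm_monoid_mult)

lemma pc_Nil: "pc [] = \<one>\<^bsub>PM\<^esub>"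
  unfolding perm_chain_def perm_module_def
  using quot_module_mult(2)[OF assoc_algebra_monoid_algebra[OF R_cring monoid_perm_monoid] perm_relations_ideal]
  by (simp add: perm_monoid_def)

lemma pc_eq: "perm_eq Q u v \<Longrightarrow> pc u = pc v"
  unfolding perm_chain_def by (simp add: perm_class_eqI)

lemma pc_degenerate: "cells_valid Q w \<Longrightarrow> cells_degenerate Q w \<Longrightarrow> pc w = \<zero>\<^bsub>PM\<^esub>"
  using PM_quot(2)[of "perm_class Q w"] perm_degenerate_iff[of w] by (simp add: perm_chain_def)

text \<open>Words containing a degeneracy vanish, so products of cubes span.\<close>

lemma pc_gen:
  "gen_submodule R PM {pc w | w. cells_valid Q w \<and> P (cells_degree w)} =
   gen_submodule R PM {pc (cube_cells w) | w. w \<in> lists good_cubes \<and> P (cells_degree (cube_cells w))}"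
    (is "gen_submodule R PM ?S = gen_submodule R PM ?T")
proof (rule gen_submodule_eqI[OF PMD(1)])
  show T: "?S \<subseteq> carrier PM" "?T \<subseteq> carrier PM"
    using pc_closed cube_cells_valid by blast+
  show "?S \<subseteq> gen_submodule R PM ?T"
  proof
    fix x assume "x \<in> ?S"
    then obtain w where w: "x = pc w" "cells_valid Q w" "P (cells_degree w)" by blast
    show "x \<in> gen_submodule R PM ?T"
    proof (cases "cells_degenerate Q w")
      case True
      then show ?thesis using w pc_degenerate gen_submodule_closed(2)[OF PMD(1) T(2)] by simp
    next
      case False
      then have "\<exists>v. w = cube_cells v"
      proof (induction w)
        case (Cons c w)
        then obtain v r a where "w = cube_cells v" "c = Cube r a" by (cases c) auto
        then show ?case by (intro exI[of _ "(r, a) # v"]) simp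
      qed auto
      then obtain v where v: "w = cube_cells v" by blast
      have "x \<in> ?T" using w unfolding v cube_cells_valid by - (rule CollectI, rule exI[of _ v], intro conjI)
      then show ?thesis by (rule subsetD[OF gen_submodule_incl])
    qed
  qed
  have "?T \<subseteq> ?S"
  proof
    fix x assume "x \<in> ?T"
    then obtain v where v: "x = pc (cube_cells v)" "cells_valid Q (cube_cells v)" "P (cells_degree (cube_cells v))"
      unfolding cube_cells_valid by (elim CollectE exE conjE)
    show "x \<in> ?S" by (rule CollectI, rule exI[of _ "cube_cells v"], intro conjI v)
  qed
  then show "?T \<subseteq> gen_submodule R PM ?S" by (rule subset_trans[OF _ gen_submodule_incl])
qed

lemma pc_span: "carrier PM = gen_submodule R PM {pc (cube_cells w) | w. w \<in> lists good_cubes}"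
proof -
  have "(\<lambda>b. perm_relations R Q +>\<^bsub>monoid_algebra R (perm_monoid Q)\<^esub> basis_elt R b) ` carrier (perm_monoid Q) =
      {pc w | w. cells_valid Q w \<and> True}"
    by (auto simp: perm_monoid_def perm_chain_def)
  then show ?thesis using PM_quot(5) pc_gen[of "\<lambda>_. True"] by simp
qed

end

text \<open>For \<open>n \<ge> 3\<close> a singleton is never the complement of a singleton, so the
  two families are disjoint. For \<open>n = 2\<close> they coincide, which is why that dimension is
  treated separately below.\<close>

lemma (in abelian_monoid) finsum_split_proper:
  assumes n: "3 \<le> n" and h: "\<And>A. A \<noteq> {} \<Longrightarrow> A \<subset> {1..n::nat} \<Longrightarrow> h A \<in> carrier G"
  shows "(\<Oplus>A\<in>{A. A \<noteq> {} \<and> A \<subset> {1..n}}. h A) =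
    (\<Oplus>A\<in>{A. A \<noteq> {} \<and> A \<subset> {1..n} \<and> 2 \<le> card A \<and> 2 \<le> card ({1..n} - A)}. h A)
      \<oplus> ((\<Oplus>i\<in>{1..n}. h {i}) \<oplus> (\<Oplus>i\<in>{1..n}. h ({1..n} - {i})))"
proof -
  let ?I = "{A. A \<noteq> {} \<and> A \<subset> {1..n} \<and> 2 \<le> card A \<and> 2 \<le> card ({1..n} - A)}"
  let ?S = "(\<lambda>i. {i}) ` {1..n}" and ?C = "(\<lambda>i. {1..n} - {i}) ` {1..n}"
  have cC: "card ({1..n} - {i}) = n - 1" if "i \<in> {1..n}" for i using that by simp
  have card: "card A = 1" if "A \<in> ?S" for A using that by auto
  have card': "card A = n - 1" "card ({1..n} - A) = 1" if A: "A \<in> ?C" for A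
  proof -
    obtain i where i: "i \<in> {1..n}" "A = {1..n} - {i}" using A by blast
    then have "{1..n} - A = {i}" by auto
    then show "card A = n - 1" "card ({1..n} - A) = 1" using i cC by simp_all
  qed
  have p: "A \<noteq> {} \<and> A \<subset> {1..n}" if "A \<in> ?S \<union> ?C" for A
  proof
    have "card A \<noteq> 0" "card A < card {1..n}" using that card card' n by fastforce+
    then show "A \<noteq> {}" "A \<subset> {1..n}" using that by auto
  qed
  have sub: "A \<in> ?I \<union> (?S \<union> ?C)" if A: "A \<noteq> {}" "A \<subset> {1..n}" for A
  proof -
    have f: "finite A" using A finite_subset[of A "{1..n}"] by blast
    consider "card A = 1" | "card ({1..n} - A) = 1" | "2 \<le> card A" "2 \<le> card ({1..n} - A)"
    proof -
      have "card A \<noteq> 0" "card ({1..n} - A) \<noteq> 0" using A f by auto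
      then show ?thesis using that by linarith
    qed
    then show ?thesis
    proof cases
      case 1
      then obtain i where "A = {i}" by (auto simp: card_1_singleton_iff)
      then show ?thesis using A by auto
    next
      case 2
      then obtain i where i: "{1..n} - A = {i}" by (auto simp: card_1_singleton_iff)
      then have "A = {1..n} - {i}" "i \<in> {1..n}" using A by blast+
      then show ?thesis by blast
    next
      case 3
      then show ?thesis using A by blast
    qed
  qed
  have eq: "{A. A \<noteq> {} \<and> A \<subset> {1..n}} = ?I \<union> (?S \<union> ?C)"
  proof (rule equalityI)
    show "{A. A \<noteq> {} \<and> A \<subset> {1..n}} \<subseteq> ?I \<union> (?S \<union> ?C)" by (intro subsetI, elim CollectE conjE, rule sub)
    show "?I \<union> (?S \<union> ?C) \<subseteq> {A. A \<noteq> {} \<and> A \<subset> {1..n}}"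
      by (intro Un_least[of ?I] subsetI CollectI) (simp, rule p)
  qed
  have fin: "finite ?I" by (rule finite_subset[of _ "Pow {1..n}"]) auto
  have hU: "h \<in> ?S \<union> ?C \<rightarrow> carrier G"
  proof (rule Pi_I)
    fix A assume "A \<in> ?S \<union> ?C"
    from p[OF this] show "h A \<in> carrier G" by (intro h) simp_all
  qed
  have hI: "h \<in> ?I \<rightarrow> carrier G" by (intro Pi_I h) simp_all
  have hS: "h \<in> ?S \<rightarrow> carrier G" by (rule Pi_I, rule funcset_mem[OF hU], erule UnI1)
  have hC: "h \<in> ?C \<rightarrow> carrier G" by (rule Pi_I, rule funcset_mem[OF hU], erule UnI2)

  have d: "?I \<inter> (?S \<union> ?C) = {}" "?S \<inter> ?C = {}"
  proof -
    have False if "A \<in> ?I" "A \<in> ?S \<union> ?C" for A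
    proof -
      have c: "2 \<le> card A" "2 \<le> card ({1..n} - A)" using that(1) by simp_all
      from that(2) show False
        by (rule UnE) (drule card card'(2), use c in linarith)+
    qed
    then show "?I \<inter> (?S \<union> ?C) = {}" by (intro equals0I, elim IntE)
    have False if "A \<in> ?S" "A \<in> ?C" for A using card[OF that(1)] card'(1)[OF that(2)] n by linarith
    then show "?S \<inter> ?C = {}" by (intro equals0I, elim IntE)
  qed
  have s: "(\<Oplus>A\<in>?S. h A) = (\<Oplus>i\<in>{1..n}. h {i})"
    by (rule finsum_reindex[OF hS]) simp
  have c: "(\<Oplus>A\<in>?C. h A) = (\<Oplus>i\<in>{1..n}. h ({1..n} - {i}))"
    by (rule finsum_reindex[OF hC]) (rule inj_onI, blast)
  have "(\<Oplus>A\<in>?I \<union> (?S \<union> ?C). h A) = (\<Oplus>A\<in>?I. h A) \<oplus> (\<Oplus>A\<in>?S \<union> ?C. h A)"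
    by (rule finsum_Un_disjoint[OF fin _ d(1) hI hU]) simp
  also have "(\<Oplus>A\<in>?S \<union> ?C. h A) = (\<Oplus>A\<in>?S. h A) \<oplus> (\<Oplus>A\<in>?C. h A)"
    by (rule finsum_Un_disjoint[OF _ _ d(2) hS hC]) simp_all
  finally show ?thesis unfolding eq s c .
qed

context simplicial_chains
begin

section \<open>The double cobar construction\<close>

abbreviation "unit_cube \<equiv> cdegen Q 0 1 (loop_class X [])"

text \<open>A non-degenerate 1-cube would be a surviving word of dimension 1, and there is none. So
  every 1-cube is the degeneracy of the only vertex.\<close>

lemma cubes_1: "cubes Q 1 = {unit_cube}"
proof -
  have "a = unit_cube" if a: "a \<in> cubes Q 1" for a
  proof -
    have "cube_degenerate Q 1 a"
    proof (rule ccontr)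
      assume "\<not> cube_degenerate Q 1 a"
      then have "(1, a) \<in> QC.all_cubes - QC.degenerate_cubes" using a by simp
      then obtain xs where xs: "xs \<in> lists S_pos" "(1, a) = cube_of xs"
        using bar_word_bij unfolding bij_betw_def by blast
      then show False using bar_dim_ge_2[OF xs(1)] by simp
    qed
    then obtain i b where ib: "b \<in> cubes Q 0" "1 \<le> i" "i \<le> Suc 0" "a = cdegen Q 0 i b"
      unfolding cube_degenerate_def by (metis One_nat_def Suc_inject)
    then have "i = 1" by simp
    then show ?thesis using ib by (simp add: cubes_0)
  qed
  moreover have "unit_cube \<in> cubes Q 1" using QC.cdegen_closed[of "loop_class X []" 0 1] by (simp add: cubes_0)
  ultimately show ?thesis by blast
qed

section \<open>The algebra map to the permutahedral chains and its effect on generators\<close>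

sublocale QP: perm_chain_set "loop_cubes X" unit_cube R
  by unfold_locales (rule cubes_1)

abbreviation "PM \<equiv> perm_module R Q"
abbreviation "pc \<equiv> perm_chain R Q"
abbreviation "lcube n a A \<equiv> cface_set Q False ({1..n} - A) n a"
abbreviation "rcube n a A \<equiv> cface_set Q True A n a"

text \<open>Single generators go to single cells. Dimensions below 2 go to zero: the 1-cube is zero
  as a chain although its cell is the unit, and vertices lie outside the positive part.\<close>

definition cube_map :: "(nat \<times> 'a letter list set \<Rightarrow> 'r) set \<Rightarrow> ('a letter list set perm_cell list set \<Rightarrow> 'r) set" where
  "cube_map = (SOME h. h \<in> linear_maps R QC.K PM \<and>
    (\<forall>n. \<forall>a\<in>cubes Q n. h (QC.cls n a) = (if 2 \<le> n then pc [Cube n a] else \<zero>\<^bsub>PM\<^esub>)))"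

lemma cube_map: "lin R QC.K PM cube_map"
  "a \<in> cubes Q n \<Longrightarrow> cube_map (QC.cls n a) = (if 2 \<le> n then pc [Cube n a] else \<zero>\<^bsub>PM\<^esub>)"
proof -
  have "\<exists>h. h \<in> linear_maps R QC.K PM \<and>
    (\<forall>n. \<forall>a\<in>cubes Q n. h (QC.cls n a) = (if 2 \<le> n then pc [Cube n a] else \<zero>\<^bsub>PM\<^esub>))"
  proof (rule QC.K_ext[OF QP.PMD(1)])
    fix n a assume "a \<in> cubes Q n"
    then show "(if 2 \<le> n then pc [Cube n a] else \<zero>\<^bsub>PM\<^esub>) \<in> carrier PM"
      using QP.pc_closed[of "[Cube n a]"] by simp
    assume "cube_degenerate Q n a"
    then show "(if 2 \<le> n then pc [Cube n a] else \<zero>\<^bsub>PM\<^esub>) = \<zero>\<^bsub>PM\<^esub>"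
      using QP.pc_degenerate[of "[Cube n a]"] \<open>a \<in> cubes Q n\<close> by simp
  qed
  note H = someI_ex[OF this, folded cube_map_def]
  show "lin R QC.K PM cube_map" using H by (simp add: linear_maps_iff)
  show "a \<in> cubes Q n \<Longrightarrow> cube_map (QC.cls n a) = (if 2 \<le> n then pc [Cube n a] else \<zero>\<^bsub>PM\<^esub>)" using H by blast
qed

abbreviation "gmap x \<equiv> cube_map (iota x)"

lemma gmap: "lin R SC.T PM (\<lambda>x. gmap x)" "lin R CT.V PM (\<lambda>x. gmap x)"
proof -
  show *: "lin R SC.T PM (\<lambda>x. gmap x)" by (rule lin_comp[OF iota_lin cube_map(1)])
  then have "lin R CT PM (\<lambda>x. gmap x)" by (simp only: same_module_lin(1)[OF same_module_CT, symmetric])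
  from lin_comp[OF CT.V_incl this] show "lin R CT.V PM (\<lambda>x. gmap x)" .
qed

lemma gmap_kc:
  assumes a: "a \<in> cubes Q n"
  shows "gmap (kc n a) = (if 2 \<le> n then pc [Cube n a] else \<zero>\<^bsub>PM\<^esub>)"
  using cube_map(2)[OF a] iota_kappa[OF QC.cls_closed[OF a]] by (simp add: kc_def)

text \<open>The universal property of the tensor algebra gives an algebra map; it is cut down to the
  carrier because isomorphisms are required to be extensional.\<close>

definition perm_iso where
  "perm_iso = restrict (SOME h. alg_hom R CT.T PM h \<and> (\<forall>v\<in>carrier CT.V. h (CT.W [v]) = gmap v)) (carrier CT.T)"

lemma perm_iso_hom: "alg_hom R CT.T PM perm_iso"
  and perm_iso_W1: "v \<in> carrier CT.V \<Longrightarrow> perm_iso (CT.W [v]) = gmap v"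
proof -
  note H = someI_ex[OF CT.TA(7)[OF QP.PM_algebra gmap(2)]]
  show "v \<in> carrier CT.V \<Longrightarrow> perm_iso (CT.W [v]) = gmap v"
    using H CT.W1_closed by (simp add: perm_iso_def)
  note H1 = H[THEN conjunct1]
  have "lin R CT.T PM perm_iso"
    unfolding perm_iso_def by (rule lin_cong[OF CT.TD(1) alg_homD(1)[OF H1]]) simp
  then show "alg_hom R CT.T PM perm_iso"
    using H1 by (simp add: alg_hom_def perm_iso_def)
qed

lemmas perm_iso_D = alg_homD[OF perm_iso_hom]

lemma kc_V: "a \<in> cubes Q n \<Longrightarrow> 0 < n \<Longrightarrow> kc n a \<in> carrier CT.V"
  using kc_hcomp[of a n] CT.hcomp_V[of n] by auto

lemma perm_iso_W2:
  assumes "v \<in> carrier CT.V" "w \<in> carrier CT.V"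
  shows "perm_iso (CT.W [v, w]) = gmap v \<otimes>\<^bsub>PM\<^esub> gmap w"
  unfolding CT.W_pair[OF assms] using assms CT.W1_closed by (simp add: perm_iso_D(3) perm_iso_W1)

lemma pc_unit: "a \<in> cubes Q 1 \<Longrightarrow> pc [Cube 1 a] = \<one>\<^bsub>PM\<^esub>"
  using QP.pc_eq[OF perm_eq.unit[of a Q]] QP.pc_Nil by simp

text \<open>The contribution of one face of a permutahedron to the differential of a single
  generator.\<close>

definition split_term where
  "split_term r a A = (neg_one_pow R (card A) \<otimes>\<^bsub>R\<^esub> shuff R A ({1..r} - A)) \<odot>\<^bsub>PM\<^esub>
    pc [Cube (card A) (lcube r a A), Cube (card ({1..r} - A)) (rcube r a A)]"

lemma split_term_eq:
  assumes a: "a \<in> cubes Q r" and A: "A \<in> proper r"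
  shows "split_term r a A = (neg_one_pow R (card A) \<otimes>\<^bsub>R\<^esub> shuff R A ({1..r} - A)) \<odot>\<^bsub>PM\<^esub>
      (pc [Cube (card A) (lcube r a A)] \<otimes>\<^bsub>PM\<^esub>
       pc [Cube (card ({1..r} - A)) (rcube r a A)])"
    and "split_term r a A \<in> carrier PM"
    and "pc [Cube (card A) (lcube r a A)] \<in> carrier PM"
    and "pc [Cube (card ({1..r} - A)) (rcube r a A)] \<in> carrier PM"
proof -
  note P = proper_facts[OF A]
  note fs = QC.face_set_cubes[OF a P(1)]
  have v: "cells_valid Q [Cube (card A) (lcube r a A)]"
    "cells_valid Q [Cube (card ({1..r} - A)) (rcube r a A)]"
    using fs P by (simp_all add: Suc_le_eq)
  show c: "pc [Cube (card A) (lcube r a A)] \<in> carrier PM"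
    "pc [Cube (card ({1..r} - A)) (rcube r a A)] \<in> carrier PM"
    by (rule QP.pc_closed[OF v(1)], rule QP.pc_closed[OF v(2)])
  show *: "split_term r a A = (neg_one_pow R (card A) \<otimes>\<^bsub>R\<^esub> shuff R A ({1..r} - A)) \<odot>\<^bsub>PM\<^esub>
      (pc [Cube (card A) (lcube r a A)] \<otimes>\<^bsub>PM\<^esub>
       pc [Cube (card ({1..r} - A)) (rcube r a A)])"
    unfolding split_term_def using QP.pc_append[OF v] by simp
  show "split_term r a A \<in> carrier PM"
    unfolding * by (intro QP.PM'.smult_closed R.m_closed sgn(1) shuff_closed[OF R_cring] QP.PM.m_closed c)
qed

lemma proper_singleton:
  assumes "2 \<le> r" "i \<in> {1..r}"
  shows "{i} \<in> proper r" "{1..r} - {i} \<in> proper r"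
proof -
  have "{i} \<noteq> {1..r}"
  proof
    assume "{i} = {1..r}"
    then have "card {i} = card {1..r}" by (rule arg_cong)
    then show False using assms(1) by simp
  qed
  then show "{i} \<in> proper r" using assms by (intro CollectI conjI psubsetI) simp_all
  have "(if i = 1 then 2 else 1) \<in> {1..r} - {i}" using assms by auto
  then have "{1..r} - {i} \<noteq> {}" by blast
  moreover have "{1..r} - {i} \<noteq> {1..r}" using assms by blast
  ultimately show "{1..r} - {i} \<in> proper r" by (intro CollectI conjI psubsetI) simp_all
qed

text \<open>The block of size 1 becomes the unit. The signs are (-1)(-1)^(i-1) for
  \<open>{i}\<close> and (-1)^(r-1)(-1)^(r-i) = (-1)^(i-1) for its complement, so the two terms
  together are the negative of the \<open>i\<close>-th term of the cubical boundary.\<close>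

lemma split_term_singleton:
  assumes a: "a \<in> cubes Q r" and r: "2 \<le> r" and i: "i \<in> {1..r}"
  shows "split_term r a {i} = (\<ominus>\<^bsub>R\<^esub> neg_one_pow R (i - 1)) \<odot>\<^bsub>PM\<^esub> pc [Cube (r - 1) (cface Q True r i a)]"
    and "split_term r a ({1..r} - {i}) = neg_one_pow R (i - 1) \<odot>\<^bsub>PM\<^esub> pc [Cube (r - 1) (cface Q False r i a)]"
proof -
  note p = proper_singleton[OF r i]
  have c: "card ({1..r} - {i}) = r - 1" "{1..r} - ({1..r} - {i}) = {i}" using i by auto
  have i': "1 \<le> i" "i \<le> r" using i by auto
  have f: "cface_set Q eps {i} r a = cface Q eps r i a" for eps by (simp add: cface_set_def)
  have u: "pc [Cube 1 (cface_set Q eps ({1..r} - {i}) r a)] = \<one>\<^bsub>PM\<^esub>" for eps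
    using QC.face_set_cubes(1)[OF a, of "{i}" eps] i by (intro pc_unit) simp
  have k: "pc [Cube (r - 1) (cface Q eps r i a)] \<in> carrier PM" for eps
    by (rule QP.pc_closed) (use QC.cface_closed'[OF a i', of eps] r in simp)
  have s: "neg_one_pow R 1 = \<ominus>\<^bsub>R\<^esub> \<one>\<^bsub>R\<^esub>" using sgn(4)[of 0] sgn(2) by simp
  have e: "neg_one_pow R (r - 1) \<otimes>\<^bsub>R\<^esub> neg_one_pow R (r - i) = neg_one_pow R (i - 1)"
  proof -
    have "even (r - 1 + (r - i)) \<longleftrightarrow> even (i - 1)" using i' by presburger
    then have "neg_one_pow R (r - 1 + (r - i)) = neg_one_pow R (i - 1)" by (simp only: neg_one_pow_parity[OF R_cring])
    then show ?thesis by (simp only: sgn(3))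
  qed
  have c1: "card {i} = 1" by simp
  show "split_term r a {i} = (\<ominus>\<^bsub>R\<^esub> neg_one_pow R (i - 1)) \<odot>\<^bsub>PM\<^esub> pc [Cube (r - 1) (cface Q True r i a)]"
    unfolding split_term_eq(1)[OF a p(1)] c1 c u f shuff_singleton_left[OF R_cring i'] s
    using k sgn(1) by (simp add: R.l_minus)
  show "split_term r a ({1..r} - {i}) = neg_one_pow R (i - 1) \<odot>\<^bsub>PM\<^esub> pc [Cube (r - 1) (cface Q False r i a)]"
    unfolding split_term_eq(1)[OF a p(2)] c c1 u f shuff_singleton_right[OF R_cring i'] e
    using k by simp
qed

lemma gmap_diff_kc:
  assumes a: "a \<in> cubes Q r"
  shows "gmap (diff CT (kc r a)) = (\<Oplus>\<^bsub>PM\<^esub>i\<in>{1..r}. neg_one_pow R (i - 1) \<odot>\<^bsub>PM\<^esub>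
    (gmap (kc (r - 1) (cface Q True r i a)) \<ominus>\<^bsub>PM\<^esub> gmap (kc (r - 1) (cface Q False r i a))))"
proof -
  have "gmap (diff CT (kc r a)) = cube_map (cube_boundary R Q (QC.cls r a))"
    using iota_diff[OF kc_closed[OF a]] iota_kappa[OF QC.cls_closed[OF a]] by (simp add: kc_def)
  also have "\<dots> = (\<Oplus>\<^bsub>PM\<^esub>i\<in>{1..r}. cube_map (QC.boundary_term r a i))"
    unfolding QC.cube_boundary_cls[OF a]
    by (rule lin_finsum[OF QC.K_module QP.PMD(1) cube_map(1)]) (use QC.boundary_term_closed[OF a] in auto)
  also have "\<dots> = (\<Oplus>\<^bsub>PM\<^esub>i\<in>{1..r}. neg_one_pow R (i - 1) \<odot>\<^bsub>PM\<^esub>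
    (gmap (kc (r - 1) (cface Q True r i a)) \<ominus>\<^bsub>PM\<^esub> gmap (kc (r - 1) (cface Q False r i a))))"
  proof (rule QP.PM.finsum_cong'[OF HOL.refl])
    fix i assume "i \<in> {1..r}"
    then have f: "cface Q eps r i a \<in> cubes Q (r - 1)" for eps using QC.cface_closed'[OF a] by simp
    note k = QC.cls_closed[OF f]
    show "cube_map (QC.boundary_term r a i) = neg_one_pow R (i - 1) \<odot>\<^bsub>PM\<^esub>
        (gmap (kc (r - 1) (cface Q True r i a)) \<ominus>\<^bsub>PM\<^esub> gmap (kc (r - 1) (cface Q False r i a)))"
      unfolding QC.boundary_term_def lin_smult[OF cube_map(1) sgn(1) QC.K.M.minus_closed[OF k k]]
        lin_minus[OF QC.K_module QP.PMD(1) cube_map(1) k k] kc_def iota_kappa[OF k] ..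
  next
    show "(\<lambda>i. neg_one_pow R (i - 1) \<odot>\<^bsub>PM\<^esub>
      (gmap (kc (r - 1) (cface Q True r i a)) \<ominus>\<^bsub>PM\<^esub> gmap (kc (r - 1) (cface Q False r i a)))) \<in> {1..r} \<rightarrow> carrier PM"
    proof
      fix i assume "i \<in> {1..r}"
      then have f: "cface Q eps r i a \<in> cubes Q (r - 1)" for eps using QC.cface_closed'[OF a] by simp
      show "neg_one_pow R (i - 1) \<odot>\<^bsub>PM\<^esub> (gmap (kc (r - 1) (cface Q True r i a)) \<ominus>\<^bsub>PM\<^esub>
          gmap (kc (r - 1) (cface Q False r i a))) \<in> carrier PM"
        by (intro QP.PM'.smult_closed sgn(1) QP.PM.minus_closed lin_closed[OF gmap(1)] kc_closed f)
    qed
  qed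
  finally show ?thesis .
qed

text \<open>The image of one summand of the quadratic part of the cobar differential, indexed by the
  same splittings as \<open>split_term\<close>.\<close>

definition cob_term where
  "cob_term r a A = neg_one_pow R (card A) \<odot>\<^bsub>PM\<^esub>
    (gmap (shuff R A ({1..r} - A) \<odot>\<^bsub>SC.T\<^esub> lface r a A) \<otimes>\<^bsub>PM\<^esub> gmap (rface r a A))"

lemma perm_iso_diff_cob:
  assumes a: "a \<in> cubes Q r" and r: "0 < r"
  shows "perm_iso (cobar_diff R CT (CT.W [kc r a])) =
    (\<ominus>\<^bsub>PM\<^esub> gmap (diff CT (kc r a))) \<oplus>\<^bsub>PM\<^esub> (\<Oplus>\<^bsub>PM\<^esub>A\<in>proper r. cob_term r a A)"
    and "\<And>A. A \<in> proper r \<Longrightarrow> cob_term r a A \<in> carrier PM"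
proof -
  let ?l = "\<lambda>A. shuff R A ({1..r} - A) \<odot>\<^bsub>SC.T\<^esub> lface r a A" and ?r = "\<lambda>A. rface r a A"
  have fin: "finite (proper r)" by (rule finite_subset[of _ "Pow {1..r}"]) auto
  have V: "?l A \<in> carrier CT.V" "?r A \<in> carrier CT.V" if "A \<in> proper r" for A
    using coprod_CT_hcomp[OF a that] CT.hcomp_V by blast+
  have W2: "CT.W [?l A, ?r A] \<in> carrier CT.T" if "A \<in> proper r" for A
    using V[OF that] by (intro CT.TA(2)) simp
  show ct: "cob_term r a A \<in> carrier PM" if "A \<in> proper r" for A unfolding cob_term_def
    by (intro QP.PM'.smult_closed sgn(1) QP.PM.m_closed lin_closed[OF gmap(2)] V that)
  have dV: "diff CT (kc r a) \<in> carrier CT.V" by (rule lin_closed[OF CT.diff_V kc_V[OF a r]])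
  have "cobar_diff R CT (CT.W [kc r a]) = (\<ominus>\<^bsub>CT.T\<^esub> CT.W [diff CT (kc r a)]) \<oplus>\<^bsub>CT.T\<^esub>
      (\<Oplus>\<^bsub>CT.T\<^esub>A\<in>proper r. neg_one_pow R (card A) \<odot>\<^bsub>CT.T\<^esub> CT.W [?l A, ?r A])"
  proof (rule CT.cobar_diff_generator[OF fin r _ coprod_CT_hcomp[OF a]])
    show "kc r a \<in> hcomp CT r" using kc_hcomp[OF a] by simp
    show "coprod CT (kc r a) = tensor R CT CT (kc r a) (coaug CT) \<oplus>\<^bsub>CT.CC\<^esub> tensor R CT CT (coaug CT) (kc r a)
      \<oplus>\<^bsub>CT.CC\<^esub> (\<Oplus>\<^bsub>CT.CC\<^esub>A\<in>proper r. tensor R CT CT (?l A) (?r A))"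
      unfolding CT_tensor by (rule coprod_CT[OF a r])
  qed
  moreover have "perm_iso (\<Oplus>\<^bsub>CT.T\<^esub>A\<in>proper r. neg_one_pow R (card A) \<odot>\<^bsub>CT.T\<^esub> CT.W [?l A, ?r A]) =
      (\<Oplus>\<^bsub>PM\<^esub>A\<in>proper r. perm_iso (neg_one_pow R (card A) \<odot>\<^bsub>CT.T\<^esub> CT.W [?l A, ?r A]))"
    by (rule lin_finsum[OF CT.TD(1) QP.PMD(1) perm_iso_D(1)]) (use W2 sgn(1) in auto)
  moreover have "\<dots> = (\<Oplus>\<^bsub>PM\<^esub>A\<in>proper r. cob_term r a A)"
  proof (rule QP.PM.finsum_cong'[OF HOL.refl])
    fix A assume A: "A \<in> proper r"
    show "perm_iso (neg_one_pow R (card A) \<odot>\<^bsub>CT.T\<^esub> CT.W [?l A, ?r A]) = cob_term r a A"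
      unfolding lin_smult[OF perm_iso_D(1) sgn(1) W2[OF A]] perm_iso_W2[OF V[OF A]] cob_term_def ..
  qed (use ct in blast)
  moreover have "(\<Oplus>\<^bsub>CT.T\<^esub>A\<in>proper r. neg_one_pow R (card A) \<odot>\<^bsub>CT.T\<^esub> CT.W [?l A, ?r A]) \<in> carrier CT.T"
    by (rule CT.T.finsum_closed) (use W2 sgn(1) in auto)
  ultimately show "perm_iso (cobar_diff R CT (CT.W [kc r a])) =
    (\<ominus>\<^bsub>PM\<^esub> gmap (diff CT (kc r a))) \<oplus>\<^bsub>PM\<^esub> (\<Oplus>\<^bsub>PM\<^esub>A\<in>proper r. cob_term r a A)"
    using CT.W1_closed[OF dV] lin_neg[OF CT.TD(1) QP.PMD(1) perm_iso_D(1) CT.W1_closed[OF dV]] perm_iso_W1[OF dV]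
      lin_add[OF perm_iso_D(1) CT.T.a_inv_closed[OF CT.W1_closed[OF dV]]]
    by simp
qed

text \<open>A factor of dimension 1 is zero as a chain, so only splittings into blocks of size at
  least 2 contribute, and there the signs agree literally.\<close>

lemma cob_term_eq:
  assumes a: "a \<in> cubes Q r" and A: "A \<in> proper r"
  shows "cob_term r a A = (if 2 \<le> card A \<and> 2 \<le> card ({1..r} - A) then split_term r a A else \<zero>\<^bsub>PM\<^esub>)"
proof -
  note P = proper_facts[OF A]
  note fs = QC.face_set_cubes[OF a P(1)]
  note sh = shuff_closed[OF R_cring]
  have "gmap (shuff R A ({1..r} - A) \<odot>\<^bsub>SC.T\<^esub> lface r a A) = shuff R A ({1..r} - A) \<odot>\<^bsub>PM\<^esub> gmap (lface r a A)"
    by (rule lin_smult[OF gmap(1) sh kc_closed[OF fs(1)]])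
  then show ?thesis
    unfolding cob_term_def split_term_eq(1)[OF a A] gmap_kc[OF fs(1)] gmap_kc[OF fs(2)]
    using split_term_eq(3,4)[OF a A] sgn(1) sh
    by (auto simp: QP.PMD(3) QP.PM'.smult_assoc1)
qed

text \<open>The comparison on generators: the negated boundary supplies the splittings with a block
  of size 1, and the reduced coproduct supplies all the others.\<close>

lemma perm_iso_diff_generator:
  assumes a: "a \<in> cubes Q r" and r: "2 \<le> r"
  shows "perm_iso (cobar_diff R CT (CT.W [kc r a])) = (\<Oplus>\<^bsub>PM\<^esub>A\<in>proper r. split_term r a A)"
proof -
  let ?P = "\<lambda>i. pc [Cube (r - 1) (cface Q True r i a)]" and ?M = "\<lambda>i. pc [Cube (r - 1) (cface Q False r i a)]"
  have k: "pc [Cube (r - 1) (cface Q eps r i a)] \<in> carrier PM" if "i \<in> {1..r}" for eps i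
    by (rule QP.pc_closed) (use QC.cface_closed'[OF a, of i eps] r that in simp)
  have r0: "0 < r" using r by simp
  note D = perm_iso_diff_cob[OF a r0] and st = split_term_eq(2)[OF a]
  have g: "gmap (kc (r - 1) (cface Q eps r i a)) = (if r = 2 then \<zero>\<^bsub>PM\<^esub> else pc [Cube (r - 1) (cface Q eps r i a)])"
    if "i \<in> {1..r}" for eps i
    using gmap_kc[OF QC.cface_closed'[OF a, of i eps]] that r by auto
  show ?thesis
  proof (cases "r = 2")
    case True
    \<comment> \<open>For \<open>r = 2\<close> both blocks are singletons. The two permutahedral
      faces are units with opposite signs and cancel, while on the cobar side every term involves a
      1-cube and is zero.\<close>
    have p: "proper 2 = {{1}, {2}}"
    proof -
      have "A \<in> {{1}, {2}}" if A: "A \<in> proper 2" for A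
      proof -
        note P = proper_facts[OF A]
        have "card A = 1" using P(2,3) QC.card_compl(1)[OF P(1)] by linarith
        then obtain i where i: "A = {i}" by (rule card_1_singletonE)
        then have "i = 1 \<or> i = 2" using P(1) by auto
        then show ?thesis using i by blast
      qed
      then have "proper 2 \<subseteq> {{1}, {2}}" by (rule subsetI)
      moreover have "{1} \<in> proper 2" "{2} \<in> proper 2" by (rule proper_singleton(1); simp)+
      ultimately show ?thesis by blast
    qed
    have "gmap (diff CT (kc r a)) = \<zero>\<^bsub>PM\<^esub>"
      unfolding gmap_diff_kc[OF a]
    proof (rule QP.PM.add.finprod_one_eqI)
      fix i assume i: "i \<in> {1..r}"
      have "gmap (kc (r - 1) (cface Q eps r i a)) = \<zero>\<^bsub>PM\<^esub>" for eps using g[OF i, of eps] True by simp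
      then show "neg_one_pow R (i - 1) \<odot>\<^bsub>PM\<^esub>
          (gmap (kc (r - 1) (cface Q True r i a)) \<ominus>\<^bsub>PM\<^esub> gmap (kc (r - 1) (cface Q False r i a))) = \<zero>\<^bsub>PM\<^esub>"
        using QP.PM'.smult_r_null[OF sgn(1)] by (simp only: a_minus_def QP.PM.minus_zero QP.PM.l_zero QP.PM.zero_closed)
    qed
    moreover have "(\<Oplus>\<^bsub>PM\<^esub>A\<in>proper r. cob_term r a A) = \<zero>\<^bsub>PM\<^esub>"
    proof (rule QP.PM.add.finprod_one_eqI)
      fix A assume A: "A \<in> proper r"
      then have "A \<in> {{1}, {2}}" unfolding True p .
      then have "card A = 1" by auto
      then show "cob_term r a A = \<zero>\<^bsub>PM\<^esub>" using cob_term_eq[OF a A] by simp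
    qed
    moreover have "(\<Oplus>\<^bsub>PM\<^esub>A\<in>proper r. split_term r a A) = \<zero>\<^bsub>PM\<^esub>"
    proof -
      have i: "1 \<in> {1..r}" "2 \<in> {1..r}" using True by auto
      have u: "pc [Cube (r - 1) (cface Q True r i a)] = \<one>\<^bsub>PM\<^esub>" if "i \<in> {1..r}" for i
        using QC.cface_closed'[OF a, of i True] that True by (simp add: pc_unit[unfolded One_nat_def])
      have P: "proper r = {{1}, {2}}" unfolding True by (rule p)
      have "split_term r a {1} \<in> carrier PM" "split_term r a {2} \<in> carrier PM"
        by (rule st, unfold P, simp)+
      then have "(\<Oplus>\<^bsub>PM\<^esub>A\<in>proper r. split_term r a A) = split_term r a {1} \<oplus>\<^bsub>PM\<^esub> split_term r a {2}"
        unfolding P by simp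
      also have "\<dots> = \<zero>\<^bsub>PM\<^esub>"
        unfolding split_term_singleton(1)[OF a r i(1)] split_term_singleton(1)[OF a r i(2)] u[OF i(1)] u[OF i(2)]
        using sgn(2) sgn(4)[of 0] by (simp add: QP.PM'.smult_l_minus QP.PM.l_neg QP.PM.r_neg)
      finally show ?thesis .
    qed
    ultimately show ?thesis unfolding D(1) by simp
  next
    case False
    then have r3: "3 \<le> r" using r by simp
    \<comment> \<open>The splittings in which neither factor becomes a unit.\<close>
    let ?I = "{A. A \<noteq> {} \<and> A \<subset> {1..r} \<and> 2 \<le> card A \<and> 2 \<le> card ({1..r} - A)}"
    let ?m = "\<lambda>i. neg_one_pow R (i - 1) \<odot>\<^bsub>PM\<^esub> (?P i \<ominus>\<^bsub>PM\<^esub> ?M i)"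
    have sc: "split_term r a {i} \<in> carrier PM" "split_term r a ({1..r} - {i}) \<in> carrier PM" if "i \<in> {1..r}" for i
      unfolding split_term_singleton[OF a r that] using k[OF that] sgn(1) by (intro QP.PM'.smult_closed R.a_inv_closed; simp)+
    note p = proper_singleton[OF r]
    have z: "(\<Oplus>\<^bsub>PM\<^esub>i\<in>{1..r}. cob_term r a {i}) = \<zero>\<^bsub>PM\<^esub>"
      "(\<Oplus>\<^bsub>PM\<^esub>i\<in>{1..r}. cob_term r a ({1..r} - {i})) = \<zero>\<^bsub>PM\<^esub>"
    proof -
      have "{1..r} - ({1..r} - {i}) = {i}" if "i \<in> {1..r}" for i using that by auto
      then show "(\<Oplus>\<^bsub>PM\<^esub>i\<in>{1..r}. cob_term r a {i}) = \<zero>\<^bsub>PM\<^esub>"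
        "(\<Oplus>\<^bsub>PM\<^esub>i\<in>{1..r}. cob_term r a ({1..r} - {i})) = \<zero>\<^bsub>PM\<^esub>"
        using cob_term_eq[OF a p(1)] cob_term_eq[OF a p(2)] by (intro QP.PM.add.finprod_one_eqI; simp)+
    qed
    have "(\<Oplus>\<^bsub>PM\<^esub>A\<in>?I. cob_term r a A) = (\<Oplus>\<^bsub>PM\<^esub>A\<in>?I. split_term r a A)"
      by (rule QP.PM.finsum_cong'[OF HOL.refl]) (use st cob_term_eq[OF a] in auto)
    moreover have Ic: "(\<Oplus>\<^bsub>PM\<^esub>A\<in>?I. split_term r a A) \<in> carrier PM"
      by (rule QP.PM.finsum_closed) (use st in auto)
    moreover have "(\<Oplus>\<^bsub>PM\<^esub>A\<in>proper r. cob_term r a A) = (\<Oplus>\<^bsub>PM\<^esub>A\<in>?I. cob_term r a A) \<oplus>\<^bsub>PM\<^esub>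
       ((\<Oplus>\<^bsub>PM\<^esub>i\<in>{1..r}. cob_term r a {i}) \<oplus>\<^bsub>PM\<^esub> (\<Oplus>\<^bsub>PM\<^esub>i\<in>{1..r}. cob_term r a ({1..r} - {i})))"
      by (rule QP.PM.finsum_split_proper[OF r3 D(2)]) simp
    ultimately have cs: "(\<Oplus>\<^bsub>PM\<^esub>A\<in>proper r. cob_term r a A) = (\<Oplus>\<^bsub>PM\<^esub>A\<in>?I. split_term r a A)"
      unfolding z by simp
    have ss: "(\<Oplus>\<^bsub>PM\<^esub>A\<in>proper r. split_term r a A) = (\<Oplus>\<^bsub>PM\<^esub>A\<in>?I. split_term r a A) \<oplus>\<^bsub>PM\<^esub>
       ((\<Oplus>\<^bsub>PM\<^esub>i\<in>{1..r}. split_term r a {i}) \<oplus>\<^bsub>PM\<^esub> (\<Oplus>\<^bsub>PM\<^esub>i\<in>{1..r}. split_term r a ({1..r} - {i})))"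
      by (rule QP.PM.finsum_split_proper[OF r3 st]) simp
    have mc: "?m i \<in> carrier PM" if "i \<in> {1..r}" for i
      by (intro QP.PM'.smult_closed sgn(1) QP.PM.minus_closed k that)
    have "\<ominus>\<^bsub>PM\<^esub> gmap (diff CT (kc r a)) = \<ominus>\<^bsub>PM\<^esub> (\<Oplus>\<^bsub>PM\<^esub>i\<in>{1..r}. ?m i)"
      unfolding gmap_diff_kc[OF a]
      by (rule arg_cong[where f = "a_inv PM"], rule QP.PM.finsum_cong'[OF HOL.refl]) (use mc g False in auto)
    also have "\<dots> = (\<Oplus>\<^bsub>PM\<^esub>i\<in>{1..r}. \<ominus>\<^bsub>PM\<^esub> ?m i)"
      by (rule lin_finsum[OF QP.PMD(1,1) lin_uminus[OF QP.PMD(1,1) lin_id[OF QP.PMD(1)]]]) (use mc in auto)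
    also have "\<dots> = (\<Oplus>\<^bsub>PM\<^esub>i\<in>{1..r}. split_term r a {i} \<oplus>\<^bsub>PM\<^esub> split_term r a ({1..r} - {i}))"
    proof (rule QP.PM.finsum_cong'[OF HOL.refl])
      fix i assume i: "i \<in> {1..r}"
      note kk = k[OF i, of True] k[OF i, of False] sgn(1)[of "i - 1"]
      note cl = QP.PM'.smult_closed[OF kk(3,1)] QP.PM'.smult_closed[OF kk(3,2)]
      have "?m i = neg_one_pow R (i - 1) \<odot>\<^bsub>PM\<^esub> ?P i \<ominus>\<^bsub>PM\<^esub> neg_one_pow R (i - 1) \<odot>\<^bsub>PM\<^esub> ?M i"
        unfolding a_minus_def using kk by (simp add: QP.PM'.smult_r_distr QP.PM'.smult_r_minus)
      then show "\<ominus>\<^bsub>PM\<^esub> ?m i = split_term r a {i} \<oplus>\<^bsub>PM\<^esub> split_term r a ({1..r} - {i})"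
        unfolding split_term_singleton[OF a r i] a_minus_def
        using cl kk by (simp add: QP.PM.minus_add QP.PM'.smult_l_minus)
    qed (use sc in auto)
    also have "\<dots> = (\<Oplus>\<^bsub>PM\<^esub>i\<in>{1..r}. split_term r a {i}) \<oplus>\<^bsub>PM\<^esub> (\<Oplus>\<^bsub>PM\<^esub>i\<in>{1..r}. split_term r a ({1..r} - {i}))"
      by (rule QP.PM.finsum_addf) (use sc in auto)
    finally have ms: "\<ominus>\<^bsub>PM\<^esub> gmap (diff CT (kc r a)) =
      (\<Oplus>\<^bsub>PM\<^esub>i\<in>{1..r}. split_term r a {i}) \<oplus>\<^bsub>PM\<^esub> (\<Oplus>\<^bsub>PM\<^esub>i\<in>{1..r}. split_term r a ({1..r} - {i}))" .
    show ?thesis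
      unfolding D(1) ms cs ss
      by (rule QP.PM.a_comm) (use sc Ic in \<open>auto intro!: QP.PM.a_closed QP.PM.finsum_closed\<close>)
  qed
qed


section \<open>Differentials of products of cubes\<close>

abbreviation "kcp p \<equiv> kc (fst p) (snd p)"

text \<open>As in \<open>tw\<close>, 1-cubes are dropped: they are units among the permutahedral
  cells but zero as chains.\<close>

definition cob_word where
  "cob_word w = CT.W (map kcp (filter (\<lambda>p. fst p \<noteq> 1) w))"

lemma cob_word_list: "w \<in> lists QP.good_cubes \<Longrightarrow> map kcp (filter (\<lambda>p. fst p \<noteq> 1) w) \<in> lists (carrier CT.V)"
  by (induction w) (auto intro!: kc_V)

lemma cob_word_closed: "w \<in> lists QP.good_cubes \<Longrightarrow> cob_word w \<in> carrier CT.T"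
  unfolding cob_word_def by (rule CT.TA(2)[OF cob_word_list])

lemma cob_word_Cons:
  assumes "p \<in> QP.good_cubes" "w \<in> lists QP.good_cubes"
  shows "cob_word (p # w) = cob_word [p] \<otimes>\<^bsub>CT.T\<^esub> cob_word w"
proof -
  have "[p] \<in> lists QP.good_cubes" using assms(1) by simp
  from CT.TA(4)[OF cob_word_list[OF this] cob_word_list[OF assms(2)]]
  show ?thesis unfolding cob_word_def by (simp only: map_append[symmetric] filter_append[symmetric] append_Cons append_Nil)
qed

lemma cob_word_hcomp:
  assumes "w \<in> lists QP.good_cubes"
  shows "cob_word w \<in> cobar_hcomp R CT (cells_degree (cube_cells w))"
proof -
  let ?v = "filter (\<lambda>p. fst p \<noteq> 1) w"
  have "list_all2 (\<lambda>v k. v \<in> hcomp CT (Suc k)) (map kcp ?v) (map (\<lambda>p. fst p - 1) ?v)"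
    using assms kc_hcomp by (induction w) (auto simp del: One_nat_def simp: Suc_pred')
  moreover have "sum_list (map (\<lambda>p. fst p - 1) ?v) = cells_degree (cube_cells w)"
    by (induction w) auto
  ultimately have "cob_word w \<in> {CT.W vs | vs ks. list_all2 (\<lambda>v k. v \<in> hcomp CT (Suc k)) vs ks \<and>
      sum_list ks = cells_degree (cube_cells w)}"
    unfolding cob_word_def by (intro CollectI exI conjI) (rule HOL.refl)
  then show ?thesis unfolding cobar_hcomp_def by (rule subsetD[OF gen_submodule_incl])
qed

lemma perm_iso_cob_word: "w \<in> lists QP.good_cubes \<Longrightarrow> perm_iso (cob_word w) = pc (cube_cells w)"
proof (induction w)
  case Nil
  then show ?case using CT.TA(3) perm_iso_D(2) QP.pc_Nil by (simp add: cob_word_def)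
next
  case (Cons p w)
  then have p: "p \<in> QP.good_cubes" "[p] \<in> lists QP.good_cubes" and w: "w \<in> lists QP.good_cubes" by auto
  obtain r a where ra: "p = (r, a)" by (cases p)
  then have a: "1 \<le> r" "a \<in> cubes Q r" using p by auto
  have v: "cells_valid Q [Cube r a]" "cells_valid Q (cube_cells w)"
    using a w QP.cube_cells_valid by simp_all
  have "perm_iso (cob_word [p]) = pc [Cube r a]"
  proof (cases "r = 1")
    case True
    then show ?thesis using ra a CT.TA(3) perm_iso_D(2) pc_unit by (simp add: cob_word_def)
  next
    case False
    then have "cob_word [p] = CT.W [kc r a]" by (simp add: cob_word_def ra)
    then show ?thesis using perm_iso_W1[OF kc_V[OF a(2)]] gmap_kc[OF a(2)] a False by simp
  qed
  moreover have "perm_iso (cob_word (p # w)) = perm_iso (cob_word [p]) \<otimes>\<^bsub>PM\<^esub> perm_iso (cob_word w)"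
    unfolding cob_word_Cons[OF p(1) w] by (rule perm_iso_D(3)[OF cob_word_closed[OF p(2)] cob_word_closed[OF w]])
  ultimately show ?case using Cons.IH[OF w] QP.pc_append[OF v] ra by simp
qed

abbreviation "split_word w i A \<equiv> take i w @
  [(card A, lcube (fst (w ! i)) (snd (w ! i)) A),
   (card ({1..fst (w ! i)} - A), rcube (fst (w ! i)) (snd (w ! i)) A)] @ drop (Suc i) w"

definition word_term where
  "word_term w i A = (neg_one_pow R (cells_degree (cube_cells (take i w))) \<otimes>\<^bsub>R\<^esub> neg_one_pow R (card A)
     \<otimes>\<^bsub>R\<^esub> shuff R A ({1..fst (w ! i)} - A)) \<odot>\<^bsub>PM\<^esub> pc (cube_cells (split_word w i A))"

abbreviation "letter_sum w i \<equiv> (\<Oplus>\<^bsub>PM\<^esub>A\<in>proper (fst (w ! i)). word_term w i A)"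

lemma word_term_closed:
  assumes w: "w \<in> lists QP.good_cubes" and i: "i < length w" and A: "A \<in> proper (fst (w ! i))"
  shows "word_term w i A \<in> carrier PM" "cells_valid Q (cube_cells (split_word w i A))"
proof -
  note P = proper_facts[OF A]
  have "w ! i \<in> QP.good_cubes" by (rule in_listsD[OF w, THEN bspec, OF nth_mem[OF i]])
  then have a: "snd (w ! i) \<in> cubes Q (fst (w ! i))" by auto
  note fs = QC.face_set_cubes[OF a P(1)]
  have "take i w \<in> lists QP.good_cubes" "drop (Suc i) w \<in> lists QP.good_cubes"
    using lists_mono set_take_subset[of i w] set_drop_subset[of "Suc i" w] w
    unfolding lists_eq_set by blast+
  moreover have "(card A, lcube (fst (w ! i)) (snd (w ! i)) A) \<in> QP.good_cubes"
    "(card ({1..fst (w ! i)} - A), rcube (fst (w ! i)) (snd (w ! i)) A) \<in> QP.good_cubes"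
    using fs P(2,3) by (simp_all add: Suc_le_eq)
  ultimately have "split_word w i A \<in> lists QP.good_cubes"     by (simp only: append_in_lists_conv Cons_in_lists_iff lists.Nil simp_thms)
  then show v: "cells_valid Q (cube_cells (split_word w i A))" by (simp only: QP.cube_cells_valid)
  show "word_term w i A \<in> carrier PM" unfolding word_term_def
    by (intro QP.PM'.smult_closed R.m_closed sgn(1) shuff_closed[OF R_cring] QP.pc_closed[OF v])
qed

text \<open>Induction on the word. The Leibniz rule splits off the first letter, whose faces form
  the summand at position 0, while positions in the rest move up by one.\<close>

lemma perm_iso_diff_cob_word:
  "w \<in> lists QP.good_cubes \<Longrightarrow> perm_iso (cobar_diff R CT (cob_word w)) =
    (\<Oplus>\<^bsub>PM\<^esub>i\<in>{..<length w}. letter_sum w i)"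
proof (induction w)
  case Nil
  have "perm_iso (cobar_diff R CT \<one>\<^bsub>CT.T\<^esub>) = \<zero>\<^bsub>PM\<^esub>"
    unfolding CT.cobar_diff_one by (rule lin_zero[OF CT.TD(1) QP.PMD(1) perm_iso_D(1)])
  then show ?case using CT.TA(3) by (simp add: cob_word_def)
next
  case (Cons p w)
  then have p: "p \<in> QP.good_cubes" "[p] \<in> lists QP.good_cubes" and w: "w \<in> lists QP.good_cubes" by auto
  have pw: "p # w \<in> lists QP.good_cubes" by (fact Cons.prems)
  obtain r a where ra: "p = (r, a)" by (cases p)
  then have a: "1 \<le> r" "a \<in> cubes Q r" using p by auto
  have v: "cells_valid Q [Cube r a]" "cells_valid Q (cube_cells w)" "cells_valid Q (cube_cells [p])"
    using a w QP.cube_cells_valid ra by simp_all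
  note wc = cob_word_closed[OF p(2)] cob_word_closed[OF w]
  note dc = lin_closed[OF CT.lin_cobar_diff wc(1)] lin_closed[OF CT.lin_cobar_diff wc(2)]
  let ?u = "pc [Cube r a]" and ?s = "neg_one_pow R (r - 1)"
  note uc = QP.pc_closed[OF v(1)] and pwc = QP.pc_closed[OF v(2)]
  have st: "split_term r a A \<in> carrier PM" if "A \<in> proper r" for A by (rule split_term_eq(2)[OF a(2) that])
  have single: "perm_iso (cobar_diff R CT (cob_word [p])) = (\<Oplus>\<^bsub>PM\<^esub>A\<in>proper r. split_term r a A)"
  proof (cases "r = 1")
    case True
    have P: "proper r = {}" unfolding True by auto
    have "perm_iso (cobar_diff R CT \<one>\<^bsub>CT.T\<^esub>) = \<zero>\<^bsub>PM\<^esub>"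
      unfolding CT.cobar_diff_one by (rule lin_zero[OF CT.TD(1) QP.PMD(1) perm_iso_D(1)])
    moreover have "cob_word [p] = \<one>\<^bsub>CT.T\<^esub>" using True ra CT.TA(3) by (simp add: cob_word_def)
    ultimately show ?thesis unfolding P by simp
  next
    case False
    then have "cob_word [p] = CT.W [kc r a]" by (simp add: cob_word_def ra)
    then show ?thesis using perm_iso_diff_generator[OF a(2)] a(1) False by simp
  qed
  have wt: "word_term w i A \<in> carrier PM" if "i < length w" "A \<in> proper (fst (w ! i))" for i A
    by (rule word_term_closed(1)[OF w that])
  have inner: "letter_sum w i \<in> carrier PM" if "i < length w" for i
    by (rule QP.PM.finsum_closed) (use wt that in blast)
  have wt': "word_term (p # w) i A \<in> carrier PM" if "i < length (p # w)" "A \<in> proper (fst ((p # w) ! i))" for i A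
    by (rule word_term_closed(1)[OF pw that])
  have inner': "letter_sum (p # w) i \<in> carrier PM" if "i < length (p # w)" for i
    by (rule QP.PM.finsum_closed) (use wt' that in blast)
  have first: "split_term r a A \<otimes>\<^bsub>PM\<^esub> pc (cube_cells w) = word_term (p # w) 0 A" if A: "A \<in> proper r" for A
  proof -
    let ?x = "[Cube (card A) (lcube r a A), Cube (card ({1..r} - A)) (rcube r a A)]"
    have x: "cells_valid Q ?x" using word_term_closed(2)[OF pw, of 0 A] A ra by simp
    have "split_term r a A \<otimes>\<^bsub>PM\<^esub> pc (cube_cells w) =
        (neg_one_pow R (card A) \<otimes>\<^bsub>R\<^esub> shuff R A ({1..r} - A)) \<odot>\<^bsub>PM\<^esub> (pc ?x \<otimes>\<^bsub>PM\<^esub> pc (cube_cells w))"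
      unfolding split_term_def
      by (rule QP.PMD(3)[OF R.m_closed[OF sgn(1) shuff_closed[OF R_cring]] QP.pc_closed[OF x] pwc])
    then show ?thesis
      unfolding QP.pc_append[OF x v(2), symmetric] word_term_def
      using ra sgn(1)[of "card A"] by (simp add: sgn(2))
  qed
  have rest: "?s \<odot>\<^bsub>PM\<^esub> (?u \<otimes>\<^bsub>PM\<^esub> word_term w i A) = word_term (p # w) (Suc i) A"
    if iA: "i < length w" "A \<in> proper (fst (w ! i))" for i A
  proof -
    let ?c = "neg_one_pow R (cells_degree (cube_cells (take i w))) \<otimes>\<^bsub>R\<^esub> neg_one_pow R (card A) \<otimes>\<^bsub>R\<^esub> shuff R A ({1..fst (w ! i)} - A)"
    note sp = word_term_closed(2)[OF w iA]
    note cc = sgn(1) shuff_closed[OF R_cring]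
    have c: "?c \<in> carrier R" by (intro R.m_closed cc)
    have "?s \<odot>\<^bsub>PM\<^esub> (?u \<otimes>\<^bsub>PM\<^esub> word_term w i A) =
        ?s \<odot>\<^bsub>PM\<^esub> (?c \<odot>\<^bsub>PM\<^esub> pc ([Cube r a] @ cube_cells (split_word w i A)))"
      unfolding word_term_def QP.PMD(4)[OF c uc QP.pc_closed[OF sp]] QP.pc_append[OF v(1) sp] ..
    also have "\<dots> = (?s \<otimes>\<^bsub>R\<^esub> ?c) \<odot>\<^bsub>PM\<^esub> pc ([Cube r a] @ cube_cells (split_word w i A))"
      by (rule QP.PM'.smult_assoc1[OF sgn(1) c QP.pc_closed, symmetric]) (use v(1) sp in simp)
    \<comment> \<open>The Leibniz sign of the first letter is absorbed into the degree of the longer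
      prefix.\<close>
    also have "?s \<otimes>\<^bsub>R\<^esub> ?c = neg_one_pow R (cells_degree (cube_cells (take (Suc i) (p # w)))) \<otimes>\<^bsub>R\<^esub> neg_one_pow R (card A)
        \<otimes>\<^bsub>R\<^esub> shuff R A ({1..fst (w ! i)} - A)"
      using ra cc by (simp add: sgn(3) R.m_assoc)
    finally show ?thesis unfolding word_term_def using ra by simp
  qed
  have "perm_iso (cobar_diff R CT (cob_word (p # w))) =
      (perm_iso (cobar_diff R CT (cob_word [p])) \<otimes>\<^bsub>PM\<^esub> perm_iso (cob_word w)) \<oplus>\<^bsub>PM\<^esub>
      ?s \<odot>\<^bsub>PM\<^esub> (perm_iso (cob_word [p]) \<otimes>\<^bsub>PM\<^esub> perm_iso (cobar_diff R CT (cob_word w)))"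
  proof -
    have d: "cells_degree (cube_cells [p]) = r - 1" using ra by simp
    note m = CT.T.m_closed[OF dc(1) wc(2)] CT.T.m_closed[OF wc(1) dc(2)]
    show ?thesis
      unfolding cob_word_Cons[OF p(1) w] CT.cobar_diff_mult[OF cob_word_hcomp[OF p(2), unfolded d] wc(2)]
        lin_add[OF perm_iso_D(1) m(1) CT.T'.smult_closed[OF sgn(1) m(2)]] lin_smult[OF perm_iso_D(1) sgn(1) m(2)]
        perm_iso_D(3)[OF dc(1) wc(2)] perm_iso_D(3)[OF wc(1) dc(2)] ..
  qed
  also have "\<dots> = (\<Oplus>\<^bsub>PM\<^esub>A\<in>proper r. word_term (p # w) 0 A) \<oplus>\<^bsub>PM\<^esub>
      (\<Oplus>\<^bsub>PM\<^esub>i\<in>{..<length w}. letter_sum (p # w) (Suc i))"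
  proof (rule arg_cong2[where f = "add PM"])
    have "(\<Oplus>\<^bsub>PM\<^esub>A\<in>proper r. split_term r a A) \<otimes>\<^bsub>PM\<^esub> pc (cube_cells w) =
        (\<Oplus>\<^bsub>PM\<^esub>A\<in>proper r. split_term r a A \<otimes>\<^bsub>PM\<^esub> pc (cube_cells w))"
      by (rule lin_finsum[OF QP.PMD(1,1) lin_mult_right[OF QP.PM_algebra pwc]]) (use st in blast)
    also have "\<dots> = (\<Oplus>\<^bsub>PM\<^esub>A\<in>proper r. word_term (p # w) 0 A)"
      by (rule QP.PM.finsum_cong'[OF HOL.refl]) (use wt'[of 0] ra first in auto)
    finally show "perm_iso (cobar_diff R CT (cob_word [p])) \<otimes>\<^bsub>PM\<^esub> perm_iso (cob_word w) =
        (\<Oplus>\<^bsub>PM\<^esub>A\<in>proper r. word_term (p # w) 0 A)"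
      unfolding single perm_iso_cob_word[OF w] .
    have l: "lin R PM PM (\<lambda>x. ?s \<odot>\<^bsub>PM\<^esub> (?u \<otimes>\<^bsub>PM\<^esub> x))"
      by (rule lin_scale[OF QP.PMD(1,1) lin_mult_left[OF QP.PM_algebra uc] sgn(1)])
    have "?s \<odot>\<^bsub>PM\<^esub> (?u \<otimes>\<^bsub>PM\<^esub> (\<Oplus>\<^bsub>PM\<^esub>i\<in>{..<length w}. letter_sum w i)) =
        (\<Oplus>\<^bsub>PM\<^esub>i\<in>{..<length w}. ?s \<odot>\<^bsub>PM\<^esub> (?u \<otimes>\<^bsub>PM\<^esub> letter_sum w i))"
      by (rule lin_finsum[OF QP.PMD(1,1) l]) (use inner in blast)
    also have "\<dots> = (\<Oplus>\<^bsub>PM\<^esub>i\<in>{..<length w}. letter_sum (p # w) (Suc i))"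
    proof (rule QP.PM.finsum_cong'[OF HOL.refl])
      show "(\<lambda>i. letter_sum (p # w) (Suc i)) \<in> {..<length w} \<rightarrow> carrier PM"
        using inner' by (intro Pi_I) force
      fix i assume "i \<in> {..<length w}"
      then have i: "i < length w" by simp
      have "?s \<odot>\<^bsub>PM\<^esub> (?u \<otimes>\<^bsub>PM\<^esub> letter_sum w i) =
          (\<Oplus>\<^bsub>PM\<^esub>A\<in>proper (fst (w ! i)). ?s \<odot>\<^bsub>PM\<^esub> (?u \<otimes>\<^bsub>PM\<^esub> word_term w i A))"
        by (rule lin_finsum[OF QP.PMD(1,1) l]) (use wt i in blast)
      also have "\<dots> = letter_sum (p # w) (Suc i)"
        by (rule QP.PM.finsum_cong') (use wt'[of "Suc i"] i rest[OF i] in auto)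
      finally show "?s \<odot>\<^bsub>PM\<^esub> (?u \<otimes>\<^bsub>PM\<^esub> letter_sum w i) =
          letter_sum (p # w) (Suc i)" .
    qed
    finally show "?s \<odot>\<^bsub>PM\<^esub> (perm_iso (cob_word [p]) \<otimes>\<^bsub>PM\<^esub> perm_iso (cobar_diff R CT (cob_word w))) =
      (\<Oplus>\<^bsub>PM\<^esub>i\<in>{..<length w}. letter_sum (p # w) (Suc i))"
      unfolding Cons.IH[OF w] perm_iso_cob_word[OF p(2)] using ra by simp
  qed
  also have "\<dots> = (\<Oplus>\<^bsub>PM\<^esub>i\<in>{..<length (p # w)}. letter_sum (p # w) i)"
  proof -
    let ?f = "\<lambda>i. letter_sum (p # w) i"
    have e: "{..<length (p # w)} = insert 0 (Suc ` {..<length w})" by (simp add: lessThan_Suc_eq_insert_0)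
    have fc: "?f \<in> Suc ` {..<length w} \<rightarrow> carrier PM"
    proof (rule Pi_I, elim imageE)
      fix j i assume "j = Suc i" "i \<in> {..<length w}"
      then show "?f j \<in> carrier PM" by (intro inner') simp
    qed
    have "(\<Oplus>\<^bsub>PM\<^esub>i\<in>{..<length (p # w)}. ?f i) = ?f 0 \<oplus>\<^bsub>PM\<^esub> (\<Oplus>\<^bsub>PM\<^esub>i\<in>Suc ` {..<length w}. ?f i)"
      unfolding e by (rule QP.PM.finsum_insert[OF _ _ fc inner']) simp_all
    also have "(\<Oplus>\<^bsub>PM\<^esub>i\<in>Suc ` {..<length w}. ?f i) = (\<Oplus>\<^bsub>PM\<^esub>i\<in>{..<length w}. ?f (Suc i))"
      by (rule QP.PM.finsum_reindex[OF fc]) simp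
    finally show ?thesis using ra by simp
  qed
  finally show ?case .
qed

lemma perm_iso_E: "xss \<in> lists CT.Bpos \<Longrightarrow>
  perm_iso (CT.E xss) = pc (cube_cells (map cube_of xss))"
proof -
  assume xss: "xss \<in> lists CT.Bpos"
  let ?w = "map cube_of xss"
  have g: "xs \<in> lists S_pos \<and> good xs \<and> 2 \<le> bar_dim xs" if "xs \<in> set xss" for xs
  proof -
    have "xs \<in> lists S_pos" "0 < bar_dim xs" using xss that by auto
    then show ?thesis using S_pos_good[of xs] bar_dim_ge_2[of xs] by blast
  qed
  have "filter (\<lambda>p. fst p \<noteq> 1) ?w = ?w" using g by (intro filter_True) fastforce
  moreover have "map kcp ?w = map SC.E xss"
    unfolding map_map by (rule map_cong[OF HOL.refl]) (use g kc_bar_word tw_S_pos in auto)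
  ultimately have c: "cob_word ?w = CT.E xss" by (simp only: cob_word_def)
  have w: "?w \<in> lists QP.good_cubes" using g good_cube by fastforce
  show ?thesis using perm_iso_cob_word[OF w] unfolding c .
qed

text \<open>The basis of words of positive words is carried to the non-degenerate permutahedral
  words. The letters match because positive dimension and dimension at least 2 mean the same for
  surviving cubes.\<close>

lemma perm_iso_bij: "bij_betw perm_iso (carrier CT.T) (carrier PM)"
proof (rule free_basis_bij[OF CT.basis_T QP.basis_PM _ perm_iso_D(1)])
  have "bij_betw cube_of CT.Bpos QP.nondeg_cubes"
  proof -
    have "cube_of ` CT.Bpos = QP.nondeg_cubes"
    proof (rule equalityI)
      show "cube_of ` CT.Bpos \<subseteq> QP.nondeg_cubes"
      proof
        fix q assume "q \<in> cube_of ` CT.Bpos"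
        then obtain xs where xs: "xs \<in> lists S_pos" "0 < bar_dim xs" "q = cube_of xs" by blast
        then have "q \<in> QC.all_cubes - QC.degenerate_cubes" using bar_word_bij unfolding bij_betw_def by blast
        then show "q \<in> QP.nondeg_cubes" using bar_dim_ge_2[OF xs(1,2)] xs(3) by auto
      qed
      show "QP.nondeg_cubes \<subseteq> cube_of ` CT.Bpos"
      proof
        fix q assume q: "q \<in> QP.nondeg_cubes"
        then have "q \<in> QC.all_cubes - QC.degenerate_cubes" by auto
        then obtain xs where xs: "xs \<in> lists S_pos" "q = cube_of xs" using bar_word_bij unfolding bij_betw_def by blast
        then have "xs \<in> CT.Bpos" using q by simp
        then show "q \<in> cube_of ` CT.Bpos" using xs(2) by (rule rev_image_eqI)
      qed
    qed
    moreover have "inj_on cube_of CT.Bpos"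
      by (rule inj_on_subset[OF bij_betw_imp_inj_on[OF bar_word_bij]]) blast
    ultimately show ?thesis by (intro bij_betw_imageI)
  qed
  then have "bij_betw (map cube_of) (lists CT.Bpos) (lists QP.nondeg_cubes)" by (rule bij_lists)
  from bij_betw_trans[OF this QP.perm_class_bij]
  show "bij_betw (\<lambda>xss. perm_class Q (cube_cells (map cube_of xss))) (lists CT.Bpos)
      (carrier (perm_monoid Q) - perm_degenerate Q)" by (simp add: comp_def)
  show "perm_iso (CT.E xss) = perm_relations R Q +>\<^bsub>monoid_algebra R (perm_monoid Q)\<^esub>
      basis_elt R (perm_class Q (cube_cells (map cube_of xss)))" if "xss \<in> lists CT.Bpos" for xss
    using perm_iso_E[OF that] by (simp only: perm_chain_def)
qed

text \<open>The description of \<open>perm_diff\<close> prescribes values on all products of cubes,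
  whose classes satisfy many relations. The cobar differential conjugated by the isomorphism has
  these values, by \<open>perm_iso_diff_cob_word\<close>, which settles existence; such products
  span, which settles uniqueness.\<close>

lemma perm_iso_diff:
  shows perm_diff_linear_maps: "perm_diff R Q \<in> linear_maps R PM PM"
    and perm_iso_perm_diff: "x \<in> carrier CT.T \<Longrightarrow> perm_iso (cobar_diff R CT x) = perm_diff R Q (perm_iso x)"
proof -
  let ?D = "restrict (\<lambda>y. perm_iso (cobar_diff R CT (inv_into (carrier CT.T) perm_iso y))) (carrier PM)"
  let ?F = "\<lambda>d. d \<in> linear_maps R PM PM \<and>
      (\<forall>w. cells_valid Q (cube_cells w) \<longrightarrow> d (pc (cube_cells w)) =
        (\<Oplus>\<^bsub>PM\<^esub>i\<in>{..<length w}. letter_sum w i))"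
  have inv: "inv_into (carrier CT.T) perm_iso (perm_iso x) = x" if "x \<in> carrier CT.T" for x
    using that perm_iso_bij by (simp add: bij_betw_def)
  have "lin R PM PM (\<lambda>y. perm_iso (cobar_diff R CT (inv_into (carrier CT.T) perm_iso y)))"
    by (rule lin_comp[OF lin_comp[OF lin_inv_into[OF CT.TD(1) QP.PMD(1) perm_iso_D(1) perm_iso_bij] CT.lin_cobar_diff] perm_iso_D(1)])
  then have Dl: "?D \<in> linear_maps R PM PM" by (rule lin_restrict[OF QP.PMD(1)])
  have DF: "?F ?D"
  proof (intro conjI allI impI Dl)
    fix w assume "cells_valid Q (cube_cells w)"
    then have w: "w \<in> lists QP.good_cubes" by (simp only: QP.cube_cells_valid)
    note e = perm_iso_cob_word[OF w]
    have "?D (perm_iso (cob_word w)) = perm_iso (cobar_diff R CT (cob_word w))"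
      using inv[OF cob_word_closed[OF w]] lin_closed[OF perm_iso_D(1) cob_word_closed[OF w]] by simp
    then show "?D (pc (cube_cells w)) =
        (\<Oplus>\<^bsub>PM\<^esub>i\<in>{..<length w}. letter_sum w i)"
      unfolding e perm_iso_diff_cob_word[OF w] .
  qed
  have gens: "{pc (cube_cells w) | w. w \<in> lists QP.good_cubes} \<subseteq> carrier PM"
    unfolding QP.pc_span by (rule gen_submodule_incl)
  have "perm_diff R Q = (THE d. ?F d)"
    by (simp only: perm_diff_def Let_def word_term_def)
  also have "\<dots> = ?D"
  proof (rule the_equality[where P = ?F, OF DF])
    fix d assume d: "?F d"
    show "d = ?D"
    proof (rule linear_maps_eqI[OF QP.PMD(1,1) d[THEN conjunct1] Dl gens equalityD1[OF QP.pc_span]])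
      fix s assume "s \<in> {pc (cube_cells w) | w. w \<in> lists QP.good_cubes}"
      then obtain w where w: "cells_valid Q (cube_cells w)" "s = pc (cube_cells w)"
        unfolding QP.cube_cells_valid by blast
      show "d s = ?D s"
        unfolding w(2) d[THEN conjunct2, rule_format, OF w(1)] DF[THEN conjunct2, rule_format, OF w(1)] ..
    qed
  qed
  finally have eq: "perm_diff R Q = ?D" .
  show "perm_diff R Q \<in> linear_maps R PM PM" unfolding eq by (rule Dl)
  show "x \<in> carrier CT.T \<Longrightarrow> perm_iso (cobar_diff R CT x) = perm_diff R Q (perm_iso x)"
    unfolding eq using inv lin_closed[OF perm_iso_D(1)] by simp
qed

section \<open>Assembly of the isomorphism\<close>

lemma perm_chains_simps [simp]:
  "carrier (perm_chains R Q) = carrier PM" "add (perm_chains R Q) = add PM"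
  "zero (perm_chains R Q) = zero PM" "smult (perm_chains R Q) = smult PM"
  "mult (perm_chains R Q) = mult PM" "one (perm_chains R Q) = one PM"
  "hcomp (perm_chains R Q) n = gen_submodule R PM {pc w | w. cells_valid Q w \<and> cells_degree w = n}"
  "diff (perm_chains R Q) = perm_diff R Q"
  by (simp_all add: perm_chains_def module.extend_def dg_module.fields_def)

lemma double_cobar_simps [simp]:
  "carrier (double_cobar R X) = carrier CT.T" "add (double_cobar R X) = add CT.T"
  "zero (double_cobar R X) = zero CT.T" "smult (double_cobar R X) = smult CT.T"
  "mult (double_cobar R X) = mult CT.T" "one (double_cobar R X) = one CT.T"
  "hcomp (double_cobar R X) n = cobar_hcomp R CT n" "diff (double_cobar R X) = cobar_diff R CT"
  by (simp_all add: double_cobar_def cobar_def module.extend_def dg_module.fields_def)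

lemma perm_iso_hcomp: "perm_iso ` cobar_hcomp R CT n =
  gen_submodule R PM {pc w | w. cells_valid Q w \<and> cells_degree w = n}"
proof -
  let ?L = "{xss \<in> lists CT.Bpos. CT.word_deg xss = n}"
  let ?T = "{pc (cube_cells w) | w. w \<in> lists QP.good_cubes \<and> cells_degree (cube_cells w) = n}"
  have sub: "CT.E ` ?L \<subseteq> carrier CT.T" using CT.TD(2) by blast
  have im: "perm_iso ` cobar_hcomp R CT n = gen_submodule R PM (perm_iso ` CT.E ` ?L)"
    unfolding CT.cobar_hcomp_eq by (rule lin_image_gen_submodule[OF CT.TD(1) QP.PMD(1) perm_iso_D(1) sub])
  have Tc: "?T \<subseteq> carrier PM"
  proof
    fix x assume "x \<in> ?T"
    then obtain w where "x = pc (cube_cells w)" "cells_valid Q (cube_cells w)"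
      unfolding QP.cube_cells_valid by blast
    then show "x \<in> carrier PM" using QP.pc_closed by simp
  qed
  have Ec: "perm_iso ` CT.E ` ?L \<subseteq> carrier PM" using sub lin_closed[OF perm_iso_D(1)] by blast
  have "gen_submodule R PM (perm_iso ` CT.E ` ?L) = gen_submodule R PM ?T"
  proof (rule gen_submodule_eqI[OF QP.PMD(1) Ec Tc])
    show "?T \<subseteq> gen_submodule R PM (perm_iso ` CT.E ` ?L)"
    proof
      fix x assume "x \<in> ?T"
      then obtain w where w: "w \<in> lists QP.good_cubes" "x = pc (cube_cells w)" "cells_degree (cube_cells w) = n"
        by blast
      have "x = perm_iso (cob_word w)" using perm_iso_cob_word[OF w(1)] w(2) by simp
      then have "x \<in> perm_iso ` cobar_hcomp R CT n"
        by (rule image_eqI) (rule cob_word_hcomp[OF w(1), unfolded w(3)])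
      then show "x \<in> gen_submodule R PM (perm_iso ` CT.E ` ?L)" by (simp only: im)
    qed
    have "perm_iso ` CT.E ` ?L \<subseteq> ?T"
    proof (rule image_subsetI, elim imageE)
      fix y xss assume y: "y = CT.E xss" and xss: "xss \<in> ?L"
      let ?w = "map cube_of xss"
      have B: "xss \<in> lists CT.Bpos" using xss by blast
      have "?w \<in> lists QP.good_cubes" using B good_cube[OF S_pos_good] by (induction xss) auto
      moreover have "cells_degree (cube_cells ?w) = CT.word_deg xss"
        unfolding CT.word_deg_def by (induction xss) auto
      ultimately show "perm_iso y \<in> ?T"
        using perm_iso_E[OF B] xss y by (intro CollectI exI[of _ ?w] conjI) simp_all
    qed
    then show "perm_iso ` CT.E ` ?L \<subseteq> gen_submodule R PM ?T" by (rule subset_trans[OF _ gen_submodule_incl])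
  qed
  then show ?thesis unfolding im QP.pc_gen[where P = "\<lambda>m. m = n"] .
qed

lemma perm_iso_dg_algebra_iso: "dg_algebra_iso R (double_cobar R X) (perm_chains R Q) perm_iso"
  unfolding dg_algebra_iso_def dg_iso_def
proof (intro conjI)
  have "perm_iso \<in> linear_maps R CT.T PM"
    unfolding linear_maps_iff using perm_iso_D(1) by (simp add: perm_iso_def)
  then show "perm_iso \<in> linear_maps R (double_cobar R X) (perm_chains R Q)" by (simp add: linear_maps_def)
  show "bij_betw perm_iso (carrier (double_cobar R X)) (carrier (perm_chains R Q))" using perm_iso_bij by simp
  show "\<forall>n. perm_iso ` hcomp (double_cobar R X) n = hcomp (perm_chains R Q) n" using perm_iso_hcomp by simp
  show "diff (double_cobar R X) \<in> carrier (double_cobar R X) \<rightarrow> carrier (double_cobar R X)"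
    using lin_closed[OF CT.lin_cobar_diff] by simp
  show "diff (perm_chains R Q) \<in> carrier (perm_chains R Q) \<rightarrow> carrier (perm_chains R Q)"
    using perm_diff_linear_maps lin_closed[of R PM PM "perm_diff R Q"] by (simp add: linear_maps_iff)
  show "\<forall>x\<in>carrier (double_cobar R X). perm_iso (diff (double_cobar R X) x) = diff (perm_chains R Q) (perm_iso x)"
    using perm_iso_perm_diff by simp
  show "perm_iso \<in> ring_hom (double_cobar R X) (perm_chains R Q)"
    by (rule ring_hom_memI) (simp_all add: lin_closed[OF perm_iso_D(1)] lin_add[OF perm_iso_D(1)] perm_iso_D(2,3))
qed

lemma perm_iso_simplex_list:
  assumes xs: "simplex_list X xs" "2 \<le> bar_dim xs"
  shows "perm_iso (CT.W [cobar_word R X xs]) = pc [Cube (bar_dim xs) (bar_word X xs)]"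
proof -
  note g = simplex_list_good[OF xs(1)]
  have "perm_iso (CT.W [kc (bar_dim xs) (bar_word X xs)]) = pc [Cube (bar_dim xs) (bar_word X xs)]"
    using perm_iso_W1[OF kc_V[OF good_cube[OF g]]] gmap_kc[OF good_cube[OF g]] xs(2) by simp
  then show ?thesis unfolding kc_bar_word[OF g] cobar_word_tw[OF xs(1)] .
qed

end

text \<open>The second conjunct expresses that the identification is canonical: an algebra
  isomorphism is determined by its values on generators. The bound \<open>2 \<le> bar_dim xs\<close>
  excludes the empty word and the 1-cubes, whose cells are units.\<close>

theorem theorem6:
  fixes R :: "('r, 'x) ring_scheme" and X :: "'a sset"
  assumes "cring R"
    and "simplicial_set X"
    and "reduced 2 (simp X)"
  shows "\<exists>\<Phi>. dg_algebra_iso R (double_cobar R X) (perm_chains R (loop_cubes X)) \<Phi> \<and>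
    (\<forall>xs. simplex_list X xs \<and> 2 \<le> bar_dim xs \<longrightarrow>
      \<Phi> (tensor_word R (pos_part R (cobar_coalgebra R X)) [cobar_word R X xs]) =
      perm_chain R (loop_cubes X) [Cube (bar_dim xs) (bar_word X xs)])"
proof -
  interpret simplicial_chains X R
    by (intro simplicial_chains.intro reduced_sset.intro simplicial_chains_axioms.intro reduced_sset_axioms.intro assms)
  show ?thesis using perm_iso_dg_algebra_iso perm_iso_simplex_list by blast
qed

end
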